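(* Let $S$ be a smooth oriented closed surface of genus $g\ge2$ with a higher complex structure $I$ of order $n$ and induced data $\Sigma,V,L,\Phi$. Let $C(\lambda)=\lambda\Phi+d_A+\lambda^{-1}\Psi$ ($\lambda\in\mathbb{C}^*$) be a family of $L$-parabolic connections on $V$, where $d_A$ is an $\mathfrak{sl}_n(\mathbb{C})$-connection with $d_A(\Phi)=0$ and $\Psi\in\Omega^1(S,\mathfrak{sl}(V))$. For $k\in\{2,\dots,n\}$, the Taylor expansion around $\lambda\to\infty$ of the parabolic curvature $\xi_k(\lambda)$ is given by $\xi_k(\lambda)=\lambda^{k-1}\zeta_k+\mathcal{O}(\lambda^{k-2})$, where $\zeta_k$ is the $\mu$-holomorphicity term for $t_k$: $$\zeta_k=(-\bar\partial+\mu_2\partial+k\,\partial\mu_2)t_k+\sum_{\ell=1}^{n-k}\big((\ell+k)\,\partial\mu_{\ell+2}+(\ell+1)\mu_{\ell+2}\,\partial\big)t_{k+\ell}.$$ In particular, if $C(\lambda)$ is flat (for all $\lambda$), the covector $(t_2,\dots,t_n)$ is $\mu$-holomorphic, i.e. $\zeta_k=0$ for all $k\in\{2,\dots,n\}$.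
   Context: Higher complex structures. $\mathrm{Hilb}^n_0(\mathbb{C}^2)$ is the set of ideals of $\mathbb{C}[x,y]$ of codimension $n$ supported at the origin. A higher complex structure of order $n$ on $S$ is a section $I$ of the bundle with fibers $\mathrm{Hilb}^n_0(T_z^{*\mathbb{C}}S)$ with $I(z)+\bar I(z)=\langle p,\bar p\rangle$ at each point, $(p,\bar p)$ being linear fiber coordinates on $T^{*\mathbb{C}}S$ associated with a local complex coordinate $z$. Locally $I=\langle p^n,-\bar p+\mu_2p+\dots+\mu_np^{n-1}\rangle$ with higher Beltrami differentials $\mu_k\in\Gamma(K^{1-k}\otimes\bar K)$. $\mu_2$ is the Beltrami differential of the induced complex structure; $\Sigma$ is the resulting Riemann surface, $K$ its canonical bundle, $(z,\bar z)$ its local coordinates (where $\mu_2=0$; $\mu_2$ is kept in formulas). $\partial=\partial/\partial z$, $\bar\partial=\partial/\partial\bar z$. Induced bundle. Fix $K^{1/2}$. $V'$ is the bundle with fiber $\mathbb{C}[p,\bar p]/I(z)$, $L'\subset V'$ is spanned by the images of constants, $V=V'\otimes K^{(n-1)/2}$, $L=L'\otimes K^{(n-1)/2}\cong K^{(n-1)/2}$; $V$ has a volume form. $\Phi\in\Omega^1(S,\mathfrak{sl}(V))$ is locally $\Phi_1dz+\Phi_2d\bar z$ with $\Phi_1,\Phi_2$ multiplication by $p,\bar p$; in a frame $(\sigma,\Phi_1\sigma,\dots,\Phi_1^{n-1}\sigma)$ with $\sigma$ a nowhere vanishing local section of $L$, $\Phi_1=\sum_iE_{i+1,i}$ and $\Phi_2=\sum_{k=2}^n\mu_k\Phi_1^{k-1}$.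 $L$-parabolic: a connection with curvature $F$ is $L$-parabolic if $\int_S\operatorname{tr}(FM)=0$ for all $M\in\mathcal{C}^\infty(S,\mathfrak{sl}(V))$ preserving $L$; equivalently, in local frames with first vector in $L$, the curvature matrix has nonzero entries only in positions $(1,2),\dots,(1,n)$. Parameters. Locally $d_A=d+A_1dz+A_2d\bar z$, $\Psi=\Psi_1dz+\Psi_2d\bar z$, $\nabla=\partial+\lambda\Phi_1+A_1+\lambda^{-1}\Psi_1$, $\bar\nabla=\bar\partial+\lambda\Phi_2+A_2+\lambda^{-1}\Psi_2$. For large $\lambda$ there is a local section $s$ of $L$ (depending on $\lambda$), unique up to an $n$-th root of unity, such that $(s,\nabla s,\dots,\nabla^{n-1}s)$ is a unit-volume basis. Define $$\nabla^ns=\hat t_ns+\hat t_{n-1}\nabla s+\dots+\hat t_2\nabla^{n-2}s,\qquad\bar\nabla s=\hat\mu_1s+\hat\mu_2\nabla s+\dots+\hat\mu_n\nabla^{n-1}s,$$ and the parabolic curvatures by $[\nabla,\bar\nabla]\nabla^{k-1}s=\xi_k(\lambda)s$ for $2\le k\le n$. All are rational in $\lambda$, and for $\lambda\to\infty$: $\hat\mu_k=\lambda^{2-k}\mu_k+O(\lambda^{1-k})$ ($\mu_k$ the higher Beltrami differentials) and $\hat t_k=\lambda^{k-1}t_k+O(\lambda^{k-2})$, which defines $t_k\in\Gamma(K^k)$. *)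

theory Defs
  imports
    "HOL-Analysis.Analysis"
    "HOL-Homology.Homology"
    "HOL-Library.Landau_Symbols"
    "Jordan_Normal_Form.Determinant"
begin

text \<open>
  Everything on the surface is written in the coordinates \<open>z\<close> of the charts of a smooth
  oriented atlas: a global object is a family of local ones, indexed by the charts and
  related by its transformation law on overlaps. Points of a chart domain are represented by
  their coordinates, so local objects are functions on an open subset of the complex plane.
  Matrix and vector indices start at 0 (the entry (1,2) of the literature is \<open>(0,1)\<close> here).
\<close>

section \<open>Smooth functions and Wirtinger derivatives\<close>

definition dz :: "(complex \<Rightarrow> complex) \<Rightarrow> complex \<Rightarrow> complex" where
  "dz f z = (frechet_derivative f (at z) 1 - \<i> * frechet_derivative f (at z) \<i>) / 2"

definition dzbar :: "(complex \<Rightarrow> complex) \<Rightarrow> complex \<Rightarrow> complex" where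
  "dzbar f z = (frechet_derivative f (at z) 1 + \<i> * frechet_derivative f (at z) \<i>) / 2"

text \<open>Differentiability is real; \<open>dz f\<close> and \<open>dzbar f\<close> span the partial derivatives of \<open>f\<close>.\<close>

primrec Ck_on :: "nat \<Rightarrow> complex set \<Rightarrow> (complex \<Rightarrow> complex) \<Rightarrow> bool" where
  "Ck_on 0 U f \<longleftrightarrow> continuous_on U f"
| "Ck_on (Suc m) U f \<longleftrightarrow>
     (\<forall>z\<in>U. f differentiable (at z)) \<and> Ck_on m U (dz f) \<and> Ck_on m U (dzbar f)"

definition smooth_on :: "complex set \<Rightarrow> (complex \<Rightarrow> complex) \<Rightarrow> bool" where
  "smooth_on U f \<longleftrightarrow> (\<forall>m. Ck_on m U f)"

definition smooth_mat_on :: "nat \<Rightarrow> complex set \<Rightarrow> (complex \<Rightarrow> complex mat) \<Rightarrow> bool" where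
  "smooth_mat_on n U B \<longleftrightarrow> (\<forall>z\<in>U. B z \<in> carrier_mat n n) \<and>
     (\<forall>i<n. \<forall>j<n. smooth_on U (\<lambda>z. B z $$ (i, j)))"

definition dz_mat :: "nat \<Rightarrow> (complex \<Rightarrow> complex mat) \<Rightarrow> complex \<Rightarrow> complex mat" where
  "dz_mat n B z = mat n n (\<lambda>(i, j). dz (\<lambda>w. B w $$ (i, j)) z)"

definition dzbar_mat :: "nat \<Rightarrow> (complex \<Rightarrow> complex mat) \<Rightarrow> complex \<Rightarrow> complex mat" where
  "dzbar_mat n B z = mat n n (\<lambda>(i, j). dzbar (\<lambda>w. B w $$ (i, j)) z)"

definition mat_tr :: "complex mat \<Rightarrow> complex" where
  "mat_tr A = (\<Sum>i<dim_row A. A $$ (i, i))"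

section \<open>Closed oriented surfaces\<close>

type_synonym 'a chart = "'a set \<times> ('a \<Rightarrow> complex)"

definition chart_dom :: "'a chart \<Rightarrow> complex set" where
  "chart_dom c = snd c ` fst c"

definition chart_overlap :: "'a chart \<Rightarrow> 'a chart \<Rightarrow> complex set" where
  "chart_overlap c d = snd c ` (fst c \<inter> fst d)"

definition chart_point :: "'a chart \<Rightarrow> complex \<Rightarrow> 'a" where
  "chart_point c = inv_into (fst c) (snd c)"

definition transition :: "'a chart \<Rightarrow> 'a chart \<Rightarrow> complex \<Rightarrow> complex" where
  "transition c d z = snd d (chart_point c z)"

definition oriented_smooth_atlas :: "'a topology \<Rightarrow> 'a chart set \<Rightarrow> bool" where
  "oriented_smooth_atlas S \<A> \<longleftrightarrow>
     (\<forall>c\<in>\<A>. openin S (fst c) \<and> open (chart_dom c) \<and>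
        homeomorphic_map (subtopology S (fst c)) (top_of_set (chart_dom c)) (snd c)) \<and>
     (\<Union>c\<in>\<A>. fst c) = topspace S \<and>
     (\<forall>c\<in>\<A>. \<forall>d\<in>\<A>. smooth_on (chart_overlap c d) (transition c d) \<and>
        (\<forall>z\<in>chart_overlap c d.
           (cmod (dz (transition c d) z))\<^sup>2 - (cmod (dzbar (transition c d) z))\<^sup>2 > 0))"

text \<open>The last condition is positivity of the real Jacobian determinant.\<close>

definition closed_oriented_surface :: "'a topology \<Rightarrow> 'a chart set \<Rightarrow> bool" where
  "closed_oriented_surface S \<A> \<longleftrightarrow>
     Hausdorff_space S \<and> compact_space S \<and> connected_space S \<and> oriented_smooth_atlas S \<A>"

definition has_genus :: "'a topology \<Rightarrow> nat \<Rightarrow> bool" where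
  "has_genus S g \<longleftrightarrow> homology_group 1 S \<cong> free_Abelian_group {..<2 * g}"

text \<open>\<open>\<omega> c z\<close> is the coefficient of \<open>dz \<and> dz\<^sup>-\<close> of a 2-form in the chart \<open>c\<close>, where \<open>z\<^sup>-\<close> is
  the conjugate coordinate. \<open>partition_on_support\<close> describes a finite smooth partition of unity
  near the support of the form, subordinate to charts indexing it.\<close>

definition partition_on_support ::
  "'a topology \<Rightarrow> 'a chart set \<Rightarrow> ('a chart \<Rightarrow> complex \<Rightarrow> complex) \<Rightarrow>
    'a chart set \<Rightarrow> ('a chart \<Rightarrow> 'a \<Rightarrow> real) \<Rightarrow> bool" where
  "partition_on_support S \<A> \<omega> \<C> \<rho> \<longleftrightarrow> finite \<C> \<and> \<C> \<subseteq> \<A> \<and>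
     (\<forall>c\<in>\<C>. (\<forall>x\<in>topspace S. \<rho> c x \<ge> 0) \<and>
        S closure_of {x \<in> topspace S. \<rho> c x \<noteq> 0} \<subseteq> fst c \<and>
        (\<forall>d\<in>\<A>. smooth_on (chart_dom d) (\<lambda>z. complex_of_real (\<rho> c (chart_point d z))))) \<and>
     (\<forall>d\<in>\<A>. \<forall>z\<in>chart_dom d. \<omega> d z \<noteq> 0 \<longrightarrow> (\<Sum>c\<in>\<C>. \<rho> c (chart_point d z)) = 1)"

text \<open>The value does not depend on the partition; on a compact surface one always exists.
  The factor comes from \<open>dz \<and> dz\<^sup>- = -2\<i> dx \<and> dy\<close>.\<close>

definition has_surface_integral ::
  "'a topology \<Rightarrow> 'a chart set \<Rightarrow> ('a chart \<Rightarrow> complex \<Rightarrow> complex) \<Rightarrow> complex \<Rightarrow> bool" where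
  "has_surface_integral S \<A> \<omega> J \<longleftrightarrow>
     (\<forall>\<C> \<rho>. partition_on_support S \<A> \<omega> \<C> \<rho> \<longrightarrow>
        J = (\<Sum>c\<in>\<C>. - 2 * \<i> *
              (LINT z:chart_dom c|lborel. complex_of_real (\<rho> c (chart_point c z)) * \<omega> c z)))"

section \<open>The polynomial ring of a complexified cotangent plane\<close>

text \<open>The ring of polynomials in the fiber coordinates \<open>p\<close> and \<open>p\<^sup>-\<close> is represented as
  \<open>complex poly poly\<close>: \<open>p\<close> is the variable of the inner ring and \<open>p\<^sup>-\<close> the outer one.\<close>

type_synonym cpoly2 = "complex poly poly"

definition cst :: "complex \<Rightarrow> cpoly2" where "cst a = [:[:a:]:]"

definition pv :: cpoly2 where "pv = [:[:0, 1:]:]"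

definition pvbar :: cpoly2 where "pvbar = [:0, 1:]"

definition eval2 :: "cpoly2 \<Rightarrow> complex \<Rightarrow> complex \<Rightarrow> complex" where
  "eval2 f x y = poly (poly f [:y:]) x"

text \<open>Apply \<open>h\<close> to the coefficients and substitute \<open>P\<close> for \<open>p\<close> and \<open>Q\<close> for \<open>p\<^sup>-\<close>.\<close>

definition subst2 :: "(complex \<Rightarrow> complex) \<Rightarrow> cpoly2 \<Rightarrow> cpoly2 \<Rightarrow> cpoly2 \<Rightarrow> cpoly2" where
  "subst2 h P Q f =
     (\<Sum>j\<le>Polynomial.degree f. \<Sum>i\<le>Polynomial.degree (Polynomial.coeff f j).
        cst (h (Polynomial.coeff (Polynomial.coeff f j) i)) * P ^ i * Q ^ j)"

definition conj2 :: "cpoly2 \<Rightarrow> cpoly2" where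
  "conj2 = subst2 cnj pvbar pv"

abbreviation ideal_gen :: "cpoly2 set \<Rightarrow> cpoly2 set" where
  "ideal_gen \<equiv> module.span (*)"

text \<open>The last condition of \<open>has_codim\<close> says that the classes of the \<open>b i\<close> form a basis of
  the quotient; an ideal is supported at the origin if the origin is its only zero.\<close>

definition has_codim :: "cpoly2 set \<Rightarrow> nat \<Rightarrow> bool" where
  "has_codim J n \<longleftrightarrow>
     (\<exists>b :: nat \<Rightarrow> cpoly2. \<forall>f. \<exists>!a. (\<forall>i\<ge>n. a i = 0) \<and> f - (\<Sum>i<n. cst (a i) * b i) \<in> J)"

definition Hilb0 :: "nat \<Rightarrow> cpoly2 set set" where
  "Hilb0 n = {J. module.subspace (*) J \<and> has_codim J n \<and>
     {(x, y). \<forall>f\<in>J. eval2 f x y = 0} = {(0, 0)}}"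

section \<open>Higher complex structures\<close>

text \<open>A covector is \<open>p dz + p\<^sup>- dz\<^sup>-\<close> in the chart \<open>c\<close>. Rewriting \<open>dw\<close> in terms of \<open>dz\<close>
  for a second chart \<open>d\<close> with coordinate \<open>w\<close> expresses the coordinates \<open>p, p\<^sup>-\<close> of \<open>c\<close>
  through those of \<open>d\<close>; \<open>fiber_change c d z\<close> is the induced map on polynomials.\<close>

definition fiber_change :: "'a chart \<Rightarrow> 'a chart \<Rightarrow> complex \<Rightarrow> cpoly2 \<Rightarrow> cpoly2" where
  "fiber_change c d z =
     (let \<tau> = transition c d; \<tau>' = (\<lambda>w. cnj (transition c d w)) in
      subst2 id (cst (dz \<tau> z) * pv + cst (dz \<tau>' z) * pvbar)
                (cst (dzbar \<tau> z) * pv + cst (dzbar \<tau>' z) * pvbar))"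

definition standard_ideal :: "nat \<Rightarrow> (nat \<Rightarrow> complex) \<Rightarrow> cpoly2 set" where
  "standard_ideal n m = ideal_gen {pv ^ n, - pvbar + (\<Sum>k=2..n. cst (m k) * pv ^ (k - 1))}"

text \<open>The higher Beltrami differentials of an ideal at a point.\<close>

definition beltrami :: "nat \<Rightarrow> cpoly2 set \<Rightarrow> nat \<Rightarrow> complex" where
  "beltrami n J = (THE m. (\<forall>k. k \<notin> {2..n} \<longrightarrow> m k = 0) \<and> J = standard_ideal n m)"

text \<open>\<open>I c z\<close> is the ideal at the point with coordinate \<open>z\<close> of the chart \<open>c\<close>. The last
  condition says that the section is smooth. It also fixes, in the charts of the atlas, the
  local form in which \<open>p\<close> (and not only \<open>p\<^sup>-\<close>) generates the quotient; this is automatic when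
  the induced complex structure is compatible with the orientation. The charts are arbitrary
  smooth ones; holomorphic coordinates of the induced Riemann surface are those in which the
  Beltrami differential \<open>beltrami n (I c z) 2\<close> vanishes.\<close>

definition higher_complex_structure ::
  "nat \<Rightarrow> 'a chart set \<Rightarrow> ('a chart \<Rightarrow> complex \<Rightarrow> cpoly2 set) \<Rightarrow> bool" where
  "higher_complex_structure n \<A> I \<longleftrightarrow>
     (\<forall>c\<in>\<A>. \<forall>z\<in>chart_dom c. I c z \<in> Hilb0 n \<and>
        {f + g |f g. f \<in> I c z \<and> g \<in> conj2 ` I c z} = ideal_gen {pv, pvbar}) \<and>
     (\<forall>c\<in>\<A>. \<forall>d\<in>\<A>. \<forall>z\<in>chart_overlap c d. \<forall>f.
        f \<in> I c z \<longleftrightarrow> fiber_change c d z f \<in> I d (transition c d z)) \<and>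
     (\<forall>c\<in>\<A>. (\<forall>z\<in>chart_dom c. I c z = standard_ideal n (beltrami n (I c z))) \<and>
        (\<forall>k\<in>{2..n}. smooth_on (chart_dom c) (\<lambda>z. beltrami n (I c z) k)))"

section \<open>The induced bundle\<close>

text \<open>Dually to \<open>K\<close>, the fiber of the inverse of \<open>K\<close> is the (1,0) part of the complexified tangent
  plane, i.e. the linear forms in \<open>p, p\<^sup>-\<close> modulo the linear part of the ideal, which is
  spanned by \<open>-p\<^sup>- + \<mu>\<^sub>2 p\<close>. The class of \<open>p\<close> is a frame, and \<open>K_inv_factor c d z\<close> is the
  factor by which the frame of \<open>c\<close> differs from that of \<open>d\<close>; it is the derivative of the
  transition map if the coordinates are holomorphic.\<close>

definition K_inv_factor ::
  "nat \<Rightarrow> ('a chart \<Rightarrow> complex \<Rightarrow> cpoly2 set) \<Rightarrow> 'a chart \<Rightarrow> 'a chart \<Rightarrow> complex \<Rightarrow> complex" where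
  "K_inv_factor n I c d z = dz (transition c d) z +
     beltrami n (I d (transition c d z)) 2 * dz (\<lambda>w. cnj (transition c d w)) z"

text \<open>Transition functions of a square root of \<open>K\<close>: the local frame of \<open>c\<close> is \<open>r c d z\<close>
  times the one of \<open>d\<close>.\<close>

definition sqrt_canonical_bundle ::
  "nat \<Rightarrow> 'a chart set \<Rightarrow> ('a chart \<Rightarrow> complex \<Rightarrow> cpoly2 set) \<Rightarrow>
    ('a chart \<Rightarrow> 'a chart \<Rightarrow> complex \<Rightarrow> complex) \<Rightarrow> bool" where
  "sqrt_canonical_bundle n \<A> I r \<longleftrightarrow>
     (\<forall>c\<in>\<A>. \<forall>d\<in>\<A>. smooth_on (chart_overlap c d) (r c d) \<and>
        (\<forall>z\<in>chart_overlap c d. (r c d z)\<^sup>2 * K_inv_factor n I c d z = 1)) \<and>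
     (\<forall>c\<in>\<A>. \<forall>d\<in>\<A>. \<forall>e\<in>\<A>. \<forall>z\<in>chart_overlap c d \<inter> chart_overlap c e.
        r c e z = r d e (transition c d z) * r c d z)"

text \<open>Coordinates of the class of \<open>f\<close> in the basis \<open>1, p, \<dots>, p\<^sup>n\<^sup>-\<^sup>1\<close> of the quotient by \<open>J\<close>.\<close>

definition quot_coords :: "nat \<Rightarrow> cpoly2 set \<Rightarrow> cpoly2 \<Rightarrow> complex vec" where
  "quot_coords n J f =
     (THE v. v \<in> carrier_vec n \<and> f - (\<Sum>i<n. cst (v $ i) * pv ^ i) \<in> J)"

text \<open>In the chart \<open>c\<close>, \<open>V\<close> has the frame formed by the classes of \<open>1, p, \<dots>, p\<^sup>n\<^sup>-\<^sup>1\<close>, each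
  multiplied by the \<open>(n-1)\<close>-st power of the local frame of the square root of \<open>K\<close>. The first
  frame vector spans \<open>L\<close>. The determinant of \<open>bundle_change\<close> is 1, and the volume
  form of \<open>V\<close> is the one for which all these frames have volume 1. The columns of
  \<open>bundle_change n I r c d z\<close> are the frame vectors of \<open>c\<close> in the frame of \<open>d\<close>.\<close>

definition bundle_change ::
  "nat \<Rightarrow> ('a chart \<Rightarrow> complex \<Rightarrow> cpoly2 set) \<Rightarrow> ('a chart \<Rightarrow> 'a chart \<Rightarrow> complex \<Rightarrow> complex) \<Rightarrow>
    'a chart \<Rightarrow> 'a chart \<Rightarrow> complex \<Rightarrow> complex mat" where
  "bundle_change n I r c d z = mat n n (\<lambda>(i, j).
     r c d z ^ (n - 1) * quot_coords n (I d (transition c d z)) (fiber_change c d z (pv ^ j)) $ i)"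

definition mult_mat :: "nat \<Rightarrow> cpoly2 set \<Rightarrow> cpoly2 \<Rightarrow> complex mat" where
  "mult_mat n J f = mat n n (\<lambda>(i, j). quot_coords n J (f * pv ^ j) $ i)"

text \<open>A matrix-valued 1-form \<open>B\<^sub>1 dz + B\<^sub>2 dz\<^sup>-\<close> in a chart is the pair of its components.\<close>

type_synonym mat_form = "(complex \<Rightarrow> complex mat) \<times> (complex \<Rightarrow> complex mat)"

definition Phi :: "nat \<Rightarrow> ('a chart \<Rightarrow> complex \<Rightarrow> cpoly2 set) \<Rightarrow> 'a chart \<Rightarrow> mat_form" where
  "Phi n I c = ((\<lambda>z. mult_mat n (I c z) pv), (\<lambda>z. mult_mat n (I c z) pvbar))"

definition form_pullback :: "(complex \<Rightarrow> complex) \<Rightarrow> mat_form \<Rightarrow> mat_form" where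
  "form_pullback \<tau> B =
     (let \<tau>' = (\<lambda>w. cnj (\<tau> w)) in
      ((\<lambda>z. dz \<tau> z \<cdot>\<^sub>m fst B (\<tau> z) + dz \<tau>' z \<cdot>\<^sub>m snd B (\<tau> z)),
       (\<lambda>z. dzbar \<tau> z \<cdot>\<^sub>m fst B (\<tau> z) + dzbar \<tau>' z \<cdot>\<^sub>m snd B (\<tau> z))))"

definition smooth_sl_components :: "nat \<Rightarrow> 'a chart set \<Rightarrow> ('a chart \<Rightarrow> mat_form) \<Rightarrow> bool" where
  "smooth_sl_components n \<A> B \<longleftrightarrow>
     (\<forall>c\<in>\<A>. smooth_mat_on n (chart_dom c) (fst (B c)) \<and> smooth_mat_on n (chart_dom c) (snd (B c)) \<and>
        (\<forall>z\<in>chart_dom c. mat_tr (fst (B c) z) = 0 \<and> mat_tr (snd (B c) z) = 0))"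

text \<open>The matrix forms \<open>B c\<close> of an sl(n)-connection transform with the usual inhomogeneous term.\<close>

definition sl_connection ::
  "nat \<Rightarrow> 'a chart set \<Rightarrow> ('a chart \<Rightarrow> complex \<Rightarrow> cpoly2 set) \<Rightarrow>
    ('a chart \<Rightarrow> 'a chart \<Rightarrow> complex \<Rightarrow> complex) \<Rightarrow> ('a chart \<Rightarrow> mat_form) \<Rightarrow> bool" where
  "sl_connection n \<A> I r B \<longleftrightarrow> smooth_sl_components n \<A> B \<and>
     (\<forall>c\<in>\<A>. \<forall>d\<in>\<A>. \<forall>z\<in>chart_overlap c d.
        let G = bundle_change n I r c d; B' = form_pullback (transition c d) (B d) in
        G z * fst (B c) z = fst B' z * G z + dz_mat n G z \<and>
        G z * snd (B c) z = snd B' z * G z + dzbar_mat n G z)"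

definition sl_one_form ::
  "nat \<Rightarrow> 'a chart set \<Rightarrow> ('a chart \<Rightarrow> complex \<Rightarrow> cpoly2 set) \<Rightarrow>
    ('a chart \<Rightarrow> 'a chart \<Rightarrow> complex \<Rightarrow> complex) \<Rightarrow> ('a chart \<Rightarrow> mat_form) \<Rightarrow> bool" where
  "sl_one_form n \<A> I r B \<longleftrightarrow> smooth_sl_components n \<A> B \<and>
     (\<forall>c\<in>\<A>. \<forall>d\<in>\<A>. \<forall>z\<in>chart_overlap c d.
        let G = bundle_change n I r c d; B' = form_pullback (transition c d) (B d) in
        G z * fst (B c) z = fst B' z * G z \<and> G z * snd (B c) z = snd B' z * G z)"

text \<open>Coefficients of \<open>dz \<and> dz\<^sup>-\<close>.\<close>

definition curvature :: "nat \<Rightarrow> mat_form \<Rightarrow> complex \<Rightarrow> complex mat" where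
  "curvature n B z = dz_mat n (snd B) z - dzbar_mat n (fst B) z
     + (fst B z * snd B z - snd B z * fst B z)"

definition covariant_ext_deriv :: "nat \<Rightarrow> mat_form \<Rightarrow> mat_form \<Rightarrow> complex \<Rightarrow> complex mat" where
  "covariant_ext_deriv n A P z = dz_mat n (snd P) z - dzbar_mat n (fst P) z
     + (fst A z * snd P z - snd P z * fst A z) - (snd A z * fst P z - fst P z * snd A z)"

definition flat_connection :: "nat \<Rightarrow> 'a chart set \<Rightarrow> ('a chart \<Rightarrow> mat_form) \<Rightarrow> bool" where
  "flat_connection n \<A> B \<longleftrightarrow> (\<forall>c\<in>\<A>. \<forall>z\<in>chart_dom c. curvature n (B c) z = 0\<^sub>m n n)"

text \<open>Smooth sections of sl(V) preserving \<open>L\<close>.\<close>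

definition sl_section_preserving_L ::
  "nat \<Rightarrow> 'a chart set \<Rightarrow> ('a chart \<Rightarrow> complex \<Rightarrow> cpoly2 set) \<Rightarrow>
    ('a chart \<Rightarrow> 'a chart \<Rightarrow> complex \<Rightarrow> complex) \<Rightarrow> ('a chart \<Rightarrow> complex \<Rightarrow> complex mat) \<Rightarrow> bool" where
  "sl_section_preserving_L n \<A> I r M \<longleftrightarrow>
     (\<forall>c\<in>\<A>. smooth_mat_on n (chart_dom c) (M c) \<and>
        (\<forall>z\<in>chart_dom c. mat_tr (M c z) = 0 \<and> (\<forall>i\<in>{1..<n}. M c z $$ (i, 0) = 0))) \<and>
     (\<forall>c\<in>\<A>. \<forall>d\<in>\<A>. \<forall>z\<in>chart_overlap c d.
        bundle_change n I r c d z * M c z = M d (transition c d z) * bundle_change n I r c d z)"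

definition L_parabolic ::
  "nat \<Rightarrow> 'a topology \<Rightarrow> 'a chart set \<Rightarrow> ('a chart \<Rightarrow> complex \<Rightarrow> cpoly2 set) \<Rightarrow>
    ('a chart \<Rightarrow> 'a chart \<Rightarrow> complex \<Rightarrow> complex) \<Rightarrow> ('a chart \<Rightarrow> mat_form) \<Rightarrow> bool" where
  "L_parabolic n S \<A> I r B \<longleftrightarrow>
     (\<forall>M. sl_section_preserving_L n \<A> I r M \<longrightarrow>
        has_surface_integral S \<A> (\<lambda>c z. mat_tr (curvature n (B c) z * M c z)) 0)"

text \<open>The family \<open>l \<Phi> + A + l\<^sup>-\<^sup>1 \<Psi>\<close>, \<open>l\<close> the spectral parameter.\<close>

definition conn_family ::
  "nat \<Rightarrow> ('a chart \<Rightarrow> complex \<Rightarrow> cpoly2 set) \<Rightarrow> ('a chart \<Rightarrow> mat_form) \<Rightarrow> ('a chart \<Rightarrow> mat_form) \<Rightarrow>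
    complex \<Rightarrow> 'a chart \<Rightarrow> mat_form" where
  "conn_family n I A \<Psi> l c =
     ((\<lambda>z. l \<cdot>\<^sub>m fst (Phi n I c) z + fst (A c) z + inverse l \<cdot>\<^sub>m fst (\<Psi> c) z),
      (\<lambda>z. l \<cdot>\<^sub>m snd (Phi n I c) z + snd (A c) z + inverse l \<cdot>\<^sub>m snd (\<Psi> c) z))"

section \<open>Parameters of a connection in a chart\<close>

definition nabla ::
  "nat \<Rightarrow> mat_form \<Rightarrow> (complex \<Rightarrow> complex vec) \<Rightarrow> complex \<Rightarrow> complex vec" where
  "nabla n B s z = vec n (\<lambda>i. dz (\<lambda>w. s w $ i) z) + fst B z *\<^sub>v s z"

definition nabla_bar ::
  "nat \<Rightarrow> mat_form \<Rightarrow> (complex \<Rightarrow> complex vec) \<Rightarrow> complex \<Rightarrow> complex vec" where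
  "nabla_bar n B s z = vec n (\<lambda>i. dzbar (\<lambda>w. s w $ i) z) + snd B z *\<^sub>v s z"

text \<open>\<open>s\<close> is a local section of \<open>L\<close> over \<open>W\<close> for which \<open>s, \<nabla>s, \<dots>, \<nabla>\<^sup>n\<^sup>-\<^sup>1s\<close> is a basis of
  volume 1.\<close>

definition unit_volume_section ::
  "nat \<Rightarrow> 'a chart \<Rightarrow> mat_form \<Rightarrow> complex set \<Rightarrow> (complex \<Rightarrow> complex vec) \<Rightarrow> bool" where
  "unit_volume_section n c B W s \<longleftrightarrow> open W \<and> W \<subseteq> chart_dom c \<and>
     (\<forall>z\<in>W. s z \<in> carrier_vec n \<and> (\<forall>i\<in>{1..<n}. s z $ i = 0)) \<and>
     (\<forall>i<n. smooth_on W (\<lambda>z. s z $ i)) \<and>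
     (\<forall>z\<in>W. det (mat_of_cols n (map (\<lambda>j. (nabla n B ^^ j) s z) [0..<n])) = 1)"

text \<open>\<open>t_hat n c B k z\<close> is the \<open>k\<close>-th coefficient in
  \<open>\<nabla>\<^sup>n s = t\<^sub>n s + t\<^sub>n\<^sub>-\<^sub>1 \<nabla>s + \<dots> + t\<^sub>2 \<nabla>\<^sup>n\<^sup>-\<^sup>2 s\<close> at \<open>z\<close>; it does not depend on the choice of \<open>s\<close>,
  which is unique up to an \<open>n\<close>-th root of unity.\<close>

definition t_hat :: "nat \<Rightarrow> 'a chart \<Rightarrow> mat_form \<Rightarrow> nat \<Rightarrow> complex \<Rightarrow> complex" where
  "t_hat n c B k z = (THE x. \<exists>W s \<tau>. z \<in> W \<and> unit_volume_section n c B W s \<and>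
     (\<forall>i<n. (nabla n B ^^ n) s z $ i = (\<Sum>j=2..n. \<tau> j * (nabla n B ^^ (n - j)) s z $ i)) \<and>
     x = \<tau> k)"

text \<open>The \<open>k\<close>-th parabolic curvature at \<open>z\<close>, defined by \<open>[\<nabla>, \<nabla>\<^sup>-] \<nabla>\<^sup>k\<^sup>-\<^sup>1 s = \<xi>\<^sub>k s\<close>.\<close>

definition parabolic_curvature :: "nat \<Rightarrow> 'a chart \<Rightarrow> mat_form \<Rightarrow> nat \<Rightarrow> complex \<Rightarrow> complex" where
  "parabolic_curvature n c B k z = (THE x. \<exists>W s. z \<in> W \<and> unit_volume_section n c B W s \<and>
     (let v = (nabla n B ^^ (k - 1)) s in
      nabla n B (nabla_bar n B v) z - nabla_bar n B (nabla n B v) z = x \<cdot>\<^sub>v s z))"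

text \<open>The coefficient \<open>t\<^sub>k\<close> of \<open>l\<^sup>k\<^sup>-\<^sup>1\<close> in the expansion at infinity of \<open>t_hat\<close> for a family \<open>C\<close>
  of connections.\<close>

definition t_coeff :: "nat \<Rightarrow> 'a chart \<Rightarrow> (complex \<Rightarrow> mat_form) \<Rightarrow> nat \<Rightarrow> complex \<Rightarrow> complex" where
  "t_coeff n c C k z = (THE x.
     (\<lambda>l. t_hat n c (C l) k z - l ^ (k - 1) * x) \<in> O[at_infinity](\<lambda>l. l ^ (k - 2)))"

text \<open>The holomorphicity term of a tuple \<open>t\<close> with respect to \<open>\<mu>\<close>.\<close>

definition zeta ::
  "nat \<Rightarrow> (nat \<Rightarrow> complex \<Rightarrow> complex) \<Rightarrow> (nat \<Rightarrow> complex \<Rightarrow> complex) \<Rightarrow> nat \<Rightarrow> complex \<Rightarrow> complex" where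
  "zeta n \<mu> t k z =
     - dzbar (t k) z + \<mu> 2 z * dz (t k) z + of_nat k * dz (\<mu> 2) z * t k z +
     (\<Sum>j=1..n - k. of_nat (j + k) * dz (\<mu> (j + 2)) z * t (k + j) z
                  + of_nat (j + 1) * \<mu> (j + 2) z * dz (t (k + j)) z)"

end

theory Submission
  imports Defs
begin

text \<open>
  Put \<open>e = 1 / l\<close> and multiply the two components of the connection by \<open>e\<close>. The rescaled
  operators \<open>nab = e \<partial> + P\<close> and \<open>nbr = e \<partial>\<^sup>- + Q\<close> have matrices that are polynomial in \<open>e\<close>,
  and for \<open>e = 0\<close> these are \<open>\<Phi>\<^sub>1\<close>, a nilpotent shift, and \<open>\<Phi>\<^sub>2\<close>, a polynomial in \<open>\<Phi>\<^sub>1\<close>. So \<open>e\<close>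
  is a semiclassical parameter: derivatives of coefficients cost a factor \<open>e\<close>, and the expansion
  for \<open>l \<rightarrow> \<infinity>\<close> becomes one for \<open>e \<rightarrow> 0\<close>.

  Let \<open>s\<close> be a section of \<open>L\<close> for which the \<open>v\<^sub>k = nab\<^sup>k s\<close> with \<open>k < n\<close> form a frame of
  volume 1. Write \<open>v\<^sub>n = \<Sum>\<^sub>k T\<^sub>k v\<^sub>n\<^sub>-\<^sub>k\<close>, \<open>nbr s = \<Sum>\<^sub>l M\<^sub>l v\<^sub>l\<^sub>-\<^sub>1\<close> and
  \<open>[nab, nbr] v\<^sub>k\<^sub>-\<^sub>1 = X\<^sub>k s\<close>; up to powers of \<open>e\<close> these are the parameters and the parabolic
  curvatures. As the \<open>n\<close>-th power of the shift vanishes, \<open>T\<^sub>k = e t\<^sub>k + O(e\<^sup>2)\<close>; moreover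
  \<open>M\<^sub>l = \<mu>\<^sub>l + O(e)\<close> and \<open>M\<^sub>1 = O(e)\<close>. The assertion is \<open>X\<^sub>m = e\<^sup>2 \<zeta>\<^sub>m + O(e\<^sup>3)\<close>.

  Evaluating \<open>nbr v\<^sub>n\<close> in two ways, by moving \<open>nbr\<close> past \<open>nab\<^sup>n\<close> and by expanding \<open>v\<^sub>n\<close>, gives
  an equation (lemma \<open>compatibility\<close>) whose curvature side is \<open>\<Sum>\<^sub>i X\<^sub>i v\<^sub>n\<^sub>-\<^sub>i\<close> to leading order.
  On the other side the terms without derivatives cancel, because
  \<open>\<Sum>\<^sub>l M\<^sub>l nab\<^sup>l\<^sup>-\<^sup>1\<close> and \<open>\<Sum>\<^sub>k T\<^sub>k nab\<^sup>n\<^sup>-\<^sup>k\<close> commute up to derivatives of their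
  coefficients. What remains is bilinear in \<open>T\<close> and \<open>M\<close> with one factor \<open>e \<partial>\<close>
  (lemma \<open>rhs_estimate\<close>), and its coefficient at \<open>v\<^sub>n\<^sub>-\<^sub>m\<close> is \<open>e\<^sup>2 \<zeta>\<^sub>m\<close> modulo \<open>e\<^sup>3\<close>
  (lemmas \<open>X_expansion\<close> and \<open>X_zeta\<close>).

  Two things have to be supplied. Parabolicity is a condition on integrals over the surface; testing
  it against sections supported in one chart shows that the curvature matrix has nonzero entries
  only in the first row, to the right of the diagonal (lemma \<open>L_parabolic_pointwise\<close>). And \<open>\<zeta>\<close>
  contains derivatives of the limits \<open>t\<^sub>k\<close>, so all error terms must be small together with their
  derivatives; this is the calculus of \<open>smooth_O\<close>.
\<close>

section \<open>Wirtinger derivatives\<close>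

text \<open>Both Wirtinger derivatives obey the same rules and are treated together: \<open>c = -\<i>\<close>
  gives \<open>dz\<close> and \<open>c = \<i>\<close> gives \<open>dzbar\<close>.\<close>

definition wd :: "complex \<Rightarrow> (complex \<Rightarrow> complex) \<Rightarrow> complex \<Rightarrow> complex" where
  "wd c f z = (frechet_derivative f (at z) 1 + c * frechet_derivative f (at z) \<i>) / 2"

lemma dz_eq_wd: "dz = wd (- \<i>)"
  by (intro ext) (simp add: dz_def wd_def)

lemma dzbar_eq_wd: "dzbar = wd \<i>"
  by (intro ext) (simp add: dzbar_def wd_def)

lemma wd_eqI:
  assumes "(f has_derivative f') (at z)"
  shows "wd c f z = (f' 1 + c * f' \<i>) / 2"
  using frechet_derivative_at[OF assms] by (simp add: wd_def)

lemma wd_cong: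
  assumes "open U" "z \<in> U" "\<And>w. w \<in> U \<Longrightarrow> f w = g w"
  shows "wd c f z = wd c g z"
proof -
  have "(f has_derivative f') (at z) \<longleftrightarrow> (g has_derivative f') (at z)" for f'
    using assms has_derivative_transform_within_open[OF _ assms(1,2), of f f' UNIV g]
      has_derivative_transform_within_open[OF _ assms(1,2), of g f' UNIV f] by auto
  then show ?thesis by (simp add: wd_def frechet_derivative_def)
qed

lemma differentiable_cong_open:
  fixes f g :: "complex \<Rightarrow> complex"
  assumes "open U" "z \<in> U" "\<And>w. w \<in> U \<Longrightarrow> f w = g w" "f differentiable (at z)"
  shows "g differentiable (at z)"
  using assms has_derivative_transform_within_open[OF _ assms(1,2), of f _ UNIV g]
  unfolding differentiable_def by blast

lemma wd_const [simp]: "wd c (\<lambda>w. a) z = 0"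
  by (subst wd_eqI[OF has_derivative_const]) simp

lemma wd_id: "wd c (\<lambda>w. w) z = (1 + c * \<i>) / 2"
  by (subst wd_eqI[OF has_derivative_ident]) simp

lemma wd_cnj_id: "wd c cnj z = (1 - c * \<i>) / 2"
  by (subst wd_eqI[OF bounded_linear_imp_has_derivative[OF bounded_linear_cnj]]) simp

context
  fixes f g :: "complex \<Rightarrow> complex" and z :: complex
  assumes f: "f differentiable (at z)" and g: "g differentiable (at z)"
begin

lemma wd_add: "wd c (\<lambda>w. f w + g w) z = wd c f z + wd c g z"
  by (subst wd_eqI[OF has_derivative_add[OF f[unfolded frechet_derivative_works] g[unfolded frechet_derivative_works]]])
    (simp add: wd_def field_simps)

lemma wd_diff: "wd c (\<lambda>w. f w - g w) z = wd c f z - wd c g z"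
  by (subst wd_eqI[OF has_derivative_diff[OF f[unfolded frechet_derivative_works] g[unfolded frechet_derivative_works]]])
    (simp add: wd_def field_simps)

lemma wd_mult: "wd c (\<lambda>w. f w * g w) z = wd c f z * g z + f z * wd c g z"
  by (subst wd_eqI[OF has_derivative_mult[OF f[unfolded frechet_derivative_works] g[unfolded frechet_derivative_works]]])
    (simp add: wd_def field_simps)

end

lemma wd_cmult: "f differentiable (at z) \<Longrightarrow> wd c (\<lambda>w. a * f w) z = a * wd c f z"
  using wd_mult[of "\<lambda>w. a" z f c] by simp

lemma wd_sum:
  assumes "\<And>i. i \<in> J \<Longrightarrow> f i differentiable (at z)"
  shows "wd c (\<lambda>w. \<Sum>i\<in>J. f i w) z = (\<Sum>i\<in>J. wd c (f i) z)"
  using assms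
proof (induction J rule: infinite_finite_induct)
  case (insert x F)
  then have "(\<lambda>w. \<Sum>i\<in>F. f i w) differentiable (at z)"
    by (intro differentiable_sum) auto
  with insert show ?case by (simp add: wd_add)
qed auto

lemma wd_prod:
  assumes "finite J" "\<And>i. i \<in> J \<Longrightarrow> f i differentiable (at z)"
  shows "wd c (\<lambda>w. \<Prod>i\<in>J. f i w) z = (\<Sum>j\<in>J. wd c (f j) z * (\<Prod>i\<in>J - {j}. f i z))"
    and "(\<lambda>w. \<Prod>i\<in>J. f i w) differentiable (at z)"
proof -
  have "wd c (\<lambda>w. \<Prod>i\<in>J. f i w) z = (\<Sum>j\<in>J. wd c (f j) z * (\<Prod>i\<in>J - {j}. f i z))
    \<and> (\<lambda>w. \<Prod>i\<in>J. f i w) differentiable (at z)"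
    using assms
  proof (induction J rule: finite_induct)
    case (insert x F)
    have eq: "(\<Prod>i\<in>insert x F - {j}. f i z) = f x z * (\<Prod>i\<in>F - {j}. f i z)" if "j \<in> F" for j
    proof -
      have "insert x F - {j} = insert x (F - {j})" using insert that by auto
      then show ?thesis using insert by simp
    qed
    have "insert x F - {x} = F" using insert by auto
    moreover have "(\<Sum>j\<in>F. wd c (f j) z * (\<Prod>i\<in>insert x F - {j}. f i z))
        = f x z * (\<Sum>j\<in>F. wd c (f j) z * (\<Prod>i\<in>F - {j}. f i z))"
      unfolding sum_distrib_left by (intro sum.cong refl) (simp add: eq)
    ultimately show ?case using insert by (simp add: wd_mult differentiable_mult)
  qed auto
  then show "wd c (\<lambda>w. \<Prod>i\<in>J. f i w) z = (\<Sum>j\<in>J. wd c (f j) z * (\<Prod>i\<in>J - {j}. f i z))"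
    and "(\<lambda>w. \<Prod>i\<in>J. f i w) differentiable (at z)" by auto
qed

lemma wd_power:
  assumes "f differentiable (at z)"
  shows "wd c (\<lambda>w. f w ^ k) z = of_nat k * f z ^ (k - 1) * wd c f z"
proof (induction k)
  case (Suc k)
  have "(\<lambda>w. f w ^ k) differentiable (at z)" using assms by (rule differentiable_power)
  with Suc assms show ?case
    by (cases k) (simp_all add: wd_mult algebra_simps)
qed auto

text \<open>The splitting of a differential into its complex linear and antilinear parts. It is the
  reason why the chain rule below involves the inner function and its conjugate.\<close>

lemma linear_wirtinger:
  fixes L :: "complex \<Rightarrow> complex"
  assumes "linear L"
  shows "L h = (L 1 - \<i> * L \<i>) / 2 * h + (L 1 + \<i> * L \<i>) / 2 * cnj h"
proof -
  have h: "h = Re h *\<^sub>R 1 + Im h *\<^sub>R \<i>" by (simp add: complex_eq_iff)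
  have "L (Re h *\<^sub>R 1 + Im h *\<^sub>R \<i>) = Re h *\<^sub>R L 1 + Im h *\<^sub>R L \<i>"
    by (simp only: linear_add[OF assms] linear_scale[OF assms])
  with h have L: "L h = of_real (Re h) * L 1 + of_real (Im h) * L \<i>"
    by (simp only: scaleR_conv_of_real)
  have "(L 1 - \<i> * L \<i>) / 2 * h + (L 1 + \<i> * L \<i>) / 2 * cnj h
      = L 1 * ((h + cnj h) / 2) + L \<i> * (\<i> * (cnj h - h) / 2)"
    by (simp add: field_simps)
  also have "(h + cnj h) / 2 = of_real (Re h)" by (simp add: complex_eq_iff)
  also have "\<i> * (cnj h - h) / 2 = of_real (Im h)" by (simp add: complex_eq_iff)
  finally show ?thesis using L by (simp add: mult.commute)
qed

lemma wd_chain: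
  assumes t: "t differentiable (at z)" and f: "f differentiable (at (t z))"
  shows "wd c (\<lambda>w. f (t w)) z =
    dz f (t z) * wd c t z + dzbar f (t z) * wd c (\<lambda>w. cnj (t w)) z"
proof -
  let ?t = "frechet_derivative t (at z)" and ?f = "frechet_derivative f (at (t z))"
  have td: "(t has_derivative ?t) (at z)" and fd: "(f has_derivative ?f) (at (t z))"
    using t f by (auto simp: frechet_derivative_works)
  have tc: "((\<lambda>w. cnj (t w)) has_derivative (\<lambda>h. cnj (?t h))) (at z)"
    using bounded_linear.has_derivative[OF bounded_linear_cnj td] .
  have "((\<lambda>w. f (t w)) has_derivative (\<lambda>h. ?f (?t h))) (at z)"
    using has_derivative_compose[OF td fd] .
  then have 1: "wd c (\<lambda>w. f (t w)) z = (?f (?t 1) + c * ?f (?t \<i>)) / 2"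
    by (rule wd_eqI)
  have lin: "linear ?f" using fd by (simp add: has_derivative_linear)
  have 2: "?f h = dz f (t z) * h + dzbar f (t z) * cnj h" for h
    using linear_wirtinger[OF lin, of h] by (simp add: dz_def dzbar_def)
  show ?thesis unfolding 1 wd_eqI[OF tc] wd_eqI[OF td]
    by (simp add: 2 field_simps)
qed

lemma wd_holomorphic_chain:
  assumes t: "t differentiable (at z)" and f: "(f has_field_derivative f') (at (t z))"
  shows "wd c (\<lambda>w. f (t w)) z = f' * wd c t z"
    and "(\<lambda>w. f (t w)) differentiable (at z)"
proof -
  let ?t = "frechet_derivative t (at z)"
  have td: "(t has_derivative ?t) (at z)"
    using t by (auto simp: frechet_derivative_works)
  have *: "((\<lambda>w. f (t w)) has_derivative (\<lambda>h. f' * ?t h)) (at z)"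
    using has_derivative_compose[OF td f[unfolded has_field_derivative_def]] by simp
  show "wd c (\<lambda>w. f (t w)) z = f' * wd c t z"
    unfolding wd_eqI[OF *] by (simp add: wd_def field_simps)
  show "(\<lambda>w. f (t w)) differentiable (at z)"
    using * unfolding differentiable_def by blast
qed

lemma differentiable_cnj: "f differentiable F \<Longrightarrow> (\<lambda>w. cnj (f w)) differentiable F"
  unfolding differentiable_def using bounded_linear.has_derivative[OF bounded_linear_cnj] by blast

lemma wd_cnj:
  assumes "f differentiable (at z)"
  shows "wd c (\<lambda>w. cnj (f w)) z = cnj (wd (cnj c) f z)"
proof -
  have "((\<lambda>w. cnj (f w)) has_derivative (\<lambda>h. cnj (frechet_derivative f (at z) h))) (at z)"
    using bounded_linear.has_derivative[OF bounded_linear_cnj] assms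
    by (auto simp: frechet_derivative_works)
  from wd_eqI[OF this] show ?thesis by (simp add: wd_def)
qed

section \<open>Smooth functions\<close>

lemma Ck_on_Suc:
  "Ck_on (Suc m) U f \<longleftrightarrow> (\<forall>z\<in>U. f differentiable (at z)) \<and>
     Ck_on m U (wd \<i> f) \<and> Ck_on m U (wd (-\<i>) f)"
  by (auto simp: dz_eq_wd dzbar_eq_wd)

lemma Ck_on_SucI:
  assumes "\<And>z. z \<in> U \<Longrightarrow> f differentiable (at z)"
    and "\<And>c. c = \<i> \<or> c = - \<i> \<Longrightarrow> Ck_on m U (wd c f)"
  shows "Ck_on (Suc m) U f"
  using assms unfolding Ck_on_Suc by auto

lemma Ck_on_SucD:
  assumes "Ck_on (Suc m) U f"
  shows "z \<in> U \<Longrightarrow> f differentiable (at z)" "c = \<i> \<or> c = - \<i> \<Longrightarrow> Ck_on m U (wd c f)"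
  using assms unfolding Ck_on_Suc by auto

declare Ck_on.simps(2) [simp del]

lemma Ck_on_mono_Suc: "Ck_on (Suc m) U f \<Longrightarrow> Ck_on m U f"
proof (induction m arbitrary: f)
  case 0
  have "continuous_on U f"
    by (intro continuous_at_imp_continuous_on ballI differentiable_imp_continuous_within
        Ck_on_SucD(1)[OF 0])
  then show ?case by simp
next
  case (Suc m)
  show ?case by (rule Ck_on_SucI) (use Ck_on_SucD[OF Suc.prems] Suc.IH in blast)+
qed

lemma Ck_on_subset: "Ck_on m U f \<Longrightarrow> V \<subseteq> U \<Longrightarrow> Ck_on m V f"
  by (induction m arbitrary: f) (auto simp: Ck_on_Suc intro: continuous_on_subset)

lemma Ck_on_cong:
  assumes "open U" "\<And>z. z \<in> U \<Longrightarrow> f z = g z" "Ck_on m U f"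
  shows "Ck_on m U g"
  using assms(2,3)
proof (induction m arbitrary: f g)
  case 0 then show ?case by (simp cong: continuous_on_cong)
next
  case (Suc m)
  show ?case
  proof (rule Ck_on_SucI)
    fix z assume "z \<in> U"
    then show "g differentiable (at z)"
      using differentiable_cong_open[OF assms(1), of z f g] Suc.prems Ck_on_SucD(1) by blast
  next
    fix c assume "c = \<i> \<or> c = - \<i>"
    with Suc.prems show "Ck_on m U (wd c g)"
      by (intro Suc.IH[of "wd c f" "wd c g"] wd_cong[OF assms(1)] Ck_on_SucD(2)) auto
  qed
qed

lemma Ck_on_Un:
  assumes "open U" "open V" "Ck_on m U f" "Ck_on m V f"
  shows "Ck_on m (U \<union> V) f"
  using assms(3,4) by (induction m arbitrary: f) (auto simp: Ck_on_Suc continuous_on_open_Un assms)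

lemma Ck_on_add:
  assumes "open U" "Ck_on m U f" "Ck_on m U g"
  shows "Ck_on m U (\<lambda>z. f z + g z)"
  using assms(2,3)
proof (induction m arbitrary: f g)
  case 0 then show ?case by (simp add: continuous_on_add)
next
  case (Suc m)
  note d = Ck_on_SucD[OF Suc.prems(1)] Ck_on_SucD[OF Suc.prems(2)]
  show ?case
  proof (rule Ck_on_SucI)
    fix c assume c: "c = \<i> \<or> c = - \<i>"
    show "Ck_on m U (wd c (\<lambda>z. f z + g z))"
      by (rule Ck_on_cong[OF assms(1) _ Suc.IH[OF d(2)[OF c] d(4)[OF c]]]) (simp add: wd_add d)
  qed (intro differentiable_add d(1,3))
qed

lemma Ck_on_mult:
  assumes "open U" "Ck_on m U f" "Ck_on m U g"
  shows "Ck_on m U (\<lambda>z. f z * g z)"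
  using assms(2,3)
proof (induction m arbitrary: f g)
  case 0 then show ?case by (simp add: continuous_on_mult)
next
  case (Suc m)
  note d = Ck_on_SucD[OF Suc.prems(1)] Ck_on_SucD[OF Suc.prems(2)]
  note e = Ck_on_mono_Suc[OF Suc.prems(1)] Ck_on_mono_Suc[OF Suc.prems(2)]
  show ?case
  proof (rule Ck_on_SucI)
    fix c assume c: "c = \<i> \<or> c = - \<i>"
    show "Ck_on m U (wd c (\<lambda>z. f z * g z))"
      by (rule Ck_on_cong[OF assms(1) _
            Ck_on_add[OF assms(1) Suc.IH[OF d(2)[OF c] e(2)] Suc.IH[OF e(1) d(4)[OF c]]]])
        (simp add: wd_mult d)
  qed (intro differentiable_mult d(1,3))
qed

lemma Ck_on_const [simp]: "Ck_on m U (\<lambda>z. a)"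
proof (induction m arbitrary: a)
  case (Suc m)
  have "wd c (\<lambda>z. a) = (\<lambda>z. 0)" for c by (rule ext) (rule wd_const)
  then show ?case using Suc[of 0] by (intro Ck_on_SucI) (simp_all only: differentiable_const)
qed simp

lemma Ck_on_inverse:
  assumes "open U" "\<And>z. z \<in> U \<Longrightarrow> f z \<noteq> 0" "Ck_on m U f"
  shows "Ck_on m U (\<lambda>z. inverse (f z))"
  using assms(3)
proof (induction m)
  case 0 then show ?case using assms(2) by (simp add: continuous_on_inverse)
next
  case (Suc m)
  note d = Ck_on_SucD[OF Suc.prems]
  have iv: "(inverse has_field_derivative - (inverse (f z) * inverse (f z))) (at (f z))" if "z \<in> U" for z
    using DERIV_inverse[OF assms(2)[OF that]] by (simp add: power2_eq_square)
  note I = Suc.IH[OF Ck_on_mono_Suc[OF Suc.prems]]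
  show ?case
  proof (rule Ck_on_SucI)
    fix c assume c: "c = \<i> \<or> c = - \<i>"
    have "Ck_on m U (\<lambda>z. (-1) * (inverse (f z) * inverse (f z)) * wd c f z)"
      by (intro Ck_on_mult assms(1) Ck_on_const I d(2) c)
    then show "Ck_on m U (wd c (\<lambda>z. inverse (f z)))"
    proof (rule Ck_on_cong[OF assms(1), rotated])
      fix z assume z: "z \<in> U"
      show "(-1) * (inverse (f z) * inverse (f z)) * wd c f z = wd c (\<lambda>z. inverse (f z)) z"
        unfolding wd_holomorphic_chain(1)[where f = inverse and t = f, OF d(1)[OF z] iv[OF z]] by simp
    qed
  next
    fix z assume z: "z \<in> U"
    show "(\<lambda>z. inverse (f z)) differentiable (at z)"
      by (rule wd_holomorphic_chain(2)[where f = inverse and t = f, OF d(1)[OF z] iv[OF z]])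
  qed
qed

lemma Ck_on_cnj:
  assumes "open U" "Ck_on m U f"
  shows "Ck_on m U (\<lambda>z. cnj (f z))"
  using assms(2)
proof (induction m arbitrary: f)
  case 0 then show ?case by (simp add: continuous_on_cnj)
next
  case (Suc m)
  note d = Ck_on_SucD[OF Suc.prems]
  show ?case
  proof (rule Ck_on_SucI)
    fix c assume c: "c = \<i> \<or> c = - \<i>"
    then have c': "cnj c = \<i> \<or> cnj c = - \<i>" by auto
    show "Ck_on m U (wd c (\<lambda>z. cnj (f z)))"
      by (rule Ck_on_cong[OF assms(1) _ Suc.IH[OF d(2)[OF c']]]) (simp add: wd_cnj d)
  qed (intro differentiable_cnj d(1))
qed

text \<open>The derivative of the composite consists of composites of derivatives of the outer function
  with derivatives of the inner function and of its conjugate, so the order can be raised by one.\<close>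

lemma Ck_on_compose:
  assumes "open U" "open V" "t ` U \<subseteq> V" "Ck_on m U t" "Ck_on m V f"
  shows "Ck_on m U (\<lambda>z. f (t z))"
  using assms(4,5)
proof (induction m arbitrary: f)
  case 0 then show ?case using assms(3) continuous_on_compose2 by (metis Ck_on.simps(1))
next
  case (Suc m)
  note dt = Ck_on_SucD[OF Suc.prems(1)] and df = Ck_on_SucD[OF Suc.prems(2)]
  note IH = Suc.IH[OF Ck_on_mono_Suc[OF Suc.prems(1)]]
  have tV: "z \<in> U \<Longrightarrow> t z \<in> V" for z using assms(3) by auto
  show ?case
  proof (rule Ck_on_SucI)
    fix z assume "z \<in> U"
    then show "(\<lambda>z. f (t z)) differentiable at z"
      using differentiable_chain_at[OF dt(1) df(1)[OF tV], of z] by (simp add: o_def)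
  next
    fix c assume c: "c = \<i> \<or> c = - \<i>"
    have "Ck_on m U (\<lambda>z. dz f (t z) * wd c t z + dzbar f (t z) * wd c (\<lambda>w. cnj (t w)) z)"
      unfolding dz_eq_wd dzbar_eq_wd
      using Ck_on_SucD(2)[OF Ck_on_cnj[OF assms(1) Suc.prems(1)] c]
      by (intro Ck_on_add Ck_on_mult assms(1) IH dt(2) df(2) c) auto
    then show "Ck_on m U (wd c (\<lambda>z. f (t z)))"
    proof (rule Ck_on_cong[OF assms(1), rotated])
      fix z assume z: "z \<in> U"
      show "dz f (t z) * wd c t z + dzbar f (t z) * wd c (\<lambda>w. cnj (t w)) z = wd c (\<lambda>z. f (t z)) z"
        using wd_chain[OF dt(1)[OF z] df(1)[OF tV[OF z]]] by simp
    qed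
  qed
qed

lemma smooth_on_const [simp, intro]: "smooth_on U (\<lambda>z. a)"
  by (simp add: smooth_on_def)

context
  fixes U :: "complex set"
  assumes U: "open U"
begin

lemma smooth_on_cong: "smooth_on U f \<Longrightarrow> (\<And>z. z \<in> U \<Longrightarrow> f z = g z) \<Longrightarrow> smooth_on U g"
  using U Ck_on_cong unfolding smooth_on_def by blast

lemma smooth_on_Un: "open V \<Longrightarrow> smooth_on U f \<Longrightarrow> smooth_on V f \<Longrightarrow> smooth_on (U \<union> V) f"
  using U Ck_on_Un unfolding smooth_on_def by blast

lemma smooth_on_add: "smooth_on U f \<Longrightarrow> smooth_on U g \<Longrightarrow> smooth_on U (\<lambda>z. f z + g z)"
  using U Ck_on_add unfolding smooth_on_def by blast

lemma smooth_on_mult: "smooth_on U f \<Longrightarrow> smooth_on U g \<Longrightarrow> smooth_on U (\<lambda>z. f z * g z)"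
  using U Ck_on_mult unfolding smooth_on_def by blast

lemma smooth_on_minus: "smooth_on U f \<Longrightarrow> smooth_on U (\<lambda>z. - f z)"
  using smooth_on_mult[of "\<lambda>z. -1" f] by simp

lemma smooth_on_diff: "smooth_on U f \<Longrightarrow> smooth_on U g \<Longrightarrow> smooth_on U (\<lambda>z. f z - g z)"
  using smooth_on_add[of f "\<lambda>z. - g z"] smooth_on_minus[of g] by simp

lemma smooth_on_inverse:
  "smooth_on U f \<Longrightarrow> (\<And>z. z \<in> U \<Longrightarrow> f z \<noteq> 0) \<Longrightarrow> smooth_on U (\<lambda>z. inverse (f z))"
  using U Ck_on_inverse unfolding smooth_on_def by blast

lemma smooth_on_cnj: "smooth_on U f \<Longrightarrow> smooth_on U (\<lambda>z. cnj (f z))"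
  using U Ck_on_cnj unfolding smooth_on_def by blast

lemma smooth_on_compose:
  "open V \<Longrightarrow> t ` U \<subseteq> V \<Longrightarrow> smooth_on U t \<Longrightarrow> smooth_on V f \<Longrightarrow> smooth_on U (\<lambda>z. f (t z))"
  using U Ck_on_compose unfolding smooth_on_def by blast

lemma smooth_on_sum: "(\<And>i. i \<in> J \<Longrightarrow> smooth_on U (f i)) \<Longrightarrow> smooth_on U (\<lambda>z. \<Sum>i\<in>J. f i z)"
  by (induction J rule: infinite_finite_induct) (auto simp: smooth_on_add)

lemma smooth_on_power: "smooth_on U f \<Longrightarrow> smooth_on U (\<lambda>z. f z ^ k)"
  by (induction k) (auto simp: smooth_on_mult)

lemma smooth_on_id: "smooth_on U (\<lambda>z. z)"
proof -
  have "Ck_on m U (\<lambda>z. z)" for m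
  proof (induction m)
    case (Suc m)
    have "wd c (\<lambda>z. z) = (\<lambda>z. (1 + c * \<i>) / 2)" for c by (rule ext) (rule wd_id)
    then show ?case by (intro Ck_on_SucI) auto
  qed simp
  then show ?thesis by (simp add: smooth_on_def)
qed

end

lemma smooth_on_subset: "smooth_on U f \<Longrightarrow> V \<subseteq> U \<Longrightarrow> smooth_on V f"
  using Ck_on_subset unfolding smooth_on_def by blast

lemma smooth_on_wd: "smooth_on U f \<Longrightarrow> c = \<i> \<or> c = - \<i> \<Longrightarrow> smooth_on U (wd c f)"
  unfolding smooth_on_def by (blast intro: Ck_on_SucD(2))

lemma smooth_on_dz: "smooth_on U f \<Longrightarrow> smooth_on U (dz f)"
  and smooth_on_dzbar: "smooth_on U f \<Longrightarrow> smooth_on U (dzbar f)"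
  by (simp_all add: dz_eq_wd dzbar_eq_wd smooth_on_wd)

lemma smooth_on_differentiable: "smooth_on U f \<Longrightarrow> z \<in> U \<Longrightarrow> f differentiable (at z)"
  unfolding smooth_on_def by (blast intro: Ck_on_SucD(1))

lemma smooth_on_continuous: "smooth_on U f \<Longrightarrow> continuous_on U f"
  unfolding smooth_on_def by (metis Ck_on.simps(1))

section \<open>Symmetry of mixed derivatives\<close>

text \<open>The second difference of \<open>f\<close> over a parallelogram with sides \<open>h u\<close> and \<open>h v\<close> is
  compared with \<open>h\<^sup>2 L v\<close> by the mean value inequality along the side \<open>h u\<close>; the derivative there is
  a difference of values of the first derivative, which is differentiable at \<open>z\<close>. Since the second
  difference is symmetric in \<open>u\<close> and \<open>v\<close>, mixed derivatives agree.\<close>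

lemma second_difference_estimate:
  fixes f :: "complex \<Rightarrow> complex"
  assumes U: "open U" "z \<in> U" and f: "\<And>w. w \<in> U \<Longrightarrow> f differentiable (at w)"
    and L: "((\<lambda>w. frechet_derivative f (at w) u) has_derivative L) (at z)" and e: "e > 0"
  shows "\<exists>\<delta>>0. \<forall>h. 0 < h \<and> h < \<delta> \<longrightarrow>
    norm (f (z + h *\<^sub>R u + h *\<^sub>R v) - f (z + h *\<^sub>R u) - f (z + h *\<^sub>R v) + f z - h\<^sup>2 *\<^sub>R L v) \<le> e * h\<^sup>2"
proof -
  define B where "B = 1 + norm u + norm v"
  have B: "B > 0" unfolding B_def by (simp add: add_pos_nonneg)
  define g where "g = (\<lambda>w. frechet_derivative f (at w) u)"
  have "e / (2 * B) > 0" using e B by simp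
  then obtain d where d: "d > 0" and
    gd: "\<And>y. norm (y - z) < d \<Longrightarrow> norm (g y - g z - L (y - z)) \<le> e / (2 * B) * norm (y - z)"
    using L unfolding has_derivative_at_alt g_def by blast
  obtain r where r: "r > 0" "ball z r \<subseteq> U" using U by (meson open_contains_ball)
  define \<delta> where "\<delta> = min d r / B"
  have \<delta>: "\<delta> > 0" using d r B by (simp add: \<delta>_def)
  show ?thesis
  proof (intro exI[of _ \<delta>] conjI allI impI \<delta>)
    fix h :: real assume h: "0 < h \<and> h < \<delta>"
    have small: "h * B < d" "h * B < r" using h B unfolding \<delta>_def by (auto simp: field_simps)
    have su: "norm (s *\<^sub>R u) \<le> h * B" "norm (s *\<^sub>R u + h *\<^sub>R v) \<le> h * B" if "s \<in> {0..h}" for s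
    proof -
      have a: "norm (s *\<^sub>R u) \<le> h * norm u" using that by (simp add: mult_right_mono)
      then show "norm (s *\<^sub>R u) \<le> h * B"
        by (rule order_trans) (use h in \<open>auto simp: B_def intro!: mult_left_mono\<close>)
      have "norm (s *\<^sub>R u + h *\<^sub>R v) \<le> h * norm u + h * norm v"
        using a h norm_triangle_ineq[of "s *\<^sub>R u" "h *\<^sub>R v"] by simp
      also have "\<dots> \<le> h * B" using h by (simp add: B_def algebra_simps)
      finally show "norm (s *\<^sub>R u + h *\<^sub>R v) \<le> h * B" .
    qed
    define k where "k = (\<lambda>s. f (z + s *\<^sub>R u + h *\<^sub>R v) - f (z + s *\<^sub>R u) - (s * h) *\<^sub>R L v)"
    have der: "(k has_vector_derivative
        (g (z + s *\<^sub>R u + h *\<^sub>R v) - g (z + s *\<^sub>R u) - h *\<^sub>R L v)) (at s within {0..h})"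
      if s: "s \<in> {0..h}" for s
    proof -
      have U1: "z + s *\<^sub>R u \<in> U" "z + s *\<^sub>R u + h *\<^sub>R v \<in> U"
        using su[OF s] small r(2) by (auto simp: subset_iff dist_norm norm_minus_commute add.assoc)
      have 1: "((\<lambda>s. f (z + s *\<^sub>R u + a)) has_vector_derivative g (z + s *\<^sub>R u + a)) (at s within {0..h})"
        if "z + s *\<^sub>R u + a \<in> U" for a
      proof -
        have "((\<lambda>s. z + s *\<^sub>R u + a) has_derivative (\<lambda>t. t *\<^sub>R u)) (at s within {0..h})"
          by (auto intro!: derivative_eq_intros)
        from has_derivative_compose[OF this f[OF that, unfolded frechet_derivative_works]]
        have "((\<lambda>s. f (z + s *\<^sub>R u + a)) has_derivative
            (\<lambda>t. frechet_derivative f (at (z + s *\<^sub>R u + a)) (t *\<^sub>R u))) (at s within {0..h})" .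
        moreover have "frechet_derivative f (at (z + s *\<^sub>R u + a)) (t *\<^sub>R u) = t *\<^sub>R g (z + s *\<^sub>R u + a)" for t
          unfolding g_def
          by (rule linear_scale[OF linear_frechet_derivative[OF f[OF that]]])
        ultimately show ?thesis by (simp add: has_vector_derivative_def)
      qed
      show ?thesis unfolding k_def
        using 1[OF U1(2)] 1[of 0] U1(1)
        by (auto intro!: derivative_eq_intros)
    qed
    have bnd: "norm (g (z + s *\<^sub>R u + h *\<^sub>R v) - g (z + s *\<^sub>R u) - h *\<^sub>R L v) \<le> e * h"
      if s: "s \<in> {0..h}" for s
    proof -
      have lin: "linear L" using L by (simp add: has_derivative_linear)
      have gk: "norm (g (z + k) - g z - L k) \<le> e / (2 * B) * (h * B)" if k: "norm k \<le> h * B" for k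
      proof -
        have "norm (g (z + k) - g z - L k) \<le> e / (2 * B) * norm k"
          using gd[of "z + k"] k small by simp
        also have "\<dots> \<le> e / (2 * B) * (h * B)" using k e B by (intro mult_left_mono) auto
        finally show ?thesis .
      qed
      have e1: "norm (g (z + s *\<^sub>R u + h *\<^sub>R v) - g z - L (s *\<^sub>R u + h *\<^sub>R v)) \<le> e / (2 * B) * (h * B)"
        using gk[OF su(2)[OF s]] by (simp add: add.assoc)
      have e2: "norm (g (z + s *\<^sub>R u) - g z - L (s *\<^sub>R u)) \<le> e / (2 * B) * (h * B)"
        using gk[OF su(1)[OF s]] .
      have "g (z + s *\<^sub>R u + h *\<^sub>R v) - g (z + s *\<^sub>R u) - h *\<^sub>R L v =
        (g (z + s *\<^sub>R u + h *\<^sub>R v) - g z - L (s *\<^sub>R u + h *\<^sub>R v)) - (g (z + s *\<^sub>R u) - g z - L (s *\<^sub>R u))"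
        by (simp add: linear_add[OF lin] linear_scale[OF lin])
      also have "norm \<dots> \<le> e / (2 * B) * (h * B) + e / (2 * B) * (h * B)"
        by (intro order_trans[OF norm_triangle_ineq4] add_mono e1 e2)
      also have "\<dots> = e * h" using B by (simp add: field_simps)
      finally show ?thesis .
    qed
    have "norm (k h - k 0) \<le> e * h * norm (h - 0)"
    proof (rule differentiable_bound[where S = "{0..h}"])
      fix s assume s: "s \<in> {0..h}"
      show "(k has_derivative (\<lambda>t. t *\<^sub>R (g (z + s *\<^sub>R u + h *\<^sub>R v) - g (z + s *\<^sub>R u) - h *\<^sub>R L v))) (at s within {0..h})"
        using der[OF s] by (simp add: has_vector_derivative_def)
      show "onorm (\<lambda>t. t *\<^sub>R (g (z + s *\<^sub>R u + h *\<^sub>R v) - g (z + s *\<^sub>R u) - h *\<^sub>R L v)) \<le> e * h"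
        using bnd[OF s] by (intro onorm_bound) (use e h in \<open>simp_all add: mult.commute mult_left_mono\<close>)
    qed (use h in auto)
    moreover have "k h - k 0 = f (z + h *\<^sub>R u + h *\<^sub>R v) - f (z + h *\<^sub>R u) - f (z + h *\<^sub>R v) + f z - h\<^sup>2 *\<^sub>R L v"
      by (simp add: k_def power2_eq_square algebra_simps)
    ultimately show "norm (f (z + h *\<^sub>R u + h *\<^sub>R v) - f (z + h *\<^sub>R u) - f (z + h *\<^sub>R v) + f z - h\<^sup>2 *\<^sub>R L v) \<le> e * h\<^sup>2"
      using h by (simp add: power2_eq_square)
  qed
qed

lemma frechet_derivative_symmetric:
  fixes f :: "complex \<Rightarrow> complex"
  assumes U: "open U" "z \<in> U" and f: "\<And>w. w \<in> U \<Longrightarrow> f differentiable (at w)"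
    and L: "((\<lambda>w. frechet_derivative f (at w) u) has_derivative L) (at z)"
    and M: "((\<lambda>w. frechet_derivative f (at w) v) has_derivative M) (at z)"
  shows "L v = M u"
proof (rule ccontr)
  assume "L v \<noteq> M u"
  then have "norm (L v - M u) / 3 > 0" (is "?e > 0") by simp
  from second_difference_estimate[OF U f L this, of v]
  obtain d1 where d1: "d1 > 0" "\<And>h. 0 < h \<and> h < d1 \<Longrightarrow>
    norm (f (z + h *\<^sub>R u + h *\<^sub>R v) - f (z + h *\<^sub>R u) - f (z + h *\<^sub>R v) + f z - h\<^sup>2 *\<^sub>R L v) \<le> ?e * h\<^sup>2" by auto
  from second_difference_estimate[OF U f M \<open>?e > 0\<close>, of u]
  obtain d2 where d2: "d2 > 0" "\<And>h. 0 < h \<and> h < d2 \<Longrightarrow>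
    norm (f (z + h *\<^sub>R v + h *\<^sub>R u) - f (z + h *\<^sub>R v) - f (z + h *\<^sub>R u) + f z - h\<^sup>2 *\<^sub>R M u) \<le> ?e * h\<^sup>2" by auto
  obtain h where h: "h > 0" "h < d1" "h < d2" using d1(1) d2(1) by (meson field_lbound_gt_zero)
  let ?D = "f (z + h *\<^sub>R u + h *\<^sub>R v) - f (z + h *\<^sub>R u) - f (z + h *\<^sub>R v) + f z"
  have "h\<^sup>2 *\<^sub>R (L v - M u) = (?D - h\<^sup>2 *\<^sub>R M u) - (?D - h\<^sup>2 *\<^sub>R L v)" by (simp add: algebra_simps)
  also have "norm \<dots> \<le> ?e * h\<^sup>2 + ?e * h\<^sup>2"
  proof (rule order_trans[OF norm_triangle_ineq4], rule add_mono)
    show "norm (?D - h\<^sup>2 *\<^sub>R L v) \<le> ?e * h\<^sup>2" using d1(2)[of h] h by blast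
    have "?D = f (z + h *\<^sub>R v + h *\<^sub>R u) - f (z + h *\<^sub>R v) - f (z + h *\<^sub>R u) + f z"
      by (simp add: algebra_simps)
    then show "norm (?D - h\<^sup>2 *\<^sub>R M u) \<le> ?e * h\<^sup>2" using d2(2)[of h] h by metis
  qed
  finally have "h\<^sup>2 * norm (L v - M u) \<le> h\<^sup>2 * (2 * norm (L v - M u) / 3)"
    unfolding norm_scaleR by simp
  then have "norm (L v - M u) \<le> 2 * norm (L v - M u) / 3" using h(1) by simp
  with \<open>?e > 0\<close> show False by simp
qed

lemma dz_dzbar_commute:
  assumes U: "open U" "z \<in> U" and f: "Ck_on 2 U f"
  shows "dz (dzbar f) z = dzbar (dz f) z"
proof -
  have f1: "Ck_on (Suc (Suc 0)) U f" using f by (simp add: numeral_2_eq_2)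
  note d = Ck_on_SucD[OF f1]
  have dd: "wd c f differentiable (at w)" if "w \<in> U" "c = \<i> \<or> c = -\<i>" for c w
    using Ck_on_SucD(1)[OF d(2)] that by blast
  let ?x = "\<lambda>w. frechet_derivative f (at w) 1" and ?y = "\<lambda>w. frechet_derivative f (at w) \<i>"
  have x: "?x = (\<lambda>w. wd \<i> f w + wd (-\<i>) f w)" by (auto simp: wd_def field_simps)
  have y: "?y = (\<lambda>w. (-\<i>) * (wd \<i> f w - wd (-\<i>) f w))" by (auto simp: wd_def field_simps)
  have dx: "?x differentiable (at z)" unfolding x using U dd by (auto intro!: differentiable_add)
  have dy: "?y differentiable (at z)" unfolding y
    using U dd by (intro differentiable_mult differentiable_const differentiable_diff) auto
  have s: "frechet_derivative ?x (at z) \<i> = frechet_derivative ?y (at z) 1"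
    by (rule frechet_derivative_symmetric[OF U d(1) dx[unfolded frechet_derivative_works]
          dy[unfolded frechet_derivative_works]])
  have w: "wd c f = (\<lambda>w. (1/2) * (?x w + c * ?y w))" for c by (auto simp: wd_def)
  have *: "wd c (wd c' f) z = (1/2) * (wd c ?x z + c' * wd c ?y z)" for c c'
    by (subst w, subst wd_cmult) (auto simp: wd_add wd_cmult dx dy intro!: differentiable_add differentiable_mult)
  show ?thesis unfolding dz_eq_wd dzbar_eq_wd * by (simp add: wd_def[of _ ?x] wd_def[of _ ?y] s field_simps)
qed

section \<open>Cutoff functions\<close>

text \<open>The derivative of a member of this family is a combination of members, so that smoothness of
  all of them follows by one induction.\<close>

definition flat_exp :: "nat \<Rightarrow> real \<Rightarrow> real" where
  "flat_exp k x = (if x > 0 then inverse x ^ k * exp (- inverse x) else 0)"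

lemma flat_exp_tendsto_0: "(flat_exp k \<longlongrightarrow> 0) (at 0)"
proof -
  have "((\<lambda>x::real. x ^ k / exp x) \<longlongrightarrow> 0) at_top" by (rule tendsto_power_div_exp_0)
  from filterlim_compose[OF this filterlim_inverse_at_top_right]
  have "((\<lambda>x::real. inverse x ^ k / exp (inverse x)) \<longlongrightarrow> 0) (at_right 0)" .
  moreover have "eventually (\<lambda>x::real. inverse x ^ k / exp (inverse x) = flat_exp k x) (at_right 0)"
    by (rule eventually_mono[OF eventually_at_right_less[of 0]])
      (simp add: flat_exp_def exp_minus divide_inverse)
  ultimately have r: "(flat_exp k \<longlongrightarrow> 0) (at_right 0)"
    by (rule Lim_transform_eventually)
  have "eventually (\<lambda>x::real. x < 0) (at_left 0)"
    by (auto simp: eventually_at_left_field intro: exI[of _ "- 1"])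
  then have "eventually (\<lambda>x. 0 = flat_exp k x) (at_left (0::real))"
    by (rule eventually_mono) (simp add: flat_exp_def)
  then have "(flat_exp k \<longlongrightarrow> 0) (at_left 0)"
    by (rule Lim_transform_eventually[rotated]) simp
  from filterlim_split_at[OF this r] show ?thesis .
qed

lemma flat_exp_derivative:
  "(flat_exp k has_real_derivative (flat_exp (k + 2) x - real k * flat_exp (k + 1) x)) (at x)"
proof (cases x "0 :: real" rule: linorder_cases)
  case less
  have "((\<lambda>x. 0) has_real_derivative 0) (at x)" by simp
  then have "(flat_exp k has_real_derivative 0) (at x)"
    by (rule has_field_derivative_transform_within_open[of _ _ _ "{..<0}"])
      (use less in \<open>auto simp: flat_exp_def\<close>)
  with less show ?thesis by (simp add: flat_exp_def)
next
  case equal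
  have "((\<lambda>y. (flat_exp k (0 + y) - flat_exp k 0) / y) \<longlongrightarrow> 0) (at 0)"
  proof (rule Lim_transform_eventually[OF flat_exp_tendsto_0[of "Suc k"]])
    show "eventually (\<lambda>y. flat_exp (Suc k) y = (flat_exp k (0 + y) - flat_exp k 0) / y) (at 0)"
      by (auto simp: eventually_at flat_exp_def field_simps intro: exI[of _ 1])
  qed
  then show ?thesis using equal by (simp add: DERIV_def flat_exp_def)
next
  case greater
  have "((\<lambda>x. inverse x ^ k * exp (- inverse x)) has_real_derivative
      (flat_exp (k + 2) x - real k * flat_exp (k + 1) x)) (at x)"
  proof (cases k)
    case (Suc j)
    have "j = 0 \<or> inverse x ^ j = inverse x * inverse x ^ (j - Suc 0)"
      by (cases j) simp_all
    with greater show ?thesis unfolding Suc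
      by (auto intro!: derivative_eq_intros simp: flat_exp_def power2_eq_square algebra_simps)
  qed (use greater in \<open>auto intro!: derivative_eq_intros simp: flat_exp_def power2_eq_square\<close>)
  then show ?thesis
    by (rule has_field_derivative_transform_within_open[of _ _ _ "{0<..}"])
      (use greater in \<open>auto simp: flat_exp_def\<close>)
qed

lemma wd_real_chain:
  fixes q :: "complex \<Rightarrow> real"
  assumes q: "(\<lambda>w. complex_of_real (q w)) differentiable (at z)"
    and h: "(h has_real_derivative h') (at (q z))"
  shows "wd c (\<lambda>w. complex_of_real (h (q w))) z = of_real h' * wd c (\<lambda>w. of_real (q w)) z"
    and "(\<lambda>w. complex_of_real (h (q w))) differentiable (at z)"
proof -
  let ?L = "frechet_derivative (\<lambda>w. complex_of_real (q w)) (at z)"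
  have 1: "((\<lambda>w. complex_of_real (q w)) has_derivative ?L) (at z)"
    using q by (simp add: frechet_derivative_works)
  have 2: "(q has_derivative (\<lambda>x. Re (?L x))) (at z)"
    using has_derivative_Re[OF 1] by simp
  have "((\<lambda>w. complex_of_real (q w)) has_derivative (\<lambda>x. of_real (Re (?L x)))) (at z)"
    using has_derivative_of_real[OF 2] .
  from has_derivative_unique[OF 1 this] have Re: "?L = (\<lambda>x. complex_of_real (Re (?L x)))" .
  have "((\<lambda>w. h (q w)) has_derivative (\<lambda>x. h' * Re (?L x))) (at z)"
    using has_derivative_compose[OF 2 h[unfolded has_field_derivative_def]] .
  from has_derivative_of_real[OF this]
  have 3: "((\<lambda>w. complex_of_real (h (q w))) has_derivative (\<lambda>x. of_real (h' * Re (?L x)))) (at z)" .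
  then show "(\<lambda>w. complex_of_real (h (q w))) differentiable (at z)"
    unfolding differentiable_def by blast
  have *: "of_real (h' * Re (?L x)) = of_real h' * ?L x" for x
    unfolding of_real_mult fun_cong[OF Re, of x, symmetric] ..
  show "wd c (\<lambda>w. complex_of_real (h (q w))) z = of_real h' * wd c (\<lambda>w. of_real (q w)) z"
    unfolding wd_eqI[OF 3] wd_eqI[OF 1] * by (simp add: algebra_simps add_divide_distrib)
qed

lemma Ck_on_flat_exp:
  fixes q :: "complex \<Rightarrow> real"
  assumes "open U" "Ck_on m U (\<lambda>z. complex_of_real (q z))"
  shows "Ck_on m U (\<lambda>z. complex_of_real (flat_exp k (q z)))"
  using assms(2)
proof (induction m arbitrary: k)
  case 0
  have "continuous_on UNIV (flat_exp k)"
    by (intro continuous_at_imp_continuous_on ballI DERIV_isCont[OF flat_exp_derivative])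
  moreover have "continuous_on U q"
    using 0 continuous_on_Re[of U "\<lambda>z. complex_of_real (q z)"] by simp
  ultimately show ?case
    using continuous_on_compose2[of UNIV "flat_exp k" U q] by (simp add: continuous_on_of_real)
next
  case (Suc m)
  note d = Ck_on_SucD[OF Suc.prems] and IH = Suc.IH[OF Ck_on_mono_Suc[OF Suc.prems]]
  note ch = wd_real_chain[OF d(1) flat_exp_derivative]
  show ?case
  proof (rule Ck_on_SucI)
    fix z assume z: "z \<in> U"
    show "(\<lambda>z. complex_of_real (flat_exp k (q z))) differentiable at z" by (rule ch(2)[OF z])
  next
    fix c assume c: "c = \<i> \<or> c = - \<i>"
    have "Ck_on m U (\<lambda>z. (complex_of_real (flat_exp (k + 2) (q z)) +
        (- of_nat k) * complex_of_real (flat_exp (k + 1) (q z))) * wd c (\<lambda>w. of_real (q w)) z)"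
      by (intro Ck_on_mult Ck_on_add Ck_on_const assms(1) IH d(2) c)
    then show "Ck_on m U (wd c (\<lambda>z. complex_of_real (flat_exp k (q z))))"
    proof (rule Ck_on_cong[OF assms(1), rotated])
      fix z assume z: "z \<in> U"
      show "(complex_of_real (flat_exp (k + 2) (q z)) +
        (- of_nat k) * complex_of_real (flat_exp (k + 1) (q z))) * wd c (\<lambda>w. of_real (q w)) z
        = wd c (\<lambda>z. complex_of_real (flat_exp k (q z))) z"
        unfolding ch(1)[OF z] by simp
    qed
  qed
qed

text \<open>The quotient \<open>p / (p + q)\<close>, where \<open>p\<close> is positive exactly for \<open>dist a z < 2 R\<close> and \<open>q\<close> exactly
  for \<open>dist a z > R\<close>.\<close>

lemma exists_cutoff:
  fixes a :: complex
  assumes R: "R > 0"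
  obtains h :: "complex \<Rightarrow> real" where
    "smooth_on UNIV (\<lambda>z. complex_of_real (h z))" "\<And>z. 0 \<le> h z"
    "\<And>z. dist a z \<le> R \<Longrightarrow> h z = 1" "\<And>z. dist a z \<ge> 2 * R \<Longrightarrow> h z = 0"
proof -
  define N where "N = (\<lambda>z. (cmod (z - a))\<^sup>2)"
  define p where "p = (\<lambda>z. flat_exp 0 (4 * R\<^sup>2 - N z))"
  define q where "q = (\<lambda>z. flat_exp 0 (N z - R\<^sup>2))"
  have N: "smooth_on UNIV (\<lambda>z. complex_of_real (N z))"
    unfolding N_def complex_norm_square
    by (intro smooth_on_mult smooth_on_cnj smooth_on_diff smooth_on_id smooth_on_const open_UNIV)
  have p: "smooth_on UNIV (\<lambda>z. complex_of_real (p z))"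
    unfolding p_def using smooth_on_diff[OF open_UNIV smooth_on_const[of _ "4 * R\<^sup>2"] N]
    by (auto simp: smooth_on_def intro!: Ck_on_flat_exp)
  have q: "smooth_on UNIV (\<lambda>z. complex_of_real (q z))"
    unfolding q_def using smooth_on_diff[OF open_UNIV N smooth_on_const[of _ "R\<^sup>2"]]
    by (auto simp: smooth_on_def intro!: Ck_on_flat_exp)
  have nn: "p z \<ge> 0" "q z \<ge> 0" for z by (simp_all add: p_def q_def flat_exp_def)
  have "R\<^sup>2 > 0" using R by simp
  then have "4 * R\<^sup>2 - N z > 0 \<or> N z - R\<^sup>2 > 0" for z by linarith
  then have pos: "p z + q z > 0" for z
    using nn[of z] by (auto simp: p_def q_def flat_exp_def add_pos_nonneg add_nonneg_pos split: if_splits)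
  have "smooth_on UNIV (\<lambda>z. complex_of_real (p z) * inverse (complex_of_real (p z) + complex_of_real (q z)))"
  proof (intro smooth_on_mult smooth_on_inverse smooth_on_add p q open_UNIV)
    fix z show "complex_of_real (p z) + complex_of_real (q z) \<noteq> 0"
      using pos[of z] by (metis of_real_add of_real_eq_0_iff less_irrefl)
  qed
  then have "smooth_on UNIV (\<lambda>z. complex_of_real (p z / (p z + q z)))"
    by (simp add: divide_inverse)
  moreover have "p z / (p z + q z) \<ge> 0" for z using nn[of z] by simp
  moreover have "p z / (p z + q z) = 1" if "dist a z \<le> R" for z
  proof -
    have "N z \<le> R\<^sup>2" unfolding N_def using that by (simp add: dist_norm norm_minus_commute power_mono)
    then have "q z = 0" by (simp add: q_def flat_exp_def)
    with pos[of z] show ?thesis by simp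
  qed
  moreover have "p z / (p z + q z) = 0" if "dist a z \<ge> 2 * R" for z
  proof -
    have "(2 * R)\<^sup>2 \<le> N z" unfolding N_def using that R
      by (intro power_mono) (simp_all add: dist_norm norm_minus_commute)
    then show ?thesis by (simp add: p_def flat_exp_def)
  qed
  ultimately show ?thesis using that[of "\<lambda>z. p z / (p z + q z)"] by blast
qed

section \<open>The quotient by a standard ideal\<close>

text \<open>Modulo the second generator of the standard ideal, \<open>p\<^sup>-\<close> is this polynomial in \<open>p\<close>.\<close>

definition beltrami_poly :: "nat \<Rightarrow> (nat \<Rightarrow> complex) \<Rightarrow> complex poly" where
  "beltrami_poly n m = (\<Sum>k=2..n. Polynomial.monom (m k) (k - 1))"

lemma pv_power: "pv ^ k = [:Polynomial.monom 1 k:]"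
  by (induction k) (simp_all add: pv_def monom_0 one_pCons Polynomial.monom_Suc)

lemma cst_mult_pv_power: "cst a * pv ^ k = [:Polynomial.monom a k:]"
  by (simp add: pv_power cst_def smult_monom)

lemma standard_generator:
  "- pvbar + (\<Sum>k=2..n. cst (m k) * pv ^ (k - 1)) = [:beltrami_poly n m, -1:]"
proof -
  have "(\<Sum>k\<in>K. [:Polynomial.monom (m k) (k - 1):]) = [:\<Sum>k\<in>K. Polynomial.monom (m k) (k - 1):]" for K
    by (induction K rule: infinite_finite_induct) auto
  then show ?thesis by (simp add: cst_mult_pv_power pvbar_def beltrami_poly_def)
qed


lemma module_mult: "Modules.module ((*) :: cpoly2 \<Rightarrow> cpoly2 \<Rightarrow> cpoly2)"
  by unfold_locales (simp_all add: algebra_simps)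


text \<open>Substituting the polynomial for \<open>p\<^sup>-\<close> is the reduction modulo the second generator; it leaves
  a polynomial in \<open>p\<close>, for which only the generator \<open>p\<^sup>n\<close> matters. All properties of the quotient
  are read off from this criterion.\<close>

lemma standard_ideal_iff:
  "f \<in> standard_ideal n m \<longleftrightarrow> Polynomial.monom 1 n dvd poly f (beltrami_poly n m)"
proof
  let ?q = "beltrami_poly n m"
  let ?G = "{pv ^ n, [:?q, -1:]}"
  interpret Modules.module "(*) :: cpoly2 \<Rightarrow> cpoly2 \<Rightarrow> cpoly2" by (rule module_mult)
  have J: "standard_ideal n m = span ?G"
    unfolding standard_ideal_def standard_generator ..
  {
    assume "f \<in> standard_ideal n m"
    then have "f \<in> span ?G" by (simp only: J)
    then show "Polynomial.monom 1 n dvd poly f ?q"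
    proof (induction rule: span_induct_alt)
      case (step c x y)
      then show ?case by (auto simp: pv_power intro!: dvd_add)
    qed simp
  }
  {
    assume "Polynomial.monom 1 n dvd poly f ?q"
    then obtain g where g: "poly f ?q = Polynomial.monom 1 n * g" by auto
    have "poly (f - [:poly f ?q:]) ?q = 0" by simp
    then have "[:- ?q, 1:] dvd f - [:poly f ?q:]" by (simp only: poly_eq_0_iff_dvd)
    then obtain h where h: "f - [:poly f ?q:] = [:- ?q, 1:] * h" by auto
    have "f = [:g:] * pv ^ n + (- h) * [:?q, -1:]"
    proof -
      have "f = [:poly f ?q:] + [:- ?q, 1:] * h" using h by (simp add: algebra_simps)
      also have "[:- ?q, 1:] * h = (- h) * [:?q, -1:]"
        by (simp add: mult.commute[of h] flip: mult_minus_right minus_mult_right)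
      also have "[:poly f ?q:] = [:g:] * pv ^ n" by (simp add: g pv_power mult.commute)
      finally show ?thesis .
    qed
    moreover have "[:g:] * pv ^ n + (- h) * [:?q, -1:] \<in> span ?G"
      by (intro span_add span_scale span_base) auto
    ultimately show "f \<in> standard_ideal n m" by (simp add: J)
  }
qed

lemma monom_dvd_iff_coeff:
  "Polynomial.monom (1 :: complex) n dvd p \<longleftrightarrow> (\<forall>i<n. poly.coeff p i = 0)"
  by (simp add: monom_1_dvd_iff')

lemma poly_sum_cst_pv:
  "poly (\<Sum>i<n. cst (v i) * pv ^ i) q = (\<Sum>i<n. Polynomial.monom (v i) i)"
  by (simp add: cst_mult_pv_power poly_sum)

lemma quot_coords_standard:
  "quot_coords n (standard_ideal n m) f = vec n (\<lambda>i. poly.coeff (poly f (beltrami_poly n m)) i)"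
proof -
  let ?p = "poly f (beltrami_poly n m)"
  have c: "poly.coeff (\<Sum>i<n. Polynomial.monom (v i) i) j = v j" if "j < n" for v :: "nat \<Rightarrow> complex" and j
    using that by (simp add: coeff_sum)
  have iff: "f - (\<Sum>i<n. cst (v $ i) * pv ^ i) \<in> standard_ideal n m \<longleftrightarrow>
      (\<forall>i<n. poly.coeff ?p i = v $ i)" for v
    by (auto simp: standard_ideal_iff poly_sum_cst_pv monom_dvd_iff_coeff c)
  show ?thesis unfolding quot_coords_def iff
    by (rule the_equality) (auto intro!: eq_vecI)
qed

lemma mult_mat_pv_standard:
  assumes "i < n" "j < n"
  shows "mult_mat n (standard_ideal n m) pv $$ (i, j) = (if i = Suc j then 1 else 0)"
proof -
  have "pv * pv ^ j = [:Polynomial.monom 1 (Suc j):]" using pv_power[of "Suc j"] by simp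
  then have "poly (pv * pv ^ j) q = Polynomial.monom 1 (Suc j)" for q by (simp del: poly_mult)
  with assms show ?thesis by (auto simp: mult_mat_def quot_coords_standard simp del: poly_mult)
qed

lemma coeff_beltrami_poly:
  "poly.coeff (beltrami_poly n m) i = (if 1 \<le> i \<and> i < n then m (Suc i) else 0)"
proof -
  have "poly.coeff (beltrami_poly n m) i = (\<Sum>k=2..n. if k = Suc i then (if 1 \<le> i then m k else 0) else 0)"
    unfolding beltrami_poly_def coeff_sum by (intro sum.cong) auto
  then show ?thesis by (auto simp: sum.delta)
qed

lemma mult_mat_pvbar_standard:
  assumes "i < n" "j < n"
  shows "mult_mat n (standard_ideal n m) pvbar $$ (i, j) = (if j < i then m (Suc i - j) else 0)"
proof -
  have "poly.coeff (beltrami_poly n m * Polynomial.monom 1 j) i =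
      (if j \<le> i then poly.coeff (beltrami_poly n m) (i - j) else 0)"
    by (simp add: mult.commute[of _ "Polynomial.monom 1 j"] coeff_monom_mult)
  then show ?thesis using assms
    by (cases i j rule: linorder_cases)
      (auto simp: mult_mat_def quot_coords_standard pv_power pvbar_def coeff_beltrami_poly Suc_diff_le)
qed

section \<open>Charts\<close>

locale surface_atlas =
  fixes S :: "'a topology" and \<A> :: "'a chart set"
  assumes atlas: "oriented_smooth_atlas S \<A>"
begin

lemma openin_chart: "c \<in> \<A> \<Longrightarrow> openin S (fst c)"
  and open_chart_dom: "c \<in> \<A> \<Longrightarrow> open (chart_dom c)"
  and chart_homeomorphic:
    "c \<in> \<A> \<Longrightarrow> homeomorphic_map (subtopology S (fst c)) (top_of_set (chart_dom c)) (snd c)"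
  and smooth_transition:
    "c \<in> \<A> \<Longrightarrow> d \<in> \<A> \<Longrightarrow> smooth_on (chart_overlap c d) (transition c d)"
  using atlas unfolding oriented_smooth_atlas_def by blast+

lemma topspace_chart: "c \<in> \<A> \<Longrightarrow> topspace (subtopology S (fst c)) = fst c"
  using openin_subset[OF openin_chart, of c] by (simp add: Int_absorb1)

lemma inj_on_chart: "c \<in> \<A> \<Longrightarrow> inj_on (snd c) (fst c)"
  using homeomorphic_imp_injective_map[OF chart_homeomorphic, of c] topspace_chart[of c] by metis

lemma chart_point: "z \<in> chart_dom c \<Longrightarrow> chart_point c z \<in> fst c"
  and coord_chart_point: "z \<in> chart_dom c \<Longrightarrow> snd c (chart_point c z) = z"
  unfolding chart_point_def chart_dom_def by (auto intro: inv_into_into f_inv_into_f)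

lemma chart_point_coord: "c \<in> \<A> \<Longrightarrow> x \<in> fst c \<Longrightarrow> chart_point c (snd c x) = x"
  unfolding chart_point_def by (rule inv_into_f_f[OF inj_on_chart])

lemma coord_in_chart_dom: "x \<in> fst c \<Longrightarrow> snd c x \<in> chart_dom c"
  by (simp add: chart_dom_def)

lemma chart_overlap_iff:
  "c \<in> \<A> \<Longrightarrow> z \<in> chart_overlap c d \<longleftrightarrow> z \<in> chart_dom c \<and> chart_point c z \<in> fst d"
  by (auto simp: chart_overlap_def chart_point_coord coord_in_chart_dom)
    (metis IntI chart_point coord_chart_point imageI)

lemma open_chart_image:
  assumes "c \<in> \<A>" "openin S X"
  shows "open (snd c ` (fst c \<inter> X))"
proof -
  have "openin (subtopology S (fst c)) (fst c \<inter> X)"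
    using assms(2) by (auto simp: openin_subtopology)
  then have "openin (top_of_set (chart_dom c)) (snd c ` (fst c \<inter> X))"
    using homeomorphic_imp_open_map[OF chart_homeomorphic[OF assms(1)]]
    unfolding open_map_def by blast
  then show ?thesis using open_chart_dom[OF assms(1)] by (metis openin_open_eq)
qed

lemma open_chart_overlap: "c \<in> \<A> \<Longrightarrow> d \<in> \<A> \<Longrightarrow> open (chart_overlap c d)"
  unfolding chart_overlap_def by (intro open_chart_image openin_chart)

lemma chart_overlap_self: "chart_overlap c c = chart_dom c"
  by (simp add: chart_overlap_def chart_dom_def)

context
  fixes c d z
  assumes cd: "c \<in> \<A>" "d \<in> \<A>" and z: "z \<in> chart_overlap c d"
begin

lemma transition_in_overlap: "transition c d z \<in> chart_overlap d c"
  and chart_point_transition: "chart_point d (transition c d z) = chart_point c z"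
  and transition_in_dom: "transition c d z \<in> chart_dom d"
  using cd z by (auto simp: chart_overlap_iff transition_def chart_point_coord coord_in_chart_dom chart_point)

lemma transition_transition:
  "transition d e (transition c d z) = transition c e z"
  using chart_point_transition by (simp add: transition_def)

end

lemma transition_self: "z \<in> chart_dom c \<Longrightarrow> transition c c z = z"
  by (simp add: transition_def coord_chart_point)

lemma transition_inverse:
  "c \<in> \<A> \<Longrightarrow> d \<in> \<A> \<Longrightarrow> z \<in> chart_overlap c d \<Longrightarrow> transition d c (transition c d z) = z"
  by (metis chart_overlap_iff transition_self transition_transition)

lemma differentiable_transition:
  "c \<in> \<A> \<Longrightarrow> d \<in> \<A> \<Longrightarrow> z \<in> chart_overlap c d \<Longrightarrow> transition c d differentiable (at z)"
  by (rule smooth_on_differentiable[OF smooth_transition])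

lemma overlap_triple:
  "c \<in> \<A> \<Longrightarrow> d \<in> \<A> \<Longrightarrow> z \<in> chart_overlap c d \<Longrightarrow> z \<in> chart_overlap c e \<Longrightarrow>
    transition c d z \<in> chart_overlap d e"
  by (simp add: chart_overlap_iff chart_point_transition transition_in_dom)

end

section \<open>Truncated substitution of polynomials\<close>

lemma pcompose_sum_smult:
  "pcompose p a = (\<Sum>k\<le>Polynomial.degree p. Polynomial.smult (poly.coeff p k) (a ^ k))"
  for p :: "complex poly"
proof -
  have "pcompose p a = poly (map_poly (\<lambda>x. [:x:]) p) a" by (rule pcompose_altdef)
  also have "\<dots> = (\<Sum>k\<le>Polynomial.degree p. [:poly.coeff p k:] * a ^ k)"
    by (subst poly_altdef, subst degree_map_poly) (auto simp: coeff_map_poly)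
  finally show ?thesis by simp
qed

lemma coeff_power_below:
  assumes "poly.coeff a 0 = 0" "i < k"
  shows "poly.coeff (a ^ k) i = (0 :: complex)"
proof -
  have "Polynomial.monom 1 1 dvd a" using assms(1) by (simp add: monom_dvd_iff_coeff)
  then have "Polynomial.monom 1 1 ^ k dvd a ^ k" by (rule dvd_power_same)
  then have "Polynomial.monom 1 k dvd a ^ k" by (simp add: monom_power)
  with assms(2) show ?thesis by (simp add: monom_dvd_iff_coeff)
qed

text \<open>Substitution of a polynomial without constant term is compatible with truncation at degree
  \<open>n\<close>. Thus such substitutions act on the quotient by \<open>p\<^sup>n\<close>, and their matrices multiply.\<close>

lemma coeff_pcompose_truncated:
  fixes p a :: "complex poly"
  assumes a: "poly.coeff a 0 = 0" and i: "i < n"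
  shows "poly.coeff (pcompose p a) i = (\<Sum>k<n. poly.coeff p k * poly.coeff (a ^ k) i)"
proof -
  let ?f = "\<lambda>k. poly.coeff p k * poly.coeff (a ^ k) i"
  have "poly.coeff (pcompose p a) i = (\<Sum>k\<le>Polynomial.degree p. ?f k)"
    unfolding pcompose_sum_smult by (simp add: coeff_sum)
  also have "\<dots> = (\<Sum>k<n + Suc (Polynomial.degree p). ?f k)"
    by (rule sum.mono_neutral_left) (auto simp: coeff_eq_0)
  also have "\<dots> = (\<Sum>k<n. ?f k)"
    by (rule sum.mono_neutral_right) (use coeff_power_below[OF a] i in auto)
  finally show ?thesis .
qed

lemma truncated_power_cong:
  fixes p q :: "complex poly"
  assumes "m dvd p - q" shows "m dvd p ^ j - q ^ j"
proof (induction j)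
  case (Suc j)
  have "p ^ Suc j - q ^ Suc j = p * (p ^ j - q ^ j) + (p - q) * q ^ j"
    by (simp add: algebra_simps)
  with Suc assms show ?case by (simp add: dvd_add dvd_mult dvd_mult2)
qed simp

lemma smooth_on_coeff_power:
  fixes p :: "complex \<Rightarrow> complex poly"
  assumes "open U" "\<And>i. smooth_on U (\<lambda>z. poly.coeff (p z) i)"
  shows "smooth_on U (\<lambda>z. poly.coeff (p z ^ j) i)"
proof (induction j arbitrary: i)
  case 0 then show ?case by (cases i) simp_all
next
  case (Suc j)
  have "smooth_on U (\<lambda>z. \<Sum>k\<le>i. poly.coeff (p z) k * poly.coeff (p z ^ j) (i - k))"
    by (intro smooth_on_sum smooth_on_mult assms Suc)
  then show ?case by (simp add: coeff_mult)
qed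

lemma pcompose_power: "pcompose (p ^ j) a = pcompose p a ^ j" for p :: "complex poly"
  by (induction j) (simp_all add: pcompose_mult pcompose_1)

lemma cst_1: "cst 1 = 1" and cst_0: "cst 0 = 0" and cst_minus_1: "cst (- 1) = - 1"
  by (simp_all add: cst_def one_pCons)

section \<open>The transition matrices of the induced bundle\<close>

locale induced_bundle = surface_atlas S \<A>
  for S :: "'a topology" and \<A> :: "'a chart set" +
  fixes n :: nat
    and I :: "'a chart \<Rightarrow> complex \<Rightarrow> cpoly2 set"
    and r :: "'a chart \<Rightarrow> 'a chart \<Rightarrow> complex \<Rightarrow> complex"
  assumes hcs: "higher_complex_structure n \<A> I"
    and sqrtK: "sqrt_canonical_bundle n \<A> I r"
begin

abbreviation mu :: "'a chart \<Rightarrow> nat \<Rightarrow> complex \<Rightarrow> complex" where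
  "mu c k z \<equiv> beltrami n (I c z) k"

definition bpoly :: "'a chart \<Rightarrow> complex \<Rightarrow> complex poly" where
  "bpoly c z = beltrami_poly n (beltrami n (I c z))"

lemma standard_form:
  "c \<in> \<A> \<Longrightarrow> z \<in> chart_dom c \<Longrightarrow> I c z = standard_ideal n (beltrami n (I c z))"
  and smooth_mu: "c \<in> \<A> \<Longrightarrow> k \<in> {2..n} \<Longrightarrow> smooth_on (chart_dom c) (mu c k)"
  and fiber_change_ideal: "c \<in> \<A> \<Longrightarrow> d \<in> \<A> \<Longrightarrow> z \<in> chart_overlap c d \<Longrightarrow>
    f \<in> I c z \<Longrightarrow> fiber_change c d z f \<in> I d (transition c d z)"
  using hcs unfolding higher_complex_structure_def by blast+

lemma ideal_iff:
  "c \<in> \<A> \<Longrightarrow> z \<in> chart_dom c \<Longrightarrow> f \<in> I c z \<longleftrightarrow> Polynomial.monom 1 n dvd poly f (bpoly c z)"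
  using standard_form[of c z] standard_ideal_iff[of f n "beltrami n (I c z)"] by (simp add: bpoly_def)

lemma quot_coords_bpoly:
  "c \<in> \<A> \<Longrightarrow> z \<in> chart_dom c \<Longrightarrow>
    quot_coords n (I c z) f = vec n (\<lambda>i. poly.coeff (poly f (bpoly c z)) i)"
  using standard_form[of c z] quot_coords_standard[of n "beltrami n (I c z)" f] by (simp add: bpoly_def)

text \<open>The images of the fiber coordinates \<open>p\<close> and \<open>p\<^sup>-\<close> of \<open>c\<close> in the quotient of \<open>d\<close>, written as
  polynomials in \<open>p\<close>. The matrix \<open>bundle_change\<close> describes the substitution \<open>subst_p\<close>.\<close>

definition subst_p :: "'a chart \<Rightarrow> 'a chart \<Rightarrow> complex \<Rightarrow> complex poly" where
  "subst_p c d z = [:0, dz (transition c d) z:] +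
     Polynomial.smult (dz (\<lambda>w. cnj (transition c d w)) z) (bpoly d (transition c d z))"

definition subst_pbar :: "'a chart \<Rightarrow> 'a chart \<Rightarrow> complex \<Rightarrow> complex poly" where
  "subst_pbar c d z = [:0, dzbar (transition c d) z:] +
     Polynomial.smult (dzbar (\<lambda>w. cnj (transition c d w)) z) (bpoly d (transition c d z))"

lemma coeff_subst_p_0: "poly.coeff (subst_p c d z) 0 = 0"
  by (simp add: subst_p_def bpoly_def coeff_beltrami_poly)

lemma fiber_change_pv_power:
  "poly (fiber_change c d z (pv ^ j)) (bpoly d (transition c d z)) = subst_p c d z ^ j"
proof -
  have "fiber_change c d z (pv ^ j) =
      (cst (dz (transition c d) z) * pv + cst (dz (\<lambda>w. cnj (transition c d w)) z) * pvbar) ^ j"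
    (is "_ = ?P ^ j")
  proof -
    have "fiber_change c d z (pv ^ j) =
        (\<Sum>i\<le>j. cst (poly.coeff (Polynomial.monom 1 j) i) * ?P ^ i)"
      unfolding fiber_change_def Let_def subst2_def pv_power by (simp add: degree_monom_eq)
    also have "\<dots> = (\<Sum>i\<le>j. if i = j then ?P ^ i else 0)"
      by (intro sum.cong) (auto simp: cst_1 cst_0)
    finally show ?thesis by simp
  qed
  then show ?thesis by (simp add: cst_def pv_def pvbar_def subst_p_def)
qed

lemma bundle_change_entry:
  assumes "c \<in> \<A>" "d \<in> \<A>" "z \<in> chart_overlap c d" "i < n" "j < n"
  shows "bundle_change n I r c d z $$ (i, j) = r c d z ^ (n - 1) * poly.coeff (subst_p c d z ^ j) i"
  using assms
  by (simp add: bundle_change_def quot_coords_bpoly transition_in_dom fiber_change_pv_power)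

text \<open>This is the compatibility of the ideals with the change of chart, applied to the second
  generator of the ideal of \<open>c\<close>.\<close>

lemma subst_p_beltrami:
  assumes c: "c \<in> \<A>" "d \<in> \<A>" and z: "z \<in> chart_overlap c d"
  shows "Polynomial.monom 1 n dvd pcompose (bpoly c z) (subst_p c d z) - subst_pbar c d z"
proof -
  have zc: "z \<in> chart_dom c" using c z by (simp add: chart_overlap_iff)
  let ?q = "bpoly d (transition c d z)" and ?g = "[:bpoly c z, -1:] :: cpoly2"
  let ?P = "cst (dz (transition c d) z) * pv + cst (dz (\<lambda>w. cnj (transition c d w)) z) * pvbar"
  let ?Q = "cst (dzbar (transition c d) z) * pv + cst (dzbar (\<lambda>w. cnj (transition c d w)) z) * pvbar"
  have "?g \<in> I c z" using c zc by (simp add: ideal_iff)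
  then have "Polynomial.monom 1 n dvd poly (fiber_change c d z ?g) ?q"
    using fiber_change_ideal[OF c z] ideal_iff[OF c(2) transition_in_dom[OF c z]] by blast
  moreover have "fiber_change c d z ?g =
      (\<Sum>i\<le>Polynomial.degree (bpoly c z). cst (poly.coeff (bpoly c z) i) * ?P ^ i) - ?Q"
    unfolding fiber_change_def Let_def subst2_def
    by (simp add: cst_minus_1 add.commute)
  moreover have "poly ?P ?q = subst_p c d z" "poly ?Q ?q = subst_pbar c d z"
    by (simp_all add: cst_def pv_def pvbar_def subst_p_def subst_pbar_def)
  moreover have "poly (cst a) ?q = [:a:]" for a by (simp add: cst_def)
  ultimately show ?thesis by (simp add: poly_sum pcompose_sum_smult)
qed

text \<open>By the chain rule the composite involves \<open>p\<^sup>-\<close> of the intermediate chart, and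
  \<open>subst_p_beltrami\<close> identifies its image there.\<close>

lemma subst_p_compose:
  assumes c: "c \<in> \<A>" "d \<in> \<A>" "e \<in> \<A>"
    and z: "z \<in> chart_overlap c d" "z \<in> chart_overlap c e"
  shows "Polynomial.monom 1 n dvd
    pcompose (subst_p c d z) (subst_p d e (transition c d z)) - subst_p c e z"
proof -
  let ?w = "transition c d z"
  let ?t = "transition c d" and ?s = "transition d e"
  let ?U = "chart_overlap c d \<inter> chart_overlap c e"
  have U: "open ?U" "z \<in> ?U" using open_chart_overlap[OF c(1,2)] open_chart_overlap[OF c(1,3)] z by auto
  have w: "?w \<in> chart_overlap d e" using overlap_triple c z by blast
  have td: "?t differentiable (at z)" and sd: "?s differentiable (at ?w)"
    using differentiable_transition c z w by auto
  have a1: "dz (transition c e) z = dz ?s ?w * dz ?t z + dzbar ?s ?w * dz (\<lambda>w. cnj (?t w)) z"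
  proof -
    have "dz (transition c e) z = dz (\<lambda>x. ?s (?t x)) z"
      unfolding dz_eq_wd by (rule wd_cong[OF U]) (use c in \<open>simp add: transition_transition\<close>)
    also have "\<dots> = dz ?s ?w * dz ?t z + dzbar ?s ?w * dz (\<lambda>w. cnj (?t w)) z"
      using wd_chain[OF td sd, of "-\<i>"] by (simp only: dz_eq_wd)
    finally show ?thesis .
  qed
  have a2: "dz (\<lambda>w. cnj (transition c e w)) z =
      dz (\<lambda>w. cnj (?s w)) ?w * dz ?t z + dzbar (\<lambda>w. cnj (?s w)) ?w * dz (\<lambda>w. cnj (?t w)) z"
  proof -
    have "dz (\<lambda>w. cnj (transition c e w)) z = dz (\<lambda>x. cnj (?s (?t x))) z"
      unfolding dz_eq_wd by (rule wd_cong[OF U]) (use c in \<open>simp add: transition_transition\<close>)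
    also have "\<dots> = dz (\<lambda>w. cnj (?s w)) ?w * dz ?t z + dzbar (\<lambda>w. cnj (?s w)) ?w * dz (\<lambda>w. cnj (?t w)) z"
      using wd_chain[where f = "\<lambda>w. cnj (?s w)", OF td differentiable_cnj[OF sd], of "-\<i>"]
      by (simp only: dz_eq_wd)
    finally show ?thesis .
  qed
  let ?b = "dz (\<lambda>w. cnj (?t w)) z"
  have eq1: "pcompose (subst_p c d z) (subst_p d e ?w) =
      Polynomial.smult (dz ?t z) (subst_p d e ?w) + Polynomial.smult ?b (pcompose (bpoly d ?w) (subst_p d e ?w))"
    unfolding subst_p_def[of c d] by (simp add: pcompose_add pcompose_smult pcompose_pCons)
  have eq2: "subst_p c e z =
      Polynomial.smult (dz ?t z) (subst_p d e ?w) + Polynomial.smult ?b (subst_pbar d e ?w)"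
    unfolding subst_p_def[of c e] subst_p_def[of d e] subst_pbar_def a1 a2
      transition_transition[OF c(1,2) z(1)]
    by (rule poly_eqI) (simp add: coeff_pCons algebra_simps split: nat.split)
  have "pcompose (subst_p c d z) (subst_p d e ?w) - subst_p c e z =
      Polynomial.smult ?b (pcompose (bpoly d ?w) (subst_p d e ?w) - subst_pbar d e ?w)"
    unfolding eq1 eq2 by (simp add: smult_diff_right)
  then show ?thesis using subst_p_beltrami[OF c(2,3) w] by (simp add: dvd_smult)
qed

lemma bundle_change_carrier [simp]: "bundle_change n I r c d z \<in> carrier_mat n n"
  by (simp add: bundle_change_def)

lemma sqrt_cocycle:
  "c \<in> \<A> \<Longrightarrow> d \<in> \<A> \<Longrightarrow> e \<in> \<A> \<Longrightarrow> z \<in> chart_overlap c d \<Longrightarrow> z \<in> chart_overlap c e \<Longrightarrow>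
    r c e z = r d e (transition c d z) * r c d z"
  and smooth_sqrt: "c \<in> \<A> \<Longrightarrow> d \<in> \<A> \<Longrightarrow> smooth_on (chart_overlap c d) (r c d)"
  and sqrt_square: "c \<in> \<A> \<Longrightarrow> d \<in> \<A> \<Longrightarrow> z \<in> chart_overlap c d \<Longrightarrow>
    (r c d z)\<^sup>2 * K_inv_factor n I c d z = 1"
  using sqrtK unfolding sqrt_canonical_bundle_def by blast+

lemma sqrt_nonzero:
  assumes "c \<in> \<A>" "d \<in> \<A>" "z \<in> chart_overlap c d" shows "r c d z \<noteq> 0"
  using sqrt_square[OF assms] by auto

lemma bundle_change_cocycle:
  assumes c: "c \<in> \<A>" "d \<in> \<A>" "e \<in> \<A>"
    and z: "z \<in> chart_overlap c d" "z \<in> chart_overlap c e"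
  shows "bundle_change n I r c e z =
    bundle_change n I r d e (transition c d z) * bundle_change n I r c d z"
proof (rule eq_matI)
  let ?w = "transition c d z"
  have w: "?w \<in> chart_overlap d e" using overlap_triple c z by blast
  fix i j assume "i < dim_row (bundle_change n I r d e ?w * bundle_change n I r c d z)"
    "j < dim_col (bundle_change n I r d e ?w * bundle_change n I r c d z)"
  then have ij: "i < n" "j < n" by (simp_all add: bundle_change_def)
  let ?p = "subst_p c d z" and ?q = "subst_p d e ?w"
  have "Polynomial.monom 1 n dvd pcompose ?p ?q ^ j - subst_p c e z ^ j"
    by (rule truncated_power_cong[OF subst_p_compose[OF c z]])
  then have 1: "poly.coeff (subst_p c e z ^ j) i = poly.coeff (pcompose ?p ?q ^ j) i"
    using ij by (simp add: monom_dvd_iff_coeff)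
  have 2: "poly.coeff (pcompose ?p ?q ^ j) i =
      (\<Sum>k<n. poly.coeff (?p ^ j) k * poly.coeff (?q ^ k) i)"
    using coeff_pcompose_truncated[OF coeff_subst_p_0 ij(1), of "?p ^ j"]
    by (simp add: pcompose_power)
  have "(bundle_change n I r d e ?w * bundle_change n I r c d z) $$ (i, j) =
      (\<Sum>k<n. bundle_change n I r d e ?w $$ (i, k) * bundle_change n I r c d z $$ (k, j))"
    using ij by (simp add: bundle_change_def scalar_prod_def atLeast0LessThan)
  also have "\<dots> = (\<Sum>k<n. r c e z ^ (n - 1) * (poly.coeff (?p ^ j) k * poly.coeff (?q ^ k) i))"
    using ij c z w by (intro sum.cong refl)
      (simp add: bundle_change_entry sqrt_cocycle[OF c z] power_mult_distrib)
  also have "\<dots> = bundle_change n I r c e z $$ (i, j)"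
    using ij c z by (simp add: bundle_change_entry 1 2 sum_distrib_left)
  finally show "bundle_change n I r c e z $$ (i, j) =
      (bundle_change n I r d e ?w * bundle_change n I r c d z) $$ (i, j)" by simp
qed (simp_all add: bundle_change_def)

lemma bundle_change_self:
  assumes c: "c \<in> \<A>" and z: "z \<in> chart_dom c"
  shows "bundle_change n I r c c z = 1\<^sub>m n"
proof -
  have zc: "z \<in> chart_overlap c c" using z by (simp add: chart_overlap_self)
  have "r c c z = r c c z * r c c z" using sqrt_cocycle[OF c c c zc zc] by (simp add: transition_self z)
  then have r: "r c c z = 1" using sqrt_nonzero[OF c c zc] by simp
  have 1: "dz (transition c c) z = 1"
  proof -
    have "dz (transition c c) z = dz (\<lambda>w. w) z" unfolding dz_eq_wd
      by (rule wd_cong[OF open_chart_dom[OF c] z]) (simp add: transition_self)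
    then show ?thesis by (simp add: dz_eq_wd wd_id)
  qed
  have 2: "dz (\<lambda>w. cnj (transition c c w)) z = 0"
  proof -
    have "dz (\<lambda>w. cnj (transition c c w)) z = dz cnj z" unfolding dz_eq_wd
      by (rule wd_cong[OF open_chart_dom[OF c] z]) (simp add: transition_self)
    then show ?thesis by (simp add: dz_eq_wd wd_cnj_id)
  qed
  have s: "subst_p c c z = Polynomial.monom 1 1"
    unfolding subst_p_def 1 2 by (simp add: monom_Suc monom_0)
  show ?thesis
    by (rule eq_matI) (auto simp: bundle_change_entry c zc r s monom_power bundle_change_def[THEN arg_cong[where f = dim_row]] bundle_change_def[THEN arg_cong[where f = dim_col]])
qed

lemma smooth_bundle_change:
  assumes c: "c \<in> \<A>" "d \<in> \<A>" and ij: "i < n" "j < n"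
  shows "smooth_on (chart_overlap c d) (\<lambda>z. bundle_change n I r c d z $$ (i, j))"
proof -
  note O = open_chart_overlap[OF c] and t = smooth_transition[OF c]
  have tV: "transition c d ` chart_overlap c d \<subseteq> chart_dom d"
    using c by (auto intro: transition_in_dom)
  have m: "smooth_on (chart_overlap c d) (\<lambda>z. mu d k (transition c d z))" if "k \<in> {2..n}" for k
    by (rule smooth_on_compose[OF O open_chart_dom[OF c(2)] tV t smooth_mu[OF c(2) that]])
  have "smooth_on (chart_overlap c d) (\<lambda>z. poly.coeff (bpoly d (transition c d z)) k)" for k
    unfolding bpoly_def coeff_beltrami_poly using m[of "Suc k"] by (cases "1 \<le> k \<and> k < n") auto
  moreover have "smooth_on (chart_overlap c d) (\<lambda>z. poly.coeff [:0, dz (transition c d) z:] k)" for k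
    using smooth_on_dz[OF t] by (cases k; cases "k - 1") (auto simp: coeff_pCons)
  ultimately have "smooth_on (chart_overlap c d) (\<lambda>z. poly.coeff (subst_p c d z) k)" for k
    unfolding subst_p_def coeff_add coeff_smult
    by (intro smooth_on_add smooth_on_mult O smooth_on_dz smooth_on_cnj t)
  then have "smooth_on (chart_overlap c d)
      (\<lambda>z. r c d z ^ (n - 1) * poly.coeff (subst_p c d z ^ j) i)"
    by (intro smooth_on_mult smooth_on_power smooth_on_coeff_power O smooth_sqrt c)
  then show ?thesis
    by (rule smooth_on_cong[OF O]) (simp add: bundle_change_entry c ij)
qed

end

section \<open>Parabolic connections have pointwise parabolic curvature\<close>

lemma mat_tr_carrier: "A \<in> carrier_mat n n \<Longrightarrow> mat_tr A = (\<Sum>i<n. A $$ (i, i))"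
  by (auto simp: mat_tr_def)

lemma mat_mult_entry:
  "A \<in> carrier_mat n n \<Longrightarrow> B \<in> carrier_mat n n \<Longrightarrow> i < n \<Longrightarrow> j < n \<Longrightarrow>
    (A * B) $$ (i, j) = (\<Sum>k<n. A $$ (i, k) * B $$ (k, j))" for A B :: "complex mat"
  by (auto simp: scalar_prod_def atLeast0LessThan)

lemma mat_tr_mult:
  "A \<in> carrier_mat n n \<Longrightarrow> B \<in> carrier_mat n n \<Longrightarrow>
    mat_tr (A * B) = (\<Sum>i<n. \<Sum>k<n. A $$ (i, k) * B $$ (k, i))"
  by (simp add: mat_tr_carrier[of _ n] mat_mult_entry del: index_mult_mat)

lemma mat_tr_mult_commute:
  assumes "A \<in> carrier_mat n n" "B \<in> carrier_mat n n"
  shows "mat_tr (A * B) = mat_tr (B * A)"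
  unfolding mat_tr_mult[OF assms] mat_tr_mult[OF assms(2,1)]
  by (subst sum.swap) (simp add: mult.commute)

lemma mat_tr_smult: "mat_tr (a \<cdot>\<^sub>m A) = a * mat_tr A" if "A \<in> carrier_mat n n"
  using that by (simp add: mat_tr_def sum_distrib_left)

lemma zero_smult_mat: "A \<in> carrier_mat n n \<Longrightarrow> 0 \<cdot>\<^sub>m A = (0\<^sub>m n n :: complex mat)"
  by (rule eq_matI) auto

text \<open>The real part of the integrand is nonnegative, and a nonnegative function with integral zero
  vanishes almost everywhere, hence not on a ball.\<close>

lemma integral_positive_on_ball:
  fixes g :: "complex \<Rightarrow> complex"
  assumes K: "compact K" "continuous_on K g" "K \<subseteq> D" and zero: "\<And>z. z \<in> D - K \<Longrightarrow> g z = 0"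
    and nn: "\<And>z. z \<in> D \<Longrightarrow> Re (g z) \<ge> 0"
    and pos: "R > 0" "ball a R \<subseteq> K" "\<And>z. z \<in> ball a R \<Longrightarrow> Re (g z) > 0"
  shows "(LINT z:D|lborel. g z) \<noteq> 0"
proof
  assume 0: "(LINT z:D|lborel. g z) = 0"
  let ?G = "\<lambda>z. indicator K z *\<^sub>R g z"
  have eq: "indicator D z *\<^sub>R g z = ?G z" for z
    using K(3) zero[of z] by (auto simp: indicator_def)
  have int: "integrable lborel ?G" by (rule borel_integrable_compact[OF K(1,2)])
  have intR: "integrable lborel (\<lambda>z. Re (?G z))" by (rule integrable_Re[OF int])
  have "(LINT z|lborel. Re (?G z)) = Re (LINT z|lborel. ?G z)" by (rule integral_Re[OF int])
  also have "(LINT z|lborel. ?G z) = 0" using 0 by (simp only: set_lebesgue_integral_def eq)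
  finally have "(LINT z|lborel. Re (?G z)) = 0" by simp
  moreover have "AE z in lborel. 0 \<le> Re (?G z)"
    using nn K(3) by (intro AE_I2) (auto simp: indicator_def)
  ultimately have "AE z in lborel. Re (?G z) = 0"
    using integral_nonneg_eq_0_iff_AE[OF intR] by blast
  then have "AE z in lborel. z \<notin> ball a R"
  proof (rule AE_mp, intro AE_I2 impI notI)
    fix z assume z: "Re (?G z) = 0" "z \<in> ball a R"
    then have "z \<in> K" using pos(2) by blast
    with z pos(3)[of z] show False by simp
  qed
  then have "ball a R \<in> null_sets lborel" by (subst AE_iff_null_sets) auto
  then have "measure lborel (ball a R) = 0" by (simp add: null_setsD1 measure_def)
  with content_ball_pos[OF pos(1), of a] show False by simp
qed

context induced_bundle
begin

lemma closed_chart_compact: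
  assumes H: "Hausdorff_space S" and c: "c \<in> \<A>" and K: "compact K" "K \<subseteq> chart_dom c"
  shows "closedin S {x \<in> fst c. snd c x \<in> K}"
proof -
  let ?X = "subtopology S (fst c)" and ?Y = "top_of_set (chart_dom c)"
  obtain g where g: "homeomorphic_maps ?X ?Y (snd c) g"
    using chart_homeomorphic[OF c] homeomorphic_map_maps by blast
  then have gc: "continuous_map ?Y ?X g" and "\<forall>x\<in>topspace ?X. g (snd c x) = x"
    unfolding homeomorphic_maps_def by blast+
  then have gi: "g (snd c x) = x" if "x \<in> fst c" for x
    using that unfolding topspace_chart[OF c] by blast
  have "compactin ?Y K" using K by (simp add: compactin_subtopology)
  then have "compactin ?X (g ` K)" by (rule image_compactin[OF _ gc])
  then have "compactin S (g ` K)" by (simp add: compactin_subtopology)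
  moreover have "g ` K = {x \<in> fst c. snd c x \<in> K}"
  proof -
    have "\<exists>x\<in>fst c. z = snd c x" if "z \<in> K" for z using that K(2) by (auto simp: chart_dom_def)
    then show ?thesis using gi by force
  qed
  ultimately show ?thesis using compactin_imp_closedin[OF H] by simp
qed

text \<open>A compact subset of a chart is closed in the Hausdorff space \<open>S\<close>. Its complement and the chart
  overlap therefore form an open cover on which smoothness can be checked separately.\<close>

lemma smooth_on_extend_by_zero:
  assumes H: "Hausdorff_space S" and c: "c \<in> \<A>" "d \<in> \<A>"
    and K: "compact K" "K \<subseteq> chart_dom c"
    and f: "smooth_on (chart_overlap d c) f"
    and zero: "\<And>z. z \<in> chart_dom d \<Longrightarrow> (z \<in> chart_overlap d c \<Longrightarrow> transition d c z \<notin> K) \<Longrightarrow> f z = 0"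
  shows "smooth_on (chart_dom d) f"
proof -
  let ?C = "{x \<in> fst c. snd c x \<in> K}"
  let ?V = "snd d ` (fst d \<inter> (topspace S - ?C))"
  have V: "open ?V"
    by (intro open_chart_image c openin_diff openin_topspace closed_chart_compact[OF H c(1) K])
  have "smooth_on ?V f"
  proof (rule smooth_on_cong[OF V smooth_on_const])
    fix z assume "z \<in> ?V"
    then obtain x where x: "x \<in> fst d" "x \<notin> ?C" "z = snd d x" by blast
    have "f z = 0"
    proof (rule zero)
      show "z \<in> chart_dom d" using x by (simp add: coord_in_chart_dom)
      assume "z \<in> chart_overlap d c"
      then have "x \<in> fst c" using x c by (simp add: chart_overlap_iff chart_point_coord)
      then show "transition d c z \<notin> K"
        using x by (simp add: transition_def chart_point_coord c)
    qed
    then show "0 = f z" by simp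
  qed
  then have "smooth_on (chart_overlap d c \<union> ?V) f"
    by (rule smooth_on_Un[OF open_chart_overlap[OF c(2,1)] V f])
  moreover have "chart_dom d \<subseteq> chart_overlap d c \<union> ?V"
  proof
    fix z assume "z \<in> chart_dom d"
    then obtain x where x: "x \<in> fst d" "z = snd d x" by (auto simp: chart_dom_def)
    moreover have "x \<in> topspace S" using x openin_subset[OF openin_chart[OF c(2)]] by blast
    ultimately show "z \<in> chart_overlap d c \<union> ?V"
      by (cases "x \<in> fst c") (auto simp: chart_overlap_def)
  qed
  ultimately show ?thesis by (rule smooth_on_subset)
qed

lemma bundle_change_first_column:
  assumes "c \<in> \<A>" "d \<in> \<A>" "z \<in> chart_overlap c d" "0 < i" "i < n"
  shows "bundle_change n I r c d z $$ (i, 0) = 0"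
  using assms by (simp add: bundle_change_entry)

text \<open>The extension by zero of the section \<open>b M\<close> over \<open>c\<close>. The inverse of the transition matrix is
  the transition matrix in the opposite direction, which is smooth and has first column in \<open>L\<close> as
  well.\<close>

definition test_section ::
  "'a chart \<Rightarrow> (complex \<Rightarrow> complex) \<Rightarrow> complex mat \<Rightarrow> 'a chart \<Rightarrow> complex \<Rightarrow> complex mat" where
  "test_section c b M d w = (if w \<in> chart_overlap d c then
     b (transition d c w) \<cdot>\<^sub>m
       (bundle_change n I r c d (transition d c w) * M * bundle_change n I r d c w)
     else 0\<^sub>m n n)"

lemma test_section_same_chart:
  assumes "c \<in> \<A>" "z \<in> chart_dom c" "M \<in> carrier_mat n n"
  shows "test_section c b M c z = b z \<cdot>\<^sub>m M"
  using assms by (simp add: test_section_def chart_overlap_self transition_self bundle_change_self)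

lemma test_section_preserving_L:
  assumes H: "Hausdorff_space S" and c: "c \<in> \<A>"
    and K: "compact K" "K \<subseteq> chart_dom c"
    and b: "smooth_on UNIV b" "\<And>z. z \<notin> K \<Longrightarrow> b z = 0"
    and M: "M \<in> carrier_mat n n" "mat_tr M = 0" "\<And>i. 0 < i \<Longrightarrow> i < n \<Longrightarrow> M $$ (i, 0) = 0"
  shows "sl_section_preserving_L n \<A> I r (test_section c b M)"
proof -
  let ?G = "bundle_change n I r"
  let ?T = "\<lambda>d w. ?G c d (transition d c w) * M * ?G d c w"
  have T: "?T d w \<in> carrier_mat n n" for d w
    by (intro mult_carrier_mat[of _ n n] bundle_change_carrier M)
  have carrier: "test_section c b M d w \<in> carrier_mat n n" for d w
    using T by (simp add: test_section_def)
  have inv: "?G d c w * ?G c d (transition d c w) = 1\<^sub>m n"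
    if d: "d \<in> \<A>" and w: "w \<in> chart_overlap d c" for d w
  proof -
    let ?x = "transition d c w"
    have x: "?x \<in> chart_overlap c d" "?x \<in> chart_dom c" "transition c d ?x = w"
      using transition_in_overlap transition_in_dom transition_inverse c d w by auto
    then have xc: "?x \<in> chart_overlap c c" by (simp add: chart_overlap_self)
    show ?thesis using bundle_change_cocycle[OF c d c x(1) xc] bundle_change_self[OF c x(2)] x(3) by simp
  qed
  have smooth: "smooth_on (chart_dom d) (\<lambda>w. test_section c b M d w $$ (i, j))"
    if d: "d \<in> \<A>" and ij: "i < n" "j < n" for d i j
  proof (rule smooth_on_extend_by_zero[OF H c d K])
    note O = open_chart_overlap[OF d c]
    have tr: "transition d c ` chart_overlap d c \<subseteq> chart_overlap c d"
      using transition_in_overlap[OF d c] by auto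
    have 1: "smooth_on (chart_overlap d c) (\<lambda>w. ?G c d (transition d c w) $$ (k, l))"
      if "k < n" "l < n" for k l
      by (rule smooth_on_compose[OF O open_chart_overlap[OF c d] tr smooth_transition[OF d c]
            smooth_bundle_change[OF c d that]])
    have 2: "smooth_on (chart_overlap d c) (\<lambda>w. b (transition d c w))"
      by (rule smooth_on_compose[OF O open_UNIV _ smooth_transition[OF d c] b(1)]) simp
    have "smooth_on (chart_overlap d c) (\<lambda>w. b (transition d c w) *
       (\<Sum>l<n. (\<Sum>k<n. ?G c d (transition d c w) $$ (i, k) * M $$ (k, l)) * ?G d c w $$ (l, j)))"
      by (intro smooth_on_mult smooth_on_sum O 1 2 smooth_bundle_change smooth_on_const ij d c) auto
    then show "smooth_on (chart_overlap d c) (\<lambda>w. test_section c b M d w $$ (i, j))"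
    proof (rule smooth_on_cong[OF O])
      fix w assume w: "w \<in> chart_overlap d c"
      have "?T d w $$ (i, j) =
          (\<Sum>l<n. (\<Sum>k<n. ?G c d (transition d c w) $$ (i, k) * M $$ (k, l)) * ?G d c w $$ (l, j))"
        using ij M by (simp add: mat_mult_entry[of _ n] mult_carrier_mat[of _ n n] del: index_mult_mat)
      moreover have "test_section c b M d w $$ (i, j) = b (transition d c w) * ?T d w $$ (i, j)"
        using w ij T[of d w] by (simp add: test_section_def del: index_mult_mat)
      ultimately show "b (transition d c w) *
       (\<Sum>l<n. (\<Sum>k<n. ?G c d (transition d c w) $$ (i, k) * M $$ (k, l)) * ?G d c w $$ (l, j))
        = test_section c b M d w $$ (i, j)" by simp
    qed
    fix z assume "z \<in> chart_dom d" "z \<in> chart_overlap d c \<Longrightarrow> transition d c z \<notin> K"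
    then show "test_section c b M d z $$ (i, j) = 0"
      using ij T[of d z] b(2) by (simp add: test_section_def del: index_mult_mat)
  qed
  have trace: "mat_tr (test_section c b M d w) = 0" if d: "d \<in> \<A>" for d w
  proof (cases "w \<in> chart_overlap d c")
    case True
    have "mat_tr (?T d w) = mat_tr (?G d c w * (?G c d (transition d c w) * M))"
      by (rule mat_tr_mult_commute[of _ n]) (intro mult_carrier_mat[of _ n n] bundle_change_carrier M)+
    also have "?G d c w * (?G c d (transition d c w) * M) = M"
    proof -
      have "?G d c w * ?G c d (transition d c w) * M = ?G d c w * (?G c d (transition d c w) * M)"
        by (rule assoc_mult_mat[of _ n n _ n _ n]) (simp_all add: M)
      then show ?thesis unfolding inv[OF d True] left_mult_one_mat[OF M(1)] by (rule sym)
    qed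
    finally have "mat_tr (?T d w) = 0" using M(2) by simp
    then show ?thesis using True mat_tr_smult[OF T[of d w]] by (simp add: test_section_def)
  qed (simp add: test_section_def mat_tr_def)
  have col: "test_section c b M d w $$ (i, 0) = 0" if d: "d \<in> \<A>" and i: "i \<in> {1..<n}" for d w i
  proof (cases "w \<in> chart_overlap d c")
    case True
    have n: "0 < n" "i < n" "0 < i" using i by auto
    let ?x = "transition d c w"
    have x: "?x \<in> chart_overlap c d" using transition_in_overlap[OF d c True] .
    have 1: "(\<Sum>k<n. ?G c d ?x $$ (i, k) * M $$ (k, 0)) = 0"
    proof (rule sum.neutral, intro ballI)
      fix k assume "k \<in> {..<n}"
      then show "?G c d ?x $$ (i, k) * M $$ (k, 0) = 0"
        using bundle_change_first_column[OF c d x n(3,2)] M(3)[of k] by (cases "k = 0") auto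
    qed
    have "?T d w $$ (i, 0) = (\<Sum>l<n. (\<Sum>k<n. ?G c d ?x $$ (i, k) * M $$ (k, l)) * ?G d c w $$ (l, 0))"
      using n M by (simp add: mat_mult_entry[of _ n] mult_carrier_mat[of _ n n] del: index_mult_mat)
    also have "\<dots> = 0"
    proof (rule sum.neutral, intro ballI)
      fix l assume "l \<in> {..<n}"
      then show "(\<Sum>k<n. ?G c d ?x $$ (i, k) * M $$ (k, l)) * ?G d c w $$ (l, 0) = 0"
        using bundle_change_first_column[OF d c True, of l] 1 by (cases "l = 0") auto
    qed
    finally show ?thesis using True n T[of d w] by (simp add: test_section_def del: index_mult_mat)
  qed (use i in \<open>simp add: test_section_def\<close>)
  have change: "?G d e w * test_section c b M d w = test_section c b M e (transition d e w) * ?G d e w"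
    if d: "d \<in> \<A>" and e: "e \<in> \<A>" and w: "w \<in> chart_overlap d e" for d e w
  proof (cases "w \<in> chart_overlap d c")
    case True
    let ?x = "transition d c w" and ?v = "transition d e w"
    have v: "?v \<in> chart_overlap e c" "transition e c ?v = ?x"
      using overlap_triple d e w True transition_transition by auto
    have x: "?x \<in> chart_overlap c d" "transition c d ?x = w"
      using transition_in_overlap transition_inverse d c True by auto
    have xe: "?x \<in> chart_overlap c e" using overlap_triple[OF d c True w] .
    have G1: "?G c e ?x = ?G d e w * ?G c d ?x"
      using bundle_change_cocycle[OF c d e x(1) xe] x(2) by simp
    have G2: "?G d c w = ?G e c ?v * ?G d e w"
      using bundle_change_cocycle[OF d e c w True] .
    have "?G d e w * ?T d w = ?T e ?v * ?G d e w"
      unfolding v(2) G1 unfolding G2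
      using M(1) by (simp add: assoc_mult_mat[of _ n n _ n _ n] mult_carrier_mat[of _ n n])
    then have "b ?x \<cdot>\<^sub>m (?G d e w * ?T d w) = b ?x \<cdot>\<^sub>m (?T e ?v * ?G d e w)" by simp
    then show ?thesis using True v T[of d w] T[of e ?v]
      by (simp add: test_section_def mult_smult_distrib[of _ n n _ n] mult_smult_assoc_mat[of _ n n _ n])
  next
    case False
    then have "transition d e w \<notin> chart_overlap e c"
      using w d e by (simp add: chart_overlap_iff chart_point_transition transition_in_dom)
    with False show ?thesis by (simp add: test_section_def left_mult_zero_mat[of _ n n] right_mult_zero_mat[of _ n n])
  qed
  show ?thesis
    unfolding sl_section_preserving_L_def smooth_mat_on_def
    using smooth carrier trace col change by blast
qed

text \<open>If the trace did not vanish at \<open>a\<close>, the test section given by \<open>M\<close> times a cutoff function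
  times the conjugate of that trace would have a pairing with positive real part. A wider cutoff
  function serves as the partition of unity, so that the integral is taken over one chart.\<close>

lemma L_parabolic_pointwise_trace:
  assumes H: "Hausdorff_space S" and c: "c \<in> \<A>" and par: "L_parabolic n S \<A> I r B"
    and F: "\<And>d z. d \<in> \<A> \<Longrightarrow> z \<in> chart_dom d \<Longrightarrow> curvature n (B d) z \<in> carrier_mat n n"
    and cont: "\<And>i j. i < n \<Longrightarrow> j < n \<Longrightarrow> continuous_on (chart_dom c) (\<lambda>z. curvature n (B c) z $$ (i, j))"
    and M: "M \<in> carrier_mat n n" "mat_tr M = 0" "\<And>i. 0 < i \<Longrightarrow> i < n \<Longrightarrow> M $$ (i, 0) = 0"
    and a: "a \<in> chart_dom c"
  shows "mat_tr (curvature n (B c) a * M) = 0"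
proof (rule ccontr)
  let ?D = "chart_dom c"
  define p where "p = (\<lambda>z. mat_tr (curvature n (B c) z * M))"
  assume "mat_tr (curvature n (B c) a * M) \<noteq> 0"
  then have v: "p a \<noteq> 0" by (simp add: p_def)
  have pc: "continuous_on ?D p"
  proof -
    have "continuous_on ?D (\<lambda>z. \<Sum>i<n. \<Sum>k<n. curvature n (B c) z $$ (i, k) * M $$ (k, i))"
      by (intro continuous_on_sum continuous_on_mult continuous_on_const cont) auto
    then show ?thesis
      by (rule continuous_on_eq) (simp add: p_def mat_tr_mult[OF F[OF c] M(1)])
  qed
  have Dopen: "open ?D" by (rule open_chart_dom[OF c])
  have "continuous_on ?D (\<lambda>z. Re (cnj (p a) * p z))"
    by (intro continuous_intros pc)
  then have "open (?D \<inter> (\<lambda>z. Re (cnj (p a) * p z)) -` {0<..})"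
    using Dopen by (rule continuous_open_preimage) simp
  moreover have "Re (cnj (p a) * p a) > 0" using v
    by (simp add: sum_power2_gt_zero_iff complex_eq_iff flip: power2_eq_square)
  ultimately obtain e where e: "e > 0" "cball a e \<subseteq> ?D \<inter> (\<lambda>z. Re (cnj (p a) * p z)) -` {0<..}"
    using a by (metis (no_types, lifting) IntI greaterThan_iff open_contains_cball vimageI)
  \<comment> \<open>radii \<open>R\<close> and \<open>2 R\<close> are for the test section, \<open>2 R\<close> and \<open>4 R\<close> for the partition of unity\<close>
  define R where "R = e / 4"
  have R: "R > 0" "4 * R = e" using e by (simp_all add: R_def)
  define K where "K = cball a (4 * R)"
  define K' where "K' = cball a (2 * R)"
  have K: "compact K" "K \<subseteq> ?D" and K': "compact K'" "K' \<subseteq> ?D"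
    using e R by (auto simp: K_def K'_def)
  obtain h where h: "smooth_on UNIV (\<lambda>z. complex_of_real (h z))" "\<And>z. 0 \<le> h z"
      "\<And>z. dist a z \<le> R \<Longrightarrow> h z = 1" "\<And>z. dist a z \<ge> 2 * R \<Longrightarrow> h z = 0"
    by (rule exists_cutoff[OF R(1), of a]) (rule that)
  obtain k where k: "smooth_on UNIV (\<lambda>z. complex_of_real (k z))" "\<And>z. 0 \<le> k z"
      "\<And>z. dist a z \<le> 2 * R \<Longrightarrow> k z = 1" "\<And>z. dist a z \<ge> 2 * (2 * R) \<Longrightarrow> k z = 0"
    by (rule exists_cutoff[of "2 * R" a]) (use R(1) in simp, rule that)
  define b where "b = (\<lambda>z. complex_of_real (h z) * cnj (p a))"
  have b: "smooth_on UNIV b" unfolding b_def by (intro smooth_on_mult h(1) open_UNIV smooth_on_const)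
  have b0: "b z = 0" if "z \<notin> K'" for z using that h(4)[of z] by (auto simp: b_def K'_def)
  let ?M = "test_section c b M"
  have "sl_section_preserving_L n \<A> I r ?M"
    by (rule test_section_preserving_L[OF H c K' b b0 M])
  then have si: "has_surface_integral S \<A> (\<lambda>d z. mat_tr (curvature n (B d) z * ?M d z)) 0" (is "has_surface_integral _ _ ?w _")
    using par unfolding L_parabolic_def by blast
  define \<rho> :: "'a chart \<Rightarrow> 'a \<Rightarrow> real" where "\<rho> = (\<lambda>_ x. if x \<in> fst c then k (snd c x) else 0)"
  have "partition_on_support S \<A> ?w {c} \<rho>"
    unfolding partition_on_support_def
  proof (intro conjI ballI impI)
    fix d assume "d \<in> {c}"
    then have dc: "d = c" by simp
    have "S closure_of {x \<in> topspace S. \<rho> d x \<noteq> 0} \<subseteq> {x \<in> fst c. snd c x \<in> K}"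
    proof (rule closure_of_minimal[OF _ closed_chart_compact[OF H c K]])
      have "k z = 0" if "z \<notin> K" for z using k(4)[of z] that by (auto simp: K_def)
      then show "{x \<in> topspace S. \<rho> d x \<noteq> 0} \<subseteq> {x \<in> fst c. snd c x \<in> K}"
        by (auto simp: \<rho>_def)
    qed
    then show "S closure_of {x \<in> topspace S. \<rho> d x \<noteq> 0} \<subseteq> fst d" using dc by auto
    fix d' assume d': "d' \<in> \<A>"
    show "smooth_on (chart_dom d') (\<lambda>z. complex_of_real (\<rho> d (chart_point d' z)))"
    proof (rule smooth_on_extend_by_zero[OF H c d' K])
      have "smooth_on (chart_overlap d' c) (\<lambda>z. complex_of_real (k (transition d' c z)))"
        by (rule smooth_on_compose[OF open_chart_overlap[OF d' c] open_UNIV _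
              smooth_transition[OF d' c] k(1)]) simp
      then show "smooth_on (chart_overlap d' c) (\<lambda>z. complex_of_real (\<rho> d (chart_point d' z)))"
        by (rule smooth_on_cong[OF open_chart_overlap[OF d' c]])
          (simp add: \<rho>_def transition_def chart_overlap_iff d')
      fix z assume z: "z \<in> chart_dom d'" "z \<in> chart_overlap d' c \<Longrightarrow> transition d' c z \<notin> K"
      have "k w = 0" if "w \<notin> K" for w using k(4)[of w] that by (auto simp: K_def)
      then show "complex_of_real (\<rho> d (chart_point d' z)) = 0"
        using z d' by (auto simp: \<rho>_def chart_overlap_iff transition_def)
    qed
  next
    fix d z assume d: "d \<in> \<A>" and z: "z \<in> chart_dom d" and nz: "?w d z \<noteq> 0"
    have "z \<in> chart_overlap d c \<and> b (transition d c z) \<noteq> 0"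
    proof (rule ccontr)
      assume *: "\<not> ?thesis"
      have "?M d z = 0\<^sub>m n n"
      proof (cases "z \<in> chart_overlap d c")
        case True
        have "bundle_change n I r c d (transition d c z) * M * bundle_change n I r d c z \<in> carrier_mat n n"
          by (intro mult_carrier_mat[of _ n n] bundle_change_carrier M)
        from zero_smult_mat[OF this] True * show ?thesis by (simp add: test_section_def)
      qed (simp add: test_section_def)
      then have "mat_tr (curvature n (B d) z * ?M d z) = 0"
        using mat_tr_mult[OF F[OF d z] zero_carrier_mat] by simp
      with nz show False by simp
    qed
    then have zo: "z \<in> chart_overlap d c" and "dist a (transition d c z) < 2 * R"
      using b0 h(4) by (auto simp: b_def) (meson not_le)
    then have "k (transition d c z) = 1" by (intro k(3)) simp
    then show "(\<Sum>c'\<in>{c}. \<rho> c' (chart_point d z)) = 1"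
      using zo d by (simp add: \<rho>_def transition_def chart_overlap_iff)
  qed (use c k in \<open>auto simp: \<rho>_def\<close>)
  then have "0 = (\<Sum>d\<in>{c}. - 2 * \<i> *
      (LINT z:chart_dom d|lborel. complex_of_real (\<rho> d (chart_point d z)) * ?w d z))"
    using si unfolding has_surface_integral_def by blast
  then have "(LINT z:?D|lborel. complex_of_real (\<rho> c (chart_point c z)) * ?w c z) = 0" by simp
  moreover have "(LINT z:?D|lborel. complex_of_real (\<rho> c (chart_point c z)) * ?w c z) \<noteq> 0"
  proof (rule integral_positive_on_ball[OF K(1) _ K(2)])
    have g: "complex_of_real (\<rho> c (chart_point c z)) * ?w c z =
        complex_of_real (k z) * (complex_of_real (h z) * (cnj (p a) * p z))" if z: "z \<in> ?D" for z
    proof -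
      have "?w c z = b z * p z"
        unfolding test_section_same_chart[OF c z M(1)] p_def
        using mat_tr_smult[OF mult_carrier_mat[OF F[OF c z] M(1)]] F[OF c z] M(1)
        by (simp add: mult_smult_distrib[of _ n n _ n])
      moreover have "\<rho> c (chart_point c z) = k z"
        using z by (simp add: \<rho>_def chart_point coord_chart_point)
      ultimately show ?thesis by (simp add: b_def mult.assoc)
    qed
    have "continuous_on K (\<lambda>z. complex_of_real (k z) * (complex_of_real (h z) * (cnj (p a) * p z)))"
      by (intro continuous_on_mult continuous_on_const continuous_on_subset[OF pc K(2)]
          continuous_on_subset[OF smooth_on_continuous[OF k(1)]]
          continuous_on_subset[OF smooth_on_continuous[OF h(1)]] subset_UNIV)
    then show "continuous_on K (\<lambda>z. complex_of_real (\<rho> c (chart_point c z)) * ?w c z)"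
      by (rule continuous_on_eq) (use K(2) g in auto)
    show "ball a R \<subseteq> K" using R by (auto simp: K_def)
    have Re: "Re (complex_of_real (\<rho> c (chart_point c z)) * ?w c z) = k z * h z * Re (cnj (p a) * p z)"
      if z: "z \<in> ?D" for z
      unfolding g[OF z] by (simp add: algebra_simps)
    have pos: "Re (cnj (p a) * p z) > 0" if "z \<in> K" for z
      using that e(2) R(2) by (auto simp: K_def)
    show "complex_of_real (\<rho> c (chart_point c z)) * ?w c z = 0" if "z \<in> ?D - K" for z
    proof -
      have "k z = 0" using that by (intro k(4)) (auto simp: K_def)
      moreover have "z \<in> ?D" using that by simp
      ultimately show ?thesis using g by simp
    qed
    show "0 \<le> Re (complex_of_real (\<rho> c (chart_point c z)) * ?w c z)" if z: "z \<in> ?D" for z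
    proof (cases "z \<in> K")
      case True
      have "0 \<le> Re (cnj (p a) * p z)" using pos[OF True] by (rule less_imp_le)
      then show ?thesis unfolding Re[OF z] using k(2)[of z] h(2)[of z] by (intro mult_nonneg_nonneg)
    next
      case False
      have "k z = 0" using False by (intro k(4)) (auto simp: K_def)
      then show ?thesis unfolding Re[OF z] by simp
    qed
    show "0 < Re (complex_of_real (\<rho> c (chart_point c z)) * ?w c z)" if z: "z \<in> ball a R" for z
    proof -
      have zK: "z \<in> K" using z R by (auto simp: K_def)
      have "h z = 1" "k z = 1" using z R by (auto intro!: h(3) k(3))
      moreover have zD: "z \<in> ?D" using zK K(2) by blast
      ultimately show ?thesis unfolding Re[OF zD] using pos[OF zK] by simp
    qed
  qed (rule R(1))
  ultimately show False by simp
qed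

text \<open>Elementary matrices remove the entries below the first row, differences of diagonal ones show
  that the diagonal entries coincide, and the trace then forces them to vanish.\<close>

lemma L_parabolic_pointwise:
  assumes H: "Hausdorff_space S" and c: "c \<in> \<A>" and par: "L_parabolic n S \<A> I r B"
    and F: "\<And>d z. d \<in> \<A> \<Longrightarrow> z \<in> chart_dom d \<Longrightarrow> curvature n (B d) z \<in> carrier_mat n n"
    and cont: "\<And>i j. i < n \<Longrightarrow> j < n \<Longrightarrow> continuous_on (chart_dom c) (\<lambda>z. curvature n (B c) z $$ (i, j))"
    and tr: "mat_tr (curvature n (B c) a) = 0"
    and a: "a \<in> chart_dom c" and ij: "i < n" "j < n" "0 < i \<or> j = 0"
  shows "curvature n (B c) a $$ (i, j) = 0"
proof -
  let ?F = "curvature n (B c) a"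
  note * = L_parabolic_pointwise_trace[OF H c par F cont _ _ _ a]
  define E where "E = (\<lambda>i j x. mat n n (\<lambda>(k, l). if (k, l) = (i, j) then x else 0 :: complex))"
  have trE: "mat_tr (?F * mat n n f) = (\<Sum>k<n. \<Sum>l<n. ?F $$ (k, l) * f (l, k))" for f
    by (simp add: mat_tr_mult[OF F[OF c a]])
  have delta: "(\<Sum>k<n. \<Sum>l<n. ?F $$ (k, l) * (if (l, k) = (s, t) then x else 0)) = ?F $$ (t, s) * x"
    if "s < n" "t < n" for s t x
  proof -
    have "(\<Sum>l<n. ?F $$ (k, l) * (if (l, k) = (s, t) then x else 0)) =
        (\<Sum>l<n. if l = s then (if k = t then ?F $$ (t, s) * x else 0) else 0)" for k
      by (intro sum.cong refl) auto
    then show ?thesis using that by simp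
  qed
  have off: "?F $$ (s, t) = 0" if st: "s < n" "t < n" "0 < s" "s \<noteq> t" for s t
  proof -
    let ?f = "\<lambda>(k, l). if (k, l) = (t, s) then 1 else 0 :: complex"
    have "mat_tr (?F * mat n n ?f) = 0"
      by (rule *) (use st in \<open>auto simp: mat_tr_def intro!: sum.neutral\<close>)
    then show ?thesis unfolding trE using delta[of t s 1] st by simp
  qed
  have diag: "?F $$ (s, s) = ?F $$ (0, 0)" if s: "s < n" for s
  proof (cases "s = 0")
    case False
    let ?f = "\<lambda>(k, l). (if (k, l) = (s, s) then 1 else 0) + (if (k, l) = (0, 0) then -1 else 0) :: complex"
    have "mat_tr (?F * mat n n ?f) = 0"
    proof (rule *)
      have "mat_tr (mat n n ?f) = (\<Sum>k<n. (if k = s then 1 else 0) + (if k = 0 then -1 else 0))"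
        by (simp add: mat_tr_def) 
      also have "\<dots> = 0" unfolding sum.distrib using s False by simp
      finally show "mat_tr (mat n n ?f) = 0" .
    qed (use s False in auto)
    then have "(\<Sum>k<n. \<Sum>l<n. ?F $$ (k, l) * (if (l, k) = (s, s) then 1 else 0)) +
        (\<Sum>k<n. \<Sum>l<n. ?F $$ (k, l) * (if (l, k) = (0, 0) then -1 else 0)) = 0"
      unfolding trE by (simp add: distrib_left sum.distrib del: mult_cancel_left)
    then show ?thesis using delta[of s s 1] delta[of 0 0 "-1"] s by simp
  qed simp
  have "(\<Sum>s<n. ?F $$ (s, s)) = of_nat n * ?F $$ (0, 0)"
    by (subst sum.cong[OF refl diag]) auto
  then have "?F $$ (0, 0) = 0" using tr ij by (simp add: mat_tr_carrier[OF F[OF c a]])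
  then show ?thesis using off[OF ij(1,2)] diag[OF ij(1)] ij(3) by (cases "i = j") auto
qed

end

section \<open>Smooth families of given order in a small parameter\<close>

text \<open>Families \<open>F e z\<close> that are of order \<open>e\<^sup>N\<close> together with all their \<open>z\<close>-derivatives, uniformly
  for \<open>z\<close> in \<open>W\<close> and \<open>0 < norm e < \<delta>\<close>. They form a filtered ring that is stable under the Wirtinger
  derivatives, which is what allows differentiating asymptotic expansions. The value \<open>e = 0\<close> is
  excluded because the connections are defined only for finite spectral parameter.\<close>

definition bound_O ::
  "complex set \<Rightarrow> real \<Rightarrow> nat \<Rightarrow> (complex \<Rightarrow> complex \<Rightarrow> complex) \<Rightarrow> bool" where
  "bound_O W \<delta> N F \<longleftrightarrow>
     (\<exists>K. \<forall>e z. e \<noteq> 0 \<longrightarrow> norm e < \<delta> \<longrightarrow> z \<in> W \<longrightarrow> norm (F e z) \<le> K * norm e ^ N)"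

primrec Ck_O ::
  "complex set \<Rightarrow> real \<Rightarrow> nat \<Rightarrow> nat \<Rightarrow> (complex \<Rightarrow> complex \<Rightarrow> complex) \<Rightarrow> bool" where
  "Ck_O W \<delta> N 0 F \<longleftrightarrow> bound_O W \<delta> N F"
| "Ck_O W \<delta> N (Suc m) F \<longleftrightarrow> bound_O W \<delta> N F \<and>
     (\<forall>e z. e \<noteq> 0 \<longrightarrow> norm e < \<delta> \<longrightarrow> z \<in> W \<longrightarrow> F e differentiable (at z)) \<and>
     (\<forall>c\<in>{\<i>, - \<i>}. Ck_O W \<delta> N m (\<lambda>e. wd c (F e)))"

definition smooth_O ::
  "complex set \<Rightarrow> real \<Rightarrow> nat \<Rightarrow> (complex \<Rightarrow> complex \<Rightarrow> complex) \<Rightarrow> bool" where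
  "smooth_O W \<delta> N F \<longleftrightarrow> (\<forall>m. Ck_O W \<delta> N m F)"

declare Ck_O.simps(2) [simp del]

lemma Ck_O_SucI:
  assumes "bound_O W \<delta> N F"
    and "\<And>e z. e \<noteq> 0 \<Longrightarrow> norm e < \<delta> \<Longrightarrow> z \<in> W \<Longrightarrow> F e differentiable (at z)"
    and "\<And>c. c = \<i> \<or> c = - \<i> \<Longrightarrow> Ck_O W \<delta> N m (\<lambda>e. wd c (F e))"
  shows "Ck_O W \<delta> N (Suc m) F"
  using assms by (simp add: Ck_O.simps(2))

lemma Ck_O_SucD:
  assumes "Ck_O W \<delta> N (Suc m) F"
  shows "bound_O W \<delta> N F"
    and "e \<noteq> 0 \<Longrightarrow> norm e < \<delta> \<Longrightarrow> z \<in> W \<Longrightarrow> F e differentiable (at z)"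
    and "c = \<i> \<or> c = - \<i> \<Longrightarrow> Ck_O W \<delta> N m (\<lambda>e. wd c (F e))"
  using assms unfolding Ck_O.simps(2) by blast+

lemma Ck_O_bound: "Ck_O W \<delta> N m F \<Longrightarrow> bound_O W \<delta> N F"
  by (cases m) (auto dest: Ck_O_SucD(1))

lemma Ck_O_mono_Suc: "Ck_O W \<delta> N (Suc m) F \<Longrightarrow> Ck_O W \<delta> N m F"
proof (induction m arbitrary: F)
  case 0
  show ?case using Ck_O_SucD(1)[OF 0] by simp
next
  case (Suc m)
  note d = Ck_O_SucD[OF Suc.prems]
  show ?case by (rule Ck_O_SucI[OF d(1,2) Suc.IH[OF d(3)]])
qed

lemma bound_O_cong:
  assumes "\<And>e z. e \<noteq> 0 \<Longrightarrow> norm e < \<delta> \<Longrightarrow> z \<in> W \<Longrightarrow> F e z = G e z" "bound_O W \<delta> N F"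
  shows "bound_O W \<delta> N G"
  using assms(2) unfolding bound_O_def by (metis assms(1))

lemma bound_O_add:
  assumes "bound_O W \<delta> N F" "bound_O W \<delta> N G"
  shows "bound_O W \<delta> N (\<lambda>e z. F e z + G e z)"
proof -
  from assms obtain K L where
    K: "\<And>e z. e \<noteq> 0 \<Longrightarrow> norm e < \<delta> \<Longrightarrow> z \<in> W \<Longrightarrow> norm (F e z) \<le> K * norm e ^ N" and
    L: "\<And>e z. e \<noteq> 0 \<Longrightarrow> norm e < \<delta> \<Longrightarrow> z \<in> W \<Longrightarrow> norm (G e z) \<le> L * norm e ^ N"
    unfolding bound_O_def by metis
  have "norm (F e z + G e z) \<le> (K + L) * norm e ^ N"
    if "e \<noteq> 0" "norm e < \<delta>" "z \<in> W" for e z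
    using norm_triangle_mono[OF K[OF that] L[OF that]] by (simp add: distrib_right)
  then show ?thesis unfolding bound_O_def by blast
qed

lemma bound_O_mult:
  assumes "bound_O W \<delta> N F" "bound_O W \<delta> M G"
  shows "bound_O W \<delta> (N + M) (\<lambda>e z. F e z * G e z)"
proof -
  from assms obtain K L where
    K: "\<And>e z. e \<noteq> 0 \<Longrightarrow> norm e < \<delta> \<Longrightarrow> z \<in> W \<Longrightarrow> norm (F e z) \<le> K * norm e ^ N" and
    L: "\<And>e z. e \<noteq> 0 \<Longrightarrow> norm e < \<delta> \<Longrightarrow> z \<in> W \<Longrightarrow> norm (G e z) \<le> L * norm e ^ M"
    unfolding bound_O_def by metis
  have "norm (F e z * G e z) \<le> (K * L) * norm e ^ (N + M)"
    if "e \<noteq> 0" "norm e < \<delta>" "z \<in> W" for e z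
  proof -
    have "0 \<le> K * norm e ^ N" by (rule order_trans[OF norm_ge_zero K[OF that]])
    then have "norm (F e z) * norm (G e z) \<le> (K * norm e ^ N) * (L * norm e ^ M)"
      using K[OF that] L[OF that] by (intro mult_mono) auto
    then show ?thesis by (simp add: norm_mult power_add mult_ac)
  qed
  then show ?thesis unfolding bound_O_def by blast
qed

lemma bound_O_weaken:
  assumes "bound_O W \<delta> N F" "M \<le> N"
  shows "bound_O W \<delta> M F"
proof -
  from assms obtain K where
    K: "\<And>e z. e \<noteq> 0 \<Longrightarrow> norm e < \<delta> \<Longrightarrow> z \<in> W \<Longrightarrow> norm (F e z) \<le> K * norm e ^ N"
    unfolding bound_O_def by metis
  have "norm (F e z) \<le> (\<bar>K\<bar> * \<delta> ^ (N - M)) * norm e ^ M"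
    if "e \<noteq> 0" "norm e < \<delta>" "z \<in> W" for e z
  proof -
    have "norm (F e z) \<le> \<bar>K\<bar> * norm e ^ N"
      using K[OF that] by (rule order_trans) (simp add: mult_right_mono)
    also have "norm e ^ N = norm e ^ (N - M) * norm e ^ M"
      using assms(2) by (simp flip: power_add)
    also have "\<dots> \<le> \<delta> ^ (N - M) * norm e ^ M"
      using that by (intro mult_right_mono power_mono) auto
    finally show ?thesis by (simp add: mult.assoc mult_left_mono)
  qed
  then show ?thesis unfolding bound_O_def by blast
qed

locale family_domain =
  fixes W :: "complex set" and \<delta> :: real
  assumes open_W: "open W"
begin

lemma wd_family_cong:
  assumes "\<And>e z. e \<noteq> 0 \<Longrightarrow> norm e < \<delta> \<Longrightarrow> z \<in> W \<Longrightarrow> F e z = G e z"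
    and "e \<noteq> 0" "norm e < \<delta>" "z \<in> W"
  shows "wd c (F e) z = wd c (G e) z"
  by (rule wd_cong[OF open_W assms(4)]) (use assms in auto)

lemma Ck_O_cong:
  assumes "\<And>e z. e \<noteq> 0 \<Longrightarrow> norm e < \<delta> \<Longrightarrow> z \<in> W \<Longrightarrow> F e z = G e z" "Ck_O W \<delta> N m F"
  shows "Ck_O W \<delta> N m G"
  using assms
proof (induction m arbitrary: F G)
  case 0
  show ?case using bound_O_cong[OF 0(1)] 0(2) by simp
next
  case (Suc m)
  note d = Ck_O_SucD[OF Suc.prems(2)]
  show ?case
  proof (rule Ck_O_SucI)
    show "bound_O W \<delta> N G" by (rule bound_O_cong[OF Suc.prems(1) d(1)])
  next
    fix e z :: complex assume e: "e \<noteq> 0" "norm e < \<delta>" "z \<in> W"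
    show "G e differentiable (at z)"
      by (rule differentiable_cong_open[OF open_W e(3) _ d(2)[OF e]]) (rule Suc.prems(1)[OF e(1,2)])
  next
    fix c assume c: "c = \<i> \<or> c = - \<i>"
    show "Ck_O W \<delta> N m (\<lambda>e. wd c (G e))"
      by (rule Suc.IH[OF _ d(3)[OF c]]) (rule wd_family_cong[OF Suc.prems(1)])
  qed
qed

lemma Ck_O_add:
  assumes "Ck_O W \<delta> N m F" "Ck_O W \<delta> N m G"
  shows "Ck_O W \<delta> N m (\<lambda>e z. F e z + G e z)"
  using assms
proof (induction m arbitrary: F G)
  case 0 then show ?case by (simp add: bound_O_add)
next
  case (Suc m)
  note d = Ck_O_SucD[OF Suc.prems(1)] Ck_O_SucD[OF Suc.prems(2)]
  show ?case
  proof (rule Ck_O_SucI)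
    show "bound_O W \<delta> N (\<lambda>e z. F e z + G e z)" by (rule bound_O_add[OF d(1,4)])
  next
    fix e z :: complex assume e: "e \<noteq> 0" "norm e < \<delta>" "z \<in> W"
    show "(\<lambda>z. F e z + G e z) differentiable (at z)"
      by (rule differentiable_add[OF d(2)[OF e] d(5)[OF e]])
  next
    fix c assume c: "c = \<i> \<or> c = - \<i>"
    show "Ck_O W \<delta> N m (\<lambda>e. wd c (\<lambda>z. F e z + G e z))"
      by (rule Ck_O_cong[OF _ Suc.IH[OF d(3)[OF c] d(6)[OF c]]])
        (rule wd_add[OF d(2) d(5), symmetric])
  qed
qed

lemma Ck_O_weaken: "Ck_O W \<delta> N m F \<Longrightarrow> M \<le> N \<Longrightarrow> Ck_O W \<delta> M m F"
proof (induction m arbitrary: F)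
  case 0 then show ?case by (simp add: bound_O_weaken)
next
  case (Suc m)
  note d = Ck_O_SucD[OF Suc.prems(1)]
  show ?case
    by (rule Ck_O_SucI[OF bound_O_weaken[OF d(1) Suc.prems(2)] d(2) Suc.IH[OF d(3) Suc.prems(2)]])
qed

lemma Ck_O_mult:
  assumes "Ck_O W \<delta> N m F" "Ck_O W \<delta> M m G"
  shows "Ck_O W \<delta> (N + M) m (\<lambda>e z. F e z * G e z)"
  using assms
proof (induction m arbitrary: F G)
  case 0 then show ?case by (simp add: bound_O_mult)
next
  case (Suc m)
  note d = Ck_O_SucD[OF Suc.prems(1)] Ck_O_SucD[OF Suc.prems(2)]
  note l = Ck_O_mono_Suc[OF Suc.prems(1)] Ck_O_mono_Suc[OF Suc.prems(2)]
  show ?case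
  proof (rule Ck_O_SucI)
    show "bound_O W \<delta> (N + M) (\<lambda>e z. F e z * G e z)" by (rule bound_O_mult[OF d(1,4)])
  next
    fix e z :: complex assume e: "e \<noteq> 0" "norm e < \<delta>" "z \<in> W"
    show "(\<lambda>z. F e z * G e z) differentiable (at z)"
      by (rule differentiable_mult[OF d(2)[OF e] d(5)[OF e]])
  next
    fix c assume c: "c = \<i> \<or> c = - \<i>"
    show "Ck_O W \<delta> (N + M) m (\<lambda>e. wd c (\<lambda>z. F e z * G e z))"
      by (rule Ck_O_cong[OF _ Ck_O_add[OF Suc.IH[OF d(3)[OF c] l(2)] Suc.IH[OF l(1) d(6)[OF c]]]])
        (rule wd_mult[OF d(2) d(5), symmetric])
  qed
qed

lemma Ck_O_zero: "Ck_O W \<delta> N m (\<lambda>e z. 0)"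
proof (induction m)
  case 0 then show ?case by (auto simp: bound_O_def intro: exI[of _ 0])
next
  case (Suc m)
  have "(\<lambda>e. wd c (\<lambda>z. 0)) = (\<lambda>(e::complex) z. 0)" for c by (intro ext) (rule wd_const)
  with Suc show ?case by (intro Ck_O_SucI) (auto simp: bound_O_def intro: exI[of _ 0])
qed

lemma Ck_O_param: "Ck_O W \<delta> k m (\<lambda>e z. a * e ^ k)"
proof -
  have b: "bound_O W \<delta> k (\<lambda>e z. a * e ^ k)"
    unfolding bound_O_def by (rule exI[of _ "norm a"]) (simp add: norm_mult norm_power)
  show ?thesis
  proof (cases m)
    case (Suc l)
    have "(\<lambda>e. wd c (\<lambda>z. a * e ^ k)) = (\<lambda>e z. 0)" for c by (intro ext) (rule wd_const)
    then show ?thesis unfolding Suc by (intro Ck_O_SucI b) (simp_all add: Ck_O_zero)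
  qed (use b in simp)
qed

lemma Ck_O_inverse:
  assumes F: "\<And>e z. e \<noteq> 0 \<Longrightarrow> norm e < \<delta> \<Longrightarrow> z \<in> W \<Longrightarrow> norm (F e z) \<ge> 1/2"
    and C: "Ck_O W \<delta> 0 m F"
  shows "Ck_O W \<delta> 0 m (\<lambda>e z. inverse (F e z))"
  using C
proof (induction m)
  case 0
  have "norm (inverse (F e z)) \<le> 2 * norm e ^ 0" if "e \<noteq> 0" "norm e < \<delta>" "z \<in> W" for e z
    using le_imp_inverse_le[OF F[OF that]] by (simp add: norm_inverse)
  then show ?case by (auto simp: bound_O_def)
next
  case (Suc m)
  note d = Ck_O_SucD[OF Suc.prems]
  note I = Suc.IH[OF Ck_O_mono_Suc[OF Suc.prems]]
  have nz: "F e z \<noteq> 0" if "e \<noteq> 0" "norm e < \<delta>" "z \<in> W" for e z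
    using F[OF that] by auto
  have iv: "(inverse has_field_derivative - (inverse (F e z) * inverse (F e z))) (at (F e z))"
    if "e \<noteq> 0" "norm e < \<delta>" "z \<in> W" for e z
    using DERIV_inverse[OF nz[OF that]] by (simp add: power2_eq_square)
  show ?case
  proof (rule Ck_O_SucI)
    show "bound_O W \<delta> 0 (\<lambda>e z. inverse (F e z))" by (rule Ck_O_bound[OF I])
  next
    fix e z :: complex assume e: "e \<noteq> 0" "norm e < \<delta>" "z \<in> W"
    show "(\<lambda>z. inverse (F e z)) differentiable (at z)"
      by (rule wd_holomorphic_chain(2)[where f = inverse and t = "F e", OF d(2)[OF e] iv[OF e]])
  next
    fix c assume c: "c = \<i> \<or> c = - \<i>"
    have "Ck_O W \<delta> (0 + 0 + 0 + 0) m
        (\<lambda>e z. (-1) * e ^ 0 * inverse (F e z) * inverse (F e z) * wd c (F e) z)"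
      by (intro Ck_O_mult Ck_O_param I d(3)[OF c])
    then have "Ck_O W \<delta> 0 m
        (\<lambda>e z. (-1) * e ^ 0 * inverse (F e z) * inverse (F e z) * wd c (F e) z)" by simp
    then show "Ck_O W \<delta> 0 m (\<lambda>e. wd c (\<lambda>z. inverse (F e z)))"
    proof (rule Ck_O_cong[rotated])
      fix e z :: complex assume e: "e \<noteq> 0" "norm e < \<delta>" "z \<in> W"
      show "(-1) * e ^ 0 * inverse (F e z) * inverse (F e z) * wd c (F e) z = wd c (\<lambda>z. inverse (F e z)) z"
        unfolding wd_holomorphic_chain(1)[where f = inverse and t = "F e", OF d(2)[OF e] iv[OF e]]
        by simp
    qed
  qed
qed

text \<open>The principal branch can be used since \<open>F\<close> stays in a half plane, and the derivative of the
  root is the root times the logarithmic derivative of \<open>F\<close>.\<close>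

lemma Ck_O_root:
  fixes n :: nat
  assumes F: "\<And>e z. e \<noteq> 0 \<Longrightarrow> norm e < \<delta> \<Longrightarrow> z \<in> W \<Longrightarrow> norm (F e z - 1) \<le> 1/2"
    and n: "n > 0" and C: "Ck_O W \<delta> 0 m F"
  shows "Ck_O W \<delta> 0 m (\<lambda>e z. exp (- Ln (F e z) / of_nat n))"
  using C
proof (induction m)
  case 0
  have "norm (exp (- Ln (F e z) / of_nat n)) \<le> exp (ln 2) * norm e ^ 0"
    if "e \<noteq> 0" "norm e < \<delta>" "z \<in> W" for e z
  proof -
    have "1 - norm (F e z) \<le> norm (1 - F e z)" using norm_triangle_ineq2[of 1 "F e z"] by simp
    then have h: "norm (F e z) \<ge> 1/2" using F[OF that] by (simp add: norm_minus_commute)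
    then have nz: "F e z \<noteq> 0" by auto
    have "- ln (norm (F e z)) \<le> ln 2"
    proof -
      have "ln (1/2) \<le> ln (norm (F e z))" using h by (subst ln_le_cancel_iff) auto
      then show ?thesis by (simp add: ln_div)
    qed
    then have "- ln (norm (F e z)) / real n \<le> ln 2"
    proof -
      have "- ln (norm (F e z)) / real n \<le> ln 2 / real n"
        using \<open>- ln (norm (F e z)) \<le> ln 2\<close> by (rule divide_right_mono) simp
      also have "\<dots> \<le> ln 2" using n by (simp add: divide_le_eq_1 field_simps)
      finally show ?thesis .
    qed
    then have "exp (- ln (norm (F e z)) / real n) \<le> exp (ln 2)" by (subst exp_le_cancel_iff)
    then show ?thesis using nz by (simp add: norm_exp_eq_Re)
  qed
  then show ?case by (auto simp: bound_O_def)
next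
  case (Suc m)
  let ?R = "\<lambda>e z. exp (- Ln (F e z) / of_nat n)"
  note d = Ck_O_SucD[OF Suc.prems]
  note I = Suc.IH[OF Ck_O_mono_Suc[OF Suc.prems]]
  have Fh: "norm (F e z) \<ge> 1/2" "F e z \<notin> \<real>\<^sub>\<le>\<^sub>0" "F e z \<noteq> 0"
    if "e \<noteq> 0" "norm e < \<delta>" "z \<in> W" for e z
  proof -
    have "1 - norm (F e z) \<le> norm (1 - F e z)" using norm_triangle_ineq2[of 1 "F e z"] by simp
    then show "norm (F e z) \<ge> 1/2" using F[OF that] by (simp add: norm_minus_commute)
    then show "F e z \<noteq> 0" by auto
    have "\<bar>Re (F e z - 1)\<bar> \<le> 1/2" using abs_Re_le_cmod F[OF that] order_trans by blast
    then have "- Re (F e z - 1) \<le> 1/2" by (rule abs_le_D2)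
    then have "Re (F e z) > 0" by simp
    then show "F e z \<notin> \<real>\<^sub>\<le>\<^sub>0" by (auto simp: complex_nonpos_Reals_iff)
  qed
  note J = Ck_O_inverse[OF Fh(1) Ck_O_mono_Suc[OF Suc.prems]]
  have der: "((\<lambda>w. exp (- Ln w / of_nat n)) has_field_derivative
      - (1 / of_nat n) * ?R e z * inverse (F e z)) (at (F e z))"
    if "e \<noteq> 0" "norm e < \<delta>" "z \<in> W" for e z
    using Fh[OF that] n by (auto intro!: derivative_eq_intros simp: field_simps)
  show ?case
  proof (rule Ck_O_SucI)
    show "bound_O W \<delta> 0 ?R" by (rule Ck_O_bound[OF I])
  next
    fix e z :: complex assume e: "e \<noteq> 0" "norm e < \<delta>" "z \<in> W"
    show "?R e differentiable (at z)"
      by (rule wd_holomorphic_chain(2)[where f = "\<lambda>w. exp (- Ln w / of_nat n)" and t = "F e",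
            OF d(2)[OF e] der[OF e]])
  next
    fix c assume c: "c = \<i> \<or> c = - \<i>"
    have "Ck_O W \<delta> (0 + 0 + 0 + 0) m
        (\<lambda>e z. - (1 / of_nat n) * e ^ 0 * ?R e z * inverse (F e z) * wd c (F e) z)"
      by (intro Ck_O_mult Ck_O_param I J d(3)[OF c])
    then have "Ck_O W \<delta> 0 m
        (\<lambda>e z. - (1 / of_nat n) * e ^ 0 * ?R e z * inverse (F e z) * wd c (F e) z)" by simp
    then show "Ck_O W \<delta> 0 m (\<lambda>e. wd c (?R e))"
    proof (rule Ck_O_cong[rotated])
      fix e z :: complex assume e: "e \<noteq> 0" "norm e < \<delta>" "z \<in> W"
      show "- (1 / of_nat n) * e ^ 0 * ?R e z * inverse (F e z) * wd c (F e) z = wd c (?R e) z"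
        unfolding wd_holomorphic_chain(1)[where f = "\<lambda>w. exp (- Ln w / of_nat n)" and t = "F e",
            OF d(2)[OF e] der[OF e]] by simp
    qed
  qed
qed

lemma Ck_O_smooth_on: "Ck_O W \<delta> N (Suc m) F \<Longrightarrow> e \<noteq> 0 \<Longrightarrow> norm e < \<delta> \<Longrightarrow> Ck_on m W (F e)"
proof (induction m arbitrary: F)
  case 0
  have "continuous_on W (F e)"
    by (intro continuous_at_imp_continuous_on ballI differentiable_imp_continuous_within
        Ck_O_SucD(2)[OF 0(1) 0(2) 0(3)])
  then show ?case by simp
next
  case (Suc m)
  note d = Ck_O_SucD[OF Suc.prems(1)]
  show ?case
    by (rule Ck_on_SucI) (use d(2) Suc.prems(2,3) Suc.IH[OF d(3)] in auto)
qed

abbreviation small :: "nat \<Rightarrow> (complex \<Rightarrow> complex \<Rightarrow> complex) \<Rightarrow> bool" where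
  "small \<equiv> smooth_O W \<delta>"

lemma small_cong:
  "small N F \<Longrightarrow> (\<And>e z. e \<noteq> 0 \<Longrightarrow> norm e < \<delta> \<Longrightarrow> z \<in> W \<Longrightarrow> F e z = G e z) \<Longrightarrow> small N G"
  unfolding smooth_O_def by (blast intro: Ck_O_cong)

lemma small_add: "small N F \<Longrightarrow> small N G \<Longrightarrow> small N (\<lambda>e z. F e z + G e z)"
  by (simp add: smooth_O_def Ck_O_add)

lemma small_mult: "small N F \<Longrightarrow> small M G \<Longrightarrow> small (N + M) (\<lambda>e z. F e z * G e z)"
  by (simp add: smooth_O_def Ck_O_mult)

lemma small_zero: "small N (\<lambda>e z. 0)"
  by (simp add: smooth_O_def Ck_O_zero)

lemma small_param: "small k (\<lambda>e z. e ^ k)"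
  using Ck_O_param[of k _ 1] by (simp add: smooth_O_def)

lemma small_param1: "small 1 (\<lambda>e z. e)"
  using small_param[of 1] by simp

lemma small_const: "small 0 (\<lambda>e z. a)"
  using Ck_O_param[of 0 _ a] by (simp add: smooth_O_def)

lemma small_weaken: "small N F \<Longrightarrow> M \<le> N \<Longrightarrow> small M F"
  unfolding smooth_O_def by (blast intro: Ck_O_weaken)

lemma small_cmult: "small N F \<Longrightarrow> small N (\<lambda>e z. a * F e z)"
  using small_mult[OF small_const[of a], of N F] by simp

lemma small_minus: "small N F \<Longrightarrow> small N (\<lambda>e z. - F e z)"
  using small_cmult[of N F "-1"] by simp

lemma small_diff: "small N F \<Longrightarrow> small N G \<Longrightarrow> small N (\<lambda>e z. F e z - G e z)"
  using small_add[of N F "\<lambda>e z. - G e z"] small_minus[of N G] by simp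

lemma small_sum: "(\<And>k. k \<in> K \<Longrightarrow> small N (F k)) \<Longrightarrow> small N (\<lambda>e z. \<Sum>k\<in>K. F k e z)"
  by (induction K rule: infinite_finite_induct) (auto simp: small_zero small_add)

lemma small_mult0: "small 0 F \<Longrightarrow> small N G \<Longrightarrow> small N (\<lambda>e z. F e z * G e z)"
  using small_mult[of 0 F N G] by simp

lemma small_prod: "(\<And>k. k \<in> K \<Longrightarrow> small 0 (F k)) \<Longrightarrow> small 0 (\<lambda>e z. \<Prod>k\<in>K. F k e z)"
  by (induction K rule: infinite_finite_induct) (auto simp: small_const small_mult0)

lemma small_power: "small 0 F \<Longrightarrow> small 0 (\<lambda>e z. F e z ^ k)"
  by (induction k) (auto simp: small_const small_mult0)

lemma small_wd: "small N F \<Longrightarrow> c = \<i> \<or> c = - \<i> \<Longrightarrow> small N (\<lambda>e. wd c (F e))"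
  unfolding smooth_O_def using Ck_O_SucD(3) by blast

lemma small_differentiable:
  "small N F \<Longrightarrow> e \<noteq> 0 \<Longrightarrow> norm e < \<delta> \<Longrightarrow> z \<in> W \<Longrightarrow> F e differentiable (at z)"
  unfolding smooth_O_def using Ck_O_SucD(2) by blast

lemma small_smooth_on: "small N F \<Longrightarrow> e \<noteq> 0 \<Longrightarrow> norm e < \<delta> \<Longrightarrow> smooth_on W (F e)"
  unfolding smooth_O_def smooth_on_def using Ck_O_smooth_on by blast

lemma small_bound:
  assumes "small N F"
  obtains K where "\<And>e z. e \<noteq> 0 \<Longrightarrow> norm e < \<delta> \<Longrightarrow> z \<in> W \<Longrightarrow> norm (F e z) \<le> K * norm e ^ N"
  using assms Ck_O.simps(1)[of W \<delta> N F] unfolding smooth_O_def bound_O_def by metis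

lemma small_root:
  "small 0 F \<Longrightarrow> (\<And>e z. e \<noteq> 0 \<Longrightarrow> norm e < \<delta> \<Longrightarrow> z \<in> W \<Longrightarrow> norm (F e z - 1) \<le> 1/2) \<Longrightarrow>
    n > 0 \<Longrightarrow> small 0 (\<lambda>e z. exp (- Ln (F e z) / of_nat n))"
  unfolding smooth_O_def by (blast intro: Ck_O_root)

text \<open>Compactness makes the bounds uniform on \<open>W\<close>.\<close>

lemma small_of_smooth_on:
  assumes f: "smooth_on U f" and K: "compact K" "K \<subseteq> U" "W \<subseteq> K"
  shows "small 0 (\<lambda>e. f)"
proof -
  have "Ck_O W \<delta> 0 m (\<lambda>e. g)" if "smooth_on U g" for m g
    using that
  proof (induction m arbitrary: g)
    case 0
    have "continuous_on K g" using smooth_on_continuous[OF 0] K(2) by (rule continuous_on_subset)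
    then have "bounded (g ` K)" by (intro compact_imp_bounded compact_continuous_image K(1))
    then obtain B where "\<forall>x\<in>g ` K. norm x \<le> B" unfolding bounded_iff by blast
    then show ?case using K(3) by (auto simp: bound_O_def intro!: exI[of _ B])
  next
    case (Suc m)
    show ?case
    proof (rule Ck_O_SucI[OF Ck_O_bound[OF Suc.IH[OF Suc.prems]]])
      fix c assume c: "c = \<i> \<or> c = - \<i>"
      show "Ck_O W \<delta> 0 m (\<lambda>e. wd c g)" by (rule Suc.IH[OF smooth_on_wd[OF Suc.prems c]])
    qed (use smooth_on_differentiable[OF Suc.prems] K in auto)
  qed
  then show ?thesis using f by (simp add: smooth_O_def)
qed

end

section \<open>Families of sections and covariant derivatives\<close>

type_synonym family = "complex \<Rightarrow> nat \<Rightarrow> complex \<Rightarrow> complex"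

definition scl :: "(complex \<Rightarrow> complex \<Rightarrow> complex) \<Rightarrow> family \<Rightarrow> family" where
  "scl a w = (\<lambda>e i z. a e z * w e i z)"

definition vadd :: "family \<Rightarrow> family \<Rightarrow> family" where
  "vadd v w = (\<lambda>e i z. v e i z + w e i z)"

definition vsub :: "family \<Rightarrow> family \<Rightarrow> family" where
  "vsub v w = (\<lambda>e i z. v e i z - w e i z)"

definition vsum :: "nat set \<Rightarrow> (nat \<Rightarrow> family) \<Rightarrow> family" where
  "vsum K f = (\<lambda>e i z. \<Sum>k\<in>K. f k e i z)"

lemmas vdefs = scl_def vadd_def vsub_def vsum_def

text \<open>The derivative that goes with the rescaled operators: it raises the order in \<open>e\<close> by one.\<close>

definition eder :: "complex \<Rightarrow> (complex \<Rightarrow> complex \<Rightarrow> complex) \<Rightarrow> complex \<Rightarrow> complex \<Rightarrow> complex" where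
  "eder c a = (\<lambda>e z. e * wd c (a e) z)"

definition cov :: "nat \<Rightarrow> complex \<Rightarrow> (complex \<Rightarrow> nat \<Rightarrow> nat \<Rightarrow> complex \<Rightarrow> complex) \<Rightarrow> family \<Rightarrow> family" where
  "cov n c R w = (\<lambda>e i z. e * wd c (w e i) z + (\<Sum>j<n. R e i j z * w e j z))"

locale section_families = family_domain W \<delta> for W \<delta> +
  fixes n :: nat
begin

text \<open>In \<open>eqv N\<close> sections are compared modulo order \<open>N\<close>, with all derivatives; \<open>eqx\<close> is exact
  equality on the domain of the family.\<close>

definition vsmall :: "nat \<Rightarrow> family \<Rightarrow> bool" where
  "vsmall N w \<longleftrightarrow> (\<forall>i<n. small N (\<lambda>e. w e i))"

definition eqv :: "nat \<Rightarrow> family \<Rightarrow> family \<Rightarrow> bool" where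
  "eqv N v w \<longleftrightarrow> vsmall N (vsub v w)"

definition eqx :: "family \<Rightarrow> family \<Rightarrow> bool" where
  "eqx v w \<longleftrightarrow> (\<forall>e z i. e \<noteq> 0 \<longrightarrow> norm e < \<delta> \<longrightarrow> z \<in> W \<longrightarrow> i < n \<longrightarrow> v e i z = w e i z)"

lemma eqxI: "(\<And>e z i. e \<noteq> 0 \<Longrightarrow> norm e < \<delta> \<Longrightarrow> z \<in> W \<Longrightarrow> i < n \<Longrightarrow> v e i z = w e i z) \<Longrightarrow> eqx v w"
  by (simp add: eqx_def)

lemma eqxD: "eqx v w \<Longrightarrow> e \<noteq> 0 \<Longrightarrow> norm e < \<delta> \<Longrightarrow> z \<in> W \<Longrightarrow> i < n \<Longrightarrow> v e i z = w e i z"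
  by (simp add: eqx_def)

lemma eqx_trans [trans]: "eqx u v \<Longrightarrow> eqx v w \<Longrightarrow> eqx u w"
  by (simp add: eqx_def)

lemma vsmall_cong: "eqx v w \<Longrightarrow> vsmall N v \<Longrightarrow> vsmall N w"
  unfolding vsmall_def by (auto intro: small_cong dest: eqxD)

lemma eqx_eqv: "eqx v w \<Longrightarrow> eqv N v w"
  unfolding eqv_def vsmall_def vsub_def
  by (intro allI impI, rule small_cong[OF small_zero]) (simp add: eqxD)

lemma eqv_trans [trans]: "eqv N u v \<Longrightarrow> eqv N v w \<Longrightarrow> eqv N u w"
proof -
  assume *: "eqv N u v" "eqv N v w"
  have "small N (\<lambda>e z. (u e i z - v e i z) + (v e i z - w e i z))" if "i < n" for i
    using * that unfolding eqv_def vsmall_def vsub_def by (intro small_add) auto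
  then show ?thesis unfolding eqv_def vsmall_def vsub_def by simp
qed

lemma eqv_eqx_trans [trans]: "eqv N u v \<Longrightarrow> eqx v w \<Longrightarrow> eqv N u w"
  and eqx_eqv_trans [trans]: "eqx u v \<Longrightarrow> eqv N v w \<Longrightarrow> eqv N u w"
  by (blast intro: eqv_trans eqx_eqv)+

lemma eqv_sym: "eqv N u v \<Longrightarrow> eqv N v u"
  unfolding eqv_def vsmall_def vsub_def using small_minus by fastforce

lemma eqv_refl: "eqv N u u"
  by (rule eqx_eqv) (simp add: eqx_def)

lemma vsmall_weaken: "vsmall N v \<Longrightarrow> M \<le> N \<Longrightarrow> vsmall M v"
  unfolding vsmall_def by (blast intro: small_weaken)

lemma eqv_weaken: "eqv N u v \<Longrightarrow> M \<le> N \<Longrightarrow> eqv M u v"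
  unfolding eqv_def by (rule vsmall_weaken)

lemma vsmall_vadd: "vsmall N v \<Longrightarrow> vsmall N w \<Longrightarrow> vsmall N (vadd v w)"
  and vsmall_vsub: "vsmall N v \<Longrightarrow> vsmall N w \<Longrightarrow> vsmall N (vsub v w)"
  and vsmall_vsum: "(\<And>k. k \<in> K \<Longrightarrow> vsmall N (f k)) \<Longrightarrow> vsmall N (vsum K f)"
  unfolding vsmall_def vdefs by (auto intro: small_add small_diff small_sum)

lemma vsmall_scl: "small r a \<Longrightarrow> vsmall N v \<Longrightarrow> vsmall (r + N) (scl a v)"
  unfolding vsmall_def vdefs by (auto intro: small_mult)

lemma vsmall_scl0: "small 0 a \<Longrightarrow> vsmall N v \<Longrightarrow> vsmall N (scl a v)"
  using vsmall_scl[of 0 a N v] by simp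

lemma vsmall_eqv: "vsmall N v \<Longrightarrow> eqv N v w \<Longrightarrow> vsmall N w"
  by (rule vsmall_cong[OF _ vsmall_vsub[of N v "vsub v w"]]) (auto simp: eqv_def eqx_def vdefs)

lemma eqv_vadd: "eqv N u u' \<Longrightarrow> eqv N v v' \<Longrightarrow> eqv N (vadd u v) (vadd u' v')"
proof -
  assume *: "eqv N u u'" "eqv N v v'"
  show ?thesis unfolding eqv_def
    by (rule vsmall_cong[OF _ vsmall_vadd[OF *[unfolded eqv_def]]]) (auto simp: eqx_def vdefs)
qed

lemma eqv_vsub: "eqv N u u' \<Longrightarrow> eqv N v v' \<Longrightarrow> eqv N (vsub u v) (vsub u' v')"
proof -
  assume *: "eqv N u u'" "eqv N v v'"
  show ?thesis unfolding eqv_def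
    by (rule vsmall_cong[OF _ vsmall_vsub[OF *[unfolded eqv_def]]]) (auto simp: eqx_def vdefs)
qed

lemma eqv_vsum: "(\<And>k. k \<in> K \<Longrightarrow> eqv N (f k) (g k)) \<Longrightarrow> eqv N (vsum K f) (vsum K g)"
proof -
  assume *: "\<And>k. k \<in> K \<Longrightarrow> eqv N (f k) (g k)"
  have "vsmall N (vsum K (\<lambda>k. vsub (f k) (g k)))"
    using * by (intro vsmall_vsum) (simp add: eqv_def)
  then show ?thesis unfolding eqv_def
    by (rule vsmall_cong[rotated]) (auto simp: eqx_def vdefs sum_subtractf)
qed

lemma eqv_scl: "small r a \<Longrightarrow> eqv N v w \<Longrightarrow> r + N = N' \<Longrightarrow> eqv N' (scl a v) (scl a w)"
proof -
  assume *: "small r a" "eqv N v w" "r + N = N'"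
  show ?thesis unfolding eqv_def *(3)[symmetric]
    by (rule vsmall_cong[OF _ vsmall_scl[OF *(1) *(2)[unfolded eqv_def]]])
      (auto simp: eqx_def vdefs right_diff_distrib)
qed

lemma eqv_drop: "vsmall N w \<Longrightarrow> eqv N (vadd v w) v"
  unfolding eqv_def by (erule vsmall_cong[rotated]) (auto simp: eqx_def vdefs)

lemma eqv_zero: "vsmall N v \<Longrightarrow> eqv N v (\<lambda>e i z. 0)"
  unfolding eqv_def by (erule vsmall_cong[rotated]) (auto simp: eqx_def vdefs)

lemma vsmall_differentiable:
  "vsmall N v \<Longrightarrow> i < n \<Longrightarrow> e \<noteq> 0 \<Longrightarrow> norm e < \<delta> \<Longrightarrow> z \<in> W \<Longrightarrow> v e i differentiable (at z)"
  unfolding vsmall_def using small_differentiable by blast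

lemma small_eder: "small N a \<Longrightarrow> c = \<i> \<or> c = - \<i> \<Longrightarrow> small (Suc N) (eder c a)"
  using small_mult[OF small_param1 small_wd, of N a c] by (simp add: eder_def)

end

locale covariant_derivative = section_families W \<delta> n for W \<delta> n +
  fixes c :: complex and R :: "complex \<Rightarrow> nat \<Rightarrow> nat \<Rightarrow> complex \<Rightarrow> complex"
  assumes c: "c = \<i> \<or> c = - \<i>"
    and R: "\<And>i j. i < n \<Longrightarrow> j < n \<Longrightarrow> small 0 (\<lambda>e. R e i j)"
begin

abbreviation nab :: "family \<Rightarrow> family" where "nab \<equiv> cov n c R"
abbreviation D :: "(complex \<Rightarrow> complex \<Rightarrow> complex) \<Rightarrow> complex \<Rightarrow> complex \<Rightarrow> complex" where "D \<equiv> eder c"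

lemma small_D: "small N a \<Longrightarrow> small (Suc N) (D a)"
  by (rule small_eder[OF _ c])

lemma vsmall_nab:
  assumes "vsmall N w" shows "vsmall N (nab w)"
  unfolding vsmall_def cov_def
proof (intro allI impI)
  fix i assume i: "i < n"
  have "small (1 + N) (\<lambda>e z. e * wd c (w e i) z)"
    using assms i by (intro small_mult small_param1 small_wd c) (auto simp: vsmall_def)
  then have "small N (\<lambda>e z. e * wd c (w e i) z)" by (rule small_weaken) simp
  moreover have "small N (\<lambda>e z. \<Sum>j<n. R e i j z * w e j z)"
    using assms i by (intro small_sum small_mult0 R) (auto simp: vsmall_def)
  ultimately show "small N (\<lambda>e z. e * wd c (w e i) z + (\<Sum>j<n. R e i j z * w e j z))"
    by (rule small_add)
qed

lemma vsmall_nab_power: "vsmall N w \<Longrightarrow> vsmall N ((nab ^^ k) w)"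
  by (induction k) (simp_all add: vsmall_nab)

lemma nab_eqx: "eqx v w \<Longrightarrow> eqx (nab v) (nab w)"
proof (rule eqxI)
  fix e z :: complex and i :: nat
  assume vw: "eqx v w" and d: "e \<noteq> 0" "norm e < \<delta>" "z \<in> W" and i: "i < n"
  have "wd c (v e i) z = wd c (w e i) z"
    by (rule wd_cong[OF open_W d(3)]) (rule eqxD[OF vw d(1,2) _ i])
  moreover have "(\<Sum>j<n. R e i j z * v e j z) = (\<Sum>j<n. R e i j z * w e j z)"
    using eqxD[OF vw d] by (intro sum.cong) auto
  ultimately show "nab v e i z = nab w e i z" by (simp add: cov_def)
qed

lemma nab_power_eqx: "eqx v w \<Longrightarrow> eqx ((nab ^^ k) v) ((nab ^^ k) w)"
  by (induction k) (simp_all add: nab_eqx)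

lemma nab_vadd: "vsmall 0 v \<Longrightarrow> vsmall 0 w \<Longrightarrow> eqx (nab (vadd v w)) (vadd (nab v) (nab w))"
  by (rule eqxI) (simp add: cov_def vadd_def wd_add vsmall_differentiable distrib_left sum.distrib)

lemma nab_vsub: "vsmall 0 v \<Longrightarrow> vsmall 0 w \<Longrightarrow> eqx (nab (vsub v w)) (vsub (nab v) (nab w))"
  by (rule eqxI) (simp add: cov_def vsub_def wd_diff vsmall_differentiable right_diff_distrib sum_subtractf)

lemma nab_vsum:
  assumes "\<And>k. k \<in> K \<Longrightarrow> vsmall 0 (f k)"
  shows "eqx (nab (vsum K f)) (vsum K (\<lambda>k. nab (f k)))"
proof (rule eqxI)
  fix e z :: complex and i :: nat
  assume d: "e \<noteq> 0" "norm e < \<delta>" "z \<in> W" and i: "i < n"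
  have "wd c (\<lambda>z. \<Sum>k\<in>K. f k e i z) z = (\<Sum>k\<in>K. wd c (f k e i) z)"
    by (rule wd_sum) (rule vsmall_differentiable[OF assms i d])
  moreover have "(\<Sum>j<n. R e i j z * (\<Sum>k\<in>K. f k e j z)) = (\<Sum>k\<in>K. \<Sum>j<n. R e i j z * f k e j z)"
    unfolding sum_distrib_left by (rule sum.swap)
  ultimately show "nab (vsum K f) e i z = vsum K (\<lambda>k. nab (f k)) e i z"
    by (simp add: cov_def vsum_def sum.distrib sum_distrib_left)
qed

lemma nab_power_vsum:
  assumes "\<And>k. k \<in> K \<Longrightarrow> vsmall 0 (f k)"
  shows "eqx ((nab ^^ m) (vsum K f)) (vsum K (\<lambda>k. (nab ^^ m) (f k)))"
proof (induction m)
  case (Suc m)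
  have "eqx (nab ((nab ^^ m) (vsum K f))) (nab (vsum K (\<lambda>k. (nab ^^ m) (f k))))"
    by (rule nab_eqx[OF Suc])
  also have "eqx \<dots> (vsum K (\<lambda>k. nab ((nab ^^ m) (f k))))"
    by (rule nab_vsum) (rule vsmall_nab_power[OF assms])
  finally show ?case by simp
qed (simp add: eqx_def)

lemma nab_scl:
  assumes "small 0 a" "vsmall 0 w"
  shows "eqx (nab (scl a w)) (vadd (scl (D a) w) (scl a (nab w)))"
proof (rule eqxI)
  fix e z :: complex and i :: nat
  assume d: "e \<noteq> 0" "norm e < \<delta>" "z \<in> W" and i: "i < n"
  have "wd c (\<lambda>z. a e z * w e i z) z = wd c (a e) z * w e i z + a e z * wd c (w e i) z"
    by (rule wd_mult[OF small_differentiable[OF assms(1) d] vsmall_differentiable[OF assms(2) i d]])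
  then show "nab (scl a w) e i z = vadd (scl (D a) w) (scl a (nab w)) e i z"
    by (simp add: cov_def vdefs eder_def algebra_simps sum_distrib_left)
qed

lemma nab_eqv:
  assumes "vsmall 0 v" "eqv N v w"
  shows "eqv N (nab v) (nab w)"
proof -
  have w: "vsmall 0 w" by (rule vsmall_eqv[OF assms(1) eqv_weaken[OF assms(2)]]) simp
  show ?thesis unfolding eqv_def
    by (rule vsmall_cong[OF nab_vsub[OF assms(1) w] vsmall_nab[OF assms(2)[unfolded eqv_def]]])
qed

lemma D_cmult:
  assumes "small 0 a" "e \<noteq> 0" "norm e < \<delta>" "z \<in> W"
  shows "D (\<lambda>e z. x * a e z) e z = x * D a e z"
  unfolding eder_def wd_cmult[OF small_differentiable[OF assms]] by simp

text \<open>The Leibniz rule, cut off after second derivatives of the coefficient: each further derivative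
  gains a factor \<open>e\<close>. Natural subtraction does no harm, since the binomial coefficients vanish where
  it truncates.\<close>

lemma nab_power_scl:
  assumes a: "small r a" and w: "vsmall 0 w"
  shows "eqv (r + 3) ((nab ^^ k) (scl a w))
    (vadd (vadd (scl a ((nab ^^ k) w)) (scl (\<lambda>e z. of_nat k * D a e z) ((nab ^^ (k - 1)) w)))
       (scl (\<lambda>e z. of_nat (k choose 2) * D (D a) e z) ((nab ^^ (k - 2)) w)))"
proof (induction k)
  case 0
  show ?case by (rule eqx_eqv) (simp add: eqx_def vdefs)
next
  case (Suc k)
  let ?w = "\<lambda>k. (nab ^^ k) w"
  let ?p = "scl a (?w k)"
  let ?k = "\<lambda>e z. of_nat k * D a e z" and ?c = "\<lambda>e z. of_nat (k choose 2) * D (D a) e z"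
  let ?q = "scl ?k (?w (k - 1))"
  let ?r = "scl ?c (?w (k - 2))"
  have a0: "small 0 a" by (rule small_weaken[OF a]) simp
  have Da: "small (Suc r) (D a)" by (rule small_D[OF a])
  have DDa: "small (Suc (Suc r)) (D (D a))" by (rule small_D[OF Da])
  have DDDa: "small (r + 3) (D (D (D a)))" using small_D[OF DDa] by (simp add: numeral_3_eq_3)
  note z = small_weaken[OF Da le0] small_weaken[OF DDa le0]
  have k0: "small 0 ?k" and c0: "small 0 ?c" by (intro small_cmult z)+
  have wk: "vsmall 0 (?w j)" for j by (rule vsmall_nab_power[OF w])
  have p: "vsmall 0 ?p" and q: "vsmall 0 ?q" and r: "vsmall 0 ?r"
    by (intro vsmall_scl0 wk a0 k0 c0)+
  have "eqv (r + 3) (nab ((nab ^^ k) (scl a w))) (nab (vadd (vadd ?p ?q) ?r))"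
    by (rule nab_eqv[OF vsmall_nab_power[OF vsmall_scl0[OF a0 w]] Suc])
  also have "eqx (nab (vadd (vadd ?p ?q) ?r)) (vadd (nab (vadd ?p ?q)) (nab ?r))"
    by (intro nab_vadd vsmall_vadd p q r)
  also have "eqx (vadd (nab (vadd ?p ?q)) (nab ?r)) (vadd
     (vadd (vadd (scl a (?w (Suc k))) (scl (\<lambda>e z. of_nat (Suc k) * D a e z) (?w (Suc k - 1))))
       (scl (\<lambda>e z. of_nat (Suc k choose 2) * D (D a) e z) (?w (Suc k - 2))))
     (scl (\<lambda>e z. of_nat (k choose 2) * D (D (D a)) e z) (?w (k - 2))))"
  proof (rule eqxI)
    fix e z :: complex and i :: nat
    assume d: "e \<noteq> 0" "norm e < \<delta>" "z \<in> W" and i: "i < n"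
    have 1: "nab (vadd ?p ?q) e i z = nab ?p e i z + nab ?q e i z"
      using eqxD[OF nab_vadd[OF p q] d i] by (simp add: vadd_def)
    have 2: "nab ?p e i z = D a e z * ?w k e i z + a e z * ?w (Suc k) e i z"
      using eqxD[OF nab_scl[OF a0 wk] d i] by (simp add: vdefs)
    have 3: "nab ?q e i z = of_nat k * D (D a) e z * ?w (k - 1) e i z + of_nat k * D a e z * nab (?w (k - 1)) e i z"
      using eqxD[OF nab_scl[OF k0 wk] d i] D_cmult[OF z(1) d] by (simp add: vdefs)
    have 4: "nab ?r e i z = of_nat (k choose 2) * D (D (D a)) e z * ?w (k - 2) e i z
        + of_nat (k choose 2) * D (D a) e z * nab (?w (k - 2)) e i z"
      using eqxD[OF nab_scl[OF c0 wk] d i] D_cmult[OF z(2) d] by (simp add: vdefs)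
    have 5: "of_nat k * nab (?w (k - 1)) e i z = of_nat k * ?w k e i z"
      by (cases k) simp_all
    have 6: "of_nat (k choose 2) * nab (?w (k - 2)) e i z = of_nat (k choose 2) * ?w (k - 1) e i z"
    proof (cases "k < 2")
      case False
      then have "k - 1 = Suc (k - 2)" by simp
      then show ?thesis by simp
    qed (simp add: binomial_eq_0)
    have 7: "Suc k choose 2 = k + (k choose 2)" by (simp add: numeral_2_eq_2)
    have 8: "Suc k - 2 = k - 1" by simp
    have e3: "nab ?q e i z = of_nat k * D (D a) e z * ?w (k - 1) e i z + D a e z * (of_nat k * ?w k e i z)"
      unfolding 3 5[symmetric] by (simp add: mult_ac)
    have e4: "nab ?r e i z = of_nat (k choose 2) * D (D (D a)) e z * ?w (k - 2) e i z
        + D (D a) e z * (of_nat (k choose 2) * ?w (k - 1) e i z)"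
      unfolding 4 6[symmetric] by (simp add: mult_ac)
    show "vadd (nab (vadd ?p ?q)) (nab ?r) e i z = vadd
     (vadd (vadd (scl a (?w (Suc k))) (scl (\<lambda>e z. of_nat (Suc k) * D a e z) (?w (Suc k - 1))))
       (scl (\<lambda>e z. of_nat (Suc k choose 2) * D (D a) e z) (?w (Suc k - 2))))
     (scl (\<lambda>e z. of_nat (k choose 2) * D (D (D a)) e z) (?w (k - 2))) e i z"
      unfolding 7 8 vadd_def[of _ "nab ?r"] 1 2 e3 e4 by (simp add: vdefs algebra_simps del: binomial_Suc_Suc)
  qed
  also have "eqv (r + 3) \<dots>
     (vadd (vadd (scl a (?w (Suc k))) (scl (\<lambda>e z. of_nat (Suc k) * D a e z) (?w (Suc k - 1))))
       (scl (\<lambda>e z. of_nat (Suc k choose 2) * D (D a) e z) (?w (Suc k - 2))))"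
    using vsmall_scl[OF small_cmult[OF DDDa] wk] by (intro eqv_drop) simp
  finally show ?case by simp
qed

lemma nab_power_scl_1:
  assumes a: "small r a" and w: "vsmall 0 w"
  shows "eqv (r + 2) ((nab ^^ k) (scl a w))
    (vadd (scl a ((nab ^^ k) w)) (scl (\<lambda>e z. of_nat k * D a e z) ((nab ^^ (k - 1)) w)))"
proof -
  have "small (r + 2) (\<lambda>e z. of_nat (k choose 2) * D (D a) e z)"
    using small_cmult[OF small_D[OF small_D[OF a]]] by simp
  from eqv_drop[OF vsmall_scl[OF this vsmall_nab_power[OF w, of "k - 2"]]]
  show ?thesis
    using eqv_trans[OF eqv_weaken[OF nab_power_scl[OF a w, of k], of "r + 2"]] by simp
qed

lemma nab_power_scl_0:
  assumes a: "small r a" and w: "vsmall 0 w"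
  shows "eqv (r + 1) ((nab ^^ k) (scl a w)) (scl a ((nab ^^ k) w))"
proof -
  have "small (r + 1) (\<lambda>e z. of_nat k * D a e z)"
    using small_cmult[OF small_D[OF a]] by simp
  from eqv_drop[OF vsmall_scl[OF this vsmall_nab_power[OF w, of "k - 1"]]]
  show ?thesis
    using eqv_trans[OF eqv_weaken[OF nab_power_scl_1[OF a w, of k], of "r + 1"]] by simp
qed

end

section \<open>The compatibility equation modulo third order\<close>

text \<open>The situation of the introduction: \<open>s\<close> and its iterated derivatives form a frame with dual frame
  \<open>Y\<close>, and \<open>T\<close>, \<open>M\<close>, \<open>X\<close> are the structure coefficients. Since \<open>T\<close> and \<open>M 1\<close> are
  small, the expansion of \<open>X k\<close> for \<open>k > 1\<close> starts at order 2.\<close>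

locale parabolic_frame = covariant_derivative W \<delta> n "- \<i>" P for W \<delta> n P +
  fixes Q :: "complex \<Rightarrow> nat \<Rightarrow> nat \<Rightarrow> complex \<Rightarrow> complex" and s :: family
    and T M X :: "nat \<Rightarrow> complex \<Rightarrow> complex \<Rightarrow> complex"
    and Y :: "complex \<Rightarrow> nat \<Rightarrow> nat \<Rightarrow> complex \<Rightarrow> complex"
  assumes n2: "2 \<le> n"
    and Q: "\<And>i j. i < n \<Longrightarrow> j < n \<Longrightarrow> small 0 (\<lambda>e. Q e i j)"
    and s: "vsmall 0 s"
    and T: "\<And>k. k \<in> {2..n} \<Longrightarrow> small 1 (T k)"
    and M: "\<And>l. l \<in> {1..n} \<Longrightarrow> small 0 (M l)"
    and M1: "small 1 (M 1)"
    and X: "\<And>k. k \<in> {1..n} \<Longrightarrow> small 0 (X k)"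
    and Y: "\<And>i j. i < n \<Longrightarrow> j < n \<Longrightarrow> small 0 (\<lambda>e. Y e i j)"
    and relT: "eqx ((nab ^^ n) s) (vsum {2..n} (\<lambda>k. scl (T k) ((nab ^^ (n - k)) s)))"
    and relM: "eqx (cov n \<i> Q s) (vsum {1..n} (\<lambda>l. scl (M l) ((nab ^^ (l - 1)) s)))"
    and relX: "\<And>k. k \<in> {1..n} \<Longrightarrow>
      eqx (vsub (nab (cov n \<i> Q ((nab ^^ (k - 1)) s))) (cov n \<i> Q ((nab ^^ k) s))) (scl (X k) s)"
    and dual: "\<And>e z i j. e \<noteq> 0 \<Longrightarrow> norm e < \<delta> \<Longrightarrow> z \<in> W \<Longrightarrow> i < n \<Longrightarrow> j < n \<Longrightarrow>
      (\<Sum>k<n. Y e j k z * (nab ^^ i) s e k z) = (if i = j then 1 else 0)"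
begin

sublocale bar: covariant_derivative W \<delta> n \<i> Q
  by unfold_locales (auto simp: Q)

abbreviation nbr :: "family \<Rightarrow> family" where "nbr \<equiv> cov n \<i> Q"
abbreviation Db :: "(complex \<Rightarrow> complex \<Rightarrow> complex) \<Rightarrow> complex \<Rightarrow> complex \<Rightarrow> complex" where "Db \<equiv> eder \<i>"

definition v :: "nat \<Rightarrow> family" where "v k = (nab ^^ k) s"

lemma vsmall_v: "vsmall 0 (v k)"
  unfolding v_def by (rule vsmall_nab_power[OF s])

lemma nab_power_v: "(nab ^^ m) (v k) = v (k + m)"
  unfolding v_def by (simp add: funpow_add add.commute[of k])

lemma v_n: "eqx (v n) (vsum {2..n} (\<lambda>k. scl (T k) (v (n - k))))"
  using relT by (simp add: v_def)

lemma T0: "k \<in> {2..n} \<Longrightarrow> small 0 (T k)"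
  by (rule small_weaken[OF T]) simp_all

lemma vsmall_Tv: "k \<in> {2..n} \<Longrightarrow> vsmall 0 (scl (T k) (v j))"
  by (intro vsmall_scl0 T0 vsmall_v)

lemma v_high: "eqx (v (n + j)) (vsum {2..n} (\<lambda>k. (nab ^^ j) (scl (T k) (v (n - k)))))"
proof -
  have "eqx (v (n + j)) ((nab ^^ j) (vsum {2..n} (\<lambda>k. scl (T k) (v (n - k)))))"
    using nab_power_eqx[OF v_n, of j] by (simp add: nab_power_v)
  also have "eqx \<dots> (vsum {2..n} (\<lambda>k. (nab ^^ j) (scl (T k) (v (n - k)))))"
    by (rule nab_power_vsum) (rule vsmall_Tv)
  finally show ?thesis .
qed

text \<open>Differentiating the relation for \<open>v n\<close>. The coefficients \<open>T k\<close> have order 1, so the Leibniz rule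
  may stop after one derivative.\<close>

lemma v_high_3: "eqv 3 (v (n + j)) (vsum {2..n} (\<lambda>k. vadd (scl (T k) (v ((n - k) + j)))
    (scl (\<lambda>e z. of_nat j * D (T k) e z) (v ((n - k) + (j - 1))))))"
proof (rule eqx_eqv_trans[OF v_high], rule eqv_vsum)
  fix k assume "k \<in> {2..n}"
  from nab_power_scl_1[OF T[OF this] vsmall_v, of j "n - k"]
  show "eqv 3 ((nab ^^ j) (scl (T k) (v (n - k)))) (vadd (scl (T k) (v ((n - k) + j)))
    (scl (\<lambda>e z. of_nat j * D (T k) e z) (v ((n - k) + (j - 1)))))"
    unfolding nab_power_v by (simp add: numeral_3_eq_3)
qed

lemma v_high_2: "eqv 2 (v (n + j)) (vsum {2..n} (\<lambda>k. scl (T k) (v ((n - k) + j))))"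
proof (rule eqx_eqv_trans[OF v_high], rule eqv_vsum)
  fix k assume "k \<in> {2..n}"
  from nab_power_scl_0[OF T[OF this] vsmall_v, of j "n - k"]
  show "eqv 2 ((nab ^^ j) (scl (T k) (v (n - k)))) (scl (T k) (v ((n - k) + j)))"
    unfolding nab_power_v by (simp add: numeral_2_eq_2)
qed

lemma v_high_1: "vsmall 1 (v (n + j))"
proof -
  have "vsmall (1 + 0) (scl (T k) (v ((n - k) + j)))" if "k \<in> {2..n}" for k
    by (rule vsmall_scl[OF T[OF that] vsmall_v])
  then have "vsmall 1 (vsum {2..n} (\<lambda>k. scl (T k) (v ((n - k) + j))))"
    by (intro vsmall_vsum) simp
  then show ?thesis by (rule vsmall_eqv[OF _ eqv_sym[OF eqv_weaken[OF v_high_2]]]) simp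
qed

lemma nbr_s: "eqx ((nab ^^ m) (nbr s)) (vsum {1..n} (\<lambda>l. (nab ^^ m) (scl (M l) (v (l - 1)))))"
proof -
  have "eqx ((nab ^^ m) (nbr s)) ((nab ^^ m) (vsum {1..n} (\<lambda>l. scl (M l) (v (l - 1)))))"
    using nab_power_eqx[OF relM, of m] by (simp add: v_def)
  also have "eqx \<dots> (vsum {1..n} (\<lambda>l. (nab ^^ m) (scl (M l) (v (l - 1)))))"
    by (rule nab_power_vsum) (intro vsmall_scl0 M vsmall_v)
  finally show ?thesis .
qed

lemma nbr_s_3: "eqv 3 ((nab ^^ m) (nbr s)) (vsum {1..n} (\<lambda>l. vadd (vadd
    (scl (M l) (v ((l - 1) + m))) (scl (\<lambda>e z. of_nat m * D (M l) e z) (v ((l - 1) + (m - 1)))))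
    (scl (\<lambda>e z. of_nat (m choose 2) * D (D (M l)) e z) (v ((l - 1) + (m - 2))))))"
proof (rule eqx_eqv_trans[OF nbr_s], rule eqv_vsum)
  fix l assume "l \<in> {1..n}"
  from nab_power_scl[OF M[OF this] vsmall_v, of m "l - 1"]
  show "eqv 3 ((nab ^^ m) (scl (M l) (v (l - 1)))) (vadd (vadd
    (scl (M l) (v ((l - 1) + m))) (scl (\<lambda>e z. of_nat m * D (M l) e z) (v ((l - 1) + (m - 1)))))
    (scl (\<lambda>e z. of_nat (m choose 2) * D (D (M l)) e z) (v ((l - 1) + (m - 2)))))"
    unfolding nab_power_v by simp
qed

lemma nbr_s_2: "eqv 2 ((nab ^^ m) (nbr s)) (vsum {1..n} (\<lambda>l. vadd
    (scl (M l) (v ((l - 1) + m))) (scl (\<lambda>e z. of_nat m * D (M l) e z) (v ((l - 1) + (m - 1))))))"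
proof (rule eqx_eqv_trans[OF nbr_s], rule eqv_vsum)
  fix l assume "l \<in> {1..n}"
  from nab_power_scl_1[OF M[OF this] vsmall_v, of m "l - 1"]
  show "eqv 2 ((nab ^^ m) (scl (M l) (v (l - 1)))) (vadd
    (scl (M l) (v ((l - 1) + m))) (scl (\<lambda>e z. of_nat m * D (M l) e z) (v ((l - 1) + (m - 1)))))"
    unfolding nab_power_v by (simp add: numeral_2_eq_2)
qed

lemma vsmall_Xs: "i \<in> {1..n} \<Longrightarrow> vsmall 0 ((nab ^^ j) (scl (X i) s))"
  by (intro vsmall_nab_power vsmall_scl0 X s)

text \<open>Moving \<open>nbr\<close> past one factor \<open>nab\<close> at a time produces one curvature term for each step.\<close>

lemma nbr_v: "j \<le> n \<Longrightarrow> eqx (nbr (v j)) (vsub ((nab ^^ j) (nbr s))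
    (vsum {1..j} (\<lambda>i. (nab ^^ (j - i)) (scl (X i) s))))"
proof (induction j)
  case 0
  show ?case by (simp add: eqx_def vdefs v_def)
next
  case (Suc j)
  let ?S = "\<lambda>j. vsum {1..j} (\<lambda>i. (nab ^^ (j - i)) (scl (X i) s))"
  have sm: "vsmall 0 (?S j)" by (intro vsmall_vsum vsmall_Xs) (use Suc.prems in auto)
  have A: "vsmall 0 ((nab ^^ j) (nbr s))"
    by (intro vsmall_nab_power bar.vsmall_nab s)
  have "eqx (nab (nbr (v j))) (nab (vsub ((nab ^^ j) (nbr s)) (?S j)))"
    by (rule nab_eqx) (use Suc in simp)
  also have "eqx \<dots> (vsub (nab ((nab ^^ j) (nbr s))) (nab (?S j)))"
    by (rule nab_vsub[OF A sm])
  finally have 1: "eqx (nab (nbr (v j))) (vsub (nab ((nab ^^ j) (nbr s))) (nab (?S j)))" .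
  have 2: "eqx (nab (?S j)) (vsum {1..j} (\<lambda>i. nab ((nab ^^ (j - i)) (scl (X i) s))))"
    by (rule nab_vsum) (use Suc.prems in \<open>auto intro: vsmall_Xs\<close>)
  have 3: "eqx (vsub (nab (nbr (v j))) (nbr (v (Suc j)))) (scl (X (Suc j)) s)"
    using relX[of "Suc j"] Suc.prems by (simp add: v_def)
  show ?case
  proof (rule eqxI)
    fix e z :: complex and i :: nat
    assume d: "e \<noteq> 0" "norm e < \<delta>" "z \<in> W" and i: "i < n"
    have 4: "(\<Sum>k\<in>{1..Suc j}. (nab ^^ (Suc j - k)) (scl (X k) s) e i z) =
        (\<Sum>k\<in>{1..j}. nab ((nab ^^ (j - k)) (scl (X k) s)) e i z) + scl (X (Suc j)) s e i z"
    proof -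
      have "(\<Sum>k\<in>{1..j}. (nab ^^ (Suc j - k)) (scl (X k) s) e i z) =
        (\<Sum>k\<in>{1..j}. nab ((nab ^^ (j - k)) (scl (X k) s)) e i z)"
        by (intro sum.cong refl) (simp add: Suc_diff_le)
      then show ?thesis by simp
    qed
    have 5: "nbr (v (Suc j)) e i z = nab (nbr (v j)) e i z - scl (X (Suc j)) s e i z"
      unfolding eqxD[OF 3 d i, symmetric] by (simp add: vsub_def)
    have 6: "nab (nbr (v j)) e i z = nab ((nab ^^ j) (nbr s)) e i z -
        (\<Sum>k\<in>{1..j}. nab ((nab ^^ (j - k)) (scl (X k) s)) e i z)"
      using eqxD[OF 1 d i] eqxD[OF 2 d i] by (simp only: vsub_def vsum_def)
    show "nbr (v (Suc j)) e i z = vsub ((nab ^^ Suc j) (nbr s)) (?S (Suc j)) e i z"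
      unfolding 5 6 vsub_def vsum_def 4 by simp
  qed
qed

text \<open>The two sides of the equation obtained from the two evaluations of \<open>nbr (v n)\<close>: all terms with
  curvature are collected in \<open>lhs\<close>.\<close>

definition lhs :: family where
  "lhs = vsub (vsum {1..n} (\<lambda>i. (nab ^^ (n - i)) (scl (X i) s)))
     (vsum {2..n} (\<lambda>k. scl (T k) (vsum {1..n-k} (\<lambda>i. (nab ^^ (n - k - i)) (scl (X i) s)))))"

definition rhs :: family where
  "rhs = vsub ((nab ^^ n) (nbr s))
     (vsum {2..n} (\<lambda>k. vadd (scl (Db (T k)) (v (n - k))) (scl (T k) ((nab ^^ (n - k)) (nbr s)))))"

lemma compatibility: "eqx lhs rhs"
proof (rule eqxI)
  fix e z :: complex and i :: nat
  assume d: "e \<noteq> 0" "norm e < \<delta>" "z \<in> W" and i: "i < n"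
  let ?S = "\<lambda>j. vsum {1..j} (\<lambda>i. (nab ^^ (j - i)) (scl (X i) s)) e i z"
  let ?A = "\<lambda>j. (nab ^^ j) (nbr s) e i z"
  have "nbr (v n) e i z = ?A n - ?S n"
    using eqxD[OF nbr_v[OF order_refl] d i] by (simp add: vsub_def)
  moreover have "nbr (v n) e i z = (\<Sum>k\<in>{2..n}. nbr (scl (T k) (v (n - k))) e i z)"
    using eqxD[OF bar.nab_eqx[OF v_n] d i] eqxD[OF bar.nab_vsum[OF vsmall_Tv] d i, of "{2..n}" "\<lambda>k. k" "\<lambda>k. n - k"]
    by (simp add: vsum_def)
  moreover have "nbr (scl (T k) (v (n - k))) e i z =
      Db (T k) e z * v (n - k) e i z + T k e z * (?A (n - k) - ?S (n - k))" if "k \<in> {2..n}" for k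
    using eqxD[OF bar.nab_scl[OF T0[OF that] vsmall_v] d i, of "n - k"] eqxD[OF nbr_v[of "n - k"] d i]
    by (simp add: vadd_def vsub_def scl_def)
  ultimately have "?A n - ?S n = (\<Sum>k\<in>{2..n}. Db (T k) e z * v (n - k) e i z + T k e z * (?A (n - k) - ?S (n - k)))"
    by simp
  also have "\<dots> = (\<Sum>k\<in>{2..n}. Db (T k) e z * v (n - k) e i z + T k e z * ?A (n - k))
      - (\<Sum>k\<in>{2..n}. T k e z * ?S (n - k))"
    by (simp add: right_diff_distrib sum.distrib sum_subtractf)
  finally show "lhs e i z = rhs e i z"
    unfolding lhs_def rhs_def vsub_def vadd_def scl_def vsum_def[of "{2..n}"]
    by (simp add: algebra_simps)
qed

lemma lhs_estimate:
  assumes X: "\<And>k. k \<in> {1..n} \<Longrightarrow> small r (X k)"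
  shows "eqv (r + 1) lhs (vsum {1..n} (\<lambda>i. scl (X i) (v (n - i))))"
proof -
  have 1: "eqv (r + 1) (vsum {1..n} (\<lambda>i. (nab ^^ (n - i)) (scl (X i) s))) (vsum {1..n} (\<lambda>i. scl (X i) (v (n - i))))"
    by (rule eqv_vsum) (use nab_power_scl_0[OF X s] in \<open>simp add: v_def\<close>)
  have "vsmall (1 + r) (scl (T k) (vsum {1..n-k} (\<lambda>i. (nab ^^ (n - k - i)) (scl (X i) s))))"
    if "k \<in> {2..n}" for k
  proof (intro vsmall_scl T that vsmall_vsum vsmall_nab_power)
    fix i assume "i \<in> {1..n-k}"
    then have "i \<in> {1..n}" by auto
    from vsmall_scl[OF X[OF this] s] show "vsmall r (scl (X i) s)" by simp
  qed
  then have "vsmall (r + 1) (vsum {2..n} (\<lambda>k. scl (T k) (vsum {1..n-k} (\<lambda>i. (nab ^^ (n - k - i)) (scl (X i) s)))))"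
    by (intro vsmall_vsum) simp
  from eqv_vsub[OF 1 eqv_zero[OF this]]
  show ?thesis unfolding lhs_def by (rule eqv_eqx_trans) (simp add: eqx_def vsub_def)
qed

text \<open>The terms of \<open>main\<close> are those of \<open>rhs\<close> that survive modulo third order. The factor \<open>l - 1\<close> in
  \<open>G\<close> comes from \<open>nab\<^sup>l\<^sup>-\<^sup>1\<close> acting on \<open>T k\<close>, and \<open>k = n - (n - k)\<close> is the difference of the factors that
  \<open>nab\<^sup>n\<close> and \<open>nab\<^sup>n\<^sup>-\<^sup>k\<close> contribute when they act on \<open>M l\<close>. The terms in \<open>h\<close> multiply \<open>v (n - 1)\<close>, which
  does not belong to any \<open>X m\<close> with \<open>m > 1\<close>.\<close>

definition G :: "nat \<Rightarrow> nat \<Rightarrow> complex \<Rightarrow> complex \<Rightarrow> complex" where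
  "G k l = (\<lambda>e z. of_nat (l - 1) * (M l e z * D (T k) e z) + of_nat k * (T k e z * D (M l) e z))"

definition h :: "complex \<Rightarrow> complex \<Rightarrow> complex" where
  "h = (\<lambda>e z. of_nat n * D (M 1) e z + of_nat (n choose 2) * D (D (M 2)) e z)"

definition main :: family where
  "main = vsub (vadd (vsum {2..n} (\<lambda>k. vsum {2..n} (\<lambda>l. scl (G k l) (v ((n - k) + (l - 2))))))
     (scl h (v (n - 1)))) (vsum {2..n} (\<lambda>k. scl (Db (T k)) (v (n - k))))"

lemma small_DT: "k \<in> {2..n} \<Longrightarrow> small 2 (D (T k))"
  and small_DbT: "k \<in> {2..n} \<Longrightarrow> small 2 (Db (T k))"
  and small_DM: "l \<in> {1..n} \<Longrightarrow> small 1 (D (M l))"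
  and small_DM1: "small 2 (D (M 1))"
  using small_D[OF T] bar.small_D[OF T] small_D[OF M] small_D[OF M1] by (simp_all add: numeral_2_eq_2)

lemma small_G: "k \<in> {2..n} \<Longrightarrow> l \<in> {2..n} \<Longrightarrow> small 2 (G k l)"
  unfolding G_def
  using small_mult0[OF M small_DT, of l k] small_mult[OF T small_DM, of k l]
  by (intro small_add small_cmult) (simp_all add: numeral_2_eq_2)

lemma small_h: "small 2 h"
  unfolding h_def using small_D[OF small_DM[of 2]] n2
  by (intro small_add small_cmult small_DM1) (simp add: numeral_2_eq_2)

text \<open>After expanding both occurrences of \<open>nbr s\<close> and reducing the \<open>v i\<close> with \<open>i \<ge> n\<close>, the products
  \<open>M l * T k\<close> without derivatives appear twice with opposite signs. Derivatives of \<open>M 1\<close> count one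
  order more because \<open>M 1\<close> itself is small.\<close>

lemma rhs_estimate: "eqv 3 rhs main"
proof -
  define A1 where "A1 = (\<lambda>l. vadd (vadd (scl (M l) (v ((l - 1) + n)))
     (scl (\<lambda>e z. of_nat n * D (M l) e z) (v ((l - 1) + (n - 1)))))
    (scl (\<lambda>e z. of_nat (n choose 2) * D (D (M l)) e z) (v ((l - 1) + (n - 2)))))"
  define B1 where "B1 = (\<lambda>k l. vadd (scl (M l) (v ((l - 1) + (n - k))))
    (scl (\<lambda>e z. of_nat (n - k) * D (M l) e z) (v ((l - 1) + (n - k - 1)))))"
  \<comment> \<open>the summands of \<open>nab\<^sup>n (nbr s)\<close> after reduction of the vectors \<open>v i\<close> with \<open>i \<ge> n\<close>\<close>
  define A2 where "A2 = (\<lambda>l. vadd (vadd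
     (scl (M l) (vsum {2..n} (\<lambda>k. vadd (scl (T k) (v ((n - k) + (l - 1))))
        (scl (\<lambda>e z. of_nat (l - 1) * D (T k) e z) (v ((n - k) + (l - 1 - 1)))))))
     (if l = 1 then scl (\<lambda>e z. of_nat n * D (M 1) e z) (v (n - 1))
      else scl (\<lambda>e z. of_nat n * D (M l) e z) (vsum {2..n} (\<lambda>k. scl (T k) (v ((n - k) + (l - 2)))))))
    (if l = 2 then scl (\<lambda>e z. of_nat (n choose 2) * D (D (M 2)) e z) (v (n - 1)) else (\<lambda>e i z. 0)))"
  define B2 where "B2 = (\<lambda>k l. vadd (scl (M l) (v ((n - k) + (l - 1))))
    (if l = 1 then (\<lambda>e i z. 0) else scl (\<lambda>e z. of_nat (n - k) * D (M l) e z) (v ((n - k) + (l - 2)))))"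
  have A: "eqv 3 (A1 l) (A2 l)" if l: "l \<in> {1..n}" for l
    unfolding A1_def A2_def
  proof (intro eqv_vadd)
    show "eqv 3 (scl (M l) (v ((l - 1) + n)))
      (scl (M l) (vsum {2..n} (\<lambda>k. vadd (scl (T k) (v ((n - k) + (l - 1))))
        (scl (\<lambda>e z. of_nat (l - 1) * D (T k) e z) (v ((n - k) + (l - 1 - 1)))))))"
      using v_high_3[of "l - 1"] by (intro eqv_scl[OF M[OF l]]) (simp_all add: add.commute)
    have D1: "small 1 (\<lambda>e z. of_nat n * D (M l) e z)" by (intro small_cmult small_DM l)
    show "eqv 3 (scl (\<lambda>e z. of_nat n * D (M l) e z) (v ((l - 1) + (n - 1))))
      (if l = 1 then scl (\<lambda>e z. of_nat n * D (M 1) e z) (v (n - 1))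
      else scl (\<lambda>e z. of_nat n * D (M l) e z) (vsum {2..n} (\<lambda>k. scl (T k) (v ((n - k) + (l - 2))))))"
    proof (cases "l = 1")
      case False
      then have "(l - 1) + (n - 1) = n + (l - 2)" using l n2 by auto
      with False show ?thesis using eqv_scl[OF D1 v_high_2[of "l - 2"], of 3] by simp
    qed (simp add: eqv_refl)
    show "eqv 3 (scl (\<lambda>e z. of_nat (n choose 2) * D (D (M l)) e z) (v ((l - 1) + (n - 2))))
      (if l = 2 then scl (\<lambda>e z. of_nat (n choose 2) * D (D (M 2)) e z) (v (n - 1)) else (\<lambda>e i z. 0))"
    proof (cases "l = 2")
      case True
      have "2 - 1 + (n - 2) = n - 1" using n2 by simp
      then show ?thesis by (simp only: True eqv_refl if_True refl)
    next
      case False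
      have "vsmall 3 (scl (\<lambda>e z. of_nat (n choose 2) * D (D (M l)) e z) (v ((l - 1) + (n - 2))))"
      proof (cases "l = 1")
        case True
        have "small 3 (\<lambda>e z. of_nat (n choose 2) * D (D (M 1)) e z)"
          using small_D[OF small_DM1] by (intro small_cmult) (simp add: numeral_3_eq_3 numeral_2_eq_2)
        from vsmall_scl[OF this vsmall_v] show ?thesis using True by simp
      next
        case l1: False
        then have "(l - 1) + (n - 2) = n + (l - 3)" using False l n2 by auto
        moreover have "small 2 (\<lambda>e z. of_nat (n choose 2) * D (D (M l)) e z)"
          using small_D[OF small_DM[OF l]] by (intro small_cmult) (simp add: numeral_2_eq_2)
        ultimately show ?thesis using vsmall_scl[OF _ v_high_1[of "l - 3"]] by fastforce
      qed
      from eqv_zero[OF this] show ?thesis using False by simp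
    qed
  qed
  have B: "eqv 2 (B1 k l) (B2 k l)" if l: "l \<in> {1..n}" for k l
    unfolding B1_def B2_def
  proof (intro eqv_vadd)
    show "eqv 2 (scl (M l) (v ((l - 1) + (n - k)))) (scl (M l) (v ((n - k) + (l - 1))))"
      by (simp add: add.commute eqv_refl)
    show "eqv 2 (scl (\<lambda>e z. of_nat (n - k) * D (M l) e z) (v ((l - 1) + (n - k - 1))))
      (if l = 1 then (\<lambda>e i z. 0) else scl (\<lambda>e z. of_nat (n - k) * D (M l) e z) (v ((n - k) + (l - 2))))"
    proof (cases "l = 1")
      case True
      have "vsmall (2 + 0) (scl (\<lambda>e z. of_nat (n - k) * D (M 1) e z) (v ((1 - 1) + (n - k - 1))))"
        by (intro vsmall_scl small_cmult small_DM1 vsmall_v)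
      from eqv_zero[OF this] show ?thesis using True by simp
    next
      case False
      have "eqx (scl (\<lambda>e z. of_nat (n - k) * D (M l) e z) (v ((l - 1) + (n - k - 1))))
        (scl (\<lambda>e z. of_nat (n - k) * D (M l) e z) (v ((n - k) + (l - 2))))"
      proof (cases "n - k = 0")
        case nk: False
        then have "(l - 1) + (n - k - 1) = (n - k) + (l - 2)" using False l by auto
        then show ?thesis by (simp add: eqx_def)
      qed (simp add: eqx_def scl_def)
      then show ?thesis using False by (simp add: eqx_eqv)
    qed
  qed
  have "eqv 3 rhs (vsub (vsum {1..n} A2)
     (vsum {2..n} (\<lambda>k. vadd (scl (Db (T k)) (v (n - k))) (scl (T k) (vsum {1..n} (B2 k))))))"
    unfolding rhs_def
  proof (intro eqv_vsub eqv_vsum eqv_vadd eqv_refl)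
    show "eqv 3 ((nab ^^ n) (nbr s)) (vsum {1..n} A2)"
      by (rule eqv_trans[OF nbr_s_3]) (rule eqv_vsum, use A in \<open>simp add: A1_def\<close>)
    fix k assume k: "k \<in> {2..n}"
    have "eqv 2 ((nab ^^ (n - k)) (nbr s)) (vsum {1..n} (B2 k))"
      by (rule eqv_trans[OF nbr_s_2]) (rule eqv_vsum, use B in \<open>simp add: B1_def\<close>)
    then show "eqv 3 (scl (T k) ((nab ^^ (n - k)) (nbr s))) (scl (T k) (vsum {1..n} (B2 k)))"
      by (rule eqv_scl[OF T[OF k]]) simp
  qed
  also have "eqx \<dots> main"
  proof (rule eqxI)
    fix e z :: complex and i :: nat
    let ?w = "\<lambda>k. v k e i z" and ?K = "{2..n}"
    let ?t = "\<lambda>k. T k e z" and ?t' = "\<lambda>k. D (T k) e z" and ?b = "\<lambda>k. Db (T k) e z"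
    let ?m = "\<lambda>l. M l e z" and ?m' = "\<lambda>l. D (M l) e z"
    let ?c = "of_nat (n choose 2) * D (D (M 2)) e z"
    have split: "(\<Sum>l\<in>{1..n}. f l) = f 1 + (\<Sum>l\<in>?K. f l)" for f :: "nat \<Rightarrow> complex"
      using n2 by (subst sum.atLeast_Suc_atMost) (simp_all add: numeral_2_eq_2)
    have n2K: "2 \<in> ?K" using n2 by simp
    have A21: "A2 1 e i z = (\<Sum>k\<in>?K. ?m 1 * (?t k * ?w (n - k))) + of_nat n * ?m' 1 * ?w (n - 1)"
      by (simp add: A2_def vdefs sum_distrib_left)
    have A2l: "A2 l e i z = (\<Sum>k\<in>?K. ?m l * (?t k * ?w (n - k + (l - 1)))) +
        (\<Sum>k\<in>?K. (of_nat (l - 1) * (?m l * ?t' k) + of_nat n * (?t k * ?m' l)) * ?w (n - k + (l - 2)))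
        + (if l = 2 then ?c * ?w (n - 1) else 0)" if l: "l \<in> ?K" for l
    proof -
      have "l - 1 - 1 = l - 2" "l \<noteq> 1" using l by auto
      then show ?thesis
        by (simp add: A2_def vdefs sum_distrib_left algebra_simps sum.distrib del: One_nat_def)
    qed
    have c2: "(\<Sum>l\<in>?K. if l = 2 then ?c * ?w (n - 1) else 0) = ?c * ?w (n - 1)"
      using n2K by (simp add: sum.delta)
    have SA: "vsum {1..n} A2 e i z = (\<Sum>k\<in>?K. ?m 1 * (?t k * ?w (n - k)))
        + of_nat n * ?m' 1 * ?w (n - 1)
        + ((\<Sum>k\<in>?K. \<Sum>l\<in>?K. ?m l * (?t k * ?w (n - k + (l - 1)))) +
        (\<Sum>k\<in>?K. \<Sum>l\<in>?K. (of_nat (l - 1) * (?m l * ?t' k) + of_nat n * (?t k * ?m' l)) * ?w (n - k + (l - 2)))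
        + ?c * ?w (n - 1))"
    proof -
      have "(\<Sum>l\<in>?K. A2 l e i z) = (\<Sum>l\<in>?K. \<Sum>k\<in>?K. ?m l * (?t k * ?w (n - k + (l - 1)))) +
        (\<Sum>l\<in>?K. \<Sum>k\<in>?K. (of_nat (l - 1) * (?m l * ?t' k) + of_nat n * (?t k * ?m' l)) * ?w (n - k + (l - 2)))
        + (\<Sum>l\<in>?K. if l = 2 then ?c * ?w (n - 1) else 0)"
      proof -
        have "(\<Sum>l\<in>?K. A2 l e i z) = (\<Sum>l\<in>?K. (\<Sum>k\<in>?K. ?m l * (?t k * ?w (n - k + (l - 1)))) +
          (\<Sum>k\<in>?K. (of_nat (l - 1) * (?m l * ?t' k) + of_nat n * (?t k * ?m' l)) * ?w (n - k + (l - 2)))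
          + (if l = 2 then ?c * ?w (n - 1) else 0))"
          by (intro sum.cong refl A2l)
        then show ?thesis unfolding sum.distrib .
      qed
      also have "(\<Sum>l\<in>?K. \<Sum>k\<in>?K. ?m l * (?t k * ?w (n - k + (l - 1)))) =
          (\<Sum>k\<in>?K. \<Sum>l\<in>?K. ?m l * (?t k * ?w (n - k + (l - 1))))" by (rule sum.swap)
      also have "(\<Sum>l\<in>?K. \<Sum>k\<in>?K. (of_nat (l - 1) * (?m l * ?t' k) + of_nat n * (?t k * ?m' l)) * ?w (n - k + (l - 2))) =
          (\<Sum>k\<in>?K. \<Sum>l\<in>?K. (of_nat (l - 1) * (?m l * ?t' k) + of_nat n * (?t k * ?m' l)) * ?w (n - k + (l - 2)))"
        by (rule sum.swap)
      finally show ?thesis unfolding vsum_def split A21 c2 by simp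
    qed
    have SB: "?t k * vsum {1..n} (B2 k) e i z = ?m 1 * (?t k * ?w (n - k)) +
        (\<Sum>l\<in>?K. ?m l * (?t k * ?w (n - k + (l - 1)))) +
        (\<Sum>l\<in>?K. of_nat (n - k) * (?t k * ?m' l) * ?w (n - k + (l - 2)))" for k
    proof -
      have "B2 k 1 e i z = ?m 1 * ?w (n - k)" by (simp add: B2_def vdefs)
      moreover have "B2 k l e i z = ?m l * ?w (n - k + (l - 1)) + of_nat (n - k) * ?m' l * ?w (n - k + (l - 2))"
        if "l \<in> ?K" for l using that by (simp add: B2_def vdefs)
      ultimately show ?thesis unfolding vsum_def split
        by (simp add: distrib_left sum.distrib sum_distrib_left mult_ac)
    qed
    have Geq: "(\<Sum>l\<in>?K. (of_nat (l - 1) * (?m l * ?t' k) + of_nat n * (?t k * ?m' l)) * ?w (n - k + (l - 2)))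
        - (\<Sum>l\<in>?K. of_nat (n - k) * (?t k * ?m' l) * ?w (n - k + (l - 2)))
        = (\<Sum>l\<in>?K. G k l e z * ?w (n - k + (l - 2)))" if k: "k \<in> ?K" for k
      unfolding sum_subtractf[symmetric] using k
      by (intro sum.cong refl) (simp add: G_def of_nat_diff algebra_simps)
    have GG: "(\<Sum>k\<in>?K. \<Sum>l\<in>?K. (of_nat (l - 1) * (?m l * ?t' k) + of_nat n * (?t k * ?m' l)) * ?w (n - k + (l - 2)))
        - (\<Sum>k\<in>?K. \<Sum>l\<in>?K. of_nat (n - k) * (?t k * ?m' l) * ?w (n - k + (l - 2)))
        = (\<Sum>k\<in>?K. \<Sum>l\<in>?K. G k l e z * ?w (n - k + (l - 2)))"
      by (rule trans[OF sum_subtractf[symmetric]]) (intro sum.cong refl Geq)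
    have R: "vsum ?K (\<lambda>k. vadd (scl (Db (T k)) (v (n - k))) (scl (T k) (vsum {1..n} (B2 k)))) e i z
      = (\<Sum>k\<in>?K. ?b k * ?w (n - k)) + ((\<Sum>k\<in>?K. ?m 1 * (?t k * ?w (n - k))) +
        (\<Sum>k\<in>?K. \<Sum>l\<in>?K. ?m l * (?t k * ?w (n - k + (l - 1)))) +
        (\<Sum>k\<in>?K. \<Sum>l\<in>?K. of_nat (n - k) * (?t k * ?m' l) * ?w (n - k + (l - 2))))"
      unfolding vsum_def[of ?K] vadd_def scl_def SB sum.distrib ..
    have "main e i z = (\<Sum>k\<in>?K. \<Sum>l\<in>?K. G k l e z * ?w (n - k + (l - 2)))
        + (of_nat n * ?m' 1 + ?c) * ?w (n - 1) - (\<Sum>k\<in>?K. ?b k * ?w (n - k))"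
      by (simp add: main_def vdefs h_def)
    then show "vsub (vsum {1..n} A2)
     (vsum ?K (\<lambda>k. vadd (scl (Db (T k)) (v (n - k))) (scl (T k) (vsum {1..n} (B2 k))))) e i z = main e i z"
      unfolding vsub_def SA R GG[symmetric] by (simp add: algebra_simps)
  qed
  finally show ?thesis .
qed

definition cf :: "nat \<Rightarrow> family \<Rightarrow> complex \<Rightarrow> complex \<Rightarrow> complex" where
  "cf j w = (\<lambda>e z. \<Sum>i<n. Y e j i z * w e i z)"

lemma small_cf: "j < n \<Longrightarrow> vsmall N w \<Longrightarrow> small N (cf j w)"
  unfolding cf_def vsmall_def by (intro small_sum small_mult0 Y) auto

lemma cf_vsub: "cf j (vsub u w) e z = cf j u e z - cf j w e z"
  and cf_vadd: "cf j (vadd u w) e z = cf j u e z + cf j w e z"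
  and cf_scl: "cf j (scl a w) e z = a e z * cf j w e z"
  by (simp_all add: cf_def vdefs algebra_simps sum_subtractf sum.distrib sum_distrib_left)

lemma cf_vsum: "cf j (vsum K f) e z = (\<Sum>k\<in>K. cf j (f k) e z)"
  unfolding cf_def vsum_def sum_distrib_left by (rule sum.swap)

lemma cf_v:
  "e \<noteq> 0 \<Longrightarrow> norm e < \<delta> \<Longrightarrow> z \<in> W \<Longrightarrow> i < n \<Longrightarrow> j < n \<Longrightarrow> cf j (v i) e z = (if i = j then 1 else 0)"
  unfolding cf_def v_def by (rule dual)

lemma cf_X:
  assumes d: "e \<noteq> 0" "norm e < \<delta>" "z \<in> W" and m: "m \<in> {1..n}"
  shows "cf (n - m) (vsum {1..n} (\<lambda>i. scl (X i) (v (n - i)))) e z = X m e z"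
proof -
  have "cf (n - m) (vsum {1..n} (\<lambda>i. scl (X i) (v (n - i)))) e z =
      (\<Sum>i\<in>{1..n}. if i = m then X m e z else 0)"
    unfolding cf_vsum cf_scl using m by (intro sum.cong refl) (auto simp: cf_v[OF d])
  also have "\<dots> = X m e z" using m by simp
  finally show ?thesis .
qed

lemma vsmall_main: "vsmall 2 main"
proof -
  have "vsmall (2 + 0) (scl (G k l) (v j))" if "k \<in> {2..n}" "l \<in> {2..n}" for k l j
    by (intro vsmall_scl small_G that vsmall_v)
  moreover have "vsmall (2 + 0) (scl (Db (T k)) (v j))" if "k \<in> {2..n}" for k j
    by (intro vsmall_scl small_DbT that vsmall_v)
  moreover have "vsmall (2 + 0) (scl h (v j))" for j
    by (intro vsmall_scl small_h vsmall_v)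
  ultimately show ?thesis unfolding main_def
    by (intro vsmall_vsub vsmall_vadd vsmall_vsum) simp_all
qed

text \<open>A bound of order \<open>r\<close> on all curvature coefficients makes the curvature side explicit up to order
  \<open>r + 1\<close>. Starting from \<open>r = 0\<close>, this is used three times, improving the bound each time.\<close>

lemma X_estimate:
  assumes X: "\<And>k. k \<in> {1..n} \<Longrightarrow> small r (X k)" and r: "r \<le> 2" and m: "m \<in> {1..n}"
  shows "small (r + 1) (\<lambda>e z. X m e z - cf (n - m) main e z)"
proof -
  let ?V = "vsum {1..n} (\<lambda>i. scl (X i) (v (n - i)))"
  have "eqv (r + 1) ?V lhs" by (rule eqv_sym[OF lhs_estimate[OF X]])
  also note compatibility
  also have "eqv (r + 1) rhs main" using r by (intro eqv_weaken[OF rhs_estimate]) simp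
  finally have "vsmall (r + 1) (vsub ?V main)" by (simp add: eqv_def)
  then have "small (r + 1) (cf (n - m) (vsub ?V main))"
    using m by (intro small_cf) auto
  then show ?thesis
  proof (rule small_cong)
    fix e z :: complex assume d: "e \<noteq> 0" "norm e < \<delta>" "z \<in> W"
    show "cf (n - m) (vsub ?V main) e z = X m e z - cf (n - m) main e z"
      unfolding cf_vsub cf_X[OF d m] ..
  qed
qed

lemma X_small_Suc:
  assumes X: "\<And>k. k \<in> {1..n} \<Longrightarrow> small r (X k)" and r: "r \<le> 1" and m: "m \<in> {1..n}"
  shows "small (r + 1) (X m)"
proof -
  have "small 2 (cf (n - m) main)" using m by (intro small_cf vsmall_main) auto
  then have "small (r + 1) (cf (n - m) main)" by (rule small_weaken) (use r in simp)
  from small_add[OF X_estimate[OF X _ m] this] r show ?thesis by simp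
qed

lemma X_small_2: "m \<in> {1..n} \<Longrightarrow> small 2 (X m)"
proof -
  have "small 1 (X k)" if "k \<in> {1..n}" for k using X_small_Suc[OF X _ that] by simp
  then show "m \<in> {1..n} \<Longrightarrow> small 2 (X m)" using X_small_Suc[of 1 m] by (simp add: numeral_2_eq_2)
qed

text \<open>The coefficient of \<open>v (n - m)\<close> in \<open>main\<close>. Vectors \<open>v i\<close> with \<open>i \<ge> n\<close> are small and only
  contribute terms of third order.\<close>

lemma X_expansion:
  assumes m: "m \<in> {2..n}"
  shows "small 3 (\<lambda>e z. X m e z - ((\<Sum>j=0..n-m. G (m + j) (j + 2) e z) - Db (T m) e z))"
proof -
  let ?K = "{2..n}"
  have nm: "n - m < n" using m by auto
  have 1: "small 3 (\<lambda>e z. X m e z - cf (n - m) main e z)"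
    using X_estimate[OF X_small_2, of m] m by (simp add: numeral_3_eq_3)
  have entry: "small 3 (\<lambda>e z. G k l e z * cf (n - m) (v (n - k + (l - 2))) e z -
      (if n - k + (l - 2) = n - m then G k l e z else 0))" if kl: "k \<in> ?K" "l \<in> ?K" for k l
  proof (cases "n - k + (l - 2) < n")
    case True
    show ?thesis by (rule small_cong[OF small_zero]) (simp add: cf_v True nm)
  next
    case False
    then obtain p where p: "n - k + (l - 2) = n + p" using le_Suc_ex[of n] by (metis not_less)
    have "small (2 + 1) (\<lambda>e z. G k l e z * cf (n - m) (v (n + p)) e z)"
      by (intro small_mult small_G kl small_cf nm v_high_1)
    then show ?thesis using p nm by (simp add: numeral_3_eq_3)
  qed
  have 2: "small 3 (\<lambda>e z. \<Sum>k\<in>?K. \<Sum>l\<in>?K. (G k l e z * cf (n - m) (v (n - k + (l - 2))) e z -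
      (if n - k + (l - 2) = n - m then G k l e z else 0)))"
    by (intro small_sum entry)
  have inner: "(\<Sum>l\<in>?K. if n - k + (l - 2) = n - m then G k l e z else 0) =
      (if m \<le> k then G k (k - m + 2) e z else 0)" if k: "k \<in> ?K" for k e z
  proof (cases "m \<le> k")
    case True
    have iff: "n - k + (l - 2) = n - m \<longleftrightarrow> l = k - m + 2" if "l \<in> ?K" for l
      using that k m True by auto
    have "(\<Sum>l\<in>?K. if n - k + (l - 2) = n - m then G k l e z else 0) =
        (\<Sum>l\<in>?K. if l = k - m + 2 then G k l e z else 0)"
      by (intro sum.cong refl) (simp only: iff)
    also have "k - m + 2 \<in> ?K" using k m by auto
    then have "(\<Sum>l\<in>?K. if l = k - m + 2 then G k l e z else 0) = G k (k - m + 2) e z" by simp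
    finally show ?thesis using True by simp
  next
    case False
    have "n - k + (l - 2) \<noteq> n - m" for l using False k m by auto
    then show ?thesis using False by (simp only: if_False sum.neutral_const)
  qed
  have outer: "(\<Sum>k\<in>?K. \<Sum>l\<in>?K. if n - k + (l - 2) = n - m then G k l e z else 0) =
      (\<Sum>j=0..n-m. G (m + j) (j + 2) e z)" for e z
  proof -
    have "(\<Sum>k\<in>?K. \<Sum>l\<in>?K. if n - k + (l - 2) = n - m then G k l e z else 0) =
        (\<Sum>k\<in>?K. if m \<le> k then G k (k - m + 2) e z else 0)"
      by (intro sum.cong refl inner)
    also have "\<dots> = (\<Sum>k\<in>{m..n}. G k (k - m + 2) e z)"
      using m by (intro sum.mono_neutral_cong_right) auto
    also have "\<dots> = (\<Sum>j\<in>{0..n-m}. G (m + j) (j + 2) e z)"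
      using m by (intro sum.reindex_bij_witness[of _ "\<lambda>j. m + j" "\<lambda>k. k - m"]) auto
    finally show ?thesis .
  qed
  have cf_main: "cf (n - m) main e z =
      (\<Sum>k\<in>?K. \<Sum>l\<in>?K. G k l e z * cf (n - m) (v (n - k + (l - 2))) e z) - Db (T m) e z"
    if d: "e \<noteq> 0" "norm e < \<delta>" "z \<in> W" for e z
  proof -
    have "cf (n - m) (v (n - 1)) e z = 0"
      using m n2 by (subst cf_v[OF d]) auto
    moreover have "(\<Sum>k\<in>?K. Db (T k) e z * cf (n - m) (v (n - k)) e z) =
        (\<Sum>k\<in>?K. if k = m then Db (T m) e z else 0)"
      using m by (intro sum.cong refl) (auto simp: cf_v[OF d])
    moreover have "(\<Sum>k\<in>?K. if k = m then Db (T m) e z else 0) = Db (T m) e z" using m by simp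
    ultimately show ?thesis by (simp add: main_def cf_vsub cf_vadd cf_vsum cf_scl)
  qed
  show ?thesis
  proof (rule small_cong[OF small_add[OF 1 2]])
    fix e z :: complex assume d: "e \<noteq> 0" "norm e < \<delta>" "z \<in> W"
    show "X m e z - cf (n - m) main e z + (\<Sum>k\<in>?K. \<Sum>l\<in>?K. G k l e z * cf (n - m) (v (n - k + (l - 2))) e z -
      (if n - k + (l - 2) = n - m then G k l e z else 0)) =
      X m e z - ((\<Sum>j=0..n-m. G (m + j) (j + 2) e z) - Db (T m) e z)"
      unfolding cf_main[OF d] sum_subtractf outer by (simp only: algebra_simps)
  qed
qed

end

section \<open>Frames of iterated derivatives and their determinants\<close>

abbreviation fmat :: "nat \<Rightarrow> (nat \<Rightarrow> nat \<Rightarrow> complex) \<Rightarrow> complex mat" where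
  "fmat n F \<equiv> mat n n (\<lambda>(i, j). F i j)"

lemma det_fmat:
  "det (fmat n F) = (\<Sum>p\<in>{p. p permutes {0..<n}}. signof p * (\<Prod>i\<in>{0..<n}. F i (p i)))"
proof -
  have "p i < n" if "p permutes {0..<n}" "i < n" for p i
    using permutes_in_image[OF that(1), of i] that(2) by auto
  then show ?thesis by (subst det_def'[of _ n]) (auto intro!: sum.cong prod.cong)
qed

lemma det_fmat_row:
  assumes i: "i < n"
  shows "(\<Sum>j<n. y j * cofactor (fmat n F) i j) =
    (\<Sum>p\<in>{p. p permutes {0..<n}}. signof p * (y (p i) * (\<Prod>k\<in>{0..<n} - {i}. F k (p k))))"
proof -
  let ?G = "\<lambda>k j. if k = i then y j else F k j"
  have "cofactor (fmat n ?G) i j = cofactor (fmat n F) i j" if "j < n" for j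
  proof -
    have "mat_delete (fmat n ?G) i j = mat_delete (fmat n F) i j"
      using i that by (intro eq_matI) (auto simp: mat_delete_def)
    then show ?thesis by (simp add: cofactor_def)
  qed
  then have "(\<Sum>j<n. y j * cofactor (fmat n F) i j) = det (fmat n ?G)"
    using laplace_expansion_row[of "fmat n ?G" n i] i by simp
  also have "\<dots> = (\<Sum>p\<in>{p. p permutes {0..<n}}. signof p *
      (y (p i) * (\<Prod>k\<in>{0..<n} - {i}. F k (p k))))"
  proof (subst det_fmat, intro sum.cong refl arg_cong2[of _ _ _ _ "(*)"])
    fix p
    have "(\<Prod>k\<in>{0..<n}. ?G k (p k)) = ?G i (p i) * (\<Prod>k\<in>{0..<n} - {i}. ?G k (p k))"
      using i by (intro prod.remove) auto
    also have "(\<Prod>k\<in>{0..<n} - {i}. ?G k (p k)) = (\<Prod>k\<in>{0..<n} - {i}. F k (p k))"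
      by (intro prod.cong) auto
    finally show "(\<Prod>k\<in>{0..<n}. ?G k (p k)) = y (p i) * (\<Prod>k\<in>{0..<n} - {i}. F k (p k))" by simp
  qed
  finally show ?thesis .
qed

text \<open>By the Leibniz formula and Laplace expansion along the differentiated row, the derivative of a
  determinant is the trace of the adjugate times the derivative of the matrix.\<close>

lemma wd_det:
  assumes V: "\<And>i j. i < n \<Longrightarrow> j < n \<Longrightarrow> V i j differentiable (at z)"
  shows "wd c (\<lambda>z. det (fmat n (\<lambda>i j. V i j z))) z =
    (\<Sum>i<n. \<Sum>j<n. wd c (V i j) z * adj_mat (fmat n (\<lambda>i j. V i j z)) $$ (j, i))"
proof -
  let ?P = "{p. p permutes {0..<n}}"
  have lt: "p i < n" if "p \<in> ?P" "i \<in> {0..<n}" for p i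
    using permutes_in_image[of p "{0..<n}" i] that by auto
  have d: "(\<lambda>z. V i (p i) z) differentiable (at z)" if "p \<in> ?P" "i \<in> {0..<n}" for p i
    using V[OF _ lt[OF that]] that by auto
  have fin: "finite ?P" by (simp add: finite_permutations)
  have "wd c (\<lambda>z. det (fmat n (\<lambda>i j. V i j z))) z =
      (\<Sum>p\<in>?P. wd c (\<lambda>z. signof p * (\<Prod>i\<in>{0..<n}. V i (p i) z)) z)"
    unfolding det_fmat
    by (rule wd_sum) (intro differentiable_mult differentiable_const wd_prod(2) d; simp)
  also have "\<dots> = (\<Sum>p\<in>?P. signof p * (\<Sum>i\<in>{0..<n}. wd c (V i (p i)) z * (\<Prod>k\<in>{0..<n} - {i}. V k (p k) z)))"
  proof (intro sum.cong refl)
    fix p assume p: "p \<in> ?P"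
    show "wd c (\<lambda>z. signof p * (\<Prod>i\<in>{0..<n}. V i (p i) z)) z =
      signof p * (\<Sum>i\<in>{0..<n}. wd c (V i (p i)) z * (\<Prod>k\<in>{0..<n} - {i}. V k (p k) z))"
      using wd_prod(1)[where J = "{0..<n}" and f = "\<lambda>i. V i (p i)" and c = c, OF _ d[OF p]]
        wd_prod(2)[where J = "{0..<n}" and f = "\<lambda>i. V i (p i)", OF _ d[OF p]]
      by (subst wd_cmult) auto
  qed
  also have "\<dots> = (\<Sum>i\<in>{0..<n}. \<Sum>p\<in>?P. signof p * (wd c (V i (p i)) z * (\<Prod>k\<in>{0..<n} - {i}. V k (p k) z)))"
    unfolding sum_distrib_left by (rule sum.swap)
  also have "\<dots> = (\<Sum>i\<in>{0..<n}. \<Sum>j<n. wd c (V i j) z * cofactor (fmat n (\<lambda>i j. V i j z)) i j)"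
    by (intro sum.cong refl det_fmat_row[symmetric]) simp
  finally show ?thesis by (simp add: adj_mat_def atLeast0LessThan)
qed

definition covd :: "nat \<Rightarrow> complex \<Rightarrow> complex \<Rightarrow> (nat \<Rightarrow> nat \<Rightarrow> complex \<Rightarrow> complex) \<Rightarrow>
    (nat \<Rightarrow> complex \<Rightarrow> complex) \<Rightarrow> nat \<Rightarrow> complex \<Rightarrow> complex" where
  "covd n a c R v = (\<lambda>i z. a * wd c (v i) z + (\<Sum>j<n. R i j z * v j z))"

lemma cov_eq_covd: "cov n c R w = (\<lambda>e. covd n e c (R e) (w e))"
  by (simp add: cov_def covd_def)

lemma cov_power_eq_covd: "(cov n c R ^^ k) w = (\<lambda>e. (covd n e c (R e) ^^ k) (w e))"
  by (induction k) (simp_all add: cov_eq_covd)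

text \<open>The entry at \<open>k\<close> in row \<open>j\<close> is the coefficient of the \<open>k\<close>-th derivative of \<open>v\<close> in the \<open>j\<close>-th
  derivative of \<open>g v\<close>. These coefficients form a triangular matrix with constant diagonal \<open>g\<close>, so
  rescaling a section multiplies the determinant of its frame by \<open>g\<^sup>n\<close>.\<close>

primrec scale_coeff :: "complex \<Rightarrow> complex \<Rightarrow> (complex \<Rightarrow> complex) \<Rightarrow> nat \<Rightarrow> nat \<Rightarrow> complex \<Rightarrow> complex" where
  "scale_coeff a c g 0 = (\<lambda>k. if k = 0 then g else (\<lambda>z. 0))"
| "scale_coeff a c g (Suc j) = (\<lambda>k z. a * wd c (scale_coeff a c g j k) z +
     (case k of 0 \<Rightarrow> 0 | Suc k' \<Rightarrow> scale_coeff a c g j k' z))"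

lemma scale_coeff_above: "j < k \<Longrightarrow> scale_coeff a c g j k = (\<lambda>z. 0)"
proof (induction j arbitrary: k)
  case (Suc j)
  from Suc.prems obtain l where l: "k = Suc l" "j < l" by (cases k) auto
  have "scale_coeff a c g j (Suc l) = (\<lambda>z. 0)" "scale_coeff a c g j l = (\<lambda>z. 0)"
    using l by (auto intro: Suc.IH)
  with l(1) show ?case by simp
qed simp

lemma scale_coeff_diag: "scale_coeff a c g j j = g"
proof (induction j)
  case (Suc j)
  have "scale_coeff a c g j (Suc j) = (\<lambda>z. 0)" by (rule scale_coeff_above) simp
  with Suc show ?case by simp
qed simp

locale frame_operator =
  fixes W :: "complex set" and n :: nat and a c :: complex
    and R :: "nat \<Rightarrow> nat \<Rightarrow> complex \<Rightarrow> complex"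
  assumes open_W: "open W" and c: "c = \<i> \<or> c = - \<i>"
    and R: "\<And>i j. i < n \<Longrightarrow> j < n \<Longrightarrow> smooth_on W (R i j)"
begin

abbreviation nab :: "(nat \<Rightarrow> complex \<Rightarrow> complex) \<Rightarrow> nat \<Rightarrow> complex \<Rightarrow> complex" where
  "nab \<equiv> covd n a c R"

lemma smooth_nab: "(\<And>i. i < n \<Longrightarrow> smooth_on W (v i)) \<Longrightarrow> i < n \<Longrightarrow> smooth_on W (nab v i)"
  unfolding covd_def
  by (intro smooth_on_add smooth_on_mult smooth_on_sum smooth_on_const open_W smooth_on_wd c R) auto

lemma smooth_nab_power:
  "(\<And>i. i < n \<Longrightarrow> smooth_on W (v i)) \<Longrightarrow> i < n \<Longrightarrow> smooth_on W ((nab ^^ k) v i)"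
  by (induction k arbitrary: i) (auto intro: smooth_nab)

lemma nab_cong:
  assumes "\<And>i z. i < n \<Longrightarrow> z \<in> W \<Longrightarrow> v i z = w i z" "i < n" "z \<in> W"
  shows "nab v i z = nab w i z"
proof -
  have "wd c (v i) z = wd c (w i) z" by (rule wd_cong[OF open_W assms(3) assms(1)[OF assms(2)]])
  moreover have "(\<Sum>j<n. R i j z * v j z) = (\<Sum>j<n. R i j z * w j z)"
    using assms(1,3) by (intro sum.cong) auto
  ultimately show ?thesis by (simp add: covd_def)
qed

lemma smooth_scale_coeff: "smooth_on W g \<Longrightarrow> smooth_on W (scale_coeff a c g j k)"
proof (induction j arbitrary: k)
  case (Suc j)
  have "smooth_on W (\<lambda>z. a * wd c (scale_coeff a c g j k) z + scale_coeff a c g j k' z)" for k'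
    by (intro smooth_on_add smooth_on_mult smooth_on_const open_W smooth_on_wd c Suc)
  moreover have "smooth_on W (\<lambda>z. a * wd c (scale_coeff a c g j k) z)"
    by (intro smooth_on_mult smooth_on_const open_W smooth_on_wd c Suc)
  ultimately show ?case by (cases k) simp_all
qed simp

lemma nab_power_scaled:
  assumes g: "smooth_on W g" and v: "\<And>i. i < n \<Longrightarrow> smooth_on W (v i)"
    and i: "i < n" and z: "z \<in> W"
  shows "(nab ^^ j) (\<lambda>i z. g z * v i z) i z = (\<Sum>k\<le>j. scale_coeff a c g j k z * (nab ^^ k) v i z)"
  using i z
proof (induction j arbitrary: i z)
  case (Suc j)
  let ?u = "scale_coeff a c g" and ?v = "\<lambda>k. (nab ^^ k) v"
  have sm: "smooth_on W (?u j k)" "i < n \<Longrightarrow> smooth_on W (?v k i)" for k i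
    by (auto intro: smooth_scale_coeff smooth_nab_power g v)
  note df = smooth_on_differentiable[OF sm(1) Suc.prems(2)]
    smooth_on_differentiable[OF sm(2)[OF Suc.prems(1)] Suc.prems(2)]
  have "(nab ^^ Suc j) (\<lambda>i z. g z * v i z) i z = nab (\<lambda>i z. \<Sum>k\<le>j. ?u j k z * ?v k i z) i z"
    unfolding funpow.simps o_apply by (rule nab_cong[OF Suc.IH Suc.prems])
  also have "\<dots> = a * (\<Sum>k\<le>j. wd c (?u j k) z * ?v k i z + ?u j k z * wd c (?v k i) z)
      + (\<Sum>k\<le>j. ?u j k z * (\<Sum>l<n. R i l z * ?v k l z))"
  proof -
    have "wd c (\<lambda>z. \<Sum>k\<le>j. ?u j k z * ?v k i z) z =
        (\<Sum>k\<le>j. wd c (\<lambda>z. ?u j k z * ?v k i z) z)"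
      by (rule wd_sum) (intro differentiable_mult df)
    moreover have "wd c (\<lambda>z. ?u j k z * ?v k i z) z = wd c (?u j k) z * ?v k i z + ?u j k z * wd c (?v k i) z" for k
      by (rule wd_mult[OF df])
    moreover have "(\<Sum>l<n. R i l z * (\<Sum>k\<le>j. ?u j k z * ?v k l z)) =
        (\<Sum>k\<le>j. ?u j k z * (\<Sum>l<n. R i l z * ?v k l z))"
      unfolding sum_distrib_left by (subst sum.swap) (simp add: mult_ac)
    ultimately show ?thesis by (simp add: covd_def)
  qed
  also have "\<dots> = (\<Sum>k\<le>j. a * wd c (?u j k) z * ?v k i z) + (\<Sum>k\<le>j. ?u j k z * ?v (Suc k) i z)"
    unfolding funpow.simps o_apply covd_def[of n a c R "(nab ^^ _) v"]
    by (simp add: sum_distrib_left sum.distrib algebra_simps)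
  also have "(\<Sum>k\<le>j. a * wd c (?u j k) z * ?v k i z) = (\<Sum>k\<le>Suc j. a * wd c (?u j k) z * ?v k i z)"
    by (simp add: scale_coeff_above)
  also have "(\<Sum>k\<le>j. ?u j k z * ?v (Suc k) i z) =
      (\<Sum>k\<le>Suc j. (case k of 0 \<Rightarrow> 0 | Suc k' \<Rightarrow> ?u j k' z) * ?v k i z)"
    by (simp add: sum.atMost_Suc_shift del: funpow.simps sum.atMost_Suc)
  finally show ?case by (simp add: sum.distrib distrib_right del: funpow.simps)
qed simp

lemma det_frame_scaled:
  assumes g: "smooth_on W g" and v: "\<And>i. i < n \<Longrightarrow> smooth_on W (v i)" and z: "z \<in> W"
  shows "det (fmat n (\<lambda>i j. (nab ^^ j) (\<lambda>i z. g z * v i z) i z)) =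
    g z ^ n * det (fmat n (\<lambda>i j. (nab ^^ j) v i z))"
proof -
  let ?V = "fmat n (\<lambda>i j. (nab ^^ j) v i z)" and ?U = "fmat n (\<lambda>k j. scale_coeff a c g j k z)"
  have "fmat n (\<lambda>i j. (nab ^^ j) (\<lambda>i z. g z * v i z) i z) = ?V * ?U"
  proof (rule eq_matI)
    fix i j assume "i < dim_row (?V * ?U)" "j < dim_col (?V * ?U)"
    then have ij: "i < n" "j < n" by auto
    have "(?V * ?U) $$ (i, j) = (\<Sum>k<n. (nab ^^ k) v i z * scale_coeff a c g j k z)"
      using ij by (simp add: scalar_prod_def atLeast0LessThan)
    also have "\<dots> = (\<Sum>k\<le>j. (nab ^^ k) v i z * scale_coeff a c g j k z)"
      using ij by (intro sum.mono_neutral_right) (auto simp: scale_coeff_above not_le)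
    finally show "fmat n (\<lambda>i j. (nab ^^ j) (\<lambda>i z. g z * v i z) i z) $$ (i, j) = (?V * ?U) $$ (i, j)"
      using ij nab_power_scaled[where j = j, OF g v ij(1) z] by (simp add: mult.commute)
  qed auto
  moreover have "det ?U = g z ^ n"
  proof -
    have "det ?U = prod_list (diag_mat ?U)"
      by (rule det_upper_triangular[of _ n]) (auto simp: scale_coeff_above)
    also have "diag_mat ?U = replicate n (g z)"
      by (rule nth_equalityI) (auto simp: diag_mat_def scale_coeff_diag)
    finally show ?thesis by simp
  qed
  moreover have "det (?V * ?U) = det ?V * det ?U" by (rule det_mult[of _ n]) auto
  ultimately show ?thesis by simp
qed

text \<open>Differentiate \<open>det = 1\<close>. Replacing the derivative of each frame vector by its covariant
  derivative changes the trace by that of \<open>R\<close>, which is zero, and among the covariant derivatives only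
  that of the last vector is not again a member of the frame.\<close>

lemma last_coordinate_zero:
  assumes n: "0 < n" and v: "\<And>i. i < n \<Longrightarrow> smooth_on W (v i)"
    and det1: "\<And>z. z \<in> W \<Longrightarrow> det (fmat n (\<lambda>i j. (nab ^^ j) v i z)) = 1"
    and tr: "(\<Sum>i<n. R i i z) = 0" and z: "z \<in> W"
  shows "(\<Sum>i<n. adj_mat (fmat n (\<lambda>i j. (nab ^^ j) v i z)) $$ (n - 1, i) * (nab ^^ n) v i z) = 0"
proof -
  let ?v = "\<lambda>j. (nab ^^ j) v" and ?V = "fmat n (\<lambda>i j. (nab ^^ j) v i z)"
  let ?Y = "\<lambda>j i. adj_mat ?V $$ (j, i)"
  have adj: "adj_mat ?V \<in> carrier_mat n n" "?V * adj_mat ?V = 1\<^sub>m n" "adj_mat ?V * ?V = 1\<^sub>m n"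
    using adj_mat[of ?V n] det1[OF z] by auto
  have YV: "(\<Sum>i<n. ?Y j i * ?v k i z) = (if j = k then 1 else 0)" if "j < n" "k < n" for j k
    using arg_cong[OF adj(3), of "\<lambda>M. M $$ (j, k)"] that adj(1)
    by (simp add: scalar_prod_def atLeast0LessThan)
  have VY: "(\<Sum>j<n. ?v j k z * ?Y j i) = (if k = i then 1 else 0)" if "k < n" "i < n" for k i
    using arg_cong[OF adj(2), of "\<lambda>M. M $$ (k, i)"] that adj(1)
    by (simp add: scalar_prod_def atLeast0LessThan)
  have "0 = a * wd c (\<lambda>z. det (fmat n (\<lambda>i j. ?v j i z))) z"
    by (subst wd_cong[OF open_W z det1]) auto
  also have "\<dots> = a * (\<Sum>i<n. \<Sum>j<n. wd c (?v j i) z * ?Y j i)"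
    by (subst wd_det) (auto intro: smooth_on_differentiable[OF smooth_nab_power[OF v] z])
  also have "\<dots> = (\<Sum>i<n. \<Sum>j<n. (?v (Suc j) i z - (\<Sum>k<n. R i k z * ?v j k z)) * ?Y j i)"
    unfolding sum_distrib_left by (intro sum.cong refl) (simp add: covd_def)
  also have "\<dots> = (\<Sum>j<n. \<Sum>i<n. ?Y j i * ?v (Suc j) i z) - (\<Sum>i<n. \<Sum>k<n. R i k z * (\<Sum>j<n. ?v j k z * ?Y j i))"
  proof -
    have "(\<Sum>i<n. \<Sum>j<n. ?v (Suc j) i z * ?Y j i) = (\<Sum>j<n. \<Sum>i<n. ?Y j i * ?v (Suc j) i z)"
      by (subst sum.swap) (simp add: mult.commute del: funpow.simps)
    moreover have "(\<Sum>i<n. \<Sum>j<n. (\<Sum>k<n. R i k z * ?v j k z) * ?Y j i) =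
        (\<Sum>i<n. \<Sum>k<n. R i k z * (\<Sum>j<n. ?v j k z * ?Y j i))"
    proof (rule sum.cong[OF refl])
      fix i
      show "(\<Sum>j<n. (\<Sum>k<n. R i k z * ?v j k z) * ?Y j i) = (\<Sum>k<n. R i k z * (\<Sum>j<n. ?v j k z * ?Y j i))"
        unfolding sum_distrib_left sum_distrib_right by (subst sum.swap) (simp add: mult.assoc)
    qed
    ultimately show ?thesis by (simp add: left_diff_distrib sum_subtractf del: funpow.simps)
  qed
  also have "(\<Sum>i<n. \<Sum>k<n. R i k z * (\<Sum>j<n. ?v j k z * ?Y j i)) = (\<Sum>i<n. R i i z)"
  proof (intro sum.cong refl)
    fix i assume i: "i \<in> {..<n}"
    have "(\<Sum>k<n. R i k z * (\<Sum>j<n. ?v j k z * ?Y j i)) = (\<Sum>k<n. if k = i then R i i z else 0)"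
      using i by (intro sum.cong refl) (auto simp: VY)
    also have "\<dots> = R i i z" using i by simp
    finally show "(\<Sum>k<n. R i k z * (\<Sum>j<n. ?v j k z * ?Y j i)) = R i i z" .
  qed
  also have "(\<Sum>j<n. \<Sum>i<n. ?Y j i * ?v (Suc j) i z) = (\<Sum>j<n. if j = n - 1 then \<Sum>i<n. ?Y (n - 1) i * ?v n i z else 0)"
  proof (intro sum.cong refl)
    fix j assume j: "j \<in> {..<n}"
    show "(\<Sum>i<n. ?Y j i * ?v (Suc j) i z) = (if j = n - 1 then \<Sum>i<n. ?Y (n - 1) i * ?v n i z else 0)"
    proof (cases "j = n - 1")
      case True
      then have "Suc j = n" using n by simp
      with True show ?thesis by simp
    next
      case False
      then have "Suc j < n" using j by auto
      with YV[of j "Suc j"] j False show ?thesis by (simp del: funpow.simps)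
    qed
  qed
  also have "\<dots> = (\<Sum>i<n. ?Y (n - 1) i * ?v n i z)" using n by simp
  finally show ?thesis using tr by simp
qed

end

section \<open>Determinants of families\<close>

context family_domain
begin

lemma small_det:
  assumes "\<And>i j. i < m \<Longrightarrow> j < m \<Longrightarrow> small 0 (\<lambda>e. F e i j)"
  shows "small 0 (\<lambda>e z. det (fmat m (\<lambda>i j. F e i j z)))"
  unfolding det_fmat
proof (intro small_sum small_mult0 small_prod)
  show "small 0 (\<lambda>e z. signof p)" for p :: "nat \<Rightarrow> nat" by (rule small_const)
  fix p i assume p: "p \<in> {p. p permutes {0..<m}}" "i \<in> {0..<m}"
  then have "p i < m" using permutes_in_image[of p "{0..<m}" i] by auto
  with p show "small 0 (\<lambda>e. F e i (p i))" by (intro assms) auto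
qed

lemma small_prod_diff:
  assumes "finite K" "\<And>k. k \<in> K \<Longrightarrow> small 0 (F k)" "\<And>k. k \<in> K \<Longrightarrow> small 0 (G k)"
    and "\<And>k. k \<in> K \<Longrightarrow> small 1 (\<lambda>e z. F k e z - G k e z)"
  shows "small 1 (\<lambda>e z. (\<Prod>k\<in>K. F k e z) - (\<Prod>k\<in>K. G k e z))"
  using assms
proof (induction K rule: finite_induct)
  case (insert x K)
  have "small 1 (\<lambda>e z. F x e z * ((\<Prod>k\<in>K. F k e z) - (\<Prod>k\<in>K. G k e z)))"
    using insert by (intro small_mult0) auto
  moreover have "small 1 (\<lambda>e z. (\<Prod>k\<in>K. G k e z) * (F x e z - G x e z))"
    using insert by (intro small_mult0 small_prod) auto
  ultimately have "small 1 (\<lambda>e z. F x e z * ((\<Prod>k\<in>K. F k e z) - (\<Prod>k\<in>K. G k e z)) +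
      (\<Prod>k\<in>K. G k e z) * (F x e z - G x e z))" by (rule small_add)
  then show ?case by (rule small_cong) (use insert in \<open>simp add: algebra_simps\<close>)
qed (simp add: small_zero)

lemma small_det_diff:
  assumes F: "\<And>i j. i < m \<Longrightarrow> j < m \<Longrightarrow> small 0 (\<lambda>e. F e i j)"
    and G: "\<And>i j. i < m \<Longrightarrow> j < m \<Longrightarrow> small 0 (\<lambda>e. G e i j)"
    and FG: "\<And>i j. i < m \<Longrightarrow> j < m \<Longrightarrow> small 1 (\<lambda>e z. F e i j z - G e i j z)"
  shows "small 1 (\<lambda>e z. det (fmat m (\<lambda>i j. F e i j z)) - det (fmat m (\<lambda>i j. G e i j z)))"
proof -
  have "small 1 (\<lambda>e z. \<Sum>p\<in>{p. p permutes {0..<m}}. signof p *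
      ((\<Prod>i\<in>{0..<m}. F e i (p i) z) - (\<Prod>i\<in>{0..<m}. G e i (p i) z)))"
  proof (intro small_sum small_cmult small_prod_diff)
    fix p i assume p: "p \<in> {p. p permutes {0..<m}}" "i \<in> {0..<m}"
    then have "p i < m" "i < m" using permutes_in_image[of p "{0..<m}" i] by auto
    then show "small 0 (\<lambda>e. F e i (p i))" "small 0 (\<lambda>e. G e i (p i))"
      "small 1 (\<lambda>e z. F e i (p i) z - G e i (p i) z)" by (blast intro: F G FG)+
  qed simp
  then show ?thesis
    by (rule small_cong) (simp add: det_fmat right_diff_distrib sum_subtractf)
qed

lemma small_adj:
  assumes F: "\<And>i j. i < m \<Longrightarrow> j < m \<Longrightarrow> small 0 (\<lambda>e. F e i j)" and ij: "i < m" "j < m"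
  shows "small 0 (\<lambda>e z. adj_mat (fmat m (\<lambda>i j. F e i j z)) $$ (j, i))"
proof -
  let ?s = "\<lambda>i k. if k < i then k else Suc k"
  have "small 0 (\<lambda>e z. (-1) ^ (i + j) * det (fmat (m - 1) (\<lambda>k l. F e (?s i k) (?s j l) z)))"
    by (intro small_cmult small_det F) (use ij in auto)
  moreover have "mat_delete (fmat m (\<lambda>i j. F e i j z)) i j =
      fmat (m - 1) (\<lambda>k l. F e (?s i k) (?s j l) z)" for e z
    using ij by (intro eq_matI) (auto simp: mat_delete_def)
  ultimately show ?thesis using ij by (simp add: adj_mat_def cofactor_def)
qed

end

section \<open>The rescaled family of connections in a chart\<close>

locale connection_family =
  fixes U :: "complex set" and n :: nat and mu :: "nat \<Rightarrow> complex \<Rightarrow> complex"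
    and A1 A2 S1 S2 :: "nat \<Rightarrow> nat \<Rightarrow> complex \<Rightarrow> complex"
  assumes open_U: "open U" and n2: "2 \<le> n"
    and mu: "\<And>k. k \<in> {2..n} \<Longrightarrow> smooth_on U (mu k)"
    and A1: "\<And>i j. i < n \<Longrightarrow> j < n \<Longrightarrow> smooth_on U (A1 i j)"
    and A2: "\<And>i j. i < n \<Longrightarrow> j < n \<Longrightarrow> smooth_on U (A2 i j)"
    and S1: "\<And>i j. i < n \<Longrightarrow> j < n \<Longrightarrow> smooth_on U (S1 i j)"
    and S2: "\<And>i j. i < n \<Longrightarrow> j < n \<Longrightarrow> smooth_on U (S2 i j)"
    and tr_A1: "\<And>z. z \<in> U \<Longrightarrow> (\<Sum>i<n. A1 i i z) = 0"
    and tr_S1: "\<And>z. z \<in> U \<Longrightarrow> (\<Sum>i<n. S1 i i z) = 0"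
begin

text \<open>The matrices of the rescaled operators and their curvature, which is \<open>e\<^sup>2\<close> times that of the
  connection.\<close>

definition P :: "complex \<Rightarrow> nat \<Rightarrow> nat \<Rightarrow> complex \<Rightarrow> complex" where
  "P e i j z = (if i = Suc j then 1 else 0) + e * A1 i j z + e ^ 2 * S1 i j z"

definition Q :: "complex \<Rightarrow> nat \<Rightarrow> nat \<Rightarrow> complex \<Rightarrow> complex" where
  "Q e i j z = (if j < i then mu (Suc i - j) z else 0) + e * A2 i j z + e ^ 2 * S2 i j z"

definition F :: "complex \<Rightarrow> nat \<Rightarrow> nat \<Rightarrow> complex \<Rightarrow> complex" where
  "F e i j z = e * dz (Q e i j) z - e * dzbar (P e i j) z +
     (\<Sum>k<n. P e i k z * Q e k j z - Q e i k z * P e k j z)"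

text \<open>The first order term in \<open>e\<close> of the \<open>k\<close>-th iterated derivative of the first frame vector; it is
  obtained from a perturbation expansion around the shift. For \<open>k = n\<close> the zeroth order term vanishes, and
  this gives the limits \<open>t\<close>.\<close>

primrec tcoef :: "nat \<Rightarrow> nat \<Rightarrow> complex \<Rightarrow> complex" where
  "tcoef 0 = (\<lambda>i z. 0)"
| "tcoef (Suc k) = (\<lambda>i z. (if i = 0 then 0 else tcoef k (i - 1) z) + A1 i k z)"

definition t :: "nat \<Rightarrow> complex \<Rightarrow> complex" where
  "t k = tcoef n (n - k)"

lemma smooth_tcoef: "k \<le> n \<Longrightarrow> i < n \<Longrightarrow> smooth_on U (tcoef k i)"
proof (induction k arbitrary: i)
  case (Suc k)
  then have "smooth_on U (\<lambda>z. (if i = 0 then 0 else tcoef k (i - 1) z))"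
    by (cases "i = 0") auto
  then show ?case using Suc.prems unfolding tcoef.simps
    by (intro smooth_on_add open_U A1) auto
qed simp

lemma trace_P: "z \<in> U \<Longrightarrow> (\<Sum>i<n. P e i i z) = 0"
  using tr_A1[of z] tr_S1[of z]
  by (simp add: P_def sum.distrib flip: sum_distrib_left)

end

locale local_family = connection_family U n mu A1 A2 S1 S2
  for U n mu A1 A2 S1 S2 +
  fixes a0 :: complex and \<rho> \<delta> :: real
  assumes ball: "cball a0 \<rho> \<subseteq> U"

sublocale local_family \<subseteq> section_families "ball a0 \<rho>" \<delta> n
  by unfold_locales simp

context local_family
begin

abbreviation W :: "complex set" where "W \<equiv> ball a0 \<rho>"

lemma W_U: "z \<in> W \<Longrightarrow> z \<in> U"
  using ball by auto

lemma small_U: "smooth_on U f \<Longrightarrow> small 0 (\<lambda>e. f)"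
  by (rule small_of_smooth_on[OF _ compact_cball ball]) auto

lemma small_e: "small 0 H \<Longrightarrow> small 1 (\<lambda>e z. e * H e z)"
  using small_mult[OF small_param1, of 0 H] by simp

lemma small_e2: "small 0 H \<Longrightarrow> small 2 (\<lambda>e z. e ^ 2 * H e z)"
  using small_mult[OF small_param[of 2], of 0 H] by simp

lemma small_P: "i < n \<Longrightarrow> j < n \<Longrightarrow> small 0 (\<lambda>e. P e i j)"
  unfolding P_def
  by (intro small_add small_const small_weaken[OF small_e le0] small_weaken[OF small_e2 le0]
      small_U A1 S1)

lemma small_Q: "i < n \<Longrightarrow> j < n \<Longrightarrow> small 0 (\<lambda>e. Q e i j)"
  unfolding Q_def
proof (intro small_add small_weaken[OF small_e le0] small_weaken[OF small_e2 le0] small_U A2 S2)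
  assume ij: "i < n" "j < n"
  show "smooth_on U (\<lambda>z. if j < i then mu (Suc i - j) z else 0)"
  proof (cases "j < i")
    case True
    then have "Suc i - j \<in> {2..n}" using ij by auto
    from mu[OF this] True show ?thesis by simp
  qed simp
qed

lemma small_Q0: "i < n \<Longrightarrow> j < n \<Longrightarrow> small 1 (\<lambda>e z. Q e i j z - (if j < i then mu (Suc i - j) z else 0))"
proof (rule small_cong)
  assume ij: "i < n" "j < n"
  show "small 1 (\<lambda>e z. e * A2 i j z + e ^ 2 * S2 i j z)"
    by (intro small_add small_e small_weaken[OF small_e2] small_U A2 S2 ij) simp
qed (simp add: Q_def)

end

sublocale local_family \<subseteq> covariant_derivative "ball a0 \<rho>" \<delta> n "- \<i>" P
  by unfold_locales (auto intro: small_P)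

sublocale local_family \<subseteq> bar: covariant_derivative "ball a0 \<rho>" \<delta> n \<i> Q
  by unfold_locales (auto intro: small_Q)

context local_family
begin

definition u :: family where "u = (\<lambda>e i z. if i = 0 then 1 else 0)"

lemma vsmall_u: "vsmall 0 u"
  unfolding vsmall_def u_def by (auto intro: small_const)

lemma frame_expansion:
  "k \<le> n \<Longrightarrow> eqv 2 ((nab ^^ k) u) (\<lambda>e i z. (if i = k then 1 else 0) + e * tcoef k i z)"
proof (induction k)
  case 0
  show ?case by (rule eqx_eqv) (simp add: eqx_def u_def)
next
  case (Suc k)
  let ?g = "\<lambda>k e i z. (if i = k then 1 else 0) + e * tcoef k i z"
  have k: "k < n" using Suc.prems by simp
  have "eqv 2 (nab ((nab ^^ k) u)) (nab (?g k))"
    by (rule nab_eqv[OF vsmall_nab_power[OF vsmall_u] Suc.IH]) (use k in simp)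
  also have "eqv 2 (nab (?g k)) (?g (Suc k))"
    unfolding eqv_def vsmall_def
  proof (intro allI impI)
    fix i assume i: "i < n"
    let ?r = "\<lambda>e z. dz (tcoef k i) z + S1 i k z + (\<Sum>j<n. A1 i j z * tcoef k j z)
        + e * (\<Sum>j<n. S1 i j z * tcoef k j z)"
    have sm: "small 0 (\<lambda>e. tcoef k j)" if "j < n" for j
      by (intro small_U smooth_tcoef that) (use k in simp)
    have "small 0 ?r"
      unfolding dz_eq_wd
      by (intro small_add small_wd sm small_U S1 A1 small_sum small_mult0 small_weaken[OF small_e le0] i k) auto
    then have "small 2 (\<lambda>e z. e ^ 2 * ?r e z)" by (rule small_e2)
    then show "small 2 (\<lambda>e. vsub (nab (?g k)) (?g (Suc k)) e i)"
    proof (rule small_cong)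
      fix e z :: complex assume d: "e \<noteq> 0" "norm e < \<delta>" "z \<in> W"
      have df: "tcoef k i differentiable (at z)" by (rule small_differentiable[OF sm[OF i] d])
      have 1: "wd (- \<i>) (\<lambda>z. (if i = k then 1 else 0) + e * tcoef k i z) z = e * dz (tcoef k i) z"
        using df by (subst wd_add) (simp_all add: wd_cmult dz_eq_wd)
      have del: "(\<Sum>j<n. a j * ((if j = k then 1 else 0) + e * tcoef k j z)) =
          a k + e * (\<Sum>j<n. a j * tcoef k j z)" for a
      proof -
        have "(\<Sum>j<n. a j * (if j = k then 1 else 0)) = (\<Sum>j<n. if j = k then a k else 0)"
          by (intro sum.cong) auto
        then have "(\<Sum>j<n. a j * (if j = k then 1 else 0)) = a k" using k by simp
        then show ?thesis by (simp add: distrib_left sum.distrib sum_distrib_left mult_ac)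
      qed
      have N: "(\<Sum>j<n. (if i = Suc j then 1 else 0) * tcoef k j z) = (if i = 0 then 0 else tcoef k (i - 1) z)"
      proof (cases i)
        case (Suc l)
        have "(\<Sum>j<n. (if i = Suc j then 1 else 0) * tcoef k j z) = (\<Sum>j<n. if j = l then tcoef k l z else 0)"
          using Suc by (intro sum.cong) auto
        then show ?thesis using Suc i by simp
      qed simp
      have "(\<Sum>j<n. P e i j z * ((if j = k then 1 else 0) + e * tcoef k j z)) =
          (if i = Suc k then 1 else 0) + e * A1 i k z + e ^ 2 * S1 i k z + e * ((if i = 0 then 0 else tcoef k (i - 1) z)
          + e * (\<Sum>j<n. A1 i j z * tcoef k j z) + e ^ 2 * (\<Sum>j<n. S1 i j z * tcoef k j z))"
        unfolding del N[symmetric]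
        by (simp add: P_def distrib_right sum.distrib sum_distrib_left mult.assoc)
      then show "e ^ 2 * ?r e z = vsub (nab (?g k)) (?g (Suc k)) e i z"
        unfolding vsub_def cov_def 1 by (simp add: algebra_simps power2_eq_square)
    qed
  qed
  finally show ?case by simp
qed

definition D0 :: "complex \<Rightarrow> complex \<Rightarrow> complex" where
  "D0 e z = det (fmat n (\<lambda>i j. (nab ^^ j) u e i z))"

lemma frame_0: "j < n \<Longrightarrow> i < n \<Longrightarrow> small 1 (\<lambda>e z. (nab ^^ j) u e i z - (if i = j then 1 else 0))"
proof -
  assume ij: "j < n" "i < n"
  have "small 2 (\<lambda>e z. (nab ^^ j) u e i z - ((if i = j then 1 else 0) + e * tcoef j i z))"
    using frame_expansion[of j] ij unfolding eqv_def vsmall_def vsub_def by auto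
  moreover have "small 1 (\<lambda>e z. e * tcoef j i z)"
    using ij by (intro small_e small_U smooth_tcoef) auto
  ultimately have "small 1 (\<lambda>e z. ((nab ^^ j) u e i z - ((if i = j then 1 else 0) + e * tcoef j i z)) + e * tcoef j i z)"
    by (intro small_add) (auto intro: small_weaken)
  then show ?thesis by (rule small_cong) simp
qed

lemma small_frame: "i < n \<Longrightarrow> small 0 (\<lambda>e. (nab ^^ j) u e i)"
  using vsmall_nab_power[OF vsmall_u] by (simp add: vsmall_def)

lemma D0_near_1: "small 1 (\<lambda>e z. D0 e z - 1)"
proof -
  have "small 1 (\<lambda>e z. det (fmat n (\<lambda>i j. (nab ^^ j) u e i z)) - det (fmat n (\<lambda>i j. if i = j then 1 else 0)))"
    by (intro small_det_diff small_frame small_const frame_0)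
  moreover have "fmat n (\<lambda>i j. if i = j then 1 else 0) = 1\<^sub>m n"
    by (rule eq_matI) auto
  ultimately show ?thesis by (simp add: D0_def)
qed

lemma small_D0: "small 0 D0"
  unfolding D0_def by (intro small_det small_frame)

text \<open>Second derivatives cancel by the symmetry of mixed derivatives, first derivatives by the product
  rule.\<close>

lemma commutator:
  assumes w: "vsmall 0 w"
  shows "eqx (vsub (nab (cov n \<i> Q w)) (cov n \<i> Q (nab w))) (\<lambda>e i z. \<Sum>j<n. F e i j z * w e j z)"
proof (rule eqxI)
  fix e z :: complex and i :: nat
  assume d: "e \<noteq> 0" "norm e < \<delta>" "z \<in> W" and i: "i < n"
  have wd: "w e j differentiable (at z)" "wd \<i> (w e j) differentiable (at z)"
    "wd (-\<i>) (w e j) differentiable (at z)" if "j < n" for j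
    using w that small_differentiable[OF _ d] small_wd unfolding vsmall_def by blast+
  have pd: "P e i j differentiable (at z)" "Q e i j differentiable (at z)" if "j < n" for j
    using small_differentiable[OF small_P[OF i that] d] small_differentiable[OF small_Q[OF i that] d] by auto
  have comm: "wd (-\<i>) (wd \<i> (w e i)) z = wd \<i> (wd (-\<i>) (w e i)) z"
  proof -
    have "smooth_on W (w e i)"
      using w i small_smooth_on[where F = "\<lambda>e. w e i", OF _ d(1,2)] unfolding vsmall_def by blast
    then show ?thesis
      using dz_dzbar_commute[OF open_W d(3), of "w e i"] by (simp add: smooth_on_def dz_eq_wd dzbar_eq_wd)
  qed
  have expand: "wd c' (\<lambda>z. e * wd c (w e i) z + (\<Sum>j<n. R j z * w e j z)) z =
      e * wd c' (wd c (w e i)) z + (\<Sum>j<n. wd c' (R j) z * w e j z + R j z * wd c' (w e j) z)"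
    if R: "\<And>j. j < n \<Longrightarrow> R j differentiable (at z)" and c: "c = \<i> \<or> c = -\<i>" for c c' R
  proof -
    have ci: "wd c (w e i) differentiable (at z)" using wd(2,3)[OF i] c by auto
    have rw: "(\<lambda>z. R j z * w e j z) differentiable (at z)" if "j < n" for j
      by (intro differentiable_mult R wd(1) that)
    have "wd c' (\<lambda>z. \<Sum>j<n. R j z * w e j z) z = (\<Sum>j<n. wd c' (\<lambda>z. R j z * w e j z) z)"
      by (rule wd_sum) (rule rw, simp)
    also have "\<dots> = (\<Sum>j<n. wd c' (R j) z * w e j z + R j z * wd c' (w e j) z)"
      by (intro sum.cong refl) (simp add: wd_mult R wd)
    finally have s: "wd c' (\<lambda>z. \<Sum>j<n. R j z * w e j z) z =
        (\<Sum>j<n. wd c' (R j) z * w e j z + R j z * wd c' (w e j) z)" .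
    have sd: "(\<lambda>z. \<Sum>j<n. R j z * w e j z) differentiable (at z)"
      by (intro differentiable_sum ballI rw) auto
    have ed: "(\<lambda>z. e * wd c (w e i) z) differentiable (at z)"
      by (intro differentiable_mult differentiable_const ci)
    show ?thesis unfolding wd_add[OF ed sd] s wd_cmult[OF ci] ..
  qed
  have A: "nab (cov n \<i> Q w) e i z =
      e * (e * wd (-\<i>) (wd \<i> (w e i)) z + (\<Sum>j<n. wd (-\<i>) (Q e i j) z * w e j z + Q e i j z * wd (-\<i>) (w e j) z))
      + (\<Sum>k<n. P e i k z * (e * wd \<i> (w e k) z + (\<Sum>j<n. Q e k j z * w e j z)))"
    unfolding cov_def by (subst expand) (auto intro: pd)
  have B: "cov n \<i> Q (nab w) e i z =
      e * (e * wd \<i> (wd (-\<i>) (w e i)) z + (\<Sum>j<n. wd \<i> (P e i j) z * w e j z + P e i j z * wd \<i> (w e j) z))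
      + (\<Sum>k<n. Q e i k z * (e * wd (-\<i>) (w e k) z + (\<Sum>j<n. P e k j z * w e j z)))"
    unfolding cov_def by (subst expand) (auto intro: pd)
  have sw: "(\<Sum>k<n. R k * (\<Sum>j<n. R' k j * w e j z)) = (\<Sum>j<n. (\<Sum>k<n. R k * R' k j) * w e j z)" for R R'
    unfolding sum_distrib_left sum_distrib_right by (subst sum.swap) (simp add: mult.assoc)
  have A': "nab (cov n \<i> Q w) e i z = e * e * wd (-\<i>) (wd \<i> (w e i)) z
      + (\<Sum>j<n. e * wd (-\<i>) (Q e i j) z * w e j z) + (\<Sum>j<n. e * (Q e i j z * wd (-\<i>) (w e j) z))
      + (\<Sum>j<n. e * (P e i j z * wd \<i> (w e j) z)) + (\<Sum>j<n. (\<Sum>k<n. P e i k z * Q e k j z) * w e j z)"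
    unfolding A sw[symmetric] by (simp add: distrib_left sum.distrib sum_distrib_left mult_ac)
  have B': "cov n \<i> Q (nab w) e i z = e * e * wd (-\<i>) (wd \<i> (w e i)) z
      + (\<Sum>j<n. e * wd \<i> (P e i j) z * w e j z) + (\<Sum>j<n. e * (P e i j z * wd \<i> (w e j) z))
      + (\<Sum>j<n. e * (Q e i j z * wd (-\<i>) (w e j) z)) + (\<Sum>j<n. (\<Sum>k<n. Q e i k z * P e k j z) * w e j z)"
    unfolding B sw[symmetric] comm by (simp add: distrib_left sum.distrib sum_distrib_left mult_ac)
  show "vsub (nab (cov n \<i> Q w)) (cov n \<i> Q (nab w)) e i z = (\<Sum>j<n. F e i j z * w e j z)"
    unfolding vsub_def A' B' F_def dz_eq_wd dzbar_eq_wd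
    by (simp add: distrib_right left_diff_distrib sum.distrib sum_subtractf)
qed

lemma small_F: "i < n \<Longrightarrow> j < n \<Longrightarrow> small 0 (\<lambda>e. F e i j)"
  unfolding F_def dz_eq_wd dzbar_eq_wd
  by (intro small_add small_diff small_sum small_mult0 small_weaken[OF small_e le0] small_wd small_P small_Q) auto

end

section \<open>The normalised frame and its structure coefficients\<close>

lemma sum_lessThan_rev: "(\<Sum>j<n. g j) = (\<Sum>k\<in>{1..n}. g (n - k))" for g :: "nat \<Rightarrow> complex"
  by (rule sum.reindex_bij_witness[of _ "\<lambda>k. n - k" "\<lambda>j. n - j"]) auto

lemma sum_lessThan_shift: "(\<Sum>j<n. g j) = (\<Sum>l\<in>{1..n}. g (l - 1))" for g :: "nat \<Rightarrow> complex"
  by (rule sum.reindex_bij_witness[of _ "\<lambda>l. l - 1" Suc]) auto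

locale parabolic_family = connection_family U n mu A1 A2 S1 S2
  for U n mu A1 A2 S1 S2 +
  assumes parabolic: "\<And>e i j z. e \<noteq> 0 \<Longrightarrow> z \<in> U \<Longrightarrow> i < n \<Longrightarrow> j < n \<Longrightarrow> 0 < i \<or> j = 0 \<Longrightarrow> F e i j z = 0"

locale normalized_family = parabolic_family U n mu A1 A2 S1 S2 + local_family U n mu A1 A2 S1 S2 a0 \<rho> \<delta>
  for U n mu A1 A2 S1 S2 a0 \<rho> \<delta> +
  assumes D0_half: "\<And>e z. e \<noteq> 0 \<Longrightarrow> norm e < \<delta> \<Longrightarrow> z \<in> ball a0 \<rho> \<Longrightarrow> norm (D0 e z - 1) \<le> 1 / 2"
begin

text \<open>The factor that normalises the volume of the frame of iterated derivatives.\<close>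

definition f :: "complex \<Rightarrow> complex \<Rightarrow> complex" where
  "f e z = exp (- Ln (D0 e z) / of_nat n)"

lemma small_f: "small 0 f"
  unfolding f_def using n2 by (intro small_root small_D0 D0_half) auto

lemma f_power: "e \<noteq> 0 \<Longrightarrow> norm e < \<delta> \<Longrightarrow> z \<in> W \<Longrightarrow> f e z ^ n * D0 e z = 1"
proof -
  assume d: "e \<noteq> 0" "norm e < \<delta>" "z \<in> W"
  have nz: "D0 e z \<noteq> 0" using D0_half[OF d] by auto
  have "f e z ^ n = exp (of_nat n * (- Ln (D0 e z) / of_nat n))"
    by (simp add: f_def flip: exp_of_nat_mult)
  also have "of_nat n * (- Ln (D0 e z) / of_nat n) = - Ln (D0 e z)" using n2 by simp
  finally show ?thesis using nz by (simp add: exp_minus)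
qed

lemma f_power_mult: "e \<noteq> 0 \<Longrightarrow> norm e < \<delta> \<Longrightarrow> z \<in> W \<Longrightarrow> f e z * (f e z ^ (n - 1) * D0 e z) = 1"
  using f_power n2 by (cases n) (simp_all add: mult.assoc)

text \<open>Differentiate \<open>f\<^sup>n D0 = 1\<close>; the derivative of \<open>D0\<close> is small because \<open>D0\<close> is close to the constant
  1.\<close>

lemma small_wd_f:
  assumes c: "c = \<i> \<or> c = - \<i>" shows "small 1 (\<lambda>e. wd c (f e))"
proof -
  have "small 1 (\<lambda>e. wd c (\<lambda>z. D0 e z - 1))" by (rule small_wd[OF D0_near_1 c])
  then have "small 1 (\<lambda>e z. - (1 / of_nat n) * (f e z ^ (n + 1) * wd c (\<lambda>z. D0 e z - 1) z))"
    by (intro small_cmult small_mult0 small_power small_f)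
  then show ?thesis
  proof (rule small_cong)
    fix e z :: complex assume d: "e \<noteq> 0" "norm e < \<delta>" "z \<in> W"
    have df: "f e differentiable (at z)" and dD: "D0 e differentiable (at z)"
      using small_differentiable[OF small_f d] small_differentiable[OF small_D0 d] .
    have "0 = wd c (\<lambda>z. f e z ^ n * D0 e z) z"
      by (subst wd_cong[OF open_W d(3) f_power[OF d(1,2)]]) auto
    also have "\<dots> = of_nat n * f e z ^ (n - 1) * wd c (f e) z * D0 e z + f e z ^ n * wd c (D0 e) z"
      using wd_mult[OF differentiable_power[OF df] dD] by (simp add: wd_power[OF df])
    finally have "0 = f e z * (of_nat n * f e z ^ (n - 1) * wd c (f e) z * D0 e z + f e z ^ n * wd c (D0 e) z)"
      by simp
    also have "\<dots> = of_nat n * wd c (f e) z * (f e z * (f e z ^ (n - 1) * D0 e z)) + f e z ^ (n + 1) * wd c (D0 e) z"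
      by (simp add: algebra_simps)
    finally have "of_nat n * wd c (f e) z = - (f e z ^ (n + 1) * wd c (D0 e) z)"
      unfolding f_power_mult[OF d] by (simp add: eq_neg_iff_add_eq_0)
    moreover have "wd c (\<lambda>z. D0 e z - 1) z = wd c (D0 e) z"
      using wd_diff[OF dD differentiable_const[of 1]] by simp
    ultimately show "- (1 / of_nat n) * (f e z ^ (n + 1) * wd c (\<lambda>z. D0 e z - 1) z) = wd c (f e) z"
      using n2 by (simp add: field_simps)
  qed
qed

definition s :: family where "s = scl f u"

definition fr :: "nat \<Rightarrow> family" where "fr k = (nab ^^ k) s"

lemma vsmall_s: "vsmall 0 s"
  unfolding s_def by (intro vsmall_scl0 small_f vsmall_u)

lemma vsmall_fr: "vsmall 0 (fr k)"
  unfolding fr_def by (rule vsmall_nab_power[OF vsmall_s])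

lemma small_fr: "i < n \<Longrightarrow> small 0 (\<lambda>e. fr k e i)"
  using vsmall_fr by (simp add: vsmall_def)

lemma frame_operator_P: "e \<noteq> 0 \<Longrightarrow> norm e < \<delta> \<Longrightarrow> frame_operator W n (- \<i>) (P e)"
  by unfold_locales (auto intro: small_smooth_on small_P)

lemma fr_eq: "fr k e = (covd n e (- \<i>) (P e) ^^ k) (s e)"
  by (simp add: fr_def cov_power_eq_covd)

lemma smooth_s: "e \<noteq> 0 \<Longrightarrow> norm e < \<delta> \<Longrightarrow> i < n \<Longrightarrow> smooth_on W (s e i)"
  using vsmall_s small_smooth_on[where F = "\<lambda>e. s e i"] unfolding vsmall_def by blast

lemma det_fr:
  assumes d: "e \<noteq> 0" "norm e < \<delta>" "z \<in> W"
  shows "det (fmat n (\<lambda>i j. fr j e i z)) = 1"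
proof -
  interpret fo: frame_operator W n e "- \<i>" "P e" by (rule frame_operator_P[OF d(1,2)])
  have "s e = (\<lambda>i z. f e z * u e i z)" by (simp add: s_def scl_def)
  then have "det (fmat n (\<lambda>i j. fr j e i z)) =
      f e z ^ n * det (fmat n (\<lambda>i j. (covd n e (- \<i>) (P e) ^^ j) (u e) i z))"
    unfolding fr_eq using fo.det_frame_scaled[OF small_smooth_on[OF small_f d(1,2)] _ d(3), of "u e"]
    by (simp add: u_def)
  also have "\<dots> = f e z ^ n * D0 e z" by (simp add: D0_def cov_power_eq_covd)
  finally show ?thesis using f_power[OF d] by simp
qed

definition Y :: "complex \<Rightarrow> nat \<Rightarrow> nat \<Rightarrow> complex \<Rightarrow> complex" where
  "Y e j i z = adj_mat (fmat n (\<lambda>i j. fr j e i z)) $$ (j, i)"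

lemma small_Y: "i < n \<Longrightarrow> j < n \<Longrightarrow> small 0 (\<lambda>e. Y e j i)"
  unfolding Y_def by (intro small_adj small_fr)

context
  fixes e z :: complex
  assumes d: "e \<noteq> 0" "norm e < \<delta>" "z \<in> W"
begin

lemma Y_fr: "i < n \<Longrightarrow> j < n \<Longrightarrow> (\<Sum>k<n. Y e j k z * fr i e k z) = (if i = j then 1 else 0)"
proof -
  assume ij: "i < n" "j < n"
  let ?V = "fmat n (\<lambda>i j. fr j e i z)"
  have adj: "adj_mat ?V \<in> carrier_mat n n" "adj_mat ?V * ?V = 1\<^sub>m n"
    using adj_mat[of ?V n] det_fr[OF d] by auto
  show ?thesis using arg_cong[OF adj(2), of "\<lambda>M. M $$ (j, i)"] ij adj(1)
    by (simp add: scalar_prod_def atLeast0LessThan Y_def)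
qed

lemma fr_Y: "i < n \<Longrightarrow> k < n \<Longrightarrow> (\<Sum>j<n. fr j e i z * Y e j k z) = (if i = k then 1 else 0)"
proof -
  assume ij: "i < n" "k < n"
  let ?V = "fmat n (\<lambda>i j. fr j e i z)"
  have adj: "adj_mat ?V \<in> carrier_mat n n" "?V * adj_mat ?V = 1\<^sub>m n"
    using adj_mat[of ?V n] det_fr[OF d] by auto
  show ?thesis using arg_cong[OF adj(2), of "\<lambda>M. M $$ (i, k)"] ij adj(1)
    by (simp add: scalar_prod_def atLeast0LessThan Y_def)
qed

end

definition coef :: "nat \<Rightarrow> family \<Rightarrow> complex \<Rightarrow> complex \<Rightarrow> complex" where
  "coef j w = (\<lambda>e z. \<Sum>i<n. Y e j i z * w e i z)"

lemma small_coef: "j < n \<Longrightarrow> vsmall N w \<Longrightarrow> small N (coef j w)"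
  unfolding coef_def vsmall_def by (intro small_sum small_mult0 small_Y) auto

text \<open>The adjugate of a matrix with determinant 1 is its inverse from both sides.\<close>

lemma coef_expand:
  assumes d: "e \<noteq> 0" "norm e < \<delta>" "z \<in> W" and i: "i < n"
  shows "w e i z = (\<Sum>j<n. coef j w e z * fr j e i z)"
proof -
  have "(\<Sum>j<n. coef j w e z * fr j e i z) = (\<Sum>k<n. (\<Sum>j<n. fr j e i z * Y e j k z) * w e k z)"
    unfolding coef_def sum_distrib_right by (subst sum.swap) (simp add: mult_ac)
  also have "\<dots> = (\<Sum>k<n. if k = i then w e i z else 0)"
    using i by (intro sum.cong refl) (auto simp: fr_Y[OF d])
  also have "\<dots> = w e i z" using i by simp
  finally show ?thesis by simp
qed

lemma coef_combination:
  assumes d: "e \<noteq> 0" "norm e < \<delta>" "z \<in> W" and j: "j < n"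
  shows "coef j (vsum {..<n} (\<lambda>k. scl (b k) (fr k))) e z = b j e z"
proof -
  have "coef j (vsum {..<n} (\<lambda>k. scl (b k) (fr k))) e z = (\<Sum>k<n. b k e z * (\<Sum>i<n. Y e j i z * fr k e i z))"
    unfolding coef_def vdefs sum_distrib_left by (subst sum.swap) (simp add: mult_ac)
  also have "\<dots> = (\<Sum>k<n. if k = j then b j e z else 0)"
    using j by (intro sum.cong refl) (auto simp: Y_fr[OF d])
  also have "\<dots> = b j e z" using j by simp
  finally show ?thesis .
qed

lemma coef_estimate:
  assumes "eqv N w (vsum {..<n} (\<lambda>k. scl (b k) (fr k)))" "j < n"
  shows "small N (\<lambda>e z. coef j w e z - b j e z)"
proof (rule small_cong)
  show "small N (coef j (vsub w (vsum {..<n} (\<lambda>k. scl (b k) (fr k)))))"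
    using assms by (intro small_coef) (simp_all add: eqv_def)
  fix e z :: complex assume d: "e \<noteq> 0" "norm e < \<delta>" "z \<in> W"
  show "coef j (vsub w (vsum {..<n} (\<lambda>k. scl (b k) (fr k)))) e z = coef j w e z - b j e z"
    unfolding coef_combination[OF d assms(2), of b, symmetric]
    by (simp add: coef_def vsub_def right_diff_distrib sum_subtractf)
qed

text \<open>By parabolicity the curvature maps every vector to a multiple of the first frame vector, and
  \<open>f\<^sup>n\<^sup>-\<^sup>1 D0\<close> is the inverse of \<open>f\<close>; this explains the formula for \<open>X\<close>.\<close>

definition T :: "nat \<Rightarrow> complex \<Rightarrow> complex \<Rightarrow> complex" where "T k = coef (n - k) (fr n)"
definition M :: "nat \<Rightarrow> complex \<Rightarrow> complex \<Rightarrow> complex" where "M l = coef (l - 1) (cov n \<i> Q s)"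
definition X :: "nat \<Rightarrow> complex \<Rightarrow> complex \<Rightarrow> complex" where
  "X k = (\<lambda>e z. f e z ^ (n - 1) * D0 e z * (\<Sum>j<n. F e 0 j z * fr (k - 1) e j z))"

lemma fr_f: "eqv 2 (fr j) (scl f ((nab ^^ j) u))"
proof -
  have "small (1 + 1) (\<lambda>e z. e * wd (-\<i>) (f e) z)"
    by (intro small_mult small_param1 small_wd_f) simp
  then have "small 2 (\<lambda>e z. of_nat j * D f e z)"
    unfolding eder_def by (intro small_cmult) (simp add: numeral_2_eq_2)
  from vsmall_scl[OF this vsmall_nab_power[OF vsmall_u, of "j - 1"]]
  have "vsmall 2 (scl (\<lambda>e z. of_nat j * D f e z) ((nab ^^ (j - 1)) u))" by (simp only: add_0_right)
  note eqv_drop[OF this, of "scl f ((nab ^^ j) u)"]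
  moreover note nab_power_scl_1[OF small_f vsmall_u, of j, unfolded add_0]
  ultimately show ?thesis unfolding fr_def s_def by (rule eqv_trans[rotated])
qed

lemma fr_delta: "j < n \<Longrightarrow> eqv 1 (fr j) (\<lambda>e i z. f e z * (if i = j then 1 else 0))"
proof -
  assume j: "j < n"
  have "eqv 1 ((nab ^^ j) u) (\<lambda>e i z. if i = j then 1 else 0)"
    using frame_0[OF j] by (simp add: eqv_def vsmall_def vsub_def)
  from eqv_scl[OF small_f this, of 1]
  have "eqv 1 (scl f ((nab ^^ j) u)) (\<lambda>e i z. f e z * (if i = j then 1 else 0))"
    by (simp add: scl_def)
  with eqv_weaken[OF fr_f, of 1 j] show ?thesis using eqv_trans by (simp add: numeral_2_eq_2)
qed

lemma fr_combination:
  assumes b: "\<And>j. j < n \<Longrightarrow> small r (b j)"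
  shows "eqv (r + 1) (\<lambda>e i z. f e z * b i e z) (vsum {..<n} (\<lambda>j. scl (b j) (fr j)))"
proof -
  have "eqx (\<lambda>e i z. f e z * b i e z) (vsum {..<n} (\<lambda>j. scl (b j) (\<lambda>e i z. f e z * (if i = j then 1 else 0))))"
  proof (rule eqxI)
    fix e z :: complex and i :: nat assume i: "i < n"
    have "(\<Sum>j<n. b j e z * (f e z * (if i = j then 1 else 0))) = (\<Sum>j<n. if j = i then f e z * b i e z else 0)"
      by (intro sum.cong) auto
    then show "f e z * b i e z = vsum {..<n} (\<lambda>j. scl (b j) (\<lambda>e i z. f e z * (if i = j then 1 else 0))) e i z"
      using i by (simp add: vsum_def scl_def)
  qed
  also have "eqv (r + 1) \<dots> (vsum {..<n} (\<lambda>j. scl (b j) (fr j)))"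
    by (rule eqv_vsum) (rule eqv_scl[OF b eqv_sym[OF fr_delta]], auto)
  finally show ?thesis .
qed

text \<open>To first order \<open>fr j\<close> is \<open>f\<close> times the \<open>j\<close>-th standard vector, and the section \<open>fr n\<close> is already of
  order 1. Hence its coordinates in both frames agree to first order.\<close>

lemma fr_n: "eqv 2 (fr n) (vsum {..<n} (\<lambda>j. scl (\<lambda>e z. e * tcoef n j z) (fr j)))"
proof -
  have "eqv 2 (fr n) (scl f ((nab ^^ n) u))" by (rule fr_f)
  also have "eqv 2 \<dots> (scl f (\<lambda>e i z. (if i = n then 1 else 0) + e * tcoef n i z))"
    by (rule eqv_scl[OF small_f frame_expansion]) simp_all
  also have "eqx \<dots> (\<lambda>e i z. f e z * (e * tcoef n i z))"
    by (rule eqxI) (simp add: scl_def)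
  also have "eqv 2 \<dots> (vsum {..<n} (\<lambda>j. scl (\<lambda>e z. e * tcoef n j z) (fr j)))"
    using fr_combination[of 1 "\<lambda>j e z. e * tcoef n j z"]
    by (simp add: numeral_2_eq_2 small_e[unfolded One_nat_def] small_U smooth_tcoef)
  finally show ?thesis .
qed

lemma T_estimate: "k \<in> {1..n} \<Longrightarrow> small 2 (\<lambda>e z. T k e z - e * t k z)"
  unfolding T_def t_def by (rule coef_estimate[OF fr_n]) auto

lemma small_t: "k \<in> {1..n} \<Longrightarrow> small 0 (\<lambda>e. t k)"
  unfolding t_def by (intro small_U smooth_tcoef) auto

lemma small_T: "k \<in> {1..n} \<Longrightarrow> small 1 (T k)"
proof -
  assume k: "k \<in> {1..n}"
  have "small 1 (\<lambda>e z. (T k e z - e * t k z) + e * t k z)"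
    by (intro small_add small_weaken[OF T_estimate[OF k]] small_e small_t k) simp
  then show ?thesis by simp
qed

lemma T_1: "e \<noteq> 0 \<Longrightarrow> norm e < \<delta> \<Longrightarrow> z \<in> W \<Longrightarrow> T 1 e z = 0"
proof -
  assume d: "e \<noteq> 0" "norm e < \<delta>" "z \<in> W"
  interpret fo: frame_operator W n e "- \<i>" "P e" by (rule frame_operator_P[OF d(1,2)])
  show ?thesis
    unfolding T_def coef_def Y_def fr_eq
    by (rule fo.last_coordinate_zero[OF _ smooth_s[OF d(1,2)] _ trace_P[OF W_U[OF d(3)]] d(3)])
      (use n2 det_fr[OF d(1,2)] in \<open>simp_all add: fr_eq\<close>)
qed

text \<open>For \<open>e = 0\<close> the vector \<open>nbr s\<close> is \<open>f\<close> times the first column of \<open>\<Phi>\<^sub>2\<close>, which contains the Beltrami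
  differentials.\<close>

lemma M_estimate: "l \<in> {1..n} \<Longrightarrow> small 1 (\<lambda>e z. M l e z - (if 2 \<le> l then mu l z else 0))"
proof -
  assume l: "l \<in> {1..n}"
  let ?b = "\<lambda>j (e::complex) z. if 0 < j then mu (Suc j) z else 0"
  have b: "small 0 (?b j)" if "j < n" for j
  proof (cases "0 < j")
    case True
    then have "Suc j \<in> {2..n}" using that by auto
    from small_U[OF mu[OF this]] True show ?thesis by simp
  qed (simp add: small_zero)
  have "eqv 1 (cov n \<i> Q s) (\<lambda>e i z. f e z * ?b i e z)"
    unfolding eqv_def vsmall_def
  proof (intro allI impI)
    fix i assume i: "i < n"
    have "small 1 (\<lambda>e z. e * wd \<i> (s e i) z + f e z * (Q e i 0 z - (if 0 < i then mu (Suc i - 0) z else 0)))"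
      using i n2 vsmall_s unfolding vsmall_def
      by (intro small_add small_e small_wd small_mult0 small_f small_Q0) auto
    then show "small 1 (\<lambda>e. vsub (cov n \<i> Q s) (\<lambda>e i z. f e z * ?b i e z) e i)"
    proof (rule small_cong)
      fix e z :: complex
      have "(\<Sum>j<n. Q e i j z * s e j z) = (\<Sum>j<n. if j = 0 then Q e i 0 z * f e z else 0)"
        by (intro sum.cong) (auto simp: s_def scl_def u_def)
      also have "\<dots> = Q e i 0 z * f e z" using n2 by simp
      finally show "e * wd \<i> (s e i) z + f e z * (Q e i 0 z - (if 0 < i then mu (Suc i - 0) z else 0))
          = vsub (cov n \<i> Q s) (\<lambda>e i z. f e z * ?b i e z) e i z"
        by (simp add: vsub_def cov_def algebra_simps)
    qed
  qed
  also have "eqv 1 (\<lambda>e i z. f e z * ?b i e z) (vsum {..<n} (\<lambda>j. scl (?b j) (fr j)))"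
    using fr_combination[of 0 ?b] b by simp
  finally have "small 1 (\<lambda>e z. coef (l - 1) (cov n \<i> Q s) e z - ?b (l - 1) e z)"
    using l by (intro coef_estimate) auto
  moreover have "?b (l - 1) e z = (if 2 \<le> l then mu l z else 0)" for e z
    using l by auto
  ultimately show ?thesis by (simp add: M_def)
qed

lemma vsmall_nbr_s: "vsmall 0 (cov n \<i> Q s)"
  by (rule bar.vsmall_nab[OF vsmall_s])

lemma small_X: "small 0 (X k)"
  unfolding X_def using n2
  by (intro small_mult0 small_power small_f small_D0 small_sum small_F small_fr) auto

lemma curvature_X:
  "k \<ge> 1 \<Longrightarrow> eqx (vsub (nab (cov n \<i> Q (fr (k - 1)))) (cov n \<i> Q (fr k))) (scl (X k) s)"
proof -
  assume k: "k \<ge> 1"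
  have "nab (fr (k - 1)) = fr k" using k by (cases k) (simp_all add: fr_def)
  then have "eqx (vsub (nab (cov n \<i> Q (fr (k - 1)))) (cov n \<i> Q (fr k)))
      (\<lambda>e i z. \<Sum>j<n. F e i j z * fr (k - 1) e j z)"
    using commutator[OF vsmall_fr, of "k - 1"] by simp
  also have "eqx \<dots> (scl (X k) s)"
  proof (rule eqxI)
    fix e z :: complex and i :: nat
    assume d: "e \<noteq> 0" "norm e < \<delta>" "z \<in> W" and i: "i < n"
    let ?S = "\<Sum>j<n. F e i j z * fr (k - 1) e j z"
    show "?S = scl (X k) s e i z"
    proof (cases "i = 0")
      case True
      have "scl (X k) s e i z = (f e z * (f e z ^ (n - 1) * D0 e z)) * ?S"
        by (simp add: True scl_def s_def u_def X_def mult_ac)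
      then show ?thesis unfolding f_power_mult[OF d] by simp
    next
      case False
      then have "?S = 0"
        using parabolic[OF d(1) W_U[OF d(3)] i] by (intro sum.neutral) auto
      with False show ?thesis by (simp add: scl_def s_def u_def)
    qed
  qed
  finally show ?thesis .
qed

lemma fr_n_T: "eqx (fr n) (vsum {2..n} (\<lambda>k. scl (T k) (fr (n - k))))"
proof (rule eqxI)
  fix e z :: complex and i :: nat
  assume d: "e \<noteq> 0" "norm e < \<delta>" "z \<in> W" and i: "i < n"
  have "fr n e i z = (\<Sum>k\<in>{1..n}. T k e z * fr (n - k) e i z)"
    unfolding T_def using coef_expand[OF d i, of "fr n"] by (simp only: sum_lessThan_rev)
  also have "\<dots> = (\<Sum>k\<in>{2..n}. T k e z * fr (n - k) e i z)"
    using n2 T_1[OF d] by (subst sum.atLeast_Suc_atMost) (simp_all add: numeral_2_eq_2)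
  finally show "fr n e i z = vsum {2..n} (\<lambda>k. scl (T k) (fr (n - k))) e i z"
    by (simp add: vsum_def scl_def)
qed

lemma nbr_s_M: "eqx (cov n \<i> Q s) (vsum {1..n} (\<lambda>l. scl (M l) (fr (l - 1))))"
proof (rule eqxI)
  fix e z :: complex and i :: nat
  assume d: "e \<noteq> 0" "norm e < \<delta>" "z \<in> W" and i: "i < n"
  show "cov n \<i> Q s e i z = vsum {1..n} (\<lambda>l. scl (M l) (fr (l - 1))) e i z"
    unfolding M_def vsum_def scl_def
    using coef_expand[OF d i, of "cov n \<i> Q s"] by (simp only: sum_lessThan_shift)
qed

end

sublocale normalized_family \<subseteq> pf: parabolic_frame "ball a0 \<rho>" \<delta> n P Q s T M X Y
proof (unfold_locales, goal_cases)
  case 1 show ?case by (rule n2)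
next
  case (2 i j) then show ?case by (rule small_Q)
next
  case 3 show ?case by (rule vsmall_s)
next
  case (4 k) then show ?case by (intro small_T) auto
next
  case (5 l) then show ?case unfolding M_def by (intro small_coef vsmall_nbr_s) auto
next
  case 6 show ?case using M_estimate[of 1] n2 by simp
next
  case (7 k) show ?case by (rule small_X)
next
  case (8 i j) then show ?case using small_Y[of j i] by simp
next
  case 9 show ?case using fr_n_T by (simp add: fr_def)
next
  case 10 show ?case using nbr_s_M by (simp add: fr_def)
next
  case (11 k) then show ?case using curvature_X[of k] by (simp add: fr_def)
next
  case (12 e z i j) then show ?case using Y_fr[of e z i j] by (simp add: fr_def)
qed

context normalized_family
begin

lemma small_eder_diff:
  assumes c: "c = \<i> \<or> c = - \<i>" and H: "small 0 H" and h: "small 0 (\<lambda>e. h)"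
    and est: "small N (\<lambda>e z. H e z - e ^ k * h z)"
  shows "small (Suc N) (\<lambda>e z. eder c H e z - e ^ Suc k * wd c h z)"
proof (rule small_cong[OF small_eder[OF est c]])
  fix e z :: complex assume d: "e \<noteq> 0" "norm e < \<delta>" "z \<in> W"
  have hd: "h differentiable (at z)" by (rule small_differentiable[OF h d])
  have "wd c (\<lambda>z. H e z - e ^ k * h z) z = wd c (H e) z - wd c (\<lambda>z. e ^ k * h z) z"
    by (rule wd_diff[OF small_differentiable[OF H d]]) (intro differentiable_mult differentiable_const hd)
  then have eq: "wd c (\<lambda>z. H e z - e ^ k * h z) z = wd c (H e) z - e ^ k * wd c h z"
    by (simp only: wd_cmult[OF hd])
  show "eder c (\<lambda>e z. H e z - e ^ k * h z) e z = eder c H e z - e ^ Suc k * wd c h z"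
    unfolding eder_def eq by (simp add: algebra_simps)
qed

lemma small_product_diff:
  assumes "small p (\<lambda>e z. H e z - H' e z)" "small q G" "small p' H'" "small q' (\<lambda>e z. G e z - G' e z)"
    and "N \<le> p + q" "N \<le> p' + q'"
  shows "small N (\<lambda>e z. H e z * G e z - H' e z * G' e z)"
proof -
  have "small N (\<lambda>e z. (H e z - H' e z) * G e z + H' e z * (G e z - G' e z))"
    by (intro small_add small_weaken[OF small_mult[OF assms(1,2)] assms(5)]
        small_weaken[OF small_mult[OF assms(3,4)] assms(6)])
  then show ?thesis by (simp add: algebra_simps)
qed

text \<open>It remains to insert the leading terms of \<open>T\<close> and \<open>M\<close>, in each product up to the order that the
  other factor leaves open.\<close>

lemma X_zeta:
  assumes m: "m \<in> {2..n}"
  shows "small 3 (\<lambda>e z. X m e z - e ^ 2 * zeta n mu t m z)"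
proof -
  have T0: "small 0 (T k)" if "k \<in> {2..n}" for k
    by (rule pf.T0[OF that])
  have dT: "small 3 (\<lambda>e z. eder c (T k) e z - e ^ 2 * wd c (t k) z)"
    if "k \<in> {2..n}" "c = \<i> \<or> c = - \<i>" for k c
    using small_eder_diff[OF that(2) T0[OF that(1)] small_t, of k 2 1] T_estimate[of k] that
    by (simp add: numeral_3_eq_3 numeral_2_eq_2)
  have mu0: "small 0 (\<lambda>e. mu l)" if "l \<in> {2..n}" for l by (rule small_U[OF mu[OF that]])
  have M0: "small 0 (M l)" if "l \<in> {2..n}" for l using pf.M[of l] that by simp
  have Mm: "small 1 (\<lambda>e z. M l e z - mu l z)" if "l \<in> {2..n}" for l
    using M_estimate[of l] that by simp
  have dM: "small 2 (\<lambda>e z. eder (-\<i>) (M l) e z - e * wd (-\<i>) (mu l) z)" if "l \<in> {2..n}" for l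
    using small_eder_diff[OF _ M0[OF that] mu0[OF that], of "-\<i>" 1 0] Mm[OF that]
    by (simp add: numeral_2_eq_2)
  let ?g = "\<lambda>k l z. of_nat (l - 1) * (mu l z * wd (-\<i>) (t k) z) + of_nat k * (t k z * wd (-\<i>) (mu l) z)"
  have G: "small 3 (\<lambda>e z. pf.G k l e z - e ^ 2 * ?g k l z)" if k: "k \<in> {2..n}" and l: "l \<in> {2..n}" for k l
  proof -
    have 1: "small 3 (\<lambda>e z. M l e z * eder (-\<i>) (T k) e z - mu l z * (e ^ 2 * wd (-\<i>) (t k) z))"
      by (rule small_product_diff[OF Mm[OF l] pf.small_DT[OF k] mu0[OF l] dT[OF k]]) auto
    have 2: "small 3 (\<lambda>e z. T k e z * eder (-\<i>) (M l) e z - e * t k z * (e * wd (-\<i>) (mu l) z))"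
      by (rule small_product_diff[OF T_estimate pf.small_DM small_e[OF small_t] dM[OF l]]) (use k l in auto)
    have "small 3 (\<lambda>e z. of_nat (l - 1) * (M l e z * eder (-\<i>) (T k) e z - mu l z * (e ^ 2 * wd (-\<i>) (t k) z))
      + of_nat k * (T k e z * eder (-\<i>) (M l) e z - e * t k z * (e * wd (-\<i>) (mu l) z)))"
      by (intro small_add small_cmult 1 2)
    then show ?thesis by (rule small_cong) (simp add: pf.G_def algebra_simps power2_eq_square)
  qed
  have 1: "small 3 (\<lambda>e z. (X m e z - ((\<Sum>j=0..n-m. pf.G (m + j) (j + 2) e z) - eder \<i> (T m) e z)) +
      (\<Sum>j=0..n-m. pf.G (m + j) (j + 2) e z - e ^ 2 * ?g (m + j) (j + 2) z) -
      (eder \<i> (T m) e z - e ^ 2 * wd \<i> (t m) z))"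
    by (intro small_add small_diff small_sum pf.X_expansion G dT m) (use m in auto)
  have z: "zeta n mu t m z = (\<Sum>j=0..n-m. ?g (m + j) (j + 2) z) - wd \<i> (t m) z" for z
    by (subst sum.atLeast_Suc_atMost)
      (simp_all add: zeta_def dz_eq_wd dzbar_eq_wd algebra_simps numeral_2_eq_2)
  show ?thesis
    by (rule small_cong[OF 1]) (simp add: z sum_subtractf sum_distrib_left right_diff_distrib)
qed

end

text \<open>The bound on \<open>D0 - 1\<close> for \<open>\<delta> = 1\<close> shows how small \<open>\<delta>\<close> has to be taken for \<open>D0\<close> to have a root.\<close>

lemma (in parabolic_family) exists_normalized_family:
  assumes a0: "a0 \<in> U"
  obtains \<rho> \<delta> where "\<rho> > 0" "\<delta> > 0" "normalized_family U n mu A1 A2 S1 S2 a0 \<rho> \<delta>"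
proof -
  obtain \<rho> where \<rho>: "\<rho> > 0" "cball a0 \<rho> \<subseteq> U"
    using open_U a0 by (meson open_contains_cball)
  interpret l: local_family U n mu A1 A2 S1 S2 a0 \<rho> 1
    by unfold_locales (rule \<rho>)
  obtain K where K: "\<And>e z. e \<noteq> 0 \<Longrightarrow> norm e < 1 \<Longrightarrow> z \<in> ball a0 \<rho> \<Longrightarrow> norm (l.D0 e z - 1) \<le> K * norm e ^ 1"
    by (rule l.small_bound[OF l.D0_near_1]) (rule that)
  define \<delta> where "\<delta> = min 1 (1 / (2 * (\<bar>K\<bar> + 1)))"
  have \<delta>: "\<delta> > 0" by (simp add: \<delta>_def)
  have "normalized_family U n mu A1 A2 S1 S2 a0 \<rho> \<delta>"
  proof (unfold_locales)
    fix e z :: complex assume d: "e \<noteq> 0" "norm e < \<delta>" "z \<in> ball a0 \<rho>"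
    have \<delta>': "\<delta> \<le> 1" "\<delta> \<le> 1 / (2 * (\<bar>K\<bar> + 1))"
      unfolding \<delta>_def by (rule min.cobounded1, rule min.cobounded2)
    have "norm (l.D0 e z - 1) \<le> K * norm e" using K[OF d(1) _ d(3)] d(2) \<delta>'(1) by simp
    also have "\<dots> \<le> (\<bar>K\<bar> + 1) * norm e" by (intro mult_right_mono) auto
    also have "\<dots> \<le> (\<bar>K\<bar> + 1) * (1 / (2 * (\<bar>K\<bar> + 1)))"
      using d(2) \<delta>'(2) by (intro mult_left_mono) auto
    also have "\<dots> = 1 / 2" by (simp add: field_simps)
    finally show "norm (l.D0 e z - 1) \<le> 1 / 2" .
  qed
  from that[OF \<rho>(1) \<delta> this] show thesis .
qed

section \<open>Parameters of a connection from one unit-volume section\<close>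

definition smooth_form :: "nat \<Rightarrow> complex set \<Rightarrow> mat_form \<Rightarrow> bool" where
  "smooth_form n U B \<longleftrightarrow> smooth_mat_on n U (fst B) \<and> smooth_mat_on n U (snd B)"

lemma smooth_formD:
  assumes "smooth_form n U B"
  shows "z \<in> U \<Longrightarrow> fst B z \<in> carrier_mat n n" "z \<in> U \<Longrightarrow> snd B z \<in> carrier_mat n n"
    and "i < n \<Longrightarrow> j < n \<Longrightarrow> smooth_on U (\<lambda>z. fst B z $$ (i, j))"
    and "i < n \<Longrightarrow> j < n \<Longrightarrow> smooth_on U (\<lambda>z. snd B z $$ (i, j))"
  using assms unfolding smooth_form_def smooth_mat_on_def by blast+

lemma nabla_entry:
  assumes "fst B z \<in> carrier_mat n n" "\<sigma> z \<in> carrier_vec n" "i < n"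
  shows "nabla n B \<sigma> z $ i = dz (\<lambda>w. \<sigma> w $ i) z + (\<Sum>j<n. fst B z $$ (i, j) * \<sigma> z $ j)"
  using assms by (auto simp: nabla_def scalar_prod_def atLeast0LessThan)

lemma nabla_bar_entry:
  assumes "snd B z \<in> carrier_mat n n" "\<sigma> z \<in> carrier_vec n" "i < n"
  shows "nabla_bar n B \<sigma> z $ i = dzbar (\<lambda>w. \<sigma> w $ i) z + (\<Sum>j<n. snd B z $$ (i, j) * \<sigma> z $ j)"
  using assms by (auto simp: nabla_bar_def scalar_prod_def atLeast0LessThan)

lemma nabla_carrier: "fst B z \<in> carrier_mat n n \<Longrightarrow> nabla n B \<sigma> z \<in> carrier_vec n"
  by (rule carrier_vecI) (simp add: nabla_def)

lemma nabla_bar_carrier: "snd B z \<in> carrier_mat n n \<Longrightarrow> nabla_bar n B \<sigma> z \<in> carrier_vec n"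
  by (rule carrier_vecI) (simp add: nabla_bar_def)

definition local_section :: "nat \<Rightarrow> complex set \<Rightarrow> (complex \<Rightarrow> complex vec) \<Rightarrow> bool" where
  "local_section n Z \<sigma> \<longleftrightarrow> (\<forall>z\<in>Z. \<sigma> z \<in> carrier_vec n) \<and> (\<forall>i<n. smooth_on Z (\<lambda>z. \<sigma> z $ i))"

text \<open>Used for factors \<open>h\<close> with vanishing derivative, for which proportionality is inherited by covariant
  derivatives.\<close>

definition proportional ::
  "nat \<Rightarrow> complex set \<Rightarrow> (complex \<Rightarrow> complex) \<Rightarrow> (complex \<Rightarrow> complex vec) \<Rightarrow> (complex \<Rightarrow> complex vec) \<Rightarrow> bool" where
  "proportional n Z h \<sigma> \<sigma>' \<longleftrightarrow> (\<forall>z\<in>Z. \<forall>i<n. \<sigma> z $ i = h z * \<sigma>' z $ i)"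

context
  fixes n :: nat and Z U :: "complex set" and B :: mat_form
  assumes Z: "open Z" "Z \<subseteq> U" and B: "smooth_form n U B"
begin

lemma local_section_nabla:
  assumes "local_section n Z \<sigma>"
  shows "local_section n Z (nabla n B \<sigma>)" "local_section n Z (nabla_bar n B \<sigma>)"
proof -
  note s = assms[unfolded local_section_def]
  have 1: "smooth_on Z (\<lambda>z. dz (\<lambda>w. \<sigma> w $ i) z + (\<Sum>j<n. fst B z $$ (i, j) * \<sigma> z $ j))"
    and 2: "smooth_on Z (\<lambda>z. dzbar (\<lambda>w. \<sigma> w $ i) z + (\<Sum>j<n. snd B z $$ (i, j) * \<sigma> z $ j))" if "i < n" for i
    using s that smooth_formD(3,4)[OF B]
    by (auto intro!: smooth_on_add smooth_on_sum smooth_on_mult smooth_on_dz smooth_on_dzbar Z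
        intro: smooth_on_subset[OF _ Z(2)])
  show "local_section n Z (nabla n B \<sigma>)" unfolding local_section_def
  proof (intro conjI ballI allI impI)
    fix i assume i: "i < n"
    show "smooth_on Z (\<lambda>z. nabla n B \<sigma> z $ i)"
      by (rule smooth_on_cong[OF Z(1) 1[OF i]])
        (use nabla_entry[OF smooth_formD(1)[OF B] _ i] s Z(2) in auto)
  qed (use Z(2) in \<open>auto intro: nabla_carrier smooth_formD(1)[OF B]\<close>)
  show "local_section n Z (nabla_bar n B \<sigma>)" unfolding local_section_def
  proof (intro conjI ballI allI impI)
    fix i assume i: "i < n"
    show "smooth_on Z (\<lambda>z. nabla_bar n B \<sigma> z $ i)"
      by (rule smooth_on_cong[OF Z(1) 2[OF i]])
        (use nabla_bar_entry[OF smooth_formD(2)[OF B] _ i] s Z(2) in auto)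
  qed (use Z(2) in \<open>auto intro: nabla_bar_carrier smooth_formD(2)[OF B]\<close>)
qed

lemma local_section_nabla_power:
  "local_section n Z \<sigma> \<Longrightarrow> local_section n Z ((nabla n B ^^ k) \<sigma>)"
  by (induction k) (auto intro: local_section_nabla)

lemma proportional_nabla:
  assumes s: "local_section n Z \<sigma>" "local_section n Z \<sigma>'" and p: "proportional n Z h \<sigma> \<sigma>'"
    and h: "\<And>z. z \<in> Z \<Longrightarrow> h differentiable (at z)"
      "\<And>z. z \<in> Z \<Longrightarrow> dz h z = 0" "\<And>z. z \<in> Z \<Longrightarrow> dzbar h z = 0"
  shows "proportional n Z h (nabla n B \<sigma>) (nabla n B \<sigma>')"
    and "proportional n Z h (nabla_bar n B \<sigma>) (nabla_bar n B \<sigma>')"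
proof -
  have sum: "(\<Sum>j<n. R j * \<sigma> z $ j) = h z * (\<Sum>j<n. R j * \<sigma>' z $ j)" if "z \<in> Z" for z R
    unfolding sum_distrib_left using p that
    by (intro sum.cong refl) (auto simp: proportional_def)
  have der: "wd c (\<lambda>w. \<sigma> w $ i) z = wd c h z * \<sigma>' z $ i + h z * wd c (\<lambda>w. \<sigma>' w $ i) z"
    if "z \<in> Z" "i < n" for z i c
  proof -
    have "wd c (\<lambda>w. \<sigma> w $ i) z = wd c (\<lambda>w. h w * \<sigma>' w $ i) z"
      by (rule wd_cong[OF Z(1) that(1)]) (use p that(2) in \<open>auto simp: proportional_def\<close>)
    also have "\<dots> = wd c h z * \<sigma>' z $ i + h z * wd c (\<lambda>w. \<sigma>' w $ i) z"
    proof (rule wd_mult[OF h(1)[OF that(1)]])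
      show "(\<lambda>w. \<sigma>' w $ i) differentiable (at z)"
        using s(2) that smooth_on_differentiable unfolding local_section_def by blast
    qed
    finally show ?thesis .
  qed
  have c: "\<sigma> z \<in> carrier_vec n" "\<sigma>' z \<in> carrier_vec n" "z \<in> U" if "z \<in> Z" for z
    using s that Z(2) by (auto simp: local_section_def)
  show "proportional n Z h (nabla n B \<sigma>) (nabla n B \<sigma>')"
    unfolding proportional_def
  proof (intro ballI allI impI)
    fix z i assume zi: "z \<in> Z" "i < n"
    note e = nabla_entry[OF smooth_formD(1)[OF B c(3)[OF zi(1)]] _ zi(2)]
    show "nabla n B \<sigma> z $ i = h z * nabla n B \<sigma>' z $ i"
      unfolding e[of \<sigma>, OF c(1)[OF zi(1)]] e[of \<sigma>', OF c(2)[OF zi(1)]] sum[OF zi(1)]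
      using der[OF zi] h(2)[OF zi(1)] by (simp add: dz_eq_wd distrib_left)
  qed
  show "proportional n Z h (nabla_bar n B \<sigma>) (nabla_bar n B \<sigma>')"
    unfolding proportional_def
  proof (intro ballI allI impI)
    fix z i assume zi: "z \<in> Z" "i < n"
    note e = nabla_bar_entry[OF smooth_formD(2)[OF B c(3)[OF zi(1)]] _ zi(2)]
    show "nabla_bar n B \<sigma> z $ i = h z * nabla_bar n B \<sigma>' z $ i"
      unfolding e[of \<sigma>, OF c(1)[OF zi(1)]] e[of \<sigma>', OF c(2)[OF zi(1)]] sum[OF zi(1)]
      using der[OF zi] h(3)[OF zi(1)] by (simp add: dzbar_eq_wd distrib_left)
  qed
qed

lemma nabla_power_entry:
  assumes s: "local_section n Z \<sigma>" and zi: "z \<in> Z" "i < n"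
  shows "(nabla n B ^^ k) \<sigma> z $ i =
    (covd n 1 (- \<i>) (\<lambda>i j z. fst B z $$ (i, j)) ^^ k) (\<lambda>i z. \<sigma> z $ i) i z"
  using zi
proof (induction k arbitrary: z i)
  case (Suc k)
  let ?v = "(covd n 1 (- \<i>) (\<lambda>i j z. fst B z $$ (i, j)) ^^ k) (\<lambda>i z. \<sigma> z $ i)"
  have "z \<in> U" using Suc.prems Z by auto
  have c: "(nabla n B ^^ k) \<sigma> z \<in> carrier_vec n"
    using local_section_nabla_power[OF s] Suc.prems by (auto simp: local_section_def)
  have "wd (-\<i>) (\<lambda>w. (nabla n B ^^ k) \<sigma> w $ i) z = wd (-\<i>) (?v i) z"
    by (rule wd_cong[OF Z(1) Suc.prems(1)]) (rule Suc.IH[OF _ Suc.prems(2)])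
  moreover have "(\<Sum>j<n. fst B z $$ (i, j) * (nabla n B ^^ k) \<sigma> z $ j) = (\<Sum>j<n. fst B z $$ (i, j) * ?v j z)"
    using Suc by (intro sum.cong) auto
  ultimately show ?case
    using nabla_entry[where \<sigma> = "(nabla n B ^^ k) \<sigma>", OF smooth_formD(1)[OF B \<open>z \<in> U\<close>] c Suc.prems(2)]
    unfolding funpow.simps o_apply
      covd_def[of n 1 "- \<i>" "\<lambda>i j z. fst B z $$ (i, j)" "(covd n 1 (- \<i>) _ ^^ k) _"]
    by (simp add: dz_eq_wd)
qed simp

end

lemma mat_of_cols_nabla:
  "mat_of_cols n (map (\<lambda>j. (nabla n B ^^ j) s z) [0..<n]) = fmat n (\<lambda>i j. (nabla n B ^^ j) s z $ i)"
  by (rule eq_matI) (auto simp: mat_of_cols_def)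

lemma unit_volume_sectionD:
  fixes s :: "complex \<Rightarrow> complex vec"
  assumes "unit_volume_section n c B W s"
  shows "open W" "W \<subseteq> chart_dom c" "local_section n W s"
    and "z \<in> W \<Longrightarrow> 0 < i \<Longrightarrow> i < n \<Longrightarrow> s z $ i = 0"
    and "z \<in> W \<Longrightarrow> det (fmat n (\<lambda>i j. (nabla n B ^^ j) s z $ i)) = 1"
  using assms unfolding unit_volume_section_def local_section_def mat_of_cols_nabla by auto

lemma det_1_dual:
  assumes "det (fmat n F) = 1" "i < n" "j < n"
  shows "(\<Sum>k<n. adj_mat (fmat n F) $$ (j, k) * F k i) = (if i = j then 1 else 0)"
proof -
  have adj: "adj_mat (fmat n F) \<in> carrier_mat n n" "adj_mat (fmat n F) * fmat n F = 1\<^sub>m n"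
    using adj_mat[of "fmat n F" n] assms(1) by auto
  show ?thesis using arg_cong[OF adj(2), of "\<lambda>M. M $$ (j, i)"] assms(2,3) adj(1)
    by (simp add: scalar_prod_def atLeast0LessThan)
qed

lemma unit_volume_section_nonzero:
  fixes s :: "complex \<Rightarrow> complex vec"
  assumes "unit_volume_section n c B W s" "z \<in> W" "0 < n"
  shows "s z $ 0 \<noteq> 0"
proof
  assume "s z $ 0 = 0"
  then have "s z $ i = 0" if "i < n" for i
    using unit_volume_sectionD(4)[OF assms(1,2)] that by (cases "i = 0") auto
  then have "(\<Sum>k<n. y k * s z $ k) = 0" for y by simp
  with det_1_dual[OF unit_volume_sectionD(5)[OF assms(1,2)] assms(3) assms(3)] show False by simp
qed

text \<open>Two unit-volume sections differ by a factor whose \<open>n\<close>-th power is 1, and the derivatives of such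
  a factor vanish. Therefore the parameters do not depend on the section, and the definite descriptions
  that define them can be evaluated on any one section.\<close>

lemma unit_volume_sections_proportional:
  fixes s s' :: "complex \<Rightarrow> complex vec"
  assumes n: "0 < n" and B: "smooth_form n (chart_dom c) B"
    and s: "unit_volume_section n c B W s" and s': "unit_volume_section n c B W' s'"
  obtains h where "proportional n (W \<inter> W') h s s'"
    "\<And>z. z \<in> W \<inter> W' \<Longrightarrow> h z \<noteq> 0" "\<And>z. z \<in> W \<inter> W' \<Longrightarrow> h differentiable (at z)"
    "\<And>z. z \<in> W \<inter> W' \<Longrightarrow> dz h z = 0" "\<And>z. z \<in> W \<inter> W' \<Longrightarrow> dzbar h z = 0"
proof -
  let ?Z = "W \<inter> W'" and ?R = "\<lambda>i j z. fst B z $$ (i, j)"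
  note d = unit_volume_sectionD[OF s] and d' = unit_volume_sectionD[OF s']
  have Z: "open ?Z" "?Z \<subseteq> chart_dom c" using d(1,2) d'(1) by auto
  have sec: "local_section n ?Z s" "local_section n ?Z s'"
    using d(3) d'(3) unfolding local_section_def by (blast intro: smooth_on_subset)+
  define h where "h = (\<lambda>z. s z $ 0 * inverse (s' z $ 0))"
  have nz: "s z $ 0 \<noteq> 0" "s' z $ 0 \<noteq> 0" if "z \<in> ?Z" for z
    using unit_volume_section_nonzero[OF s _ n] unit_volume_section_nonzero[OF s' _ n] that by auto
  have hs: "smooth_on ?Z h" unfolding h_def
    using sec n nz(2) by (intro smooth_on_mult smooth_on_inverse Z) (auto simp: local_section_def)
  have pr: "proportional n ?Z h s s'"
    unfolding proportional_def
  proof (intro ballI allI impI)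
    fix z i assume z: "z \<in> ?Z" and i: "i < n"
    show "s z $ i = h z * s' z $ i"
      using nz[OF z] d(4)[of z i] d'(4)[of z i] z i by (cases "i = 0") (auto simp: h_def)
  qed
  interpret fo: frame_operator ?Z n 1 "- \<i>" ?R
    by unfold_locales (rule Z(1), simp, rule smooth_on_subset[OF smooth_formD(3)[OF B] Z(2)])
  have hn: "h z ^ n = 1" if z: "z \<in> ?Z" for z
  proof -
    have eq: "(fo.nab ^^ k) (\<lambda>i z. s z $ i) i w = (fo.nab ^^ k) (\<lambda>i z. h z * s' z $ i) i w"
      if "i < n" "w \<in> ?Z" for i w k
      using that
    proof (induction k arbitrary: i w)
      case 0 then show ?case using pr by (simp add: proportional_def)
    next
      case (Suc k)
      show ?case unfolding funpow.simps o_apply by (rule fo.nab_cong[OF Suc.IH Suc.prems])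
    qed
    have 1: "fmat n (\<lambda>i j. (nabla n B ^^ j) s z $ i) = fmat n (\<lambda>i j. (fo.nab ^^ j) (\<lambda>i z. h z * s' z $ i) i z)"
      by (rule eq_matI) (simp_all add: nabla_power_entry[OF Z B sec(1) z] eq[OF _ z])
    have 2: "fmat n (\<lambda>i j. (nabla n B ^^ j) s' z $ i) = fmat n (\<lambda>i j. (fo.nab ^^ j) (\<lambda>i z. s' z $ i) i z)"
      by (rule eq_matI) (simp_all add: nabla_power_entry[OF Z B sec(2) z])
    have "1 = det (fmat n (\<lambda>i j. (fo.nab ^^ j) (\<lambda>i z. h z * s' z $ i) i z))"
      using d(5)[of z] z unfolding 1 by simp
    also have "\<dots> = h z ^ n * det (fmat n (\<lambda>i j. (fo.nab ^^ j) (\<lambda>i z. s' z $ i) i z))"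
      by (rule fo.det_frame_scaled[OF hs _ z]) (use sec(2) in \<open>auto simp: local_section_def\<close>)
    also have "\<dots> = h z ^ n" using d'(5)[of z] z unfolding 2 by simp
    finally show ?thesis by simp
  qed
  have hd: "h differentiable (at z)" if "z \<in> ?Z" for z
    by (rule smooth_on_differentiable[OF hs that])
  have hnz: "h z \<noteq> 0" if "z \<in> ?Z" for z using hn[OF that] n by (auto simp: power_0_left)
  have wdh: "wd c' h z = 0" if z: "z \<in> ?Z" for z c'
  proof -
    have "0 = wd c' (\<lambda>z. h z ^ n) z"
      by (subst wd_cong[OF Z(1) z hn]) auto
    also have "\<dots> = of_nat n * h z ^ (n - 1) * wd c' h z" by (rule wd_power[OF hd[OF z]])
    finally show ?thesis using hnz[OF z] n by simp
  qed
  show thesis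
    by (rule that[OF pr hnz hd]) (simp_all add: wdh dz_eq_wd dzbar_eq_wd)
qed

lemma t_hat_eqI:
  fixes s :: "complex \<Rightarrow> complex vec"
  assumes n: "0 < n" and B: "smooth_form n (chart_dom c) B"
    and s: "unit_volume_section n c B W s" and z: "z \<in> W"
    and \<tau>: "\<And>i. i < n \<Longrightarrow> (nabla n B ^^ n) s z $ i = (\<Sum>j=2..n. \<tau> j * (nabla n B ^^ (n - j)) s z $ i)"
    and k: "k \<in> {2..n}"
  shows "t_hat n c B k z = \<tau> k"
  unfolding t_hat_def
proof (rule the_equality)
  show "\<exists>W s \<tau>'. z \<in> W \<and> unit_volume_section n c B W s \<and>
     (\<forall>i<n. (nabla n B ^^ n) s z $ i = (\<Sum>j=2..n. \<tau>' j * (nabla n B ^^ (n - j)) s z $ i)) \<and> \<tau> k = \<tau>' k"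
    using s z \<tau> by blast
next
  fix x
  assume "\<exists>W s \<tau>'. z \<in> W \<and> unit_volume_section n c B W s \<and>
     (\<forall>i<n. (nabla n B ^^ n) s z $ i = (\<Sum>j=2..n. \<tau>' j * (nabla n B ^^ (n - j)) s z $ i)) \<and> x = \<tau>' k"
  then obtain W' s' \<tau>' where z': "z \<in> W'" and s': "unit_volume_section n c B W' s'"
    and \<tau>': "\<And>i. i < n \<Longrightarrow> (nabla n B ^^ n) s' z $ i = (\<Sum>j=2..n. \<tau>' j * (nabla n B ^^ (n - j)) s' z $ i)"
    and x: "x = \<tau>' k" by blast
  obtain h where h: "proportional n (W \<inter> W') h s s'"
    "\<And>z. z \<in> W \<inter> W' \<Longrightarrow> h z \<noteq> 0" "\<And>z. z \<in> W \<inter> W' \<Longrightarrow> h differentiable (at z)"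
    "\<And>z. z \<in> W \<inter> W' \<Longrightarrow> dz h z = 0" "\<And>z. z \<in> W \<inter> W' \<Longrightarrow> dzbar h z = 0"
    by (rule unit_volume_sections_proportional[OF n B s s']) (rule that)
  have Z: "open (W \<inter> W')" "W \<inter> W' \<subseteq> chart_dom c"
    using unit_volume_sectionD(1,2)[OF s] unit_volume_sectionD(1)[OF s'] by auto
  have sec: "local_section n (W \<inter> W') s" "local_section n (W \<inter> W') s'"
    using unit_volume_sectionD(3)[OF s] unit_volume_sectionD(3)[OF s']
    unfolding local_section_def by (blast intro: smooth_on_subset)+
  have pk: "proportional n (W \<inter> W') h ((nabla n B ^^ j) s) ((nabla n B ^^ j) s')" for j
  proof (induction j)
    case (Suc j)
    show ?case unfolding funpow.simps o_apply
      by (rule proportional_nabla(1)[OF Z B local_section_nabla_power[OF Z B sec(1)]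
            local_section_nabla_power[OF Z B sec(2)] Suc h(3-5)])
  qed (use h(1) in simp)
  have zz: "z \<in> W \<inter> W'" using z z' by simp
  let ?V = "fmat n (\<lambda>i j. (nabla n B ^^ j) s' z $ i)"
  let ?y = "\<lambda>i. adj_mat ?V $$ (n - k, i)"
  have eq: "(\<Sum>j=2..n. \<tau> j * (nabla n B ^^ (n - j)) s' z $ i) = (\<Sum>j=2..n. \<tau>' j * (nabla n B ^^ (n - j)) s' z $ i)"
    if i: "i < n" for i
  proof -
    have ps: "(nabla n B ^^ j) s z $ i = h z * (nabla n B ^^ j) s' z $ i" for j
      using pk[of j] zz i unfolding proportional_def by blast
    have "h z * (\<Sum>j=2..n. \<tau> j * (nabla n B ^^ (n - j)) s' z $ i) = (nabla n B ^^ n) s z $ i"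
      by (subst \<tau>[OF i]) (simp add: ps sum_distrib_left mult_ac)
    also have "\<dots> = h z * (\<Sum>j=2..n. \<tau>' j * (nabla n B ^^ (n - j)) s' z $ i)"
      unfolding ps \<tau>'[OF i] ..
    finally show ?thesis using h(2)[OF zz] by simp
  qed
  have ext: "(\<Sum>i<n. ?y i * (\<Sum>j=2..n. a j * (nabla n B ^^ (n - j)) s' z $ i)) = a k" for a
  proof -
    have "(\<Sum>i<n. ?y i * (\<Sum>j=2..n. a j * (nabla n B ^^ (n - j)) s' z $ i)) =
        (\<Sum>j=2..n. a j * (\<Sum>i<n. ?y i * (nabla n B ^^ (n - j)) s' z $ i))"
      unfolding sum_distrib_left by (subst sum.swap) (simp add: mult_ac)
    also have "\<dots> = (\<Sum>j=2..n. if j = k then a k else 0)"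
    proof (rule sum.cong[OF refl])
      fix j assume j: "j \<in> {2..n}"
      show "a j * (\<Sum>i<n. ?y i * (nabla n B ^^ (n - j)) s' z $ i) = (if j = k then a k else 0)"
        using det_1_dual[OF unit_volume_sectionD(5)[OF s' z'], of "n - j" "n - k"] j k by auto
    qed
    also have "\<dots> = a k" using k by simp
    finally show ?thesis .
  qed
  have "\<tau> k = (\<Sum>i<n. ?y i * (\<Sum>j=2..n. \<tau> j * (nabla n B ^^ (n - j)) s' z $ i))" by (rule ext[symmetric])
  also have "\<dots> = (\<Sum>i<n. ?y i * (\<Sum>j=2..n. \<tau>' j * (nabla n B ^^ (n - j)) s' z $ i))"
    by (intro sum.cong refl arg_cong2[of _ _ _ _ "(*)"] eq) simp
  also have "\<dots> = \<tau>' k" by (rule ext)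
  finally show "x = \<tau> k" using x by simp
qed

lemma parabolic_curvature_eqI:
  fixes s :: "complex \<Rightarrow> complex vec"
  assumes n: "0 < n" and B: "smooth_form n (chart_dom c) B"
    and s: "unit_volume_section n c B W s" and z: "z \<in> W"
    and x: "\<And>i. i < n \<Longrightarrow> nabla n B (nabla_bar n B ((nabla n B ^^ (k - 1)) s)) z $ i
       - nabla_bar n B (nabla n B ((nabla n B ^^ (k - 1)) s)) z $ i = x * s z $ i"
  shows "parabolic_curvature n c B k z = x"
  unfolding parabolic_curvature_def Let_def
proof (rule the_equality)
  let ?C = "\<lambda>s. nabla n B (nabla_bar n B ((nabla n B ^^ (k - 1)) s)) z
      - nabla_bar n B (nabla n B ((nabla n B ^^ (k - 1)) s)) z"
  have zU: "z \<in> chart_dom c" using unit_volume_sectionD(2)[OF s] z by auto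
  note car = nabla_carrier[where n = n, OF smooth_formD(1)[OF B zU]] nabla_bar_carrier[where n = n, OF smooth_formD(2)[OF B zU]]
  have Cc: "?C s \<in> carrier_vec n" for s by (intro minus_carrier_vec car)
  have Ci: "?C s $ i = nabla n B (nabla_bar n B ((nabla n B ^^ (k - 1)) s)) z $ i
      - nabla_bar n B (nabla n B ((nabla n B ^^ (k - 1)) s)) z $ i" if "i < n" for s i
    using that carrier_vecD[OF car(2)] by simp
  have sc: "s z \<in> carrier_vec n"
    using unit_volume_sectionD(3)[OF s] z by (auto simp: local_section_def)
  have "?C s = x \<cdot>\<^sub>v s z"
  proof (rule eq_vecI)
    fix i assume "i < dim_vec (x \<cdot>\<^sub>v s z)"
    then have i: "i < n" using sc by simp
    show "?C s $ i = (x \<cdot>\<^sub>v s z) $ i" unfolding Ci[OF i] x[OF i] using i sc by simp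
  qed (use carrier_vecD[OF Cc] carrier_vecD[OF sc] in simp)
  then show "\<exists>W s. z \<in> W \<and> unit_volume_section n c B W s \<and> ?C s = x \<cdot>\<^sub>v s z"
    using s z by blast
  fix x'
  assume "\<exists>W s. z \<in> W \<and> unit_volume_section n c B W s \<and> ?C s = x' \<cdot>\<^sub>v s z"
  then obtain W' s' where z': "z \<in> W'" and s': "unit_volume_section n c B W' s'"
    and x': "?C s' = x' \<cdot>\<^sub>v s' z" by blast
  obtain h where h: "proportional n (W \<inter> W') h s s'"
    "\<And>z. z \<in> W \<inter> W' \<Longrightarrow> h z \<noteq> 0" "\<And>z. z \<in> W \<inter> W' \<Longrightarrow> h differentiable (at z)"
    "\<And>z. z \<in> W \<inter> W' \<Longrightarrow> dz h z = 0" "\<And>z. z \<in> W \<inter> W' \<Longrightarrow> dzbar h z = 0"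
    by (rule unit_volume_sections_proportional[OF n B s s']) (rule that)
  have Z: "open (W \<inter> W')" "W \<inter> W' \<subseteq> chart_dom c"
    using unit_volume_sectionD(1,2)[OF s] unit_volume_sectionD(1)[OF s'] by auto
  have sec: "local_section n (W \<inter> W') s" "local_section n (W \<inter> W') s'"
    using unit_volume_sectionD(3)[OF s] unit_volume_sectionD(3)[OF s']
    unfolding local_section_def by (blast intro: smooth_on_subset)+
  note pn = proportional_nabla[OF Z B _ _ _ h(3-5)] and ln = local_section_nabla[OF Z B]
    and lp = local_section_nabla_power[OF Z B]
  have pk: "proportional n (W \<inter> W') h ((nabla n B ^^ j) s) ((nabla n B ^^ j) s')" for j
  proof (induction j)
    case (Suc j)
    show ?case unfolding funpow.simps o_apply by (rule pn(1)[OF lp[OF sec(1)] lp[OF sec(2)] Suc])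
  qed (use h(1) in simp)
  have zz: "z \<in> W \<inter> W'" using z z' by simp
  have 1: "proportional n (W \<inter> W') h (nabla n B (nabla_bar n B ((nabla n B ^^ (k - 1)) s)))
      (nabla n B (nabla_bar n B ((nabla n B ^^ (k - 1)) s')))"
    by (intro pn ln lp sec pk)
  have 2: "proportional n (W \<inter> W') h (nabla_bar n B (nabla n B ((nabla n B ^^ (k - 1)) s)))
      (nabla_bar n B (nabla n B ((nabla n B ^^ (k - 1)) s')))"
    by (intro pn ln lp sec pk)
  have "x * s z $ 0 = h z * ?C s' $ 0"
    unfolding x[OF n, symmetric] Ci[OF n] using 1 2 zz n
    by (simp add: proportional_def right_diff_distrib)
  also have "?C s' $ 0 = x' * s' z $ 0"
    unfolding x' using unit_volume_sectionD(3)[OF s'] z' n by (auto simp: local_section_def)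
  also have "h z * (x' * s' z $ 0) = x' * s z $ 0"
    using h(1) zz n by (simp add: proportional_def)
  finally show "x' = x" using unit_volume_section_nonzero[OF s z n] by simp
qed

text \<open>This makes the leading coefficient of an expansion unique.\<close>

lemma power_bigo_lower_zero:
  assumes "(\<lambda>l. l ^ (k - 1) * d) \<in> O[at_infinity](\<lambda>l :: complex. l ^ (k - 2))" "2 \<le> k"
  shows "d = 0"
proof (rule ccontr)
  assume d: "d \<noteq> 0"
  obtain K where "eventually (\<lambda>l. norm (l ^ (k - 1) * d) \<le> K * norm (l ^ (k - 2))) at_infinity"
    using landau_o.bigE[OF assms(1)] by blast
  then obtain b where b: "\<And>l. b \<le> norm l \<Longrightarrow> norm (l ^ (k - 1) * d) \<le> K * norm (l ^ (k - 2))"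
    unfolding eventually_at_infinity by blast
  define x where "x = max 1 (max b (\<bar>K\<bar> / norm d + 1))"
  have x: "x \<ge> 1" "x \<ge> b" "x > \<bar>K\<bar> / norm d" by (auto simp: x_def)
  have "k - 1 = Suc (k - 2)" using assms(2) by simp
  then have "x ^ (k - 2) * (x * norm d) \<le> x ^ (k - 2) * K"
    using b[of "of_real x"] x by (simp add: norm_mult norm_power mult_ac)
  then have "x * norm d \<le> K" using x(1) by simp
  moreover have "x * norm d > \<bar>K\<bar>" using x(3) d by (simp add: field_simps)
  ultimately show False by linarith
qed

lemma bigo_inverse_parameter:
  fixes g :: "complex \<Rightarrow> complex"
  assumes \<delta>: "\<delta> > 0" and K: "\<And>e. e \<noteq> 0 \<Longrightarrow> norm e < \<delta> \<Longrightarrow> norm (g (inverse e)) \<le> K * norm (inverse e) ^ m"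
  shows "g \<in> O[at_infinity](\<lambda>l. l ^ m)"
proof (rule bigoI)
  show "\<forall>\<^sub>F l in at_infinity. norm (g l) \<le> K * norm (l ^ m)"
    unfolding eventually_at_infinity
  proof (intro exI[of _ "inverse \<delta> + 1"] allI impI)
    fix l :: complex assume l: "inverse \<delta> + 1 \<le> norm l"
    have "inverse \<delta> > 0" using \<delta> by simp
    with l have pos: "norm l > inverse \<delta>" "norm l > 0" by linarith+
    have "inverse (norm l) < inverse (inverse \<delta>)" using pos \<delta> by (intro less_imp_inverse_less) auto
    then have "norm (inverse l) < \<delta>" by (simp add: norm_inverse)
    then show "norm (g l) \<le> K * norm (l ^ m)"
      using K[of "inverse l"] pos by (simp add: norm_power)
  qed
qed

lemma zeta_cong:
  assumes "open U" "z \<in> U" "k \<in> {2..n}"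
    and "\<And>j w. j \<in> {2..n} \<Longrightarrow> w \<in> U \<Longrightarrow> t j w = t' j w"
  shows "zeta n m t k z = zeta n m t' k z"
proof -
  have d: "dz (t j) z = dz (t' j) z" "dzbar (t j) z = dzbar (t' j) z" "t j z = t' j z" if "j \<in> {2..n}" for j
    unfolding dz_eq_wd dzbar_eq_wd using assms that by (auto intro!: wd_cong[OF assms(1,2)])
  have "(\<Sum>j=1..n-k. of_nat (j + k) * dz (m (j + 2)) z * t (k + j) z + of_nat (j + 1) * m (j + 2) z * dz (t (k + j)) z)
    = (\<Sum>j=1..n-k. of_nat (j + k) * dz (m (j + 2)) z * t' (k + j) z + of_nat (j + 1) * m (j + 2) z * dz (t' (k + j)) z)"
  proof (rule sum.cong[OF refl])
    fix j assume "j \<in> {1..n-k}"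
    then have "k + j \<in> {2..n}" using assms(3) by auto
    from d[OF this]
    show "of_nat (j + k) * dz (m (j + 2)) z * t (k + j) z + of_nat (j + 1) * m (j + 2) z * dz (t (k + j)) z =
      of_nat (j + k) * dz (m (j + 2)) z * t' (k + j) z + of_nat (j + 1) * m (j + 2) z * dz (t' (k + j)) z"
      by (simp only:)
  qed
  then show ?thesis unfolding zeta_def by (simp add: d[OF assms(3)])
qed

section \<open>Asymptotics of the parameters of a connection\<close>

text \<open>The operators of the connection are \<open>l\<close> times the rescaled ones, so iterated derivatives differ by
  powers of \<open>l\<close>, which are constant.\<close>

lemma covd_rescaled:
  assumes "l \<noteq> 0" "open W" "\<And>i j z. i < n \<Longrightarrow> j < n \<Longrightarrow> z \<in> W \<Longrightarrow> R' i j z = l * R i j z"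
    and "\<And>i z. i < n \<Longrightarrow> z \<in> W \<Longrightarrow> v' i z = x * v i z"
    and "\<And>i z. i < n \<Longrightarrow> z \<in> W \<Longrightarrow> v i differentiable (at z)"
    and "i < n" "z \<in> W"
  shows "covd n 1 c R' v' i z = l * x * covd n (inverse l) c R v i z"
proof -
  have "wd c (v' i) z = wd c (\<lambda>z. x * v i z) z"
    by (rule wd_cong[OF assms(2,7)]) (rule assms(4)[OF assms(6)])
  also have "\<dots> = x * wd c (v i) z" by (rule wd_cmult[OF assms(5)[OF assms(6,7)]])
  finally have "wd c (v' i) z = x * wd c (v i) z" .
  moreover have "(\<Sum>j<n. R' i j z * v' j z) = (\<Sum>j<n. l * x * (R i j z * v j z))"
    using assms by (intro sum.cong) auto
  ultimately show ?thesis using assms(1) by (simp add: covd_def distrib_left sum_distrib_left)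
qed

lemma det_fmat_column_scaled:
  "det (fmat n (\<lambda>i j. b j * F i j)) = (\<Prod>j<n. b j) * det (fmat n F)"
proof -
  have "(\<Prod>i\<in>{0..<n}. b (p i) * F i (p i)) = (\<Prod>j<n. b j) * (\<Prod>i\<in>{0..<n}. F i (p i))"
    if "p permutes {0..<n}" for p
    using prod.permute[OF that, of b] by (simp add: prod.distrib o_def atLeast0LessThan)
  then show ?thesis unfolding det_fmat sum_distrib_left
    by (intro sum.cong refl) (simp add: mult_ac)
qed

text \<open>A family of connections in a chart whose matrices are \<open>l\<close> times those of a rescaled parabolic
  family with parameter \<open>1 / l\<close>.\<close>

locale parabolic_chart = parabolic_family "chart_dom c" n mu A1 A2 S1 S2
  for c :: "'a chart" and n mu A1 A2 S1 S2 +
  fixes B :: "complex \<Rightarrow> mat_form"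
  assumes smooth_B: "\<And>l. l \<noteq> 0 \<Longrightarrow> smooth_form n (chart_dom c) (B l)"
    and fst_B: "\<And>l i j z. l \<noteq> 0 \<Longrightarrow> z \<in> chart_dom c \<Longrightarrow> i < n \<Longrightarrow> j < n \<Longrightarrow>
      fst (B l) z $$ (i, j) = l * P (inverse l) i j z"
    and snd_B: "\<And>l i j z. l \<noteq> 0 \<Longrightarrow> z \<in> chart_dom c \<Longrightarrow> i < n \<Longrightarrow> j < n \<Longrightarrow>
      snd (B l) z $$ (i, j) = l * Q (inverse l) i j z"
begin

text \<open>The section \<open>nf.s\<close> becomes a unit-volume section of the connection itself after multiplication by a
  constant \<open>x\<close>, which compensates the powers of \<open>l\<close> in the columns of the frame.\<close>

lemma parameters_at_point:
  assumes nf: "normalized_family (chart_dom c) n mu A1 A2 S1 S2 a0 \<rho> \<delta>" and \<rho>: "\<rho> > 0"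
    and l: "l \<noteq> 0" "norm (inverse l) < \<delta>"
  defines "T \<equiv> normalized_family.T n A1 S1" and "X \<equiv> normalized_family.X n mu A1 A2 S1 S2"
  assumes k: "k \<in> {2..n}"
  shows "t_hat n c (B l) k a0 = l ^ k * T k (inverse l) a0"
    and "parabolic_curvature n c (B l) k a0 = l ^ (k + 1) * X k (inverse l) a0"
proof -
  interpret nf: normalized_family "chart_dom c" n mu A1 A2 S1 S2 a0 \<rho> \<delta> by (rule nf)
  let ?W = "ball a0 \<rho>"
  define e where "e = inverse l"
  have e: "e \<noteq> 0" "norm e < \<delta>" and le: "inverse l = e" "l = inverse e" using l by (auto simp: e_def)
  have W: "open ?W" "?W \<subseteq> chart_dom c" "a0 \<in> ?W" using nf.ball \<rho> by auto
  note Bs = smooth_B[OF l(1)]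
  \<comment> \<open>the frame of the connection has the columns of the rescaled frame multiplied by \<open>l\<^sup>j\<close>\<close>
  define a where "a = inverse (\<Prod>j<n. l ^ j)"
  have a: "a \<noteq> 0" using l by (simp add: a_def)
  define x where "x = exp (Ln a / of_nat n)"
  have xn: "x ^ n = a" "x \<noteq> 0"
  proof -
    have "x ^ n = exp (of_nat n * (Ln a / of_nat n))" unfolding x_def by (simp flip: exp_of_nat_mult)
    then show "x ^ n = a" using a n2 by simp
  qed (simp add: x_def)
  define s where "s = (\<lambda>z. vec n (\<lambda>i. x * nf.s e i z))"
  have ss: "smooth_on ?W (nf.s e i)" if "i < n" for i by (rule nf.smooth_s[OF e that])
  have sec: "local_section n ?W s"
    unfolding local_section_def s_def using ss by (auto intro!: smooth_on_mult)
  have sf: "smooth_on ?W (nf.fr k e i)" if "i < n" for k i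
    using nf.small_smooth_on[OF nf.small_fr[OF that] e] .
  let ?R = "\<lambda>i j z. fst (B l) z $$ (i, j)"
  have R: "?R i j z = l * P e i j z" "snd (B l) z $$ (i, j) = l * Q e i j z"
    if "i < n" "j < n" "z \<in> ?W" for i j z
    using fst_B[OF l(1) _ that(1,2), of z] snd_B[OF l(1) _ that(1,2), of z] that(3) W(2) le by auto
  have pow: "(nabla n (B l) ^^ k) s z $ i = l ^ k * x * nf.fr k e i z" if "i < n" "z \<in> ?W" for k i z
    unfolding nabla_power_entry[OF W(1,2) Bs sec that(2,1)] using that
  proof (induction k arbitrary: i z)
    case 0
    then show ?case by (simp add: s_def nf.fr_def)
  next
    case (Suc k)
    have "(covd n 1 (- \<i>) ?R ^^ Suc k) (\<lambda>i z. s z $ i) i z =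
        covd n 1 (- \<i>) ?R ((covd n 1 (- \<i>) ?R ^^ k) (\<lambda>i z. s z $ i)) i z" by simp
    also have "\<dots> = l * (l ^ k * x) * covd n (inverse l) (- \<i>) (P e) (nf.fr k e) i z"
      by (rule covd_rescaled[where W = ?W, OF l(1) W(1) R(1) Suc.IH smooth_on_differentiable[OF sf] Suc.prems])
    also have "covd n (inverse l) (- \<i>) (P e) (nf.fr k e) = nf.fr (Suc k) e"
      by (simp add: nf.fr_eq le(1))
    finally show ?case by (simp add: mult.assoc)
  qed
  have unit: "unit_volume_section n c (B l) ?W s"
    unfolding unit_volume_section_def mat_of_cols_nabla
  proof (intro conjI ballI allI impI W(1,2))
    fix z assume z: "z \<in> ?W"
    show "s z \<in> carrier_vec n" by (simp add: s_def)
    show "s z $ i = 0" if "i \<in> {1..<n}" for i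
      using that by (simp add: s_def nf.s_def nf.u_def scl_def)
    have "fmat n (\<lambda>i j. (nabla n (B l) ^^ j) s z $ i) = fmat n (\<lambda>i j. (l ^ j * x) * nf.fr j e i z)"
      by (rule eq_matI) (simp_all add: pow[OF _ z])
    then have "det (fmat n (\<lambda>i j. (nabla n (B l) ^^ j) s z $ i)) = (\<Prod>j<n. l ^ j * x) * 1"
      using nf.det_fr[OF e z] by (simp only: det_fmat_column_scaled)
    also have "\<dots> = 1" using a xn by (simp add: prod.distrib a_def)
    finally show "det (fmat n (\<lambda>i j. (nabla n (B l) ^^ j) s z $ i)) = 1" .
  next
    show "smooth_on ?W (\<lambda>z. s z $ i)" if "i < n" for i
      using sec that by (simp add: local_section_def)
  qed
  have n0: "0 < n" using n2 by simp
  show "t_hat n c (B l) k a0 = l ^ k * T k (inverse l) a0"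
    unfolding le(1)
  proof (rule t_hat_eqI[OF n0 Bs unit W(3) _ k])
    fix i assume i: "i < n"
    have "nf.fr n e i a0 = (\<Sum>j=2..n. nf.T j e a0 * nf.fr (n - j) e i a0)"
      using nf.eqxD[OF nf.fr_n_T e W(3) i] by (simp add: vsum_def scl_def)
    then have "(nabla n (B l) ^^ n) s a0 $ i = (\<Sum>j=2..n. l ^ n * x * (nf.T j e a0 * nf.fr (n - j) e i a0))"
      unfolding pow[OF i W(3)] by (simp add: sum_distrib_left)
    also have "\<dots> = (\<Sum>j=2..n. l ^ j * T j e a0 * (nabla n (B l) ^^ (n - j)) s a0 $ i)"
    proof (rule sum.cong[OF refl])
      fix j assume "j \<in> {2..n}"
      then have "l ^ n = l ^ j * l ^ (n - j)" by (simp flip: power_add)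
      then show "l ^ n * x * (nf.T j e a0 * nf.fr (n - j) e i a0) =
          l ^ j * T j e a0 * (nabla n (B l) ^^ (n - j)) s a0 $ i"
        unfolding pow[OF i W(3)] T_def by (simp add: mult_ac)
    qed
    finally show "(nabla n (B l) ^^ n) s a0 $ i = (\<Sum>j=2..n. l ^ j * T j e a0 * (nabla n (B l) ^^ (n - j)) s a0 $ i)" .
  qed
  show "parabolic_curvature n c (B l) k a0 = l ^ (k + 1) * X k (inverse l) a0"
    unfolding le(1)
  proof (rule parabolic_curvature_eqI[OF n0 Bs unit W(3)])
    fix i assume i: "i < n"
    let ?v = "(nabla n (B l) ^^ (k - 1)) s"
    have secv: "local_section n ?W ((nabla n (B l) ^^ j) s)" for j
      by (rule local_section_nabla_power[OF W(1,2) Bs sec])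
    have bar: "nabla_bar n (B l) ((nabla n (B l) ^^ j) s) z $ i = l * (l ^ j * x) * cov n \<i> Q (nf.fr j) e i z"
      if "i < n" "z \<in> ?W" for j i z
    proof -
      have "nabla_bar n (B l) ((nabla n (B l) ^^ j) s) z $ i =
          covd n 1 \<i> (\<lambda>i j z. snd (B l) z $$ (i, j)) (\<lambda>i z. (nabla n (B l) ^^ j) s z $ i) i z"
        using nabla_bar_entry[where \<sigma> = "(nabla n (B l) ^^ j) s", OF smooth_formD(2)[OF Bs] _ that(1), of z]
          secv[of j] that(2) W(2) by (auto simp: covd_def dzbar_eq_wd local_section_def)
      also have "\<dots> = l * (l ^ j * x) * covd n (inverse l) \<i> (Q e) (nf.fr j e) i z"
        by (rule covd_rescaled[where W = ?W, OF l(1) W(1) R(2) pow smooth_on_differentiable[OF sf] that])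
      finally show ?thesis by (simp add: cov_eq_covd le(1))
    qed
    have "nf.vsmall 0 (cov n \<i> Q (nf.fr (k - 1)))" by (rule nf.bar.vsmall_nab[OF nf.vsmall_fr])
    then have sb: "smooth_on ?W (cov n \<i> Q (nf.fr (k - 1)) e i)" if "i < n" for i
      using that nf.small_smooth_on[where F = "\<lambda>e. cov n \<i> Q (nf.fr (k - 1)) e i", OF _ e]
      unfolding nf.vsmall_def by blast
    have 1: "nabla n (B l) (nabla_bar n (B l) ?v) a0 $ i =
        l * (l * (l ^ (k - 1) * x)) * cov n (- \<i>) P (cov n \<i> Q (nf.fr (k - 1))) e i a0"
    proof -
      have lb: "local_section n ?W (nabla_bar n (B l) ?v)"
        by (rule local_section_nabla(2)[OF W(1,2) Bs secv])
      have "nabla n (B l) (nabla_bar n (B l) ?v) a0 $ i =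
          covd n 1 (- \<i>) ?R (\<lambda>i z. nabla_bar n (B l) ?v z $ i) i a0"
        using nabla_entry[where \<sigma> = "nabla_bar n (B l) ?v", OF smooth_formD(1)[OF Bs] _ i, of a0]
          lb W(3) subsetD[OF W(2,3)] unfolding covd_def dz_eq_wd local_section_def by (simp del: mem_ball)
      also have "\<dots> = l * (l * (l ^ (k - 1) * x)) *
          covd n (inverse l) (- \<i>) (P e) (cov n \<i> Q (nf.fr (k - 1)) e) i a0"
        by (rule covd_rescaled[where W = ?W, OF l(1) W(1) R(1) bar smooth_on_differentiable[OF sb] i W(3)])
      finally show ?thesis by (simp add: cov_eq_covd le(1))
    qed
    have kk: "Suc (k - 1) = k" using k by simp
    have "nabla n (B l) ?v = (nabla n (B l) ^^ Suc (k - 1)) s" by simp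
    then have 2: "nabla_bar n (B l) (nabla n (B l) ?v) a0 $ i = l * (l ^ k * x) * cov n \<i> Q (nf.fr k) e i a0"
      using bar[OF i W(3), of k] by (simp only: kk)
    have D: "cov n (- \<i>) P (cov n \<i> Q (nf.fr (k - 1))) e i a0 - cov n \<i> Q (nf.fr k) e i a0 = nf.X k e a0 * nf.s e i a0"
      using nf.eqxD[OF nf.curvature_X[of k] e W(3) i] k by (simp add: vsub_def scl_def)
    have E: "l * (l * (l ^ (k - 1) * x)) = l * (l ^ k * x)" using kk by (metis power_Suc mult.assoc)
    show "nabla n (B l) (nabla_bar n (B l) ?v) a0 $ i - nabla_bar n (B l) (nabla n (B l) ?v) a0 $ i =
        l ^ (k + 1) * X k e a0 * s a0 $ i"
      unfolding 1 2 E right_diff_distrib[symmetric] D using i by (simp add: s_def X_def mult_ac)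
  qed
qed

lemma parameter_asymptotics:
  assumes a0: "a0 \<in> chart_dom c" and k: "k \<in> {2..n}"
  shows "(\<lambda>l. t_hat n c (B l) k a0 - l ^ (k - 1) * t k a0) \<in> O[at_infinity](\<lambda>l. l ^ (k - 2))"
    and "(\<lambda>l. parabolic_curvature n c (B l) k a0 - l ^ (k - 1) * zeta n mu t k a0)
      \<in> O[at_infinity](\<lambda>l. l ^ (k - 2))"
proof -
  obtain \<rho> \<delta> where \<rho>: "\<rho> > 0" and \<delta>: "\<delta> > 0"
    and nf: "normalized_family (chart_dom c) n mu A1 A2 S1 S2 a0 \<rho> \<delta>"
    by (rule exists_normalized_family[OF a0]) (rule that)
  interpret nf: normalized_family "chart_dom c" n mu A1 A2 S1 S2 a0 \<rho> \<delta> by (rule nf)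
  have W: "a0 \<in> ball a0 \<rho>" using \<rho> by simp
  note par = parameters_at_point[OF nf \<rho> _ _ k]
  obtain K where K: "\<And>e z. e \<noteq> 0 \<Longrightarrow> norm e < \<delta> \<Longrightarrow> z \<in> ball a0 \<rho> \<Longrightarrow>
      norm (nf.T k e z - e * t k z) \<le> K * norm e ^ 2"
    by (rule nf.small_bound[OF nf.T_estimate[of k]]) (use k in simp, rule that)
  obtain L where L: "\<And>e z. e \<noteq> 0 \<Longrightarrow> norm e < \<delta> \<Longrightarrow> z \<in> ball a0 \<rho> \<Longrightarrow>
      norm (nf.X k e z - e ^ 2 * zeta n mu t k z) \<le> L * norm e ^ 3"
    by (rule nf.small_bound[OF nf.X_zeta[OF k]]) (rule that)
  obtain p where p: "k = p + 2" using k by (metis atLeastAtMost_iff le_add_diff_inverse2)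
  show "(\<lambda>l. t_hat n c (B l) k a0 - l ^ (k - 1) * t k a0) \<in> O[at_infinity](\<lambda>l. l ^ (k - 2))"
  proof (rule bigo_inverse_parameter[OF \<delta>])
    fix e :: complex assume e: "e \<noteq> 0" "norm e < \<delta>"
    let ?l = "inverse e"
    have "t_hat n c (B ?l) k a0 - ?l ^ (k - 1) * t k a0 = ?l ^ k * (nf.T k e a0 - e * t k a0)"
      using par(1)[of ?l] e p by (simp add: right_diff_distrib)
    then have "norm (t_hat n c (B ?l) k a0 - ?l ^ (k - 1) * t k a0) \<le> norm ?l ^ k * (K * norm e ^ 2)"
      using K[OF e W] by (simp add: norm_mult norm_power mult_left_mono)
    also have "\<dots> = K * norm ?l ^ (k - 2)"
    proof -
      have "norm ?l * norm e = 1" using e by (simp add: norm_inverse)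
      then have "(norm ?l * norm e) ^ 2 = 1" by simp
      moreover have "norm ?l ^ k * (K * norm e ^ 2) = K * norm ?l ^ (k - 2) * (norm ?l * norm e) ^ 2"
        unfolding p power_add power_mult_distrib by (simp add: mult_ac)
      ultimately show ?thesis by simp
    qed
    finally show "norm (t_hat n c (B ?l) k a0 - ?l ^ (k - 1) * t k a0) \<le> K * norm ?l ^ (k - 2)" .
  qed
  show "(\<lambda>l. parabolic_curvature n c (B l) k a0 - l ^ (k - 1) * zeta n mu t k a0)
      \<in> O[at_infinity](\<lambda>l. l ^ (k - 2))"
  proof (rule bigo_inverse_parameter[OF \<delta>])
    fix e :: complex assume e: "e \<noteq> 0" "norm e < \<delta>"
    let ?l = "inverse e"
    have "parabolic_curvature n c (B ?l) k a0 - ?l ^ (k - 1) * zeta n mu t k a0 =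
        ?l ^ (k + 1) * (nf.X k e a0 - e ^ 2 * zeta n mu t k a0)"
    proof -
      have "?l ^ 2 * e ^ 2 = 1" using e by (simp flip: power_mult_distrib)
      moreover have "?l ^ (k + 1) = ?l ^ (k - 1) * ?l ^ 2" using p by (simp flip: power_add)
      then have "?l ^ (k + 1) * (e ^ 2 * zeta n mu t k a0) = ?l ^ (k - 1) * (?l ^ 2 * e ^ 2) * zeta n mu t k a0"
        by (simp only: mult.assoc)
      ultimately have E: "?l ^ (k + 1) * (e ^ 2 * zeta n mu t k a0) = ?l ^ (k - 1) * zeta n mu t k a0"
        by simp
      show ?thesis unfolding right_diff_distrib E using par(2)[of ?l] e by simp
    qed
    then have "norm (parabolic_curvature n c (B ?l) k a0 - ?l ^ (k - 1) * zeta n mu t k a0)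
        \<le> norm ?l ^ (k + 1) * (L * norm e ^ 3)"
      using L[OF e W] by (simp only: norm_mult norm_power mult_left_mono zero_le_power norm_ge_zero)
    also have "\<dots> = L * norm ?l ^ (k - 2)"
    proof -
      have "norm ?l * norm e = 1" using e by (simp add: norm_inverse)
      then have "(norm ?l * norm e) ^ 3 = 1" by simp
      moreover have "norm ?l ^ (k + 1) = norm ?l ^ (k - 2) * norm ?l ^ 3"
      proof -
        have "k + 1 = (k - 2) + 3" using p by simp
        then show ?thesis by (simp only: power_add)
      qed
      then have "norm ?l ^ (k + 1) * (L * norm e ^ 3) = L * norm ?l ^ (k - 2) * (norm ?l * norm e) ^ 3"
        unfolding power_mult_distrib by (simp add: mult_ac)
      ultimately show ?thesis by simp
    qed
    finally show "norm (parabolic_curvature n c (B ?l) k a0 - ?l ^ (k - 1) * zeta n mu t k a0)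
        \<le> L * norm ?l ^ (k - 2)" .
  qed
qed

lemma t_coeff_eq:
  assumes "a0 \<in> chart_dom c" "k \<in> {2..n}"
  shows "t_coeff n c B k a0 = t k a0"
  unfolding t_coeff_def
proof (rule the_equality[of _ "t k a0"])
  show "(\<lambda>l. t_hat n c (B l) k a0 - l ^ (k - 1) * t k a0) \<in> O[at_infinity](\<lambda>l. l ^ (k - 2))"
    by (rule parameter_asymptotics(1)[OF assms])
  fix x assume "(\<lambda>l. t_hat n c (B l) k a0 - l ^ (k - 1) * x) \<in> O[at_infinity](\<lambda>l. l ^ (k - 2))"
  from sum_in_bigo(2)[OF parameter_asymptotics(1)[OF assms] this]
  have "(\<lambda>l. l ^ (k - 1) * (x - t k a0)) \<in> O[at_infinity](\<lambda>l. l ^ (k - 2))"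
    by (simp add: right_diff_distrib)
  then have "x - t k a0 = 0" by (rule power_bigo_lower_zero) (use assms(2) in simp)
  then show "x = t k a0" by simp
qed

lemma parabolic_curvature_expansion:
  assumes z: "z \<in> chart_dom c" and k: "k \<in> {2..n}"
  shows "(\<lambda>l. parabolic_curvature n c (B l) k z - l ^ (k - 1) * zeta n mu (t_coeff n c B) k z)
    \<in> O[at_infinity](\<lambda>l. l ^ (k - 2))"
  using parameter_asymptotics(2)[OF z k] zeta_cong[where t = "t_coeff n c B" and t' = t and m = mu, OF open_U z k t_coeff_eq]
  by simp

text \<open>For a flat family the parabolic curvature vanishes, so the leading term of its expansion does as
  well.\<close>

lemma flat_zeta_zero:
  assumes z: "z \<in> chart_dom c" and k: "k \<in> {2..n}"
    and flat: "\<And>l. l \<noteq> 0 \<Longrightarrow> curvature n (B l) z = 0\<^sub>m n n"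
    and cur: "\<And>l. l \<noteq> 0 \<Longrightarrow> (\<forall>i<n. \<forall>j<n. curvature n (B l) z $$ (i, j) = l ^ 2 * F (inverse l) i j z)"
  shows "zeta n mu (t_coeff n c B) k z = 0"
proof -
  obtain \<rho> \<delta> where \<rho>: "\<rho> > 0" and \<delta>: "\<delta> > 0"
    and nf: "normalized_family (chart_dom c) n mu A1 A2 S1 S2 z \<rho> \<delta>"
    by (rule exists_normalized_family[OF z]) (rule that)
  interpret nf: normalized_family "chart_dom c" n mu A1 A2 S1 S2 z \<rho> \<delta> by (rule nf)
  have pc: "parabolic_curvature n c (B l) k z = 0" if l: "l \<noteq> 0" "norm (inverse l) < \<delta>" for l
  proof -
    have "F (inverse l) 0 j z = 0" if "j < n" for j
      using cur[OF l(1)] flat[OF l(1)] that n2 l(1) by auto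
    then have "nf.X k (inverse l) z = 0" by (simp add: nf.X_def)
    then show ?thesis using parameters_at_point(2)[OF nf \<rho> l k] by simp
  qed
  let ?z = "zeta n mu (t_coeff n c B) k z"
  have "(\<lambda>l. parabolic_curvature n c (B l) k z) \<in> O[at_infinity](\<lambda>l. l ^ (k - 2))"
    by (rule bigo_inverse_parameter[OF \<delta>, of _ 0]) (simp add: pc)
  from sum_in_bigo(2)[OF this parabolic_curvature_expansion[OF z k]]
  have "(\<lambda>l. l ^ (k - 1) * ?z) \<in> O[at_infinity](\<lambda>l. l ^ (k - 2))" by simp
  then show ?thesis by (rule power_bigo_lower_zero) (use k in simp)
qed

end

section \<open>The family of connections on the induced bundle\<close>

locale connection_on_bundle = induced_bundle S \<A> n I r
  for S :: "'a topology" and \<A> :: "'a chart set" and n I r +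
  fixes A \<Psi> :: "'a chart \<Rightarrow> mat_form"
  assumes n2: "2 \<le> n"
    and A: "smooth_sl_components n \<A> A" and \<Psi>: "smooth_sl_components n \<A> \<Psi>"
begin

abbreviation C :: "complex \<Rightarrow> 'a chart \<Rightarrow> mat_form" where "C \<equiv> conn_family n I A \<Psi>"

abbreviation "A1 \<equiv> \<lambda>c i j z. fst (A c) z $$ (i, j)"
abbreviation "A2 \<equiv> \<lambda>c i j z. snd (A c) z $$ (i, j)"
abbreviation "S1 \<equiv> \<lambda>c i j z. fst (\<Psi> c) z $$ (i, j)"
abbreviation "S2 \<equiv> \<lambda>c i j z. snd (\<Psi> c) z $$ (i, j)"

lemma sl_componentsD:
  assumes "smooth_sl_components n \<A> B" "c \<in> \<A>"
  shows "i < n \<Longrightarrow> j < n \<Longrightarrow> smooth_on (chart_dom c) (\<lambda>z. fst (B c) z $$ (i, j))"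
    and "i < n \<Longrightarrow> j < n \<Longrightarrow> smooth_on (chart_dom c) (\<lambda>z. snd (B c) z $$ (i, j))"
    and "z \<in> chart_dom c \<Longrightarrow> fst (B c) z \<in> carrier_mat n n"
    and "z \<in> chart_dom c \<Longrightarrow> snd (B c) z \<in> carrier_mat n n"
    and "z \<in> chart_dom c \<Longrightarrow> mat_tr (fst (B c) z) = 0"
    and "z \<in> chart_dom c \<Longrightarrow> mat_tr (snd (B c) z) = 0"
  using assms unfolding smooth_sl_components_def smooth_mat_on_def by blast+

lemma trace_entries:
  assumes "smooth_sl_components n \<A> B" "c \<in> \<A>" "z \<in> chart_dom c"
  shows "(\<Sum>i<n. fst (B c) z $$ (i, i)) = 0" "(\<Sum>i<n. snd (B c) z $$ (i, i)) = 0"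
  using sl_componentsD(5,6)[OF assms] mat_tr_carrier[OF sl_componentsD(3)[OF assms]]
    mat_tr_carrier[OF sl_componentsD(4)[OF assms]] by auto

lemma connection_family_chart:
  assumes c: "c \<in> \<A>"
  shows "connection_family (chart_dom c) n (mu c) (A1 c) (A2 c) (S1 c) (S2 c)"
  by unfold_locales (use n2 open_chart_dom[OF c] smooth_mu[OF c] sl_componentsD(1,2)[OF A c]
      sl_componentsD(1,2)[OF \<Psi> c] trace_entries(1)[OF A c] trace_entries(1)[OF \<Psi> c] in blast)+

abbreviation "Pc c \<equiv> connection_family.P (A1 c) (S1 c)"
abbreviation "Qc c \<equiv> connection_family.Q (mu c) (A2 c) (S2 c)"
abbreviation "Fc c \<equiv> connection_family.F n (mu c) (A1 c) (A2 c) (S1 c) (S2 c)"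

context
  fixes c l
  assumes c: "c \<in> \<A>" and l: "l \<noteq> (0 :: complex)"
begin

interpretation cf: connection_family "chart_dom c" n "mu c" "A1 c" "A2 c" "S1 c" "S2 c"
  by (rule connection_family_chart[OF c])

lemma Phi_entries:
  assumes z: "z \<in> chart_dom c" and ij: "i < n" "j < n"
  shows "fst (Phi n I c) z $$ (i, j) = (if i = Suc j then 1 else 0)"
    and "snd (Phi n I c) z $$ (i, j) = (if j < i then mu c (Suc i - j) z else 0)"
proof -
  note e = arg_cong[OF standard_form[OF c z]]
  show "fst (Phi n I c) z $$ (i, j) = (if i = Suc j then 1 else 0)"
    using e[of "\<lambda>J. mult_mat n J pv $$ (i, j)"] mult_mat_pv_standard[OF ij, of "beltrami n (I c z)"]
    unfolding Phi_def fst_conv by (rule trans)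
  show "snd (Phi n I c) z $$ (i, j) = (if j < i then mu c (Suc i - j) z else 0)"
    using e[of "\<lambda>J. mult_mat n J pvbar $$ (i, j)"] mult_mat_pvbar_standard[OF ij, of "beltrami n (I c z)"]
    unfolding Phi_def snd_conv by (rule trans)
qed

lemma C_carrier:
  assumes z: "z \<in> chart_dom c"
  shows "fst (C l c) z \<in> carrier_mat n n" "snd (C l c) z \<in> carrier_mat n n"
  using sl_componentsD(3,4)[OF \<Psi> c z] unfolding conn_family_def by auto

lemma C_entries:
  assumes z: "z \<in> chart_dom c" and ij: "i < n" "j < n"
  shows "fst (C l c) z $$ (i, j) = l * Pc c (inverse l) i j z"
    and "snd (C l c) z $$ (i, j) = l * Qc c (inverse l) i j z"
proof -
  have ll: "l * (inverse l * x + inverse l ^ 2 * y) = x + inverse l * y" for x y :: complex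
    using l by (simp add: distrib_left power2_eq_square flip: mult.assoc)
  have "fst (C l c) z $$ (i, j) = l * fst (Phi n I c) z $$ (i, j) + A1 c i j z + inverse l * S1 c i j z"
    using sl_componentsD(3)[OF A c z] sl_componentsD(3)[OF \<Psi> c z] ij
    by (simp add: conn_family_def Phi_def mult_mat_def)
  then show "fst (C l c) z $$ (i, j) = l * Pc c (inverse l) i j z"
    unfolding Phi_entries(1)[OF z ij] cf.P_def using ll[of "A1 c i j z" "S1 c i j z"]
    by (simp only: distrib_left add.assoc)
  have "snd (C l c) z $$ (i, j) = l * snd (Phi n I c) z $$ (i, j) + A2 c i j z + inverse l * S2 c i j z"
    using sl_componentsD(4)[OF A c z] sl_componentsD(4)[OF \<Psi> c z] ij
    by (simp add: conn_family_def Phi_def mult_mat_def)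
  then show "snd (C l c) z $$ (i, j) = l * Qc c (inverse l) i j z"
    unfolding Phi_entries(2)[OF z ij] cf.Q_def using ll[of "A2 c i j z" "S2 c i j z"]
    by (simp only: distrib_left add.assoc)
qed

lemma smooth_P: "i < n \<Longrightarrow> j < n \<Longrightarrow> smooth_on (chart_dom c) (Pc c e i j)"
  unfolding cf.P_def
  by (intro smooth_on_add smooth_on_mult smooth_on_const open_chart_dom[OF c] cf.A1 cf.S1)

lemma smooth_Q: "i < n \<Longrightarrow> j < n \<Longrightarrow> smooth_on (chart_dom c) (Qc c e i j)"
proof -
  assume ij: "i < n" "j < n"
  have "smooth_on (chart_dom c) (\<lambda>z. if j < i then mu c (Suc i - j) z else 0)"
  proof (cases "j < i")
    case True
    then have "Suc i - j \<in> {2..n}" using ij by auto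
    from smooth_mu[OF c this] True show ?thesis by simp
  qed simp
  then show ?thesis unfolding cf.Q_def
    by (intro smooth_on_add smooth_on_mult smooth_on_const open_chart_dom[OF c] cf.A2 cf.S2 ij)
qed

lemma smooth_C: "smooth_form n (chart_dom c) (C l c)"
proof -
  have "smooth_on (chart_dom c) (\<lambda>z. fst (C l c) z $$ (i, j))"
    "smooth_on (chart_dom c) (\<lambda>z. snd (C l c) z $$ (i, j))" if ij: "i < n" "j < n" for i j
  proof -
    have "smooth_on (chart_dom c) (\<lambda>z. l * Pc c (inverse l) i j z)"
      "smooth_on (chart_dom c) (\<lambda>z. l * Qc c (inverse l) i j z)"
      by (intro smooth_on_mult smooth_on_const open_chart_dom[OF c] smooth_P smooth_Q ij)+
    then show "smooth_on (chart_dom c) (\<lambda>z. fst (C l c) z $$ (i, j))"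
      "smooth_on (chart_dom c) (\<lambda>z. snd (C l c) z $$ (i, j))"
      by (auto intro: smooth_on_cong[OF open_chart_dom[OF c]] simp: C_entries ij)
  qed
  then show ?thesis unfolding smooth_form_def smooth_mat_on_def using C_carrier by blast
qed

lemma curvature_carrier: "z \<in> chart_dom c \<Longrightarrow> curvature n (C l c) z \<in> carrier_mat n n"
  using C_carrier[of z] unfolding curvature_def dz_mat_def dzbar_mat_def by auto

lemma curvature_entries:
  assumes z: "z \<in> chart_dom c" and ij: "i < n" "j < n"
  shows "curvature n (C l c) z $$ (i, j) = l ^ 2 * Fc c (inverse l) i j z"
proof -
  note U = open_chart_dom[OF c]
  have d1: "dz (\<lambda>w. snd (C l c) w $$ (i, j)) z = l * dz (Qc c (inverse l) i j) z"
    unfolding dz_eq_wd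
    by (subst wd_cong[OF U z C_entries(2)[OF _ ij]], assumption)
      (rule wd_cmult[OF smooth_on_differentiable[OF smooth_Q[OF ij] z]])
  have d2: "dzbar (\<lambda>w. fst (C l c) w $$ (i, j)) z = l * dzbar (Pc c (inverse l) i j) z"
    unfolding dzbar_eq_wd
    by (subst wd_cong[OF U z C_entries(1)[OF _ ij]], assumption)
      (rule wd_cmult[OF smooth_on_differentiable[OF smooth_P[OF ij] z]])
  note car = C_carrier[OF z]
  have m: "(fst (C l c) z * snd (C l c) z) $$ (i, j) = l ^ 2 * (\<Sum>k<n. Pc c (inverse l) i k z * Qc c (inverse l) k j z)"
    "(snd (C l c) z * fst (C l c) z) $$ (i, j) = l ^ 2 * (\<Sum>k<n. Qc c (inverse l) i k z * Pc c (inverse l) k j z)"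
    unfolding mat_mult_entry[OF car ij] mat_mult_entry[OF car(2,1) ij] sum_distrib_left
    using ij by (auto intro!: sum.cong simp: C_entries[OF z] power2_eq_square)
  have "curvature n (C l c) z $$ (i, j) = dz (\<lambda>w. snd (C l c) w $$ (i, j)) z - dzbar (\<lambda>w. fst (C l c) w $$ (i, j)) z
      + ((fst (C l c) z * snd (C l c) z) $$ (i, j) - (snd (C l c) z * fst (C l c) z) $$ (i, j))"
    using car ij by (simp add: curvature_def dz_mat_def dzbar_mat_def del: index_mult_mat(1))
  moreover have "l ^ 2 * (inverse l * x) = l * x" for x
    using l by (simp add: power2_eq_square)
  ultimately show ?thesis unfolding d1 d2 m cf.F_def
    by (simp only: sum_subtractf distrib_left right_diff_distrib)
qed

lemma curvature_trace:
  assumes z: "z \<in> chart_dom c"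
  shows "mat_tr (curvature n (C l c) z) = 0"
proof -
  note U = open_chart_dom[OF c] and car = C_carrier[OF z]
  have s: "\<And>i j w. i < n \<Longrightarrow> j < n \<Longrightarrow> w \<in> chart_dom c \<Longrightarrow> (\<lambda>w. fst (C l c) w $$ (i, j)) differentiable (at w)"
    "\<And>i j w. i < n \<Longrightarrow> j < n \<Longrightarrow> w \<in> chart_dom c \<Longrightarrow> (\<lambda>w. snd (C l c) w $$ (i, j)) differentiable (at w)"
    using smooth_formD(3,4)[OF smooth_C] smooth_on_differentiable by blast+
  have t1: "(\<Sum>i<n. fst (C l c) w $$ (i, i)) = 0" if "w \<in> chart_dom c" for w
    using cf.trace_P[OF that, of "inverse l"] that
    by (simp add: C_entries flip: sum_distrib_left)
  have t2: "(\<Sum>i<n. snd (C l c) w $$ (i, i)) = 0" if w: "w \<in> chart_dom c" for w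
  proof -
    have "(\<Sum>i<n. snd (C l c) w $$ (i, i)) = (\<Sum>i<n. A2 c i i w + inverse l * S2 c i i w)"
      using l w by (intro sum.cong refl) (simp add: C_entries cf.Q_def distrib_left power2_eq_square flip: mult.assoc)
    then show ?thesis using trace_entries(2)[OF A c w] trace_entries(2)[OF \<Psi> c w]
      by (simp add: sum.distrib flip: sum_distrib_left)
  qed
  have "(\<Sum>i<n. dz (\<lambda>w. snd (C l c) w $$ (i, i)) z) = dz (\<lambda>w. \<Sum>i<n. snd (C l c) w $$ (i, i)) z"
    unfolding dz_eq_wd by (rule wd_sum[symmetric]) (use s(2) z in auto)
  also have "\<dots> = 0" unfolding dz_eq_wd by (subst wd_cong[OF U z t2]) auto
  finally have 1: "(\<Sum>i<n. dz (\<lambda>w. snd (C l c) w $$ (i, i)) z) = 0" .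
  have "(\<Sum>i<n. dzbar (\<lambda>w. fst (C l c) w $$ (i, i)) z) = dzbar (\<lambda>w. \<Sum>i<n. fst (C l c) w $$ (i, i)) z"
    unfolding dzbar_eq_wd by (rule wd_sum[symmetric]) (use s(1) z in auto)
  also have "\<dots> = 0" unfolding dzbar_eq_wd by (subst wd_cong[OF U z t1]) auto
  finally have 2: "(\<Sum>i<n. dzbar (\<lambda>w. fst (C l c) w $$ (i, i)) z) = 0" .
  have "mat_tr (curvature n (C l c) z) = (\<Sum>i<n. dz (\<lambda>w. snd (C l c) w $$ (i, i)) z - dzbar (\<lambda>w. fst (C l c) w $$ (i, i)) z
      + ((fst (C l c) z * snd (C l c) z) $$ (i, i) - (snd (C l c) z * fst (C l c) z) $$ (i, i)))"
    unfolding mat_tr_carrier[OF curvature_carrier[OF z]] using car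
    by (intro sum.cong refl) (simp add: curvature_def dz_mat_def dzbar_mat_def del: index_mult_mat(1))
  also have "\<dots> = mat_tr (fst (C l c) z * snd (C l c) z) - mat_tr (snd (C l c) z * fst (C l c) z)"
    unfolding sum.distrib sum_subtractf 1 2
    by (simp only: mat_tr_carrier[OF mult_carrier_mat[OF car]] mat_tr_carrier[OF mult_carrier_mat[OF car(2,1)]]) simp
  also have "\<dots> = 0" using mat_tr_mult_commute[OF car] by simp
  finally show ?thesis .
qed

lemma continuous_curvature:
  assumes ij: "i < n" "j < n"
  shows "continuous_on (chart_dom c) (\<lambda>z. curvature n (C l c) z $$ (i, j))"
proof -
  note U = open_chart_dom[OF c]
  have "smooth_on (chart_dom c) (\<lambda>z. l ^ 2 * Fc c (inverse l) i j z)"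
    unfolding cf.F_def
    by (intro smooth_on_mult smooth_on_add smooth_on_diff smooth_on_sum smooth_on_const U
        smooth_on_dz smooth_on_dzbar smooth_P smooth_Q ij) auto
  from smooth_on_continuous[OF this] show ?thesis
    by (rule continuous_on_eq) (simp add: curvature_entries ij)
qed

end

lemma parabolic_chart:
  assumes H: "Hausdorff_space S" and c: "c \<in> \<A>"
    and par: "\<And>l. l \<noteq> 0 \<Longrightarrow> L_parabolic n S \<A> I r (C l)"
  shows "parabolic_chart c n (mu c) (A1 c) (A2 c) (S1 c) (S2 c) (\<lambda>l. C l c)"
proof -
  interpret cf: connection_family "chart_dom c" n "mu c" "A1 c" "A2 c" "S1 c" "S2 c"
    by (rule connection_family_chart[OF c])
  show ?thesis
  proof (unfold_locales)
    fix e z :: complex and i j :: nat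
    assume e: "e \<noteq> 0" and z: "z \<in> chart_dom c" and ij: "i < n" "j < n" "0 < i \<or> j = 0"
    have l: "inverse e \<noteq> 0" using e by simp
    have "curvature n (C (inverse e) c) z $$ (i, j) = 0"
      by (rule L_parabolic_pointwise[OF H c par[OF l] curvature_carrier[OF _ l] continuous_curvature[OF c l]
            curvature_trace[OF c l z] z ij])
    then show "cf.F e i j z = 0" using curvature_entries[OF c l z ij(1,2)] e by simp
  qed (use smooth_C[OF c] C_entries[OF c] in blast)+
qed

end

section \<open>The expansion of the parabolic curvature\<close>

theorem theorem4p7:
  fixes S :: "'a topology" and \<A> :: "'a chart set" and n g :: nat
    and I :: "'a chart \<Rightarrow> complex \<Rightarrow> cpoly2 set"
    and r :: "'a chart \<Rightarrow> 'a chart \<Rightarrow> complex \<Rightarrow> complex"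
    and A \<Psi> :: "'a chart \<Rightarrow> mat_form"
    and C :: "complex \<Rightarrow> 'a chart \<Rightarrow> mat_form"
    and \<mu> t :: "'a chart \<Rightarrow> nat \<Rightarrow> complex \<Rightarrow> complex"
  assumes "closed_oriented_surface S \<A>" and "has_genus S g" and "g \<ge> 2"
    and "higher_complex_structure n \<A> I"
    and "sqrt_canonical_bundle n \<A> I r"
    and "sl_connection n \<A> I r A"
    and "\<forall>c\<in>\<A>. \<forall>z\<in>chart_dom c. covariant_ext_deriv n (A c) (Phi n I c) z = 0\<^sub>m n n"
    and "sl_one_form n \<A> I r \<Psi>"
    and C_def: "C = conn_family n I A \<Psi>"
    and "\<forall>l. l \<noteq> 0 \<longrightarrow> L_parabolic n S \<A> I r (C l)"
    and mu_def: "\<mu> = (\<lambda>c k z. beltrami n (I c z) k)"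
    and t_def: "t = (\<lambda>c. t_coeff n c (\<lambda>l. C l c))"
  shows "(\<forall>c\<in>\<A>. \<forall>z\<in>chart_dom c. \<forall>k\<in>{2..n}.
            (\<lambda>l. parabolic_curvature n c (C l c) k z - l ^ (k - 1) * zeta n (\<mu> c) (t c) k z)
              \<in> O[at_infinity](\<lambda>l. l ^ (k - 2))) \<and>
         ((\<forall>l. l \<noteq> 0 \<longrightarrow> flat_connection n \<A> (C l)) \<longrightarrow>
            (\<forall>c\<in>\<A>. \<forall>z\<in>chart_dom c. \<forall>k\<in>{2..n}. zeta n (\<mu> c) (t c) k z = 0))"
proof (cases "2 \<le> n")
  case True
  have H: "Hausdorff_space S" and atlas: "oriented_smooth_atlas S \<A>"
    using assms(1) unfolding closed_oriented_surface_def by blast+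
  interpret cb: connection_on_bundle S \<A> n I r A \<Psi>
    by unfold_locales
      (use atlas assms(4,5,6,8) True in \<open>auto simp: sl_connection_def sl_one_form_def\<close>)
  have chart: "parabolic_chart c n (\<mu> c) (cb.A1 c) (cb.A2 c) (cb.S1 c) (cb.S2 c) (\<lambda>l. C l c)"
    if "c \<in> \<A>" for c
    unfolding C_def mu_def
    by (rule cb.parabolic_chart[OF H that]) (use assms(10) in \<open>simp add: C_def\<close>)
  show ?thesis
  proof (intro conjI impI ballI)
    fix c z k assume c: "c \<in> \<A>" and z: "z \<in> chart_dom c" and k: "k \<in> {2..n}"
    interpret pc: parabolic_chart c n "\<mu> c" "cb.A1 c" "cb.A2 c" "cb.S1 c" "cb.S2 c" "\<lambda>l. C l c"
      by (rule chart[OF c])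
    show "(\<lambda>l. parabolic_curvature n c (C l c) k z - l ^ (k - 1) * zeta n (\<mu> c) (t c) k z)
        \<in> O[at_infinity](\<lambda>l. l ^ (k - 2))"
      unfolding t_def by (rule pc.parabolic_curvature_expansion[OF z k])
    assume flat: "\<forall>l. l \<noteq> 0 \<longrightarrow> flat_connection n \<A> (C l)"
    show "zeta n (\<mu> c) (t c) k z = 0"
      unfolding t_def
    proof (rule pc.flat_zeta_zero[OF z k])
      fix l :: complex assume l: "l \<noteq> 0"
      show "curvature n (C l c) z = 0\<^sub>m n n"
        using flat l c z unfolding flat_connection_def by blast
      show "\<forall>i<n. \<forall>j<n. curvature n (C l c) z $$ (i, j) = l ^ 2 * pc.F (inverse l) i j z"
        using cb.curvature_entries[OF c l z] unfolding C_def mu_def by blast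
    qed
  qed
qed auto

end
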